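(* Let $(A,\bar{\mathfrak{m}})$ be a commutative noetherian local DG-ring with bounded cohomology. Then the following are equivalent: (1) The DG-ring $(A,\bar{\mathfrak{m}})$ is sequence-regular, i.e. the maximal ideal $\bar{\mathfrak{m}}\subseteq \mathrm{H}^0(A)$ can be generated by an $A$-regular sequence. (2) The DG-ring $(A,\bar{\mathfrak{m}})$ is a Cohen–Macaulay DG-ring, and moreover the ring $\mathrm{H}^0(A)$ is a regular local ring.
   Context: All DG-rings are unital, non-positively graded, $A=\bigoplus_{n\le 0}A^n$ with differential of degree $+1$ satisfying the graded Leibniz rule, and commutative: $ba=(-1)^{\deg(a)\deg(b)}ab$ for homogeneous $a,b$, and $a^2=0$ for $a$ of odd degree. There is a natural surjection $\pi_A^0:A^0\to \mathrm{H}^0(A)$. For a DG-module $M$, $\inf(M)=\inf\{n\mid \mathrm{H}^n(M)\neq 0\}$. $\mathsf{D}(A)$ is the derived category of DG-modules over $A$, and $\mathsf{D}^+(A)$ is its full subcategory of DG-modules with bounded below cohomology. $A$ is noetherian if $\mathrm{H}^0(A)$ is a noetherian ring and each $\mathrm{H}^i(A)$, $i<0$, is a finitely generated $\mathrm{H}^0(A)$-module. $A$ has bounded cohomology if $\mathrm{H}^i(A)=0$ for $i\ll 0$. A noetherian local DG-ring $(A,\bar{\mathfrak{m}})$ is a noetherian DG-ring such that $\mathrm{H}^0(A)$ is a local ring with maximal ideal $\bar{\mathfrak{m}}$. Localization: for $\bar{\mathfrak{p}}\in\operatorname{Spec}(\mathrm{H}^0(A))$ put $\mathfrak{p}=(\pi_A^0)^{-1}(\bar{\mathfrak{p}})$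 and $A_{\bar{\mathfrak{p}}}=A\otimes_{A^0}A^0_{\mathfrak{p}}$; then $\mathrm{H}^0(A_{\bar{\mathfrak{p}}})=\mathrm{H}^0(A)_{\bar{\mathfrak{p}}}$. Koszul complex: for $\bar a_1,\dots,\bar a_n\in \mathrm{H}^0(A)$ choose lifts $a_i\in A^0$ and set $K(A;\bar a_1,\dots,\bar a_n)=K(A^0;a_1,\dots,a_n)\otimes_{A^0}A$, a commutative DG-ring independent of the lifts up to isomorphism in the homotopy category of DG-rings; for $M\in\mathsf{D}(A)$, $K(M;\bar a_1,\dots,\bar a_n)=K(A;\bar a_1,\dots,\bar a_n)\otimes_A M$. Regular sequences: for a noetherian local DG-ring $(A,\bar{\mathfrak{m}})$ and $M\in\mathsf{D}^+(A)$, an element $\bar x\in\bar{\mathfrak{m}}$ is $M$-regular if multiplication by $\bar x$ on $\mathrm{H}^{\inf(M)}(M)$ is injective. A sequence $\bar a_1,\dots,\bar a_n\in\bar{\mathfrak{m}}$ is $M$-regular if $\bar a_1$ is $M$-regular and $\bar a_2,\dots,\bar a_n$ is $K(M;\bar a_1)$-regular. Cohen–Macaulay: a noetherian local DG-ring $(A,\bar{\mathfrak{m}})$ with bounded cohomology is local-Cohen–Macaulay if the maximal length of an $A$-regular sequence in $\bar{\mathfrak{m}}$ (which is always at most $\dim \mathrm{H}^0(A)$) equals $\dim \mathrm{H}^0(A)$. A noetherian DG-ring $A$ with bounded cohomology is Cohen–Macaulay if $A_{\bar{\mathfrak{p}}}$ is local-Cohen–Macaulay for every $\bar{\mathfrak{p}}\in\operatorname{Spec}(\mathrm{H}^0(A))$.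 *)

theory Defs
  imports
    "HOL-Algebra.Ring_Divisibility"
    "HOL-Algebra.QuotRing"
    "HOL-Algebra.Module"
    "HOL-Library.Extended_Nat"
begin

section \<open>Commutative algebra\<close>

definition local_ring :: "('a, 'b) ring_scheme \<Rightarrow> 'a set \<Rightarrow> bool" where
  "local_ring R m \<longleftrightarrow> cring R \<and> maximalideal m R \<and> (\<forall>I. maximalideal I R \<longrightarrow> I = m)"

definition finitely_generated_module ::
    "('a, 'b) ring_scheme \<Rightarrow> ('a, 'c, 'd) module_scheme \<Rightarrow> bool" where
  "finitely_generated_module R M \<longleftrightarrow> module R M \<and>
     (\<exists>S \<subseteq> carrier M. finite S \<and>
        (\<forall>x \<in> carrier M. \<exists>c \<in> S \<rightarrow> carrier R. x = (\<Oplus>\<^bsub>M\<^esub>s\<in>S. c s \<odot>\<^bsub>M\<^esub> s)))"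

definition krull_dim :: "('a, 'b) ring_scheme \<Rightarrow> enat" where
  "krull_dim R = Sup {enat n | n. \<exists>p. (\<forall>i\<le>n. primeideal (p i) R) \<and> (\<forall>i<n. p i \<subset> p (Suc i))}"

definition min_generators :: "('a, 'b) ring_scheme \<Rightarrow> 'a set \<Rightarrow> nat" where
  "min_generators R I = (LEAST n. \<exists>S \<subseteq> carrier R. finite S \<and> card S = n \<and> I = Idl\<^bsub>R\<^esub> S)"

text \<open>
  By Nakayama's lemma, \<^term>\<open>min_generators R m\<close> is the dimension of the cotangent space of a
  noetherian local ring, i.e. its embedding dimension.
\<close>

definition regular_local_ring :: "('a, 'b) ring_scheme \<Rightarrow> 'a set \<Rightarrow> bool" where
  "regular_local_ring R m \<longleftrightarrow> noetherian_ring R \<and> local_ring R m \<and>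
     enat (min_generators R m) = krull_dim R"


section \<open>Graded objects with a differential\<close>

text \<open>
  \<^term>\<open>carrier C\<close> is the total object, the internal direct sum of the homogeneous parts
  \<^term>\<open>gr C n\<close>.  For a DG-ring the ring operations are those of the total ring; for a DG-module
  the inherited fields \<^term>\<open>mult C\<close> and \<^term>\<open>one C\<close> are irrelevant.
\<close>

record 'a cochain = "'a ring" +
  gr :: "int \<Rightarrow> 'a set"
  dif :: "'a \<Rightarrow> 'a"

record ('a, 'm) dg_mod = "'m cochain" +
  act :: "'a \<Rightarrow> 'm \<Rightarrow> 'm"

definition graded_decomp :: "('a, 'b) cochain_scheme \<Rightarrow> 'a \<Rightarrow> (int \<Rightarrow> 'a) \<Rightarrow> bool" where
  "graded_decomp C x f \<longleftrightarrow> (\<forall>n. f n \<in> gr C n) \<and> finite {n. f n \<noteq> \<zero>\<^bsub>C\<^esub>} \<and>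
     x = (\<Oplus>\<^bsub>C\<^esub>n\<in>{n. f n \<noteq> \<zero>\<^bsub>C\<^esub>}. f n)"

definition koszul_sign :: "('a, 'b) ring_scheme \<Rightarrow> int \<Rightarrow> 'a \<Rightarrow> 'a" where
  "koszul_sign R n x = (if even n then x else \<ominus>\<^bsub>R\<^esub> x)"

definition cocycles :: "('a, 'b) cochain_scheme \<Rightarrow> int \<Rightarrow> 'a set" where
  "cocycles C n = {z \<in> gr C n. dif C z = \<zero>\<^bsub>C\<^esub>}"

definition coboundaries :: "('a, 'b) cochain_scheme \<Rightarrow> int \<Rightarrow> 'a set" where
  "coboundaries C n = dif C ` gr C (n - 1)"


section \<open>Commutative DG-rings and their cohomology\<close>

locale dg_ring = ring A for A :: "('a, 'b) cochain_scheme" (structure) +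
  assumes gr_subgroup: "additive_subgroup (gr A n) A"
    and gr_direct_sum: "x \<in> carrier A \<Longrightarrow> \<exists>!f. graded_decomp A x f"
    and gr_nonpos: "n > 0 \<Longrightarrow> gr A n = {\<zero>}"
    and one_gr: "\<one> \<in> gr A 0"
    and mult_gr: "a \<in> gr A i \<Longrightarrow> b \<in> gr A j \<Longrightarrow> a \<otimes> b \<in> gr A (i + j)"
    and dif_add: "x \<in> carrier A \<Longrightarrow> y \<in> carrier A \<Longrightarrow> dif A (x \<oplus> y) = dif A x \<oplus> dif A y"
    and dif_gr: "a \<in> gr A i \<Longrightarrow> dif A a \<in> gr A (i + 1)"
    and dif_dif: "x \<in> carrier A \<Longrightarrow> dif A (dif A x) = \<zero>"
    and leibniz: "a \<in> gr A i \<Longrightarrow> b \<in> gr A j \<Longrightarrow>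
      dif A (a \<otimes> b) = dif A a \<otimes> b \<oplus> koszul_sign A i (a \<otimes> dif A b)"
    and graded_comm: "a \<in> gr A i \<Longrightarrow> b \<in> gr A j \<Longrightarrow> b \<otimes> a = koszul_sign A (i * j) (a \<otimes> b)"
    and odd_square: "a \<in> gr A i \<Longrightarrow> odd i \<Longrightarrow> a \<otimes> a = \<zero>"

text \<open>Since \<^term>\<open>gr A 1\<close> is trivial, the degree-zero cocycles are all of \<^term>\<open>gr A 0\<close>.\<close>

definition H0 :: "('a, 'b) cochain_scheme \<Rightarrow> 'a set ring" where
  "H0 A = (A\<lparr>carrier := cocycles A 0\<rparr>) Quot (coboundaries A 0)"

text \<open>
  The \<open>n\<close>-th cohomology of a DG-module over \<open>A\<close>, as a module over \<^term>\<open>H0 A\<close>.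
\<close>

definition cohomology :: "('a, 'm, 'b) dg_mod_scheme \<Rightarrow> int \<Rightarrow> ('a set, 'm set) module" where
  "cohomology M n =
    \<lparr>carrier = {coboundaries M n +>\<^bsub>M\<^esub> z | z. z \<in> cocycles M n},
     mult = undefined, one = undefined,
     zero = coboundaries M n, add = set_add M,
     smult = (\<lambda>X Y. \<Union>a\<in>X. \<Union>z\<in>Y. coboundaries M n +>\<^bsub>M\<^esub> act M a z)\<rparr>"

definition cohomology_zero :: "('a, 'm, 'b) dg_mod_scheme \<Rightarrow> int \<Rightarrow> bool" where
  "cohomology_zero M n \<longleftrightarrow> carrier (cohomology M n) = {\<zero>\<^bsub>cohomology M n\<^esub>}"

text \<open>
  This is the infimum whenever \<open>M\<close> has nonzero, bounded below cohomology.  For acyclic \<open>M\<close> the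
  value is an arbitrary integer; the notions below then only see a zero module.
\<close>

definition dg_inf :: "('a, 'm, 'b) dg_mod_scheme \<Rightarrow> int" where
  "dg_inf M = Inf {n. \<not> cohomology_zero M n}"

definition self_module :: "('a, 'b) cochain_scheme \<Rightarrow> ('a, 'a) dg_mod" where
  "self_module A =
    \<lparr>carrier = carrier A, mult = mult A, one = one A, zero = zero A, add = add A,
     gr = gr A, dif = dif A, act = mult A\<rparr>"

definition noetherian_dg_ring :: "('a, 'b) cochain_scheme \<Rightarrow> bool" where
  "noetherian_dg_ring A \<longleftrightarrow> dg_ring A \<and> noetherian_ring (H0 A) \<and>
     (\<forall>i<0. finitely_generated_module (H0 A) (cohomology (self_module A) i))"

definition bounded_cohomology :: "('a, 'b) cochain_scheme \<Rightarrow> bool" where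
  "bounded_cohomology A \<longleftrightarrow> (\<exists>N. \<forall>i<N. cohomology_zero (self_module A) i)"

definition noetherian_local_dg_ring :: "('a, 'b) cochain_scheme \<Rightarrow> 'a set set \<Rightarrow> bool" where
  "noetherian_local_dg_ring A m \<longleftrightarrow> noetherian_dg_ring A \<and> local_ring (H0 A) m"


section \<open>Localization\<close>

definition prime_preimage :: "('a, 'b) cochain_scheme \<Rightarrow> 'a set set \<Rightarrow> 'a set" where
  "prime_preimage A p = {a \<in> gr A 0. coboundaries A 0 +>\<^bsub>A\<^esub> a \<in> p}"

text \<open>
  For a multiplicative subset \<open>S\<close> of the central subring \<^term>\<open>gr A 0\<close>, the base change of \<open>A\<close>
  to the localization of \<^term>\<open>gr A 0\<close> at \<open>S\<close> is realized by fractions \<open>a/s\<close>.  The differential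
  is \<^term>\<open>gr A 0\<close>-linear, so that \<open>d(a/s) = d(a)/s\<close>.
\<close>

definition fraction :: "('a, 'b) cochain_scheme \<Rightarrow> 'a set \<Rightarrow> 'a \<Rightarrow> 'a \<Rightarrow> ('a \<times> 'a) set" where
  "fraction A S a s =
     {(b, t). b \<in> carrier A \<and> t \<in> S \<and>
        (\<exists>u\<in>S. u \<otimes>\<^bsub>A\<^esub> (t \<otimes>\<^bsub>A\<^esub> a) = u \<otimes>\<^bsub>A\<^esub> (s \<otimes>\<^bsub>A\<^esub> b))}"

definition localization :: "('a, 'b) cochain_scheme \<Rightarrow> 'a set \<Rightarrow> ('a \<times> 'a) set cochain" where
  "localization A S =
    \<lparr>carrier = {fraction A S a s | a s. a \<in> carrier A \<and> s \<in> S},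
     mult = (\<lambda>X Y. \<Union>(a, s)\<in>X. \<Union>(b, t)\<in>Y. fraction A S (a \<otimes>\<^bsub>A\<^esub> b) (s \<otimes>\<^bsub>A\<^esub> t)),
     one = fraction A S \<one>\<^bsub>A\<^esub> \<one>\<^bsub>A\<^esub>,
     zero = fraction A S \<zero>\<^bsub>A\<^esub> \<one>\<^bsub>A\<^esub>,
     add = (\<lambda>X Y. \<Union>(a, s)\<in>X. \<Union>(b, t)\<in>Y.
              fraction A S (t \<otimes>\<^bsub>A\<^esub> a \<oplus>\<^bsub>A\<^esub> s \<otimes>\<^bsub>A\<^esub> b) (s \<otimes>\<^bsub>A\<^esub> t)),
     gr = (\<lambda>n. {fraction A S a s | a s. a \<in> gr A n \<and> s \<in> S}),
     dif = (\<lambda>X. \<Union>(a, s)\<in>X. fraction A S (dif A a) s)\<rparr>"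

definition localization_at :: "('a, 'b) cochain_scheme \<Rightarrow> 'a set set \<Rightarrow> ('a \<times> 'a) set cochain" where
  "localization_at A p = localization A (gr A 0 - prime_preimage A p)"


section \<open>Koszul complexes and regular sequences\<close>

text \<open>
  The definition of a regular sequence passes from \<open>M\<close> to its Koszul complex on one element,
  whose elements are pairs of elements of \<open>M\<close>.  As a recursion cannot change the type of \<open>M\<close>,
  elements of iterated Koszul complexes are represented as binary trees over \<open>'m\<close>: the complex
  on \<open>k\<close> elements lives on the full trees of depth \<open>k\<close>.
\<close>

datatype 'm tree = Leaf (leaf: 'm) | Node (left: "'m tree") (right: "'m tree")

definition leaf_module :: "('a, 'm) dg_mod \<Rightarrow> ('a, 'm tree) dg_mod" where
  "leaf_module M =
    \<lparr>carrier = Leaf ` carrier M,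
     mult = undefined, one = undefined,
     zero = Leaf \<zero>\<^bsub>M\<^esub>,
     add = (\<lambda>x y. Leaf (leaf x \<oplus>\<^bsub>M\<^esub> leaf y)),
     gr = (\<lambda>n. Leaf ` gr M n),
     dif = (\<lambda>x. Leaf (dif M (leaf x))),
     act = (\<lambda>b x. Leaf (act M b (leaf x)))\<rparr>"

text \<open>The degree involution, multiplication by \<open>(-1)\<^sup>n\<close> on the part of degree \<open>n\<close>.\<close>

definition degree_involution :: "('a, 'b) cochain_scheme \<Rightarrow> 'a \<Rightarrow> 'a" where
  "degree_involution A b =
     (let f = (THE f. graded_decomp A b f)
      in \<Oplus>\<^bsub>A\<^esub>n\<in>{n. f n \<noteq> \<zero>\<^bsub>A\<^esub>}. koszul_sign A n (f n))"

text \<open>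
  For \<open>a\<close> in degree zero, the Koszul complex of \<^term>\<open>gr A 0\<close> on \<open>a\<close> is free on \<open>1\<close> and on
  \<open>e\<close>, with \<open>e\<close> of degree \<open>-1\<close> and \<open>d(e) = a\<close>.  Hence its tensor product with \<open>M\<close> is the direct
  sum of \<open>M\<close> and \<open>e M\<close>, with \<open>d(x + e y) = (d(x) + a y) - e d(y)\<close> and
  \<open>b (x + e y) = b x + (-1)\<^sup>|\<^sup>b\<^sup>| e (b y)\<close>.  \<^term>\<open>Node x y\<close> stands for \<open>x + e y\<close>.
\<close>

definition koszul_lift ::
    "('a, 'b) cochain_scheme \<Rightarrow> ('a, 'm tree) dg_mod \<Rightarrow> 'a \<Rightarrow> ('a, 'm tree) dg_mod" where
  "koszul_lift A M a =
    \<lparr>carrier = {Node x y | x y. x \<in> carrier M \<and> y \<in> carrier M},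
     mult = undefined, one = undefined,
     zero = Node \<zero>\<^bsub>M\<^esub> \<zero>\<^bsub>M\<^esub>,
     add = (\<lambda>u v. Node (left u \<oplus>\<^bsub>M\<^esub> left v) (right u \<oplus>\<^bsub>M\<^esub> right v)),
     gr = (\<lambda>n. {Node x y | x y. x \<in> gr M n \<and> y \<in> gr M (n + 1)}),
     dif = (\<lambda>u. Node (dif M (left u) \<oplus>\<^bsub>M\<^esub> act M a (right u)) (\<ominus>\<^bsub>M\<^esub> dif M (right u))),
     act = (\<lambda>b u. Node (act M b (left u)) (act M (degree_involution A b) (right u)))\<rparr>"

text \<open>
  Elements of \<^term>\<open>H0 A\<close> are cosets, so a lift of \<open>x\<close> is an element of \<open>x\<close>.  Different lifts
  give isomorphic complexes.
\<close>

definition koszul ::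
    "('a, 'b) cochain_scheme \<Rightarrow> ('a, 'm tree) dg_mod \<Rightarrow> 'a set \<Rightarrow> ('a, 'm tree) dg_mod" where
  "koszul A M x = koszul_lift A M (SOME a. a \<in> x)"

definition regular_element :: "'a set set \<Rightarrow> ('a, 'm, 'b) dg_mod_scheme \<Rightarrow> 'a set \<Rightarrow> bool" where
  "regular_element m M x \<longleftrightarrow> x \<in> m \<and>
     inj_on (\<lambda>y. x \<odot>\<^bsub>cohomology M (dg_inf M)\<^esub> y) (carrier (cohomology M (dg_inf M)))"

primrec regular_tree_sequence ::
    "('a, 'b) cochain_scheme \<Rightarrow> 'a set set \<Rightarrow> ('a, 'm tree) dg_mod \<Rightarrow> 'a set list \<Rightarrow> bool" where
  "regular_tree_sequence A m M [] \<longleftrightarrow> True"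
| "regular_tree_sequence A m M (x # xs) \<longleftrightarrow>
     regular_element m M x \<and> regular_tree_sequence A m (koszul A M x) xs"

definition regular_sequence ::
    "('a, 'b) cochain_scheme \<Rightarrow> 'a set set \<Rightarrow> ('a, 'm) dg_mod \<Rightarrow> 'a set list \<Rightarrow> bool" where
  "regular_sequence A m M xs \<longleftrightarrow> regular_tree_sequence A m (leaf_module M) xs"

definition dg_regular_sequence :: "('a, 'b) cochain_scheme \<Rightarrow> 'a set set \<Rightarrow> 'a set list \<Rightarrow> bool" where
  "dg_regular_sequence A m xs \<longleftrightarrow> regular_sequence A m (self_module A) xs"

definition sequence_regular :: "('a, 'b) cochain_scheme \<Rightarrow> 'a set set \<Rightarrow> bool" where
  "sequence_regular A m \<longleftrightarrow> (\<exists>xs. dg_regular_sequence A m xs \<and> m = Idl\<^bsub>H0 A\<^esub> (set xs))"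


section \<open>Cohen--Macaulay DG-rings\<close>

definition seq_depth :: "('a, 'b) cochain_scheme \<Rightarrow> 'a set set \<Rightarrow> enat" where
  "seq_depth A m = Sup {enat (length xs) | xs. dg_regular_sequence A m xs}"

definition local_cohen_macaulay :: "('a, 'b) cochain_scheme \<Rightarrow> 'a set set \<Rightarrow> bool" where
  "local_cohen_macaulay A m \<longleftrightarrow> noetherian_local_dg_ring A m \<and> bounded_cohomology A \<and>
     seq_depth A m = krull_dim (H0 A)"

text \<open>The maximal ideal of the cohomology ring of a localization is unique, if it exists.\<close>

definition cohen_macaulay :: "('a, 'b) cochain_scheme \<Rightarrow> bool" where
  "cohen_macaulay A \<longleftrightarrow> noetherian_dg_ring A \<and> bounded_cohomology A \<and>
     (\<forall>p. primeideal p (H0 A) \<longrightarrow> (\<exists>n. local_cohen_macaulay (localization_at A p) n))"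

end

theory Submission
  imports Defs
begin

text \<open>
  The depth is invariant: if \<open>M\<close> has a regular sequence of length \<open>k + 1\<close> and \<open>y\<close> is \<open>M\<close>-regular,
  then \<open>K(M; y)\<close> has a regular sequence of length \<open>k\<close>.  This follows by induction from prime
  avoidance, once the socles of the lowest cohomology modules of \<open>K(M; x)\<close> and \<open>K(M; y)\<close> are
  compared through \<open>K(M; x, y)\<close>.

  Let \<open>x\<^sub>1, \<dots>, x\<^sub>n\<close> be a regular sequence.  Associated primes of the lowest cohomology modules of the
  successive Koszul complexes form a chain \<open>P\<^sub>0 \<subset> \<dots> \<subset> P\<^sub>n\<close> with \<open>x\<^sub>k \<in> P\<^sub>k - P\<^sub>k\<^sub>-\<^sub>1\<close>.  If the
  sequence generates the maximal ideal, then downward induction with Nakayama's lemma gives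
  \<open>P\<^sub>k = (x\<^sub>1, \<dots>, x\<^sub>k)\<close>.  Hence \<open>H\<^sup>0(A)\<close> is a regular domain of dimension \<open>n\<close> that embeds into the lowest
  cohomology of \<open>A\<close>.  Let \<open>t\<close> be the length of a maximal regular sequence in a prime \<open>p\<close>.  Then
  \<open>p\<close> is contained in an associated prime of its Koszul complex, and invariance of the depth yields a
  chain of primes of length \<open>n - t\<close> above \<open>p\<close>.  So the height of \<open>p\<close> is at most \<open>t\<close>, while the
  sequence stays regular after localization at \<open>p\<close>.

  Conversely, let \<open>z\<^sub>1, \<dots>, z\<^sub>d\<close> be minimal generators of the maximal ideal.  As long as the depth is
  positive, prime avoidance makes \<open>z\<^sub>i\<close> regular by adding an element of the ideal of the remaining
  generators, and by invariance the depth drops by exactly one.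
\<close>

section \<open>Ideals of noetherian rings\<close>

text \<open>Forming a Koszul complex on an element of H^0(A) requires a lift to A^0, and two lifts
  differ by a coboundary, which acts as zero only up to homotopy. Hence complexes carry
  null-homotopies, and maps between Koszul complexes contain them as correction terms. Regularity of
  x in the maximal ideal is turned into a vanishing statement: the cohomology of K(M; x) is zero one
  degree below inf(M). For a second element this is a condition on K(M; x, y), which is symmetric in
  x and y up to isomorphism; socles shift by one degree in the same way.

  The Cohen-Macaulay hypothesis yields a regular sequence not over A but over its localization at
  the maximal ideal, a different DG-ring. That sequence is not pulled back; it only certifies depth
  there. The sequence over A is built anew from generators, and the two sides are linked by
  comparing socles.

  At a smaller prime the lowest cohomology might vanish, and regularity would then refer to another
  degree; this is why a class with annihilator zero is produced.\<close>

lemma (in ring) ideal_iff: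
  "ideal J R \<longleftrightarrow> J \<subseteq> carrier R \<and> \<zero> \<in> J \<and> (\<forall>a\<in>J. \<forall>b\<in>J. a \<oplus> b \<in> J) \<and>
     (\<forall>a\<in>J. \<forall>r\<in>carrier R. r \<otimes> a \<in> J \<and> a \<otimes> r \<in> J)" (is "?L \<longleftrightarrow> ?R")
proof
  assume ?L
  then interpret ideal J R .
  show ?R using a_subset I_l_closed I_r_closed zero_closed a_closed by auto
next
  assume R: ?R
  have "\<ominus> a \<in> J" if "a \<in> J" for a
  proof -
    have "(\<ominus> \<one>) \<otimes> a \<in> J" using R that by blast
    then show ?thesis using R that by (metis l_minus l_one one_closed subsetD)
  qed
  then show ?L
    using R by (intro idealI ring_axioms subgroup.intro) (auto simp: a_inv_def[symmetric])
qed

lemma (in ring) ideal_minus: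
  "ideal J R \<Longrightarrow> a \<in> J \<Longrightarrow> b \<in> J \<Longrightarrow> a \<ominus> b \<in> J"
  by (simp add: a_minus_def additive_subgroup.a_closed additive_subgroup.a_inv_closed ideal_def)

lemma (in cring) primeideal_iff:
  "primeideal P R \<longleftrightarrow> ideal P R \<and> \<one> \<notin> P \<and>
     (\<forall>a\<in>carrier R. \<forall>b\<in>carrier R. a \<otimes> b \<in> P \<longrightarrow> a \<in> P \<or> b \<in> P)"
proof -
  have "carrier R \<noteq> P \<longleftrightarrow> \<one> \<notin> P" if "ideal P R"
    using that ideal.one_imp_carrier one_closed by metis
  then show ?thesis
    using cring_axioms unfolding primeideal_def primeideal_axioms_def by blast
qed

text \<open>\<open>J\<close> plus the principal ideal of \<open>z\<close>, in a form that lets later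
  proofs read off the coefficient of \<open>z\<close>.\<close>

lemma (in cring) add_pideal_ideal:
  assumes "ideal J R" "z \<in> carrier R"
  shows "ideal {j \<oplus> r \<otimes> z | j r. j \<in> J \<and> r \<in> carrier R} R"
  unfolding ideal_iff
proof (intro conjI ballI)
  have J: "J \<subseteq> carrier R" "\<zero> \<in> J" and Ja: "\<And>a b. a \<in> J \<Longrightarrow> b \<in> J \<Longrightarrow> a \<oplus> b \<in> J"
    and Jm: "\<And>a r. a \<in> J \<Longrightarrow> r \<in> carrier R \<Longrightarrow> r \<otimes> a \<in> J"
    using assms(1) unfolding ideal_iff by blast+
  let ?K = "{j \<oplus> r \<otimes> z | j r. j \<in> J \<and> r \<in> carrier R}"
  show "?K \<subseteq> carrier R" using J assms(2) by auto
  show "\<zero> \<in> ?K"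
    by (rule CollectI, rule exI[of _ \<zero>], rule exI[of _ \<zero>]) (use J assms(2) in auto)
  fix a assume "a \<in> ?K"
  then obtain j r where a: "a = j \<oplus> r \<otimes> z" "j \<in> J" "r \<in> carrier R" by auto
  {
    fix b assume "b \<in> ?K"
    then obtain j' r' where b: "b = j' \<oplus> r' \<otimes> z" "j' \<in> J" "r' \<in> carrier R" by auto
    have "a \<oplus> b = (j \<oplus> j') \<oplus> (r \<oplus> r') \<otimes> z"
      using a b J assms(2) by (simp add: subset_eq l_distr a_ac)
    then show "a \<oplus> b \<in> ?K" using a b Ja by blast
  }
  fix s assume s: "s \<in> carrier R"
  have e: "s \<otimes> a = (s \<otimes> j) \<oplus> (s \<otimes> r) \<otimes> z"
    using a s J assms(2) by (simp add: subset_eq r_distr m_assoc)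
  then show "s \<otimes> a \<in> ?K" using a s Jm by blast
  moreover have "a \<in> carrier R" using a J assms(2) by auto
  ultimately show "a \<otimes> s \<in> ?K" using s m_comm[of a s] by simp
qed

lemma (in noetherian_ring) ideals_acc:
  assumes "\<And>n::nat. ideal (L n) R" "\<And>n. L n \<subseteq> L (Suc n)"
  shows "\<exists>n0. \<forall>n\<ge>n0. L n = L n0"
proof -
  have mono: "L i \<subseteq> L j" if "i \<le> j" for i j
    using that by (rule lift_Suc_mono_le[of L, OF assms(2)])
  have "L i \<subseteq> L j \<or> L j \<subseteq> L i" for i j
    using mono by (cases "i \<le> j") auto
  then have "subset.chain {I. ideal I R} (range L)"
    unfolding subset_chain_def using assms(1) by auto
  then have "\<Union>(range L) \<in> range L"
    by (intro ideal_chain_is_trivial) auto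
  then obtain n0 where "\<Union>(range L) = L n0" by auto
  then show ?thesis using mono by (intro exI[of _ n0]) blast
qed

text \<open>In a noetherian ring the union of a nonempty chain of ideals belongs to the chain, so
  Zorn's lemma applies to every nonempty family.\<close>

lemma (in noetherian_ring) ideal_family_has_maximal:
  assumes "F \<noteq> {}" "\<And>J. J \<in> F \<Longrightarrow> ideal J R"
  shows "\<exists>J\<in>F. \<forall>K\<in>F. J \<subseteq> K \<longrightarrow> K = J"
proof -
  have "\<Union>C \<in> F" if "C \<noteq> {}" "subset.chain F C" for C
  proof -
    have "subset.chain {I. ideal I R} C"
      using that(2) assms(2) by (auto simp: subset.chain_def)
    then have "\<Union>C \<in> C" using ideal_chain_is_trivial that(1) by blast
    moreover have "C \<subseteq> F" using that(2) by (auto simp: subset.chain_def)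
    ultimately show ?thesis by blast
  qed
  then show ?thesis using subset_Zorn_nonempty[OF assms(1)] by blast
qed

locale noetherian_cring = noetherian_ring R + cring R for R (structure)

context noetherian_cring
begin

text \<open>
  \<open>c u\<close> is to be thought of as the annihilator of \<open>u\<close>, and the last assumption is satisfied by
  \<open>v = b u\<close>.
\<close>

lemma maximal_colon_prime:
  assumes u: "u \<in> U"
    and ideal: "\<And>u. u \<in> U \<Longrightarrow> ideal (c u) R"
    and proper: "\<And>u. u \<in> U \<Longrightarrow> \<one> \<notin> c u"
    and colon: "\<And>u b. u \<in> U \<Longrightarrow> b \<in> carrier R \<Longrightarrow> b \<notin> c u \<Longrightarrow>
       \<exists>v\<in>U. c v = {r \<in> carrier R. r \<otimes> b \<in> c u}"
  shows "\<exists>v\<in>U. c u \<subseteq> c v \<and> primeideal (c v) R \<and> (\<forall>w\<in>U. c v \<subseteq> c w \<longrightarrow> c w = c v)"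
proof -
  have "\<exists>J\<in>{c v | v. v \<in> U \<and> c u \<subseteq> c v}. \<forall>K\<in>{c v | v. v \<in> U \<and> c u \<subseteq> c v}. J \<subseteq> K \<longrightarrow> K = J"
    by (rule ideal_family_has_maximal) (use u ideal in auto)
  then obtain J where J: "J \<in> {c v | v. v \<in> U \<and> c u \<subseteq> c v}"
    and max': "\<And>K. K \<in> {c v | v. v \<in> U \<and> c u \<subseteq> c v} \<Longrightarrow> J \<subseteq> K \<Longrightarrow> K = J"
    by meson
  from J obtain v where v: "v \<in> U" "c u \<subseteq> c v" and Jv: "J = c v" by auto
  note max0 = max'[unfolded Jv]
  have max: "c w = c v" if "w \<in> U" "c v \<subseteq> c w" for w
    using max0[of "c w"] that v by auto
  have "a \<in> c v \<or> b \<in> c v"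
    if ab: "a \<in> carrier R" "b \<in> carrier R" "a \<otimes> b \<in> c v" for a b
  proof (rule disjCI)
    \<comment> \<open>The colon ideal of \<open>c v\<close> by \<open>b\<close> is again some
      \<open>c w\<close> and contains \<open>c v\<close>, so it equals \<open>c v\<close> by
      maximality; and it contains \<open>a\<close>.\<close>
    assume "b \<notin> c v"
    then obtain w where w: "w \<in> U" "c w = {r \<in> carrier R. r \<otimes> b \<in> c v}"
      using colon v(1) ab(2) by meson
    have "c v \<subseteq> c w"
      using ideal[OF v(1)] ab(2) unfolding w ideal_iff by auto
    then show "a \<in> c v" using max[OF w(1)] w ab by auto
  qed
  then have "primeideal (c v) R"
    using ideal proper v(1) unfolding primeideal_iff by auto
  then show ?thesis using v max by blast
qed

text \<open>The witness is a product with one factor from each ideal, all chosen outside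
  \<open>Q\<close>. This is the contrapositive of the fact that a prime containing a finite
  intersection of ideals contains one of them.\<close>

lemma finite_inter_not_in_prime:
  assumes "finite F" "primeideal Q R" "\<And>P. P \<in> F \<Longrightarrow> ideal P R \<and> \<not> P \<subseteq> Q"
  shows "\<exists>a\<in>carrier R. (\<forall>P\<in>F. a \<in> P) \<and> a \<notin> Q"
  using assms(1,3)
proof (induction F rule: finite_induct)
  case empty
  then show ?case using assms(2) by (auto simp: primeideal_iff)
next
  case (insert P F)
  then obtain a where a: "a \<in> carrier R" "\<forall>P\<in>F. a \<in> P" "a \<notin> Q" by auto
  obtain b where b: "b \<in> P" "b \<notin> Q" using insert by auto
  have bc: "b \<in> carrier R" using b insert.prems[of P] by (auto simp: ideal_iff)
  have "a \<otimes> b \<notin> Q" using assms(2) a b bc by (auto simp: primeideal_iff)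
  moreover have "a \<otimes> b \<in> P'" if "P' \<in> insert P F" for P'
    using that a b bc insert.prems[OF that] by (auto simp: ideal_iff)
  ultimately show ?case using a bc by blast
qed

text \<open>Prime avoidance inside the coset of \<open>z\<close> modulo \<open>J\<close>. Without
  one inclusion-minimal prime \<open>P\<close> there is a solution \<open>c\<close> by induction; if
  it falls into \<open>P\<close>, it is corrected by an element of \<open>J\<close> that lies in all
  the other primes but not in \<open>P\<close>.\<close>

lemma coset_prime_avoidance:
  assumes "finite F" "\<And>P. P \<in> F \<Longrightarrow> primeideal P R" "ideal J R" "z \<in> carrier R"
    and "\<And>P. P \<in> F \<Longrightarrow> z \<in> P \<Longrightarrow> \<not> J \<subseteq> P"
  shows "\<exists>c\<in>J. \<forall>P\<in>F. z \<oplus> c \<notin> P"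
  using assms(1,2,5)
proof (induction F rule: finite_psubset_induct)
  case (psubset F)
  have Jz: "\<zero> \<in> J" and Jc: "J \<subseteq> carrier R" using assms(3) by (auto simp: ideal_iff)
  show ?case
  proof (cases "F = {}")
    case True
    then show ?thesis using Jz by auto
  next
    case False
    \<comment> \<open>Minimality of \<open>P\<close> means that no other member of \<open>F\<close>
      lies inside \<open>P\<close>, so the intersection of the others is not contained in
      \<open>P\<close> either.\<close>
    then obtain P where P: "P \<in> F" "\<And>P'. P' \<in> F \<Longrightarrow> P' \<subseteq> P \<Longrightarrow> P' = P"
      using finite_has_minimal[OF psubset.hyps(1)] by metis
    have primeP: "primeideal P R" using psubset.prems P by auto
    have "F - {P} \<subset> F" using P by auto
    then obtain c where c: "c \<in> J" "\<And>P'. P' \<in> F - {P} \<Longrightarrow> z \<oplus> c \<notin> P'"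
      using psubset.IH[of "F - {P}"] psubset.prems by (metis DiffD1)
    show ?thesis
    proof (cases "z \<oplus> c \<in> P")
      case False
      then show ?thesis using c by blast
    next
      case True
      have idP: "ideal P R" using primeP by (simp add: primeideal_iff)
      have "\<not> J \<subseteq> P"
      proof
        assume JP: "J \<subseteq> P"
        then have "(z \<oplus> c) \<ominus> c \<in> P" using ideal_minus[OF idP True] c by auto
        moreover have "(z \<oplus> c) \<ominus> c = z"
          using c Jc assms(4) by (simp add: subset_eq a_minus_def a_assoc r_neg)
        ultimately show False using psubset.prems(2)[OF P(1)] JP by simp
      qed
      then obtain j where j: "j \<in> J" "j \<notin> P" by auto
      have "\<exists>a\<in>carrier R. (\<forall>P'\<in>F - {P}. a \<in> P') \<and> a \<notin> P"
        using psubset.hyps psubset.prems(1) P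
        by (intro finite_inter_not_in_prime primeP) (auto simp: primeideal_def)
      then obtain a where a: "a \<in> carrier R" "\<And>P'. P' \<in> F - {P} \<Longrightarrow> a \<in> P'" "a \<notin> P" by auto
      have jc: "j \<in> carrier R" and cc: "c \<in> carrier R" using j c Jc by auto
      have ja: "j \<otimes> a \<notin> P" using primeP j a jc by (auto simp: primeideal_iff)
      have jaJ: "j \<otimes> a \<in> J" using assms(3) j a by (auto simp: ideal_iff)
      have cancel: "((z \<oplus> c) \<oplus> d) \<ominus> (z \<oplus> c) = d" "((z \<oplus> c) \<oplus> d) \<ominus> d = z \<oplus> c" if "d \<in> carrier R" for d
        using that cc assms(4) by algebra+
      \<comment> \<open>Modulo \<open>P\<close> the new summand moves \<open>z \<oplus> c\<close>
        away from zero, and modulo every other prime it vanishes.\<close>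
      have "z \<oplus> (c \<oplus> j \<otimes> a) \<notin> P'" if P': "P' \<in> F" for P'
      proof
        assume "z \<oplus> (c \<oplus> j \<otimes> a) \<in> P'"
        then have in': "(z \<oplus> c) \<oplus> j \<otimes> a \<in> P'" using cc a jc assms(4) by (simp add: a_assoc)
        have idP': "ideal P' R" using psubset.prems(1)[OF P'] by (simp add: primeideal_iff)
        show False
        proof (cases "P' = P")
          case True
          then show False
            using ideal_minus[OF idP' in', of "z \<oplus> c"] \<open>z \<oplus> c \<in> P\<close> ja cancel(1)[of "j \<otimes> a"] a jc by auto
        next
          case False
          then have "j \<otimes> a \<in> P'" using a(2) P' idP' jc by (auto simp: ideal_iff)
          then show False
            using ideal_minus[OF idP' in', of "j \<otimes> a"] cancel(2)[of "j \<otimes> a"] a jc c(2) P' False by auto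
        qed
      qed
      moreover have "c \<oplus> j \<otimes> a \<in> J" using c jaJ assms(3) by (auto simp: ideal_iff)
      ultimately show ?thesis by blast
    qed
  qed
qed

end

section \<open>Saturation at a prime and Nakayama's lemma for ideals\<close>

context noetherian_cring
begin

text \<open>The set is the contraction to \<open>R\<close> of the extension of \<open>J\<close> to
  the localization at \<open>P\<close>. With it, localized ideals are handled inside
  \<open>R\<close>.\<close>

lemma saturation_ideal:
  assumes P: "primeideal P R" and J: "ideal J R"
  shows "ideal {r \<in> carrier R. \<exists>t\<in>carrier R - P. t \<otimes> r \<in> J} R" (is "ideal ?S R")
  unfolding ideal_iff
proof (intro conjI ballI)
  have Jc: "J \<subseteq> carrier R" and J0: "\<zero> \<in> J" and Ja: "\<And>a b. a \<in> J \<Longrightarrow> b \<in> J \<Longrightarrow> a \<oplus> b \<in> J"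
    and Jm: "\<And>a r. a \<in> J \<Longrightarrow> r \<in> carrier R \<Longrightarrow> r \<otimes> a \<in> J"
    using J unfolding ideal_iff by blast+
  have Pm: "s \<otimes> t \<in> carrier R - P" if "s \<in> carrier R - P" "t \<in> carrier R - P" for s t
    using that P unfolding primeideal_iff by auto
  show "?S \<subseteq> carrier R" by auto
  have "\<one> \<in> carrier R - P" using P unfolding primeideal_iff by auto
  moreover have "\<one> \<otimes> \<zero> \<in> J" using J0 by simp
  ultimately show "\<zero> \<in> ?S" by blast
  fix a assume "a \<in> ?S"
  then obtain t where a: "a \<in> carrier R" and t: "t \<in> carrier R - P" "t \<otimes> a \<in> J" by auto
  {
    fix b assume "b \<in> ?S"
    then obtain s where b: "b \<in> carrier R" and s: "s \<in> carrier R - P" "s \<otimes> b \<in> J" by auto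
    have "s \<otimes> (t \<otimes> a) \<oplus> t \<otimes> (s \<otimes> b) \<in> J" using Ja Jm s t by auto
    moreover have "s \<otimes> (t \<otimes> a) \<oplus> t \<otimes> (s \<otimes> b) = (s \<otimes> t) \<otimes> (a \<oplus> b)"
    proof -
      have "s \<in> carrier R" "t \<in> carrier R" using s t by auto
      then show ?thesis using a b by algebra
    qed
    ultimately have "(s \<otimes> t) \<otimes> (a \<oplus> b) \<in> J" by simp
    then show "a \<oplus> b \<in> ?S" using a b Pm[OF s(1) t(1)] by blast
  }
  fix r assume r: "r \<in> carrier R"
  have "t \<otimes> (r \<otimes> a) = r \<otimes> (t \<otimes> a)" using t(1) a r by (simp add: m_lcomm)
  then have "t \<otimes> (r \<otimes> a) \<in> J" using Jm[OF t(2) r] by simp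
  then show ra: "r \<otimes> a \<in> ?S" using t(1) a r by blast
  then show "a \<otimes> r \<in> ?S" using m_comm[OF a r] by simp
qed

text \<open>Nakayama's lemma over the localization at \<open>P\<close>, modulo \<open>J\<close>. As
  \<open>Y\<close> is a mere set, the chain condition takes the place of finite generation:
  iterating \<open>step\<close> from an element of \<open>Y\<close> gives elements z_n for which the
  ideals J + R z_n increase locally at \<open>P\<close>.\<close>

lemma prime_local_nakayama:
  assumes P: "primeideal P R" and J: "ideal J R"
    and sat: "\<And>t r. t \<in> carrier R - P \<Longrightarrow> r \<in> carrier R \<Longrightarrow> t \<otimes> r \<in> J \<Longrightarrow> r \<in> J"
    and x: "x \<in> P" and Y: "Y \<subseteq> carrier R"
    and step: "\<And>z. z \<in> Y \<Longrightarrow> \<exists>t\<in>carrier R - P. \<exists>j\<in>J. \<exists>r\<in>Y. t \<otimes> z = j \<oplus> r \<otimes> x"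
  shows "Y \<subseteq> J"
proof
  fix z0 assume z0: "z0 \<in> Y"
  have Jc: "J \<subseteq> carrier R" and J0: "\<zero> \<in> J" and Ja: "\<And>a b. a \<in> J \<Longrightarrow> b \<in> J \<Longrightarrow> a \<oplus> b \<in> J"
    and Jm: "\<And>a r. a \<in> J \<Longrightarrow> r \<in> carrier R \<Longrightarrow> r \<otimes> a \<in> J"
    using J unfolding ideal_iff by blast+
  have Pm: "s \<otimes> t \<in> carrier R - P" if "s \<in> carrier R - P" "t \<in> carrier R - P" for s t
    using that P unfolding primeideal_iff by auto
  have idP: "ideal P R" using P by (simp add: primeideal_def)
  have xc: "x \<in> carrier R" using x idP by (auto simp: ideal_iff)
  have "\<exists>z. \<forall>n. z n \<in> Y \<and> (n = 0 \<longrightarrow> z n = z0) \<and>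
      (\<exists>t\<in>carrier R - P. \<exists>j\<in>J. t \<otimes> z n = j \<oplus> z (Suc n) \<otimes> x)"
  proof -
    have "\<exists>z. \<forall>n. (z n \<in> Y \<and> (n = 0 \<longrightarrow> z n = z0)) \<and>
      (\<exists>t\<in>carrier R - P. \<exists>j\<in>J. t \<otimes> z n = j \<oplus> z (Suc n) \<otimes> x)"
    proof (rule dependent_nat_choice)
      show "\<exists>x. x \<in> Y \<and> (0 = (0::nat) \<longrightarrow> x = z0)" using z0 by blast
      fix y and n :: nat assume "y \<in> Y \<and> (n = 0 \<longrightarrow> y = z0)"
      then show "\<exists>w. (w \<in> Y \<and> (Suc n = 0 \<longrightarrow> w = z0)) \<and>
          (\<exists>t\<in>carrier R - P. \<exists>j\<in>J. t \<otimes> y = j \<oplus> w \<otimes> x)"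
        using step[of y] by blast
    qed
    then show ?thesis by blast
  qed
  then obtain z where zY: "\<And>n. z n \<in> Y" and z0': "z 0 = z0"
    and zs: "\<And>n. \<exists>t\<in>carrier R - P. \<exists>j\<in>J. t \<otimes> z n = j \<oplus> z (Suc n) \<otimes> x"
    by metis
  have zc: "z n \<in> carrier R" for n using zY Y by auto
  obtain t j where t: "\<And>n. t n \<in> carrier R - P" and j: "\<And>n. j n \<in> J"
    and tj: "\<And>n. t n \<otimes> z n = j n \<oplus> z (Suc n) \<otimes> x"
    using zs by metis
  have tc: "t n \<in> carrier R" and jc: "j n \<in> carrier R" for n using t j Jc by auto
  \<comment> \<open>\<open>L n\<close> is the contraction of J + R z_n from the localization at
    \<open>P\<close>. It increases because t_n z_n = j_n + z_{n+1} x.\<close>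
  define A where "A = (\<lambda>n. {i \<oplus> r \<otimes> z n | i r. i \<in> J \<and> r \<in> carrier R})"
  define L where "L = (\<lambda>n. {r \<in> carrier R. \<exists>t\<in>carrier R - P. t \<otimes> r \<in> A n})"
  have "ideal (L n) R" for n
    unfolding L_def A_def by (intro saturation_ideal P add_pideal_ideal J zc)
  moreover have "L n \<subseteq> L (Suc n)" for n
  proof
    fix r assume "r \<in> L n"
    then obtain s i c where r: "r \<in> carrier R" and s: "s \<in> carrier R - P"
      and i: "i \<in> J" and c: "c \<in> carrier R" and e: "s \<otimes> r = i \<oplus> c \<otimes> z n"
      unfolding L_def A_def by auto
    have car: "s \<in> carrier R" "i \<in> carrier R" using s i Jc by auto
    have "(t n \<otimes> s) \<otimes> r = t n \<otimes> i \<oplus> c \<otimes> (t n \<otimes> z n)"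
      using car r c tc zc e by (simp add: m_assoc r_distr m_lcomm)
    also have "\<dots> = (t n \<otimes> i \<oplus> c \<otimes> j n) \<oplus> (c \<otimes> x) \<otimes> z (Suc n)"
    proof -
      have "z (Suc n) \<in> carrier R" "t n \<in> carrier R" "j n \<in> carrier R" using tc jc zc by auto
      then show ?thesis unfolding tj using car c xc by algebra
    qed
    finally have "(t n \<otimes> s) \<otimes> r \<in> A (Suc n)"
      unfolding A_def using Ja[OF Jm[OF i tc] Jm[OF j c]] c xc by blast
    then show "r \<in> L (Suc n)" unfolding L_def using r Pm[OF t s] by blast
  qed
  ultimately obtain n where n: "L (Suc n) = L n"
    using ideals_acc[of L] by (metis le_Suc_eq order_refl)
  have "z (Suc n) \<in> L (Suc n)"
  proof -
    have "\<one> \<otimes> z (Suc n) = \<zero> \<oplus> \<one> \<otimes> z (Suc n)" using zc by simp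
    then have "\<one> \<otimes> z (Suc n) \<in> A (Suc n)" unfolding A_def using J0 by blast
    moreover have "\<one> \<in> carrier R - P" using P unfolding primeideal_iff by auto
    ultimately show ?thesis unfolding L_def using zc by blast
  qed
  then have "z (Suc n) \<in> L n" using n by simp
  then obtain s i c where s: "s \<in> carrier R - P"
      and i: "i \<in> J" and c: "c \<in> carrier R" and e: "s \<otimes> z (Suc n) = i \<oplus> c \<otimes> z n"
    unfolding L_def A_def by auto
  have car: "s \<in> carrier R" "i \<in> carrier R" using s i Jc by auto
  have "(t n \<otimes> s) \<otimes> z (Suc n) = t n \<otimes> i \<oplus> c \<otimes> (t n \<otimes> z n)"
    using car c tc zc e by (simp add: m_assoc r_distr m_lcomm)
  also have "\<dots> = (t n \<otimes> i \<oplus> c \<otimes> j n) \<oplus> (c \<otimes> x) \<otimes> z (Suc n)"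
  proof -
    have "z (Suc n) \<in> carrier R" "t n \<in> carrier R" "j n \<in> carrier R" using tc jc zc by auto
    then show ?thesis unfolding tj using car c xc by algebra
  qed
  finally have e2: "(t n \<otimes> s) \<otimes> z (Suc n) = (t n \<otimes> i \<oplus> c \<otimes> j n) \<oplus> (c \<otimes> x) \<otimes> z (Suc n)" .
  have jj: "t n \<otimes> i \<oplus> c \<otimes> j n \<in> J" using Ja[OF Jm[OF i tc] Jm[OF j c]] .
  \<comment> \<open>Stationarity expresses z_{n+1} by z_n, hence by itself with coefficient c x. The
    factor t_n s - c x is outside \<open>P\<close>, since x lies in \<open>P\<close> and t_n s does
    not; as \<open>J\<close> is saturated, it can be cancelled.\<close>
  have "((t n \<otimes> s) \<ominus> (c \<otimes> x)) \<otimes> z (Suc n) = t n \<otimes> i \<oplus> c \<otimes> j n"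
  proof -
    have m: "\<And>a b u w. \<lbrakk>a \<in> carrier R; b \<in> carrier R; u \<in> carrier R; w \<in> carrier R; a \<otimes> w = u \<oplus> b \<otimes> w\<rbrakk>
        \<Longrightarrow> (a \<ominus> b) \<otimes> w = u"
      by (simp add: a_minus_def l_distr l_minus a_assoc r_neg)
    show ?thesis by (rule m[OF _ _ _ _ e2]) (use car c tc jc zc xc in auto)
  qed
  moreover have "(t n \<otimes> s) \<ominus> (c \<otimes> x) \<in> carrier R - P"
  proof -
    have cx: "c \<otimes> x \<in> P" using idP x c by (auto simp: ideal_iff)
    have "t n \<otimes> s \<in> P" if "(t n \<otimes> s) \<ominus> (c \<otimes> x) \<in> P"
    proof -
      have "((t n \<otimes> s) \<ominus> (c \<otimes> x)) \<oplus> (c \<otimes> x) \<in> P" using idP that cx by (auto simp: ideal_iff)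
      moreover have "((t n \<otimes> s) \<ominus> (c \<otimes> x)) \<oplus> (c \<otimes> x) = t n \<otimes> s"
        using tc car c xc by (simp add: a_minus_def a_assoc l_neg)
      ultimately show ?thesis by simp
    qed
    then show ?thesis using Pm[OF t s] tc car c xc by auto
  qed
  ultimately have base: "z (Suc n) \<in> J" using sat zc jj by metis
  \<comment> \<open>The relation t_k z_k = j_k + z_{k+1} x carries membership in \<open>J\<close>
    back down the sequence to z_0.\<close>
  have pred: "z k \<in> J" if "z (Suc k) \<in> J" for k
  proof -
    have "z (Suc k) \<otimes> x \<in> J" using Jm[OF that xc] m_comm[OF zc xc] by simp
    then have "t k \<otimes> z k \<in> J" unfolding tj using Ja j by simp
    then show ?thesis using sat t zc by blast
  qed
  have "z (Suc n - k) \<in> J" for k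
  proof (induction k)
    case (Suc k)
    then show ?case using pred[of "Suc n - Suc k"] 
      by (cases "k \<le> n") (simp_all add: Suc_diff_le)
  qed (use base in simp)
  from this[of "Suc n"] show "z0 \<in> J" using z0' by simp
qed

end

section \<open>Noetherian modules\<close>

text \<open>The ascending chain condition rather than finite generation, because chains of
  submodules can be compared directly along Koszul complexes and localizations.\<close>

definition noetherian_module ::
    "('a, 'b) ring_scheme \<Rightarrow> ('a, 'c, 'd) module_scheme \<Rightarrow> bool" where
  "noetherian_module R N \<longleftrightarrow> module R N \<and>
     (\<forall>L :: nat \<Rightarrow> 'c set. (\<forall>n. submodule (L n) R N \<and> L n \<subseteq> L (Suc n)) \<longrightarrow>
        (\<exists>n0. \<forall>n\<ge>n0. L n = L n0))"

definition annihilator ::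
    "('a, 'b) ring_scheme \<Rightarrow> ('a, 'c, 'd) module_scheme \<Rightarrow> 'c \<Rightarrow> 'a set" where
  "annihilator R N u = {r \<in> carrier R. r \<odot>\<^bsub>N\<^esub> u = \<zero>\<^bsub>N\<^esub>}"

lemma (in module) submodule_iff:
  "submodule L R M \<longleftrightarrow> L \<subseteq> carrier M \<and> \<zero>\<^bsub>M\<^esub> \<in> L \<and> (\<forall>u\<in>L. \<forall>v\<in>L. u \<oplus>\<^bsub>M\<^esub> v \<in> L) \<and>
     (\<forall>r\<in>carrier R. \<forall>u\<in>L. r \<odot>\<^bsub>M\<^esub> u \<in> L)" (is "_ \<longleftrightarrow> ?R")
proof
  assume L: "submodule L R M"
  note E = submoduleE[OF L]
  obtain u where "u \<in> L" using E(2) by auto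
  then have "\<zero> \<odot>\<^bsub>M\<^esub> u \<in> L" "u \<in> carrier M" using E by auto
  then have "\<zero>\<^bsub>M\<^esub> \<in> L" by simp
  then show ?R using E by auto
next
  assume R: ?R
  have "\<ominus>\<^bsub>M\<^esub> u \<in> L" if "u \<in> L" for u
    using R that smult_l_minus[of \<one> u] R.one_closed R.a_inv_closed smult_one by (metis subsetD)
  then show "submodule L R M"
    using R by (intro submoduleI) auto
qed

lemma (in module) annihilator_ideal:
  assumes "u \<in> carrier M"
  shows "ideal (annihilator R M u) R"
proof -
  have "a \<odot>\<^bsub>M\<^esub> (r \<odot>\<^bsub>M\<^esub> u) = \<zero>\<^bsub>M\<^esub>"
    if "a \<in> carrier R" "r \<in> carrier R" "a \<odot>\<^bsub>M\<^esub> u = \<zero>\<^bsub>M\<^esub>" for a r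
    using that assms smult_assoc1[of a r u] smult_assoc1[of r a u] by (simp add: R.m_comm)
  then show ?thesis
    unfolding R.ideal_iff annihilator_def
    using assms by (auto simp: smult_l_distr smult_assoc1)
qed

text \<open>The colon of the annihilator of \<open>v\<close> by \<open>b\<close> is the annihilator
  of \<open>b\<close> times \<open>v\<close>, so \<open>maximal_colon_prime\<close> applies: an
  annihilator that is maximal among those of nonzero elements of \<open>L\<close> is prime.\<close>

lemma (in noetherian_cring) annihilator_in_associated_prime:
  assumes "module R N" "submodule L R N" "u \<in> L" "u \<noteq> \<zero>\<^bsub>N\<^esub>"
  shows "\<exists>v\<in>L. v \<noteq> \<zero>\<^bsub>N\<^esub> \<and> annihilator R N u \<subseteq> annihilator R N v \<and> primeideal (annihilator R N v) R \<and>
     (\<forall>w\<in>L - {\<zero>\<^bsub>N\<^esub>}. annihilator R N v \<subseteq> annihilator R N w \<longrightarrow> annihilator R N w = annihilator R N v)"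
proof -
  interpret N: module R N by fact
  have L: "L \<subseteq> carrier N" and Lm: "\<And>r v. r \<in> carrier R \<Longrightarrow> v \<in> L \<Longrightarrow> r \<odot>\<^bsub>N\<^esub> v \<in> L"
    using assms(2) unfolding N.submodule_iff by blast+
  have "\<exists>v\<in>L - {\<zero>\<^bsub>N\<^esub>}. annihilator R N u \<subseteq> annihilator R N v \<and> primeideal (annihilator R N v) R \<and>
     (\<forall>w\<in>L - {\<zero>\<^bsub>N\<^esub>}. annihilator R N v \<subseteq> annihilator R N w \<longrightarrow> annihilator R N w = annihilator R N v)"
  proof (rule maximal_colon_prime)
    show "u \<in> L - {\<zero>\<^bsub>N\<^esub>}" using assms by simp
    show "ideal (annihilator R N v) R" if "v \<in> L - {\<zero>\<^bsub>N\<^esub>}" for v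
      using that L by (intro N.annihilator_ideal) auto
    show "\<one> \<notin> annihilator R N v" if "v \<in> L - {\<zero>\<^bsub>N\<^esub>}" for v
      using that L by (auto simp: annihilator_def)
    show "\<exists>w\<in>L - {\<zero>\<^bsub>N\<^esub>}. annihilator R N w = {r \<in> carrier R. r \<otimes> b \<in> annihilator R N v}"
      if v: "v \<in> L - {\<zero>\<^bsub>N\<^esub>}" and b: "b \<in> carrier R" "b \<notin> annihilator R N v" for v b
    proof (rule bexI)
      have vc: "v \<in> carrier N" using v L by auto
      show "annihilator R N (b \<odot>\<^bsub>N\<^esub> v) = {r \<in> carrier R. r \<otimes> b \<in> annihilator R N v}"
        using vc b by (auto simp: annihilator_def N.smult_assoc1)
      show "b \<odot>\<^bsub>N\<^esub> v \<in> L - {\<zero>\<^bsub>N\<^esub>}"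
        using v b Lm by (auto simp: annihilator_def)
    qed
  qed
  then show ?thesis by auto
qed

text \<open>The associated primes that are maximal among all annihilators of nonzero elements. Over
  a noetherian ring their union is the set of zero divisors on a nonzero \<open>N\<close>.\<close>

definition maximal_annihilators ::
    "('a, 'b) ring_scheme \<Rightarrow> ('a, 'c, 'd) module_scheme \<Rightarrow> 'a set set" where
  "maximal_annihilators R N = {annihilator R N v | v. v \<in> carrier N - {\<zero>\<^bsub>N\<^esub>} \<and>
     primeideal (annihilator R N v) R \<and>
     (\<forall>w\<in>carrier N - {\<zero>\<^bsub>N\<^esub>}. annihilator R N v \<subseteq> annihilator R N w \<longrightarrow>
        annihilator R N w = annihilator R N v)}"

context noetherian_cring
begin

lemma zero_divisor_in_maximal_annihilator:
  assumes "module R N" "u \<in> carrier N" "u \<noteq> \<zero>\<^bsub>N\<^esub>" "r \<in> carrier R" "r \<odot>\<^bsub>N\<^esub> u = \<zero>\<^bsub>N\<^esub>"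
  shows "\<exists>P\<in>maximal_annihilators R N. r \<in> P"
proof -
  interpret N: module R N by fact
  have r: "r \<in> annihilator R N u" using assms by (simp add: annihilator_def)
  obtain v where "v \<in> carrier N" "v \<noteq> \<zero>\<^bsub>N\<^esub>" "annihilator R N u \<subseteq> annihilator R N v"
    "primeideal (annihilator R N v) R"
    "\<forall>w\<in>carrier N - {\<zero>\<^bsub>N\<^esub>}. annihilator R N v \<subseteq> annihilator R N w \<longrightarrow> annihilator R N w = annihilator R N v"
    using annihilator_in_associated_prime[OF assms(1) N.carrier_is_submodule assms(2,3)] by blast
  then have "annihilator R N v \<in> maximal_annihilators R N" "r \<in> annihilator R N v"
    using r unfolding maximal_annihilators_def by blast+
  then show ?thesis by blast
qed

text \<open>Given distinct primes p_n, the annihilator of v_n, let \<open>L n\<close> consist of the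
  elements killed by the intersection of the first n primes. These submodules increase. Once
  \<open>L (Suc n) = L n\<close>, that intersection kills v_n and so lies in p_n; then some earlier
  p_i lies in p_n, and maximality makes them equal.\<close>

lemma finite_maximal_annihilators:
  assumes "noetherian_module R N"
  shows "finite (maximal_annihilators R N)"
proof (rule ccontr)
  interpret N: module R N using assms by (simp add: noetherian_module_def)
  assume "infinite (maximal_annihilators R N)"
  then obtain p :: "nat \<Rightarrow> 'a set" where p: "inj p" "range p \<subseteq> maximal_annihilators R N"
    using infinite_countable_subset by blast
  then have pM: "p n \<in> maximal_annihilators R N" for n by auto
  then have "\<forall>n. \<exists>v. p n = annihilator R N v \<and> v \<in> carrier N - {\<zero>\<^bsub>N\<^esub>} \<and>
     primeideal (annihilator R N v) R \<and>
     (\<forall>w\<in>carrier N - {\<zero>\<^bsub>N\<^esub>}. annihilator R N v \<subseteq> annihilator R N w \<longrightarrow>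
        annihilator R N w = annihilator R N v)"
    unfolding maximal_annihilators_def by blast
  then obtain v where v: "\<And>n. p n = annihilator R N (v n)" "\<And>n. v n \<in> carrier N - {\<zero>\<^bsub>N\<^esub>}"
    "\<And>n. primeideal (p n) R"
    and max: "\<And>n w. w \<in> carrier N - {\<zero>\<^bsub>N\<^esub>} \<Longrightarrow> p n \<subseteq> annihilator R N w \<Longrightarrow> annihilator R N w = p n"
    by metis
  define L where "L = (\<lambda>n. {w \<in> carrier N. \<forall>r\<in>carrier R. (\<forall>i<n. r \<in> p i) \<longrightarrow> r \<odot>\<^bsub>N\<^esub> w = \<zero>\<^bsub>N\<^esub>})"
  have "submodule (L n) R N" for n
    unfolding N.submodule_iff L_def
    by (auto simp: N.smult_r_distr N.smult_assoc1[symmetric] N.smult_assoc1 m_comm)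
  moreover have "L n \<subseteq> L (Suc n)" for n unfolding L_def by auto
  ultimately obtain n where n: "L (Suc n) = L n"
    using assms unfolding noetherian_module_def by (metis le_Suc_eq order_refl)
  have "v n \<in> L (Suc n)" unfolding L_def using v(2)[of n] by (auto simp: v(1) annihilator_def)
  then have vn: "v n \<in> L n" using n by simp
  have "\<exists>i<n. p i \<subseteq> p n"
  proof (rule ccontr)
    assume "\<not> (\<exists>i<n. p i \<subseteq> p n)"
    then have "\<exists>a\<in>carrier R. (\<forall>P\<in>p ` {..<n}. a \<in> P) \<and> a \<notin> p n"
      by (intro finite_inter_not_in_prime v) (use v(3) in \<open>auto simp: primeideal_def\<close>)
    then obtain a where "a \<in> carrier R" "\<forall>i<n. a \<in> p i" "a \<notin> p n" by auto
    then show False using vn by (auto simp: L_def v(1) annihilator_def)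
  qed
  then obtain i where i: "i < n" "p i \<subseteq> p n" by auto
  then have "p n = p i" using max[of "v n" i] v by auto
  then show False using p(1) i by (auto dest: injD)
qed

end

section \<open>Krull's principal ideal theorem\<close>

context noetherian_cring
begin

lemma saturation_saturated:
  assumes "primeideal P R" "t \<in> carrier R - P" "r \<in> carrier R"
    "t \<otimes> r \<in> {r \<in> carrier R. \<exists>t\<in>carrier R - P. t \<otimes> r \<in> J}"
  shows "r \<in> {r \<in> carrier R. \<exists>t\<in>carrier R - P. t \<otimes> r \<in> J}"
proof -
  obtain s where s: "s \<in> carrier R - P" "s \<otimes> (t \<otimes> r) \<in> J" using assms(4) by auto
  then have "(s \<otimes> t) \<otimes> r \<in> J" using assms by (simp add: m_assoc)
  moreover have "s \<otimes> t \<in> carrier R - P" using assms(1,2) s by (auto simp: primeideal_iff)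
  ultimately show ?thesis using assms(3) by blast
qed

lemma subset_saturation:
  assumes "primeideal P R" "J \<subseteq> carrier R"
  shows "J \<subseteq> {r \<in> carrier R. \<exists>t\<in>carrier R - P. t \<otimes> r \<in> J}"
proof
  fix r assume "r \<in> J"
  moreover from this have "r \<in> carrier R" "\<one> \<otimes> r \<in> J" using assms by auto
  moreover have "\<one> \<in> carrier R - P" using assms by (auto simp: primeideal_iff)
  ultimately show "r \<in> {r \<in> carrier R. \<exists>t\<in>carrier R - P. t \<otimes> r \<in> J}" by blast
qed

lemma subset_add_pideal:
  assumes "J \<subseteq> carrier R" "z \<in> carrier R"
  shows "J \<subseteq> {j \<oplus> r \<otimes> z | j r. j \<in> J \<and> r \<in> carrier R}"
proof
  fix j assume "j \<in> J"
  moreover from this have "j = j \<oplus> \<zero> \<otimes> z" using assms by auto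
  ultimately show "j \<in> {j \<oplus> r \<otimes> z | j r. j \<in> J \<and> r \<in> carrier R}" by blast
qed

lemma in_add_pideal:
  assumes "\<zero> \<in> J" "z \<in> carrier R"
  shows "z \<in> {j \<oplus> r \<otimes> z | j r. j \<in> J \<and> r \<in> carrier R}"
proof -
  have "z = \<zero> \<oplus> \<one> \<otimes> z" using assms by simp
  then show ?thesis using assms(1) by blast
qed

text \<open>Locally at a prime \<open>P\<close> minimal over \<open>F\<close>, the ring modulo
  \<open>F\<close> is artinian; saturated ideals stand for the ideals of that local ring. By
  noetherian induction, let \<open>J\<close> be maximal among the saturated ideals above which the
  descending chain condition fails. Adjoining a suitable \<open>f\<close> to \<open>J\<close> adds
  one copy of the residue field at \<open>P\<close>, and the condition holds above the
  result.\<close>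

lemma minimal_prime_descending_chain:
  assumes P: "primeideal P R" and F: "F \<subseteq> P"
    and minimal: "\<And>Q. primeideal Q R \<Longrightarrow> F \<subseteq> Q \<Longrightarrow> Q \<subseteq> P \<Longrightarrow> Q = P"
    and L: "\<And>n::nat. ideal (L n) R" "\<And>n. F \<subseteq> L n" "\<And>n. L (Suc n) \<subseteq> L n"
    and sat: "\<And>n t r. t \<in> carrier R - P \<Longrightarrow> r \<in> carrier R \<Longrightarrow> t \<otimes> r \<in> L n \<Longrightarrow> r \<in> L n"
  shows "\<exists>n0. \<forall>n\<ge>n0. L n = L n0"
proof -
  let ?sat = "\<lambda>J. ideal J R \<and> (\<forall>t\<in>carrier R - P. \<forall>r\<in>carrier R. t \<otimes> r \<in> J \<longrightarrow> r \<in> J)"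
  let ?dcc = "\<lambda>J. \<forall>L. (\<forall>n::nat. ?sat (L n) \<and> J \<subseteq> L n \<and> L (Suc n) \<subseteq> L n) \<longrightarrow> (\<exists>n0. \<forall>n\<ge>n0. L n = L n0)"
  have P1: "\<one> \<in> carrier R - P" and Pm: "\<And>s t. s \<in> carrier R - P \<Longrightarrow> t \<in> carrier R - P \<Longrightarrow> s \<otimes> t \<in> carrier R - P"
    using P unfolding primeideal_iff by auto
  have idP: "ideal P R" using P by (simp add: primeideal_def)
  have dcc: "?dcc J" if "?sat J" "F \<subseteq> J" for J
  proof (rule ccontr)
    assume "\<not> ?dcc J"
    moreover define bad where "bad = (\<lambda>J. ?sat J \<and> F \<subseteq> J \<and> \<not> ?dcc J)"
    ultimately have "bad J" using that by simp
    then have "{J. bad J} \<noteq> {}" by blast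
    moreover have "ideal K R" if "K \<in> {J. bad J}" for K using that by (simp add: bad_def)
    ultimately have "\<exists>J\<in>{J. bad J}. \<forall>K\<in>{J. bad J}. J \<subseteq> K \<longrightarrow> K = J"
      by (rule ideal_family_has_maximal)
    then obtain J where bad: "bad J" and maxbad: "\<And>K. bad K \<Longrightarrow> J \<subseteq> K \<Longrightarrow> K = J" by auto
    have J: "?sat J" "F \<subseteq> J" "\<not> ?dcc J" using bad unfolding bad_def by simp_all
    have max: "?dcc K" if K: "?sat K" "F \<subseteq> K" "J \<subset> K" for K
    proof (rule ccontr)
      assume "\<not> ?dcc K"
      then have "bad K" using K(1,2) unfolding bad_def by simp
      then show False using maxbad[of K] K(3) by auto
    qed
    have idJ: "ideal J R" and satJ: "\<And>t r. t \<in> carrier R - P \<Longrightarrow> r \<in> carrier R \<Longrightarrow> t \<otimes> r \<in> J \<Longrightarrow> r \<in> J"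
      using J(1) by auto
    obtain L where L: "\<And>n. ?sat (L n)" "\<And>n. J \<subseteq> L n" "\<And>n. L (Suc n) \<subseteq> L n"
      and nstab: "\<not> (\<exists>n0. \<forall>n\<ge>n0. L n = L n0)"
      using J(3) by blast
    have Ldec: "L n \<subseteq> L m" if "m \<le> n" for m n
      using that by (rule lift_Suc_antimono_le[of L, OF L(3)])
    have idL: "ideal (L n) R" and satL: "\<And>t r. t \<in> carrier R - P \<Longrightarrow> r \<in> carrier R \<Longrightarrow> t \<otimes> r \<in> L n \<Longrightarrow> r \<in> L n" for n
      using L(1)[of n] by auto
    have Jc: "J \<subseteq> carrier R" and Lc: "L n \<subseteq> carrier R" for n using idJ idL by (auto simp: ideal_iff)
    have "J \<noteq> carrier R"
    proof
      assume "J = carrier R"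
      then have "L n = carrier R" for n using L(2)[of n] Lc[of n] by auto
      then show False using nstab by blast
    qed
    then obtain f0 where f0: "f0 \<in> carrier R - J" using Jc by auto
    have "\<exists>f\<in>carrier R - J. {r \<in> carrier R. r \<otimes> f0 \<in> J} \<subseteq> {r \<in> carrier R. r \<otimes> f \<in> J} \<and>
        primeideal {r \<in> carrier R. r \<otimes> f \<in> J} R \<and>
        (\<forall>w\<in>carrier R - J. {r \<in> carrier R. r \<otimes> f \<in> J} \<subseteq> {r \<in> carrier R. r \<otimes> w \<in> J} \<longrightarrow>
           {r \<in> carrier R. r \<otimes> w \<in> J} = {r \<in> carrier R. r \<otimes> f \<in> J})"
    proof (rule maximal_colon_prime[OF f0])
      show "ideal {r \<in> carrier R. r \<otimes> f \<in> J} R" if f: "f \<in> carrier R - J" for f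
      proof -
        have "r \<otimes> s \<otimes> f \<in> J" if "r \<in> carrier R" "s \<in> carrier R" "s \<otimes> f \<in> J" for r s
          using that f idJ by (auto simp: ideal_iff m_assoc)
        then have "r \<otimes> s \<otimes> f \<in> J" "s \<otimes> r \<otimes> f \<in> J" if "r \<in> carrier R" "s \<in> carrier R" "s \<otimes> f \<in> J" for r s
          using that m_comm[of s r] by auto
        then show ?thesis using f idJ by (auto simp: ideal_iff l_distr)
      qed
      show "\<one> \<notin> {r \<in> carrier R. r \<otimes> f \<in> J}" if "f \<in> carrier R - J" for f using that by auto
      show "\<exists>v\<in>carrier R - J. {r \<in> carrier R. r \<otimes> v \<in> J} = {r \<in> carrier R. r \<otimes> b \<in> {r \<in> carrier R. r \<otimes> f \<in> J}}"
        if "f \<in> carrier R - J" "b \<in> carrier R" "b \<notin> {r \<in> carrier R. r \<otimes> f \<in> J}" for f b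
        using that by (intro bexI[of _ "b \<otimes> f"]) (auto simp: m_assoc)
    qed
    then obtain f where f: "f \<in> carrier R" "f \<notin> J" and prime: "primeideal {r \<in> carrier R. r \<otimes> f \<in> J} R"
      by auto
    \<comment> \<open>This colon ideal is prime and contains \<open>F\<close>. It lies in
      \<open>P\<close> because \<open>J\<close> is saturated and does not contain \<open>f\<close>,
      so minimality of \<open>P\<close> applies.\<close>
    have "{r \<in> carrier R. r \<otimes> f \<in> J} = P"
    proof (rule minimal[OF prime])
      have "r \<otimes> f \<in> J" if "r \<in> F" for r
        using that J(2) idJ f(1) by (auto simp: ideal_iff)
      then show "F \<subseteq> {r \<in> carrier R. r \<otimes> f \<in> J}" using J(2) Jc by auto
      show "{r \<in> carrier R. r \<otimes> f \<in> J} \<subseteq> P" using satJ f by auto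
    qed
    then have colon: "r \<otimes> f \<in> J \<longleftrightarrow> r \<in> P" if "r \<in> carrier R" for r using that by auto
    have J0: "\<zero> \<in> J" using idJ by (simp add: ideal_iff)
    define A where "A = {j \<oplus> c \<otimes> f | j c. j \<in> J \<and> c \<in> carrier R}"
    have idA: "ideal A R" unfolding A_def by (intro add_pideal_ideal idJ f)
    then have Ac: "A \<subseteq> carrier R" by (simp add: ideal_iff)
    have JA: "J \<subseteq> A" unfolding A_def by (rule subset_add_pideal[OF Jc f(1)])
    have fA: "f \<in> A" unfolding A_def by (rule in_add_pideal[OF J0 f(1)])
    define K where "K = {r \<in> carrier R. \<exists>t\<in>carrier R - P. t \<otimes> r \<in> A}"
    have idK: "ideal K R" unfolding K_def by (intro saturation_ideal P idA)
    have satK: "r \<in> K" if "t \<in> carrier R - P" "r \<in> carrier R" "t \<otimes> r \<in> K" for t r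
      using saturation_saturated[OF P that(1,2), of A] that(3) unfolding K_def by simp
    have AK: "A \<subseteq> K" unfolding K_def by (rule subset_saturation[OF P Ac])
    have dccK: "?dcc K"
      using idK satK J(2) JA AK fA f(2) by (intro max) auto
    show False
    proof (cases "\<forall>n. f \<in> L n")
      case True
      have "K \<subseteq> L n" for n
      proof
        fix r assume "r \<in> K"
        then obtain t j c where t: "t \<in> carrier R - P" and r: "r \<in> carrier R" and "j \<in> J" "c \<in> carrier R"
          and "t \<otimes> r = j \<oplus> c \<otimes> f" unfolding K_def A_def by auto
        then have "t \<otimes> r \<in> L n" using L(2)[of n] idL[of n] True by (auto simp: ideal_iff)
        then show "r \<in> L n" using satL t r by blast
      qed
      then have "\<exists>n0. \<forall>n\<ge>n0. L n = L n0"
        using L by (intro dccK[THEN spec, THEN mp]) simp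
      then show False using nstab by contradiction
    next
      case False
      then obtain n1 where n1: "f \<notin> L n1" by auto
      \<comment> \<open>Locally \<open>L n\<close> meets J + R f only in \<open>J\<close>: a
        coefficient of \<open>f\<close> outside \<open>P\<close> would put \<open>f\<close> into
        \<open>L n\<close>, and a coefficient in \<open>P\<close> multiplies \<open>f\<close> into
        \<open>J\<close>.\<close>
      have inter: "y \<in> J" if "n \<ge> n1" "y \<in> L n" "t \<in> carrier R - P" "t \<otimes> y \<in> A" for n y t
      proof -
        have yc: "y \<in> carrier R" using that Lc by auto
        from \<open>t \<otimes> y \<in> A\<close> obtain j c where j: "j \<in> J" and c: "c \<in> carrier R" and e: "t \<otimes> y = j \<oplus> c \<otimes> f"
          unfolding A_def by auto
        have "c \<in> P"
        proof (rule ccontr)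
          assume "c \<notin> P"
          have "(t \<otimes> y) \<ominus> j \<in> L n"
            using ideal_minus[OF idL, of "t \<otimes> y" n j] that j L(2)[of n] idL[of n] by (auto simp: ideal_iff)
          moreover have "(t \<otimes> y) \<ominus> j = c \<otimes> f"
          proof -
            have "j \<in> carrier R" using j Jc by auto
            then show ?thesis unfolding e using c f by algebra
          qed
          ultimately have "f \<in> L n" using satL[of c f n] c f \<open>c \<notin> P\<close> by auto
          then show False using n1 Ldec[OF that(1)] by auto
        qed
        then have "c \<otimes> f \<in> J" using colon c by simp
        then have "t \<otimes> y \<in> J" using e j idJ by (auto simp: ideal_iff)
        then show ?thesis using satJ that(3) yc by blast
      qed
      \<comment> \<open>The modular law: from some index on, the nested ideals \<open>L n\<close>
        have the same intersection with J + R f, namely \<open>J\<close>, and up to saturation the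
        same sum with it, so they coincide.\<close>
      define L' where "L' = (\<lambda>n. {r \<in> carrier R. \<exists>t\<in>carrier R - P. t \<otimes> r \<in> L n <+>\<^bsub>R\<^esub> A})"
      have idLA: "ideal (L n <+>\<^bsub>R\<^esub> A) R" for n by (intro add_ideals idL idA)
      have id': "ideal (L' n) R" for n unfolding L'_def by (intro saturation_ideal P idLA)
      have sat': "r \<in> L' n" if "t \<in> carrier R - P" "r \<in> carrier R" "t \<otimes> r \<in> L' n" for t r n
        using saturation_saturated[OF P that(1,2), of "L n <+>\<^bsub>R\<^esub> A"] that(3) unfolding L'_def by simp
      have set_addI: "u \<oplus> v \<in> U <+>\<^bsub>R\<^esub> V" if "u \<in> U" "v \<in> V" for u v U V
        using that unfolding set_add_def' by auto
      have zero: "\<zero> \<in> A" "\<zero> \<in> L n" for n using idA idL[of n] by (auto simp: ideal_iff)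
      have sub1: "L n \<subseteq> L n <+>\<^bsub>R\<^esub> A" for n
      proof
        fix l assume "l \<in> L n"
        then show "l \<in> L n <+>\<^bsub>R\<^esub> A" using set_addI[of l "L n" \<zero> A] zero Lc[of n] by auto
      qed
      have sub2: "A \<subseteq> L n <+>\<^bsub>R\<^esub> A" for n
      proof
        fix l assume "l \<in> A"
        then show "l \<in> L n <+>\<^bsub>R\<^esub> A" using set_addI[of \<zero> "L n" l A] zero Ac by auto
      qed
      have sub': "L n <+>\<^bsub>R\<^esub> A \<subseteq> L' n" for n
        unfolding L'_def using idLA[of n] by (intro subset_saturation[OF P]) (simp add: ideal_iff)
      have dec': "L' (Suc n) \<subseteq> L' n" for n
      proof -
        have "L (Suc n) <+>\<^bsub>R\<^esub> A \<subseteq> L n <+>\<^bsub>R\<^esub> A"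
          using L(3)[of n] unfolding set_add_def' by auto
        then show ?thesis unfolding L'_def by auto
      qed
      have "K \<subseteq> L' n" for n
        using sub2[of n] unfolding K_def L'_def by auto
      then have "\<exists>n0. \<forall>n\<ge>n0. L' n = L' n0"
        using id' sat' dec' by (intro dccK[THEN spec, THEN mp]) simp
      then obtain n2 where n2: "\<And>n. n \<ge> n2 \<Longrightarrow> L' n = L' n2"
        by auto
      have "L n = L (max n1 n2)" if n: "n \<ge> max n1 n2" for n
      proof
        show "L n \<subseteq> L (max n1 n2)" using Ldec n by blast
        show "L (max n1 n2) \<subseteq> L n"
        proof
          fix y assume y: "y \<in> L (max n1 n2)"
          then have "y \<in> L' (max n1 n2)" using sub1 sub' by blast
          then have "y \<in> L' n" using n2[of n] n2[of "max n1 n2"] n by auto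
          then obtain t where t: "t \<in> carrier R - P" and "t \<otimes> y \<in> L n <+>\<^bsub>R\<^esub> A"
            unfolding L'_def by auto
          then obtain l a where l: "l \<in> L n" and a: "a \<in> A" and e: "t \<otimes> y = l \<oplus> a"
            unfolding set_add_def' by auto
          have ac: "a \<in> carrier R" using a idA by (auto simp: ideal_iff)
          have yc: "y \<in> carrier R" using y Lc by auto
          have lc: "l \<in> carrier R" using l Lc by auto
          have lm: "l \<in> L (max n1 n2)" using Ldec[of "max n1 n2" n] n l by auto
          have "(t \<otimes> y) \<ominus> l \<in> L (max n1 n2)"
            using ideal_minus[OF idL _ lm, of "t \<otimes> y"] y t idL[of "max n1 n2"] by (auto simp: ideal_iff)
          moreover have "(t \<otimes> y) \<ominus> l = a" unfolding e using lc ac by algebra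
          ultimately have "a \<in> L (max n1 n2)" by simp
          then have "a \<in> J" using inter[of "max n1 n2" a \<one>] P1 a ac by simp
          then have "t \<otimes> y \<in> L n" unfolding e using l L(2)[of n] idL[of n] by (auto simp: ideal_iff)
          then show "y \<in> L n" using satL t yc by blast
        qed
      qed
      then have "\<forall>n\<ge>max n1 n2. L n = L (max n1 n2)" by (intro allI impI)
      then show False by (rule notE[OF nstab exI])
    qed
  qed
  \<comment> \<open>The saturation of the ideal generated by \<open>F\<close> lies in every
    \<open>L n\<close>, so the chain condition above it covers the given chain.\<close>
  define J where "J = {r \<in> carrier R. \<exists>t\<in>carrier R - P. t \<otimes> r \<in> Idl F}"
  have Fc: "F \<subseteq> carrier R" using F idP by (auto simp: ideal_iff)
  have "ideal J R" unfolding J_def by (intro saturation_ideal P genideal_ideal Fc)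
  moreover have "r \<in> J" if "t \<in> carrier R - P" "r \<in> carrier R" "t \<otimes> r \<in> J" for t r
    using saturation_saturated[OF P that(1,2), of "Idl F"] that(3) unfolding J_def by simp
  moreover have "F \<subseteq> J"
    using genideal_self[OF Fc] subset_saturation[OF P, of "Idl F"] genideal_ideal[OF Fc]
    unfolding J_def by (auto simp: ideal_iff)
  ultimately have d: "?dcc J" by (intro dcc) auto
  have "J \<subseteq> L n" for n
  proof
    fix r assume "r \<in> J"
    then obtain t where "r \<in> carrier R" "t \<in> carrier R - P" "t \<otimes> r \<in> Idl F" unfolding J_def by auto
    moreover have "Idl F \<subseteq> L n" using L genideal_minimal by blast
    ultimately show "r \<in> L n" using sat by blast
  qed
  then show ?thesis using L sat by (intro d[THEN spec, THEN mp]) simp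
qed

end

context noetherian_cring
begin

text \<open>
  Krull's principal ideal theorem modulo \<open>q0\<close>.  Instead of the symbolic powers of \<open>q\<close>, the proof
  uses the contractions of the principal ideals generated by the powers of one element of \<open>q\<close>.
\<close>

lemma intermediate_prime:
  assumes q0: "primeideal q0 R" and q: "primeideal q R" and P: "primeideal P R"
    and "q0 \<subset> q" "q \<subset> P" and x: "x \<in> P"
  shows "\<exists>Q. primeideal Q R \<and> q0 \<subset> Q \<and> Q \<subset> P \<and> x \<in> Q"
proof (rule ccontr)
  assume none: "\<not> ?thesis"
  then have xq: "x \<notin> q" using assms by blast
  \<comment> \<open>If the claim fails, \<open>P\<close> is minimal over \<open>x\<close> together
    with \<open>q0\<close>: a prime \<open>Q\<close> containing both contains \<open>q0\<close>
    strictly, since \<open>x\<close> is outside \<open>q\<close> and hence outside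
    \<open>q0\<close>.\<close>
  have minimal: "Q = P" if "primeideal Q R" "insert x q0 \<subseteq> Q" "Q \<subseteq> P" for Q
    using none that xq \<open>q0 \<subset> q\<close> by blast
  have idq0: "ideal q0 R" and idP: "ideal P R" and idq: "ideal q R" using q0 P q by (auto simp: primeideal_def)
  have q0c: "q0 \<subseteq> carrier R" and qc: "q \<subseteq> carrier R" and Pc: "P \<subseteq> carrier R" using idq0 idP idq by (auto simp: ideal_iff)
  have xc: "x \<in> carrier R" using x Pc by auto
  obtain y where y: "y \<in> q" "y \<notin> q0" using \<open>q0 \<subset> q\<close> by blast
  have yc: "y \<in> carrier R" using y qc by auto
  have ypow: "y [^] n \<notin> q0" for n :: nat
    by (induction n) (use y q0 yc in \<open>auto simp: primeideal_iff\<close>)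
  \<comment> \<open>\<open>A n\<close> is q0 + (y^n), \<open>Y n\<close> its contraction from the
    localization at \<open>q\<close>, and \<open>L n\<close> the contraction of Y n + (x) from the
    localization at \<open>P\<close>. The chain of the \<open>L n\<close> is the one that minimality
    of \<open>P\<close> makes stationary.\<close>
  define A where "A = (\<lambda>n::nat. {j \<oplus> c \<otimes> (y [^] n) | j c. j \<in> q0 \<and> c \<in> carrier R})"
  define Y where "Y = (\<lambda>n. {r \<in> carrier R. \<exists>t\<in>carrier R - q. t \<otimes> r \<in> A n})"
  define B where "B = (\<lambda>n. {i \<oplus> c \<otimes> x | i c. i \<in> Y n \<and> c \<in> carrier R})"
  define L where "L = (\<lambda>n. {r \<in> carrier R. \<exists>t\<in>carrier R - P. t \<otimes> r \<in> B n})"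
  have idY: "ideal (Y n) R" for n
    unfolding Y_def A_def using yc by (intro saturation_ideal q add_pideal_ideal idq0) auto
  have satY: "r \<in> Y n" if "t \<in> carrier R - q" "r \<in> carrier R" "t \<otimes> r \<in> Y n" for t r n
    using saturation_saturated[OF q that(1,2), of "A n"] that(3) unfolding Y_def by simp
  have idL: "ideal (L n) R" for n
    unfolding L_def B_def by (intro saturation_ideal P add_pideal_ideal idY xc)
  have satL: "r \<in> L n" if "t \<in> carrier R - P" "r \<in> carrier R" "t \<otimes> r \<in> L n" for t r n
    using saturation_saturated[OF P that(1,2), of "B n"] that(3) unfolding L_def by simp
  have Yc: "Y n \<subseteq> carrier R" for n unfolding Y_def by auto
  have one: "\<one> \<in> carrier R - q" "\<one> \<in> carrier R - P" using q P by (auto simp: primeideal_iff)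
  have "A (Suc n) \<subseteq> A n" for n
  proof
    fix r assume "r \<in> A (Suc n)"
    then obtain j c where "j \<in> q0" "c \<in> carrier R" "r = j \<oplus> c \<otimes> (y [^] Suc n)" unfolding A_def by auto
    moreover from this have "r = j \<oplus> (c \<otimes> y) \<otimes> (y [^] n)" using yc by (simp add: m_assoc m_comm)
    ultimately show "r \<in> A n" unfolding A_def using yc by blast
  qed
  then have Ydec: "Y (Suc n) \<subseteq> Y n" for n unfolding Y_def by blast
  then have Ldec: "L (Suc n) \<subseteq> L n" for n unfolding L_def B_def by blast
  have q0Y: "q0 \<subseteq> Y n" for n
  proof
    fix j assume j: "j \<in> q0"
    then have jc: "j \<in> carrier R" using q0c by auto
    have "\<one> \<otimes> j = j \<oplus> \<zero> \<otimes> (y [^] n)" using jc yc by simp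
    then show "j \<in> Y n" unfolding Y_def A_def using one(1) j jc by blast
  qed
  have FL: "insert x q0 \<subseteq> L n" for n
  proof -
    have "\<one> \<otimes> x = \<zero> \<oplus> \<one> \<otimes> x" using xc by simp
    moreover have "\<zero> \<in> Y n" using idY by (simp add: ideal_iff)
    ultimately have "x \<in> L n" unfolding L_def B_def using one(2) xc by blast
    moreover have "j \<in> L n" if "j \<in> q0" for j
    proof -
      have jc: "j \<in> carrier R" using that q0c by auto
      have "\<one> \<otimes> j = j \<oplus> \<zero> \<otimes> x" using jc xc by simp
      then show ?thesis unfolding L_def B_def using one(2) q0Y[of n] that jc by blast
    qed
    ultimately show ?thesis by blast
  qed
  have "\<exists>n0. \<forall>n\<ge>n0. L n = L n0"
  proof (rule minimal_prime_descending_chain[where F = "insert x q0" and P = P and L = L, OF P _ minimal idL FL Ldec satL])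
    show "insert x q0 \<subseteq> P" using x assms by blast
  qed auto
  then obtain n where n: "L (Suc n) = L n" by (metis le_Suc_eq order_refl)
  \<comment> \<open>Up to a denominator outside \<open>P\<close>, an element of \<open>Y n\<close>
    has the form i + c x with i in \<open>Y (Suc n)\<close>. Then c x lies in \<open>Y n\<close>,
    and so does c, because \<open>x\<close> is outside \<open>q\<close>. Thus Y n = Y (Suc n) + x Y
    n locally at \<open>P\<close>, and Nakayama's lemma applies.\<close>
  have "Y n \<subseteq> Y (Suc n)"
  proof (rule prime_local_nakayama[OF P idY _ x Yc])
    show "r \<in> Y (Suc n)" if "t \<in> carrier R - P" "r \<in> carrier R" "t \<otimes> r \<in> Y (Suc n)" for t r
      using satY[of t r] that \<open>q \<subset> P\<close> by blast
    fix z assume z: "z \<in> Y n"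
    then have zc: "z \<in> carrier R" using Yc by auto
    have "\<one> \<otimes> z = z \<oplus> \<zero> \<otimes> x" using zc xc by simp
    then have "z \<in> L n" unfolding L_def B_def using z zc one(2) by blast
    then have "z \<in> L (Suc n)" using n by simp
    then obtain t i c where t: "t \<in> carrier R - P" and i: "i \<in> Y (Suc n)" and c: "c \<in> carrier R"
      and e: "t \<otimes> z = i \<oplus> c \<otimes> x" unfolding L_def B_def by auto
    have "(t \<otimes> z) \<ominus> i \<in> Y n"
      using ideal_minus[OF idY, of "t \<otimes> z" n i] t z i Ydec[of n] idY[of n] by (auto simp: ideal_iff)
    moreover have "(t \<otimes> z) \<ominus> i = x \<otimes> c"
    proof -
      have "i \<in> carrier R" using i Yc by auto
      then show ?thesis unfolding e using c xc by algebra
    qed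
    ultimately have "c \<in> Y n" using satY[of x c n] xc xq c by auto
    then show "\<exists>t\<in>carrier R - P. \<exists>j\<in>Y (Suc n). \<exists>r\<in>Y n. t \<otimes> z = j \<oplus> r \<otimes> x"
      using t i e by blast
  qed
  moreover have "y [^] n \<in> Y n"
  proof -
    have "\<one> \<otimes> (y [^] n) = \<zero> \<oplus> \<one> \<otimes> (y [^] n)" using yc by simp
    moreover have "\<zero> \<in> q0" using idq0 by (simp add: ideal_iff)
    ultimately show ?thesis unfolding Y_def A_def using one(1) yc by blast
  qed
  ultimately have "y [^] n \<in> Y (Suc n)" by blast
  then obtain t j c where t: "t \<in> carrier R - q" and j: "j \<in> q0" and c: "c \<in> carrier R"
    and e: "t \<otimes> (y [^] n) = j \<oplus> c \<otimes> (y [^] Suc n)" unfolding Y_def A_def by auto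
  \<comment> \<open>Since y^n is outside \<open>q0\<close>, this forces t - c y into
    \<open>q0\<close> and hence \<open>t\<close> into \<open>q\<close>, against the choice of
    \<open>t\<close>.\<close>
  have "(t \<ominus> c \<otimes> y) \<otimes> (y [^] n) = j"
  proof -
    have "j \<in> carrier R" "t \<in> carrier R" "y [^] n \<in> carrier R" using j q0c t yc by auto
    then have "(t \<ominus> c \<otimes> y) \<otimes> (y [^] n) = (t \<otimes> (y [^] n)) \<ominus> c \<otimes> (y [^] n \<otimes> y)"
      using c yc by algebra
    also have "\<dots> = j" using e \<open>j \<in> carrier R\<close> c yc by (simp add: a_minus_def a_assoc r_neg)
    finally show ?thesis .
  qed
  then have "t \<ominus> c \<otimes> y \<in> q0" using q0 j ypow t c yc by (auto simp: primeideal_iff)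
  then have "t \<ominus> c \<otimes> y \<in> q" using \<open>q0 \<subset> q\<close> by blast
  moreover have "c \<otimes> y \<in> q" using idq y c by (auto simp: ideal_iff)
  ultimately have "(t \<ominus> c \<otimes> y) \<oplus> c \<otimes> y \<in> q" using idq by (auto simp: ideal_iff)
  moreover have "(t \<ominus> c \<otimes> y) \<oplus> c \<otimes> y = t" using t c yc by (simp add: a_minus_def a_assoc l_neg)
  ultimately show False using t by simp
qed

end

section \<open>Chains of prime ideals and the height theorem\<close>

definition prime_chain :: "('a, 'b) ring_scheme \<Rightarrow> (nat \<Rightarrow> 'a set) \<Rightarrow> nat \<Rightarrow> bool" where
  "prime_chain R p n \<longleftrightarrow> (\<forall>i\<le>n. primeideal (p i) R) \<and> (\<forall>i<n. p i \<subset> p (Suc i))"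

lemma krull_dim_prime_chain: "krull_dim R = Sup {enat n | n. \<exists>p. prime_chain R p n}"
  by (simp add: krull_dim_def prime_chain_def)

lemma prime_chain_le_krull_dim: "prime_chain R p n \<Longrightarrow> enat n \<le> krull_dim R"
  unfolding krull_dim_prime_chain by (rule Sup_upper) auto

lemma krull_dim_le: "(\<And>p n. prime_chain R p n \<Longrightarrow> n \<le> d) \<Longrightarrow> krull_dim R \<le> enat d"
  unfolding krull_dim_prime_chain by (rule Sup_least) auto

lemma prime_chain_replace_last:
  assumes "prime_chain R p n" "primeideal Q R" "p n \<subseteq> Q"
  shows "prime_chain R (p(n := Q)) n"
  using assms unfolding prime_chain_def by (auto simp: less_Suc_eq)

lemma prime_chain_Suc:
  assumes "prime_chain R p n" "primeideal Q R" "p n \<subset> Q"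
  shows "prime_chain R (p(Suc n := Q)) (Suc n)"
  using assms unfolding prime_chain_def by (auto simp: le_Suc_eq less_Suc_eq)

lemma prime_chain_shift:
  assumes "prime_chain R p (Suc n)"
  shows "prime_chain R (\<lambda>i. p (Suc i)) n"
  using assms unfolding prime_chain_def by auto

lemma prime_chain_append:
  assumes "prime_chain R p h" "prime_chain R q k" "p h \<subseteq> q 0"
  shows "\<exists>r. prime_chain R r (h + k)"
proof -
  \<comment> \<open>The top of the lower chain is dropped in favour of \<open>q 0\<close>, so the
    combined length is \<open>h + k\<close> even if the two primes coincide.\<close>
  define r where "r = (\<lambda>i. if i < h then p i else q (i - h))"
  have "r i \<subset> r (Suc i)" if "i < h + k" for i
  proof (cases "i < h")
    case True
    then have "p i \<subset> p (Suc i)" using assms(1) by (auto simp: prime_chain_def)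
    then show ?thesis
      using True assms(3) by (cases "Suc i = h") (auto simp: r_def)
  next
    case False
    then have "i - h < k" "Suc i - h = Suc (i - h)" using that by auto
    then show ?thesis using False assms(2) by (auto simp: r_def prime_chain_def)
  qed
  moreover have "primeideal (r i) R" if "i \<le> h + k" for i
    using that assms unfolding r_def prime_chain_def by auto
  ultimately show ?thesis unfolding prime_chain_def by blast
qed

lemma prime_chain_mono:
  assumes "prime_chain R p n" "i \<le> j" "j \<le> n"
  shows "p i \<subseteq> p j"
  using assms(2,3)
proof (induction j rule: dec_induct)
  case (step k)
  then have "p k \<subset> p (Suc k)" using assms(1) by (auto simp: prime_chain_def)
  then show ?case using step by auto
qed simp

context noetherian_cring
begin

text \<open>The principal ideal theorem is applied from the top downward: the prime below the top is
  replaced by one that contains \<open>x\<close>, and the chain that ends there is treated by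
  induction. Both ends stay fixed.\<close>

lemma prime_chain_through:
  assumes "prime_chain R p (Suc n)" "x \<in> p (Suc n)"
  shows "\<exists>p'. prime_chain R p' (Suc n) \<and> p' 0 = p 0 \<and> p' (Suc n) = p (Suc n) \<and> x \<in> p' 1"
  using assms
proof (induction n arbitrary: p)
  case 0
  then show ?case by auto
next
  case (Suc n)
  have "\<exists>Q. primeideal Q R \<and> p n \<subset> Q \<and> Q \<subset> p (Suc (Suc n)) \<and> x \<in> Q"
    using Suc.prems by (intro intermediate_prime[of _ "p (Suc n)"]) (auto simp: prime_chain_def)
  then obtain Q where Q: "primeideal Q R" "p n \<subset> Q" "Q \<subset> p (Suc (Suc n))" "x \<in> Q" by blast
  have "prime_chain R (p(Suc n := Q)) (Suc n)"
    using Suc.prems(1) Q by (intro prime_chain_Suc) (auto simp: prime_chain_def)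
  from Suc.IH[OF this] Q(4) obtain p' where p': "prime_chain R p' (Suc n)" "p' 0 = p 0"
    "p' (Suc n) = Q" "x \<in> p' 1" by auto
  have "prime_chain R (p'(Suc (Suc n) := p (Suc (Suc n)))) (Suc (Suc n))"
    using p' Q Suc.prems by (intro prime_chain_Suc) (auto simp: prime_chain_def)
  moreover have "(p'(Suc (Suc n) := p (Suc (Suc n)))) 0 = p 0"
    "(p'(Suc (Suc n) := p (Suc (Suc n)))) (Suc (Suc n)) = p (Suc (Suc n))"
    "x \<in> (p'(Suc (Suc n) := p (Suc (Suc n)))) 1"
    using p' by auto
  ultimately show ?case by blast
qed

text \<open>Krull's height theorem, by induction on the generators that the bottom prime has not yet
  absorbed. Moving \<open>y\<close> into the second prime and dropping the first costs one step of
  the chain and one generator.\<close>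

lemma prime_chain_length_le_generators:
  assumes "prime_chain R p n" "p n = Idl (set xs \<union> set ys)" "set xs \<subseteq> p 0" "set ys \<subseteq> carrier R"
  shows "n \<le> length ys"
  using assms
proof (induction ys arbitrary: xs p n)
  case Nil
  have "ideal (p 0) R" using Nil by (auto simp: prime_chain_def primeideal_def)
  then have "p n \<subseteq> p 0" using Nil genideal_minimal by auto
  moreover have "p 0 \<subset> p n" if "n > 0"
    using Nil(1) prime_chain_mono[OF Nil(1), of 1 n] that by (auto simp: prime_chain_def)
  ultimately show ?case by blast
next
  case (Cons y ys)
  show ?case
  proof (cases n)
    case (Suc k)
    have "ideal (p 0) R" using Cons.prems(1) by (simp add: prime_chain_def primeideal_def)
    then have xsc: "set xs \<subseteq> carrier R"
      using Cons.prems(3) by (auto simp: ideal_iff)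
    have "y \<in> p n"
      using genideal_self[of "set xs \<union> set (y # ys)"] xsc Cons.prems by auto
    then obtain p' where p': "prime_chain R p' (Suc k)" "p' 0 = p 0" "p' (Suc k) = p (Suc k)" "y \<in> p' 1"
      using prime_chain_through[of p k y] Cons.prems Suc by auto
    have "k \<le> length ys"
    proof (rule Cons.IH[OF prime_chain_shift[OF p'(1)], of "y # xs"])
      show "p' (Suc k) = Idl (set (y # xs) \<union> set ys)"
        using p' Cons.prems Suc by simp
      show "set (y # xs) \<subseteq> p' (Suc 0)"
        using p' Cons.prems(3) prime_chain_mono[OF p'(1), of 0 1] by auto
    qed (use Cons.prems in auto)
    then show ?thesis using Suc by simp
  qed simp
qed

end

section \<open>Noetherian local rings\<close>

locale noetherian_local = noetherian_cring +
  fixes m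
  assumes local: "local_ring R m"
begin

lemma maximal: "maximalideal m R" using local by (simp add: local_ring_def)
lemma m_prime: "primeideal m R" using maximalideal_prime[OF maximal] .
lemma m_ideal: "ideal m R" using m_prime by (simp add: primeideal_def)
lemma m_carrier: "m \<subseteq> carrier R" using m_ideal by (simp add: ideal_iff)
lemma one_notin_m: "\<one> \<notin> m" using m_prime by (simp add: primeideal_iff)

lemma proper_ideal_le_m:
  assumes "ideal I R" "\<one> \<notin> I"
  shows "I \<subseteq> m"
proof -
  have "\<exists>J\<in>{J. ideal J R \<and> I \<subseteq> J \<and> \<one> \<notin> J}. \<forall>K\<in>{J. ideal J R \<and> I \<subseteq> J \<and> \<one> \<notin> J}. J \<subseteq> K \<longrightarrow> K = J"
    using assms by (intro ideal_family_has_maximal) auto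
  then obtain J where J: "ideal J R" "I \<subseteq> J" "\<one> \<notin> J"
    and max: "\<And>K. ideal K R \<Longrightarrow> \<one> \<notin> K \<Longrightarrow> J \<subseteq> K \<Longrightarrow> K = J"
    by (smt (verit, best) mem_Collect_eq subset_trans)
  have "maximalideal J R"
  proof (rule maximalidealI[OF J(1)])
    show "carrier R \<noteq> J" using J(3) by auto
    fix K assume "ideal K R" "J \<subseteq> K" "K \<subseteq> carrier R"
    then show "K = J \<or> K = carrier R"
      using max[of K] ideal.one_imp_carrier by blast
  qed
  then show ?thesis using local J by (auto simp: local_ring_def)
qed

lemma prime_le_m: "primeideal P R \<Longrightarrow> P \<subseteq> m"
  by (rule proper_ideal_le_m) (auto simp: primeideal_iff)

lemma not_m_unit:
  assumes "x \<in> carrier R" "x \<notin> m"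
  shows "\<exists>y\<in>carrier R. y \<otimes> x = \<one>"
proof (rule ccontr)
  assume "\<not> ?thesis"
  then have "\<one> \<notin> PIdl x" by (auto simp: cgenideal_def)
  then have "PIdl x \<subseteq> m" by (intro proper_ideal_le_m cgenideal_ideal assms)
  then show False using assms cgenideal_self[OF assms(1)] by auto
qed

lemma one_minus_notin_m:
  assumes "x \<in> m"
  shows "\<one> \<ominus> x \<notin> m"
proof
  assume "\<one> \<ominus> x \<in> m"
  then have "(\<one> \<ominus> x) \<oplus> x \<in> m" using assms m_ideal by (auto simp: ideal_iff)
  moreover have "(\<one> \<ominus> x) \<oplus> x = \<one>" using assms m_carrier by (auto simp: a_minus_def a_assoc l_neg)
  ultimately show False using one_notin_m by simp
qed

lemma krull_dim_le_generators:
  assumes "finite S" "S \<subseteq> carrier R" "m = Idl S"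
  shows "krull_dim R \<le> enat (card S)"
proof (rule krull_dim_le)
  fix p n assume p: "prime_chain R p n"
  obtain ys where ys: "set ys = S" "length ys = card S"
    using finite_distinct_list[OF assms(1)] distinct_card by metis
  have "p n \<subseteq> m" using p by (intro prime_le_m) (auto simp: prime_chain_def)
  \<comment> \<open>Replacing the top of the chain by \<open>m\<close> keeps the length, and it
    makes the top an ideal with known generators.\<close>
  then have "prime_chain R (p(n := m)) n" by (intro prime_chain_replace_last p m_prime)
  then have "n \<le> length ys"
    by (rule prime_chain_length_le_generators[where xs = "[]"]) (use ys assms in auto)
  then show "n \<le> card S" using ys by simp
qed

text \<open>A sequence v_n = x v_{n+1} in \<open>L\<close> has increasing cyclic submodules. When
  these become stationary, v_{n+1} = r x v_{n+1} for some r, and 1 - r x is a unit. So finite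
  generation of \<open>L\<close> is replaced by the chain condition on \<open>N\<close>.\<close>

lemma module_nakayama:
  assumes N: "noetherian_module R N" and x: "x \<in> m" and L: "L \<subseteq> carrier N"
    and step: "\<And>v. v \<in> L \<Longrightarrow> \<exists>w\<in>L. v = x \<odot>\<^bsub>N\<^esub> w"
  shows "L \<subseteq> {\<zero>\<^bsub>N\<^esub>}"
proof
  interpret N: module R N using N by (simp add: noetherian_module_def)
  fix v0 assume v0: "v0 \<in> L"
  have "\<exists>v. \<forall>n::nat. (v n \<in> L \<and> (n = 0 \<longrightarrow> v n = v0)) \<and> v n = x \<odot>\<^bsub>N\<^esub> v (Suc n)"
    by (rule dependent_nat_choice) (use v0 step in blast)+
  then obtain v where vL: "\<And>n::nat. v n \<in> L" and v: "v 0 = v0" "\<And>n. v n = x \<odot>\<^bsub>N\<^esub> v (Suc n)" by metis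
  have vc: "v n \<in> carrier N" for n using vL L by auto
  have xc: "x \<in> carrier R" using x m_carrier by auto
  define U where "U = (\<lambda>n. {r \<odot>\<^bsub>N\<^esub> v n | r. r \<in> carrier R})"
  have "submodule (U n) R N" for n
    unfolding N.submodule_iff
  proof (intro conjI ballI)
    show "U n \<subseteq> carrier N" using vc by (auto simp: U_def)
    show "\<zero>\<^bsub>N\<^esub> \<in> U n" using vc by (auto simp: U_def intro!: exI[of _ \<zero>])
    fix a assume "a \<in> U n"
    then obtain r where r: "r \<in> carrier R" "a = r \<odot>\<^bsub>N\<^esub> v n" by (auto simp: U_def)
    show "a \<oplus>\<^bsub>N\<^esub> b \<in> U n" if "b \<in> U n" for b
    proof -
      obtain s where s: "s \<in> carrier R" "b = s \<odot>\<^bsub>N\<^esub> v n" using \<open>b \<in> U n\<close> by (auto simp: U_def)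
      then have "a \<oplus>\<^bsub>N\<^esub> b = (r \<oplus> s) \<odot>\<^bsub>N\<^esub> v n" using r vc by (simp add: N.smult_l_distr)
      then show ?thesis using r s unfolding U_def by blast
    qed
    show "s \<odot>\<^bsub>N\<^esub> a \<in> U n" if s: "s \<in> carrier R" for s
    proof -
      have "s \<odot>\<^bsub>N\<^esub> a = (s \<otimes> r) \<odot>\<^bsub>N\<^esub> v n" using r s vc by (simp add: N.smult_assoc1)
      then show ?thesis using r s unfolding U_def by blast
    qed
  qed
  moreover have "U n \<subseteq> U (Suc n)" for n
  proof
    fix a assume "a \<in> U n"
    then obtain r where r: "r \<in> carrier R" "a = r \<odot>\<^bsub>N\<^esub> v n" by (auto simp: U_def)
    have "a = (r \<otimes> x) \<odot>\<^bsub>N\<^esub> v (Suc n)" using r xc vc v(2)[of n] by (simp add: N.smult_assoc1)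
    then show "a \<in> U (Suc n)" using r xc unfolding U_def by blast
  qed
  ultimately obtain n where n: "U (Suc n) = U n"
    using N unfolding noetherian_module_def by (metis le_Suc_eq order_refl)
  have "v (Suc n) \<in> U (Suc n)" using vc unfolding U_def by (auto intro!: exI[of _ \<one>])
  then obtain r where r: "r \<in> carrier R" "v (Suc n) = r \<odot>\<^bsub>N\<^esub> v n" using n unfolding U_def by auto
  have rx: "r \<otimes> x \<in> m" using m_ideal x r by (auto simp: ideal_iff)
  have rxc: "r \<otimes> x \<in> carrier R" using r xc by simp
  have e: "v (Suc n) = (r \<otimes> x) \<odot>\<^bsub>N\<^esub> v (Suc n)"
    using r xc vc v(2)[of n] by (simp add: N.smult_assoc1)
  obtain y where y: "y \<in> carrier R" "y \<otimes> (\<one> \<ominus> r \<otimes> x) = \<one>"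
    using not_m_unit[of "\<one> \<ominus> r \<otimes> x"] one_minus_notin_m[OF rx] rxc by auto
  have "(\<one> \<ominus> r \<otimes> x) \<odot>\<^bsub>N\<^esub> v (Suc n) = v (Suc n) \<oplus>\<^bsub>N\<^esub> \<ominus>\<^bsub>N\<^esub> ((r \<otimes> x) \<odot>\<^bsub>N\<^esub> v (Suc n))"
    using rxc vc by (simp add: a_minus_def N.smult_l_distr N.smult_l_minus)
  also have "\<dots> = \<zero>\<^bsub>N\<^esub>" unfolding e[symmetric] using vc by (simp add: N.M.r_neg)
  finally have z0: "(\<one> \<ominus> r \<otimes> x) \<odot>\<^bsub>N\<^esub> v (Suc n) = \<zero>\<^bsub>N\<^esub>" .
  have "(y \<otimes> (\<one> \<ominus> r \<otimes> x)) \<odot>\<^bsub>N\<^esub> v (Suc n) = y \<odot>\<^bsub>N\<^esub> ((\<one> \<ominus> r \<otimes> x) \<odot>\<^bsub>N\<^esub> v (Suc n))"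
    using y rxc vc by (intro N.smult_assoc1) auto
  then have "v (Suc n) = \<zero>\<^bsub>N\<^esub>" using y vc z0 by simp
  then have z: "v n = \<zero>\<^bsub>N\<^esub>" using v(2)[of n] xc by simp
  have "v (n - k) = \<zero>\<^bsub>N\<^esub>" for k
  proof (induction k)
    case (Suc k)
    then show ?case using v(2)[of "n - Suc k"] xc by (cases "k < n") (simp_all add: Suc_diff_Suc)
  qed (use z in simp)
  from this[of n] show "v0 \<in> {\<zero>\<^bsub>N\<^esub>}" using v(1) by simp
qed

text \<open>
  If \<open>\<alpha>\<close> has kernel \<open>x N\<close> and \<open>x\<close> is regular on \<open>N\<close>, then an associated prime of \<open>N\<close> is properly
  contained in one of \<open>N'\<close> that contains \<open>x\<close>: by Nakayama's lemma \<open>\<alpha>\<close> does not vanish on the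
  elements that are killed by the given prime.
\<close>

lemma associated_prime_step:
  assumes N: "noetherian_module R N" and N': "module R N'" and x: "x \<in> m"
    and u: "u \<in> carrier N" "u \<noteq> \<zero>\<^bsub>N\<^esub>"
    and reg: "\<And>v. v \<in> carrier N \<Longrightarrow> x \<odot>\<^bsub>N\<^esub> v = \<zero>\<^bsub>N\<^esub> \<Longrightarrow> v = \<zero>\<^bsub>N\<^esub>"
    and \<alpha>: "\<And>v. v \<in> carrier N \<Longrightarrow> \<alpha> v \<in> carrier N'"
      "\<And>r v. r \<in> carrier R \<Longrightarrow> v \<in> carrier N \<Longrightarrow> \<alpha> (r \<odot>\<^bsub>N\<^esub> v) = r \<odot>\<^bsub>N'\<^esub> \<alpha> v"
      "\<And>v. v \<in> carrier N \<Longrightarrow> \<alpha> v = \<zero>\<^bsub>N'\<^esub> \<longleftrightarrow> (\<exists>w\<in>carrier N. v = x \<odot>\<^bsub>N\<^esub> w)"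
  shows "\<exists>u'\<in>carrier N'. u' \<noteq> \<zero>\<^bsub>N'\<^esub> \<and> primeideal (annihilator R N' u') R \<and>
    annihilator R N u \<subset> annihilator R N' u' \<and> x \<in> annihilator R N' u'"
proof -
  interpret N: module R N using N by (simp add: noetherian_module_def)
  interpret N': module R N' by fact
  have xc: "x \<in> carrier R" using x m_carrier by auto
  define L where "L = {v \<in> carrier N. \<forall>r\<in>annihilator R N u. r \<odot>\<^bsub>N\<^esub> v = \<zero>\<^bsub>N\<^esub>}"
  have "\<exists>v\<in>L. \<alpha> v \<noteq> \<zero>\<^bsub>N'\<^esub>"
  proof (rule ccontr)
    assume none: "\<not> ?thesis"
    have "L \<subseteq> {\<zero>\<^bsub>N\<^esub>}"
    proof (rule module_nakayama[OF N x])
      show "L \<subseteq> carrier N" by (auto simp: L_def)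
      fix v assume v: "v \<in> L"
      then obtain w where w: "w \<in> carrier N" "v = x \<odot>\<^bsub>N\<^esub> w" using none \<alpha>(3) unfolding L_def by blast
      \<comment> \<open>Because \<open>x\<close> is regular, division by \<open>x\<close> does not
        leave \<open>L\<close>. If \<open>\<alpha>\<close> vanished on \<open>L\<close>, then L
        would be contained in x L.\<close>
      have "r \<odot>\<^bsub>N\<^esub> w = \<zero>\<^bsub>N\<^esub>" if r: "r \<in> annihilator R N u" for r
      proof -
        have rc: "r \<in> carrier R" using r by (simp add: annihilator_def)
        have "x \<odot>\<^bsub>N\<^esub> (r \<odot>\<^bsub>N\<^esub> w) = r \<odot>\<^bsub>N\<^esub> v"
          using w rc xc by (metis N.smult_assoc1 m_comm)
        also have "\<dots> = \<zero>\<^bsub>N\<^esub>" using v r by (simp add: L_def)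
        finally show ?thesis using reg w rc by simp
      qed
      then show "\<exists>w\<in>L. v = x \<odot>\<^bsub>N\<^esub> w" using w unfolding L_def by blast
    qed
    moreover have "u \<in> L" using u by (simp add: L_def annihilator_def)
    ultimately show False using u by blast
  qed
  then obtain v where v: "v \<in> carrier N" "\<And>r. r \<in> annihilator R N u \<Longrightarrow> r \<odot>\<^bsub>N\<^esub> v = \<zero>\<^bsub>N\<^esub>" "\<alpha> v \<noteq> \<zero>\<^bsub>N'\<^esub>"
    by (auto simp: L_def)
  have \<alpha>0: "\<alpha> \<zero>\<^bsub>N\<^esub> = \<zero>\<^bsub>N'\<^esub>"
    using \<alpha>(3)[of "\<zero>\<^bsub>N\<^esub>"] xc by (metis N.M.zero_closed N.smult_r_null)
  have 1: "annihilator R N u \<subseteq> annihilator R N' (\<alpha> v)"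
    using v \<alpha>(2) \<alpha>0 unfolding annihilator_def by fastforce
  have 2: "x \<in> annihilator R N' (\<alpha> v)"
    using v xc \<alpha>(2)[of x v, symmetric] \<alpha>(3)[of "x \<odot>\<^bsub>N\<^esub> v"] by (auto simp: annihilator_def)
  have 3: "x \<notin> annihilator R N u" using reg u by (auto simp: annihilator_def)
  obtain u' where "u' \<in> carrier N'" "u' \<noteq> \<zero>\<^bsub>N'\<^esub>" "annihilator R N' (\<alpha> v) \<subseteq> annihilator R N' u'"
    "primeideal (annihilator R N' u') R"
    using annihilator_in_associated_prime[OF N' N'.carrier_is_submodule \<alpha>(1)[OF v(1)] v(3)] by blast
  then show ?thesis using 1 2 3 by blast
qed

end

section \<open>The chain condition and finite generation for modules\<close>

lemma (in module) submoduleD: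
  assumes "submodule W R M"
  shows "W \<subseteq> carrier M" "\<zero>\<^bsub>M\<^esub> \<in> W" "\<And>u v. u \<in> W \<Longrightarrow> v \<in> W \<Longrightarrow> u \<oplus>\<^bsub>M\<^esub> v \<in> W"
    "\<And>r u. r \<in> carrier R \<Longrightarrow> u \<in> W \<Longrightarrow> r \<odot>\<^bsub>M\<^esub> u \<in> W"
  using assms unfolding submodule_iff by auto

lemma (in module) submodule_adjoin:
  assumes W: "submodule W R M" and t: "t \<in> carrier M"
  shows "submodule {v \<oplus>\<^bsub>M\<^esub> r \<odot>\<^bsub>M\<^esub> t | v r. v \<in> W \<and> r \<in> carrier R} R M" (is "submodule ?W R M")
    and "W \<subseteq> {v \<oplus>\<^bsub>M\<^esub> r \<odot>\<^bsub>M\<^esub> t | v r. v \<in> W \<and> r \<in> carrier R}"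
    and "t \<in> {v \<oplus>\<^bsub>M\<^esub> r \<odot>\<^bsub>M\<^esub> t | v r. v \<in> W \<and> r \<in> carrier R}"
proof -
  note Wc = submoduleD(1)[OF W] and W0 = submoduleD(2)[OF W] and Wa = submoduleD(3)[OF W]
    and Wm = submoduleD(4)[OF W]
  show 1: "W \<subseteq> ?W"
  proof
    fix w assume w: "w \<in> W"
    then have "w = w \<oplus>\<^bsub>M\<^esub> \<zero> \<odot>\<^bsub>M\<^esub> t" using Wc t by auto
    then show "w \<in> ?W" using w by blast
  qed
  have "t = \<zero>\<^bsub>M\<^esub> \<oplus>\<^bsub>M\<^esub> \<one> \<odot>\<^bsub>M\<^esub> t" using t by simp
  then show "t \<in> ?W" using W0 by blast
  show "submodule ?W R M"
    unfolding submodule_iff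
  proof (intro conjI ballI)
    show "?W \<subseteq> carrier M" using Wc t by auto
    show "\<zero>\<^bsub>M\<^esub> \<in> ?W" using 1 W0 by blast
  next
    fix a b assume "a \<in> ?W" "b \<in> ?W"
    then obtain v r w s where *: "v \<in> W" "r \<in> carrier R" "a = v \<oplus>\<^bsub>M\<^esub> r \<odot>\<^bsub>M\<^esub> t"
      "w \<in> W" "s \<in> carrier R" "b = w \<oplus>\<^bsub>M\<^esub> s \<odot>\<^bsub>M\<^esub> t" by auto
    moreover from * have "v \<in> carrier M" "w \<in> carrier M" using Wc by auto
    ultimately have "a \<oplus>\<^bsub>M\<^esub> b = (v \<oplus>\<^bsub>M\<^esub> w) \<oplus>\<^bsub>M\<^esub> (r \<oplus> s) \<odot>\<^bsub>M\<^esub> t"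
      using t by (simp add: smult_l_distr M.a_ac)
    then show "a \<oplus>\<^bsub>M\<^esub> b \<in> ?W" using * Wa by blast
  next
    fix s a assume s: "s \<in> carrier R" and "a \<in> ?W"
    then obtain v r where *: "v \<in> W" "r \<in> carrier R" "a = v \<oplus>\<^bsub>M\<^esub> r \<odot>\<^bsub>M\<^esub> t" by auto
    moreover from * have "v \<in> carrier M" using Wc by auto
    ultimately have "s \<odot>\<^bsub>M\<^esub> a = (s \<odot>\<^bsub>M\<^esub> v) \<oplus>\<^bsub>M\<^esub> (s \<otimes> r) \<odot>\<^bsub>M\<^esub> t"
      using t s by (simp add: smult_r_distr smult_assoc1)
    then show "s \<odot>\<^bsub>M\<^esub> a \<in> ?W" using * s Wm by blast
  qed
qed

lemma (in module) submodule_minus: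
  "submodule W R M \<Longrightarrow> u \<in> W \<Longrightarrow> v \<in> W \<Longrightarrow> u \<ominus>\<^bsub>M\<^esub> v \<in> W"
  unfolding M.minus_eq by (simp add: submoduleE)

context noetherian_cring
begin

text \<open>Generators are adjoined one at a time, starting from the zero submodule;
  \<open>step\<close> shows that adjoining one preserves the chain condition on submodules contained
  in the span.\<close>

lemma finitely_generated_imp_noetherian_module:
  assumes "finitely_generated_module R N"
  shows "noetherian_module R N"
proof -
  interpret N: module R N using assms by (simp add: finitely_generated_module_def)
  let ?acc = "\<lambda>W. \<forall>L :: nat \<Rightarrow> 'c set. (\<forall>n. submodule (L n) R N \<and> L n \<subseteq> W \<and> L n \<subseteq> L (Suc n)) \<longrightarrow>
    (\<exists>n0. \<forall>n\<ge>n0. L n = L n0)"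
  obtain S where S: "S \<subseteq> carrier N" "finite S"
    "\<And>x. x \<in> carrier N \<Longrightarrow> \<exists>c\<in>S \<rightarrow> carrier R. x = (\<Oplus>\<^bsub>N\<^esub>s\<in>S. c s \<odot>\<^bsub>N\<^esub> s)"
    using assms unfolding finitely_generated_module_def by auto
  have step: "?acc {v \<oplus>\<^bsub>N\<^esub> r \<odot>\<^bsub>N\<^esub> t | v r. v \<in> W \<and> r \<in> carrier R}"
    if W: "submodule W R N" "?acc W" and t: "t \<in> carrier N" for W :: "'c set" and t
  proof (intro allI impI)
    fix L :: "nat \<Rightarrow> 'c set"
    assume L: "\<forall>n. submodule (L n) R N \<and> L n \<subseteq> {v \<oplus>\<^bsub>N\<^esub> r \<odot>\<^bsub>N\<^esub> t | v r. v \<in> W \<and> r \<in> carrier R} \<and> L n \<subseteq> L (Suc n)"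
    note Wc = N.submoduleD(1)[OF W(1)] and W0 = N.submoduleD(2)[OF W(1)]
      and Wa = N.submoduleD(3)[OF W(1)] and Wm = N.submoduleD(4)[OF W(1)]
    have sL: "submodule (L n) R N" and Ls: "L n \<subseteq> L (Suc n)" for n
      using L by simp_all
    note L0 = N.submoduleD(2)[OF sL] and La = N.submoduleD(3)[OF sL] and Lm = N.submoduleD(4)[OF sL]
    have Lmono: "L i \<subseteq> L j" if "i \<le> j" for i j
      using that by (rule lift_Suc_mono_le[of L, OF Ls])
    \<comment> \<open>A submodule of W + R t is controlled by its intersection with \<open>W\<close>
      and by the ideal of coefficients of \<open>t\<close> that occur in it.\<close>
    define L1 where "L1 n = L n \<inter> W" for n
    define L2 where "L2 n = {r \<in> carrier R. \<exists>v\<in>W. v \<oplus>\<^bsub>N\<^esub> r \<odot>\<^bsub>N\<^esub> t \<in> L n}" for n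
    have "submodule (L1 n) R N" for n
      unfolding N.submodule_iff L1_def using Wc W0 Wa Wm L0 La Lm by auto
    moreover have "L1 n \<subseteq> L1 (Suc n)" "L1 n \<subseteq> W" for n using Ls unfolding L1_def by blast+
    ultimately obtain n1 where n1: "\<And>n. n \<ge> n1 \<Longrightarrow> L1 n = L1 n1"
      using W(2)[THEN spec, of L1] by auto
    have "ideal (L2 n) R" for n
      unfolding ideal_iff
    proof (intro conjI ballI)
      show "L2 n \<subseteq> carrier R" by (auto simp: L2_def)
      show "\<zero> \<in> L2 n" using W0 L0 t by (auto simp: L2_def intro!: bexI[of _ "\<zero>\<^bsub>N\<^esub>"])
      fix a assume "a \<in> L2 n"
      then obtain v where v: "a \<in> carrier R" "v \<in> W" "v \<oplus>\<^bsub>N\<^esub> a \<odot>\<^bsub>N\<^esub> t \<in> L n" by (auto simp: L2_def)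
      {
        fix b assume "b \<in> L2 n"
        then obtain w where w: "b \<in> carrier R" "w \<in> W" "w \<oplus>\<^bsub>N\<^esub> b \<odot>\<^bsub>N\<^esub> t \<in> L n" by (auto simp: L2_def)
        have c: "v \<in> carrier N" "w \<in> carrier N" using v w Wc by auto
        have "(v \<oplus>\<^bsub>N\<^esub> a \<odot>\<^bsub>N\<^esub> t) \<oplus>\<^bsub>N\<^esub> (w \<oplus>\<^bsub>N\<^esub> b \<odot>\<^bsub>N\<^esub> t) = (v \<oplus>\<^bsub>N\<^esub> w) \<oplus>\<^bsub>N\<^esub> (a \<oplus> b) \<odot>\<^bsub>N\<^esub> t"
          using c v w t by (simp add: N.smult_l_distr N.M.a_ac)
        then show "a \<oplus> b \<in> L2 n" using La[OF v(3) w(3)] v w Wa by (auto simp: L2_def)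
      }
      fix r assume r: "r \<in> carrier R"
      have c: "v \<in> carrier N" using v Wc by auto
      have "r \<odot>\<^bsub>N\<^esub> (v \<oplus>\<^bsub>N\<^esub> a \<odot>\<^bsub>N\<^esub> t) = (r \<odot>\<^bsub>N\<^esub> v) \<oplus>\<^bsub>N\<^esub> (r \<otimes> a) \<odot>\<^bsub>N\<^esub> t"
        using c v r t by (simp add: N.smult_r_distr N.smult_assoc1)
      then show "r \<otimes> a \<in> L2 n" using Lm[OF r v(3)] v r Wm by (auto simp: L2_def)
      then show "a \<otimes> r \<in> L2 n" using m_comm[OF v(1) r] by simp
    qed
    moreover have "L2 n \<subseteq> L2 (Suc n)" for n using Ls unfolding L2_def by blast
    ultimately obtain n2 where n2: "\<And>n. n \<ge> n2 \<Longrightarrow> L2 n = L2 n2"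
      using ideals_acc[of L2] by auto
    have "L n = L (max n1 n2)" if n: "n \<ge> max n1 n2" for n
    proof
      show "L (max n1 n2) \<subseteq> L n" using Lmono n by blast
      show "L n \<subseteq> L (max n1 n2)"
      proof
        fix y assume y: "y \<in> L n"
        then have "y \<in> {v \<oplus>\<^bsub>N\<^esub> r \<odot>\<^bsub>N\<^esub> t | v r. v \<in> W \<and> r \<in> carrier R}" using L by auto
        then obtain v r where v: "v \<in> W" "r \<in> carrier R" "y = v \<oplus>\<^bsub>N\<^esub> r \<odot>\<^bsub>N\<^esub> t" by auto
        then have "r \<in> L2 n" using y unfolding L2_def by blast
        then have "r \<in> L2 (max n1 n2)" using n2[of n] n2[of "max n1 n2"] n by auto
        then obtain w where w: "w \<in> W" "w \<oplus>\<^bsub>N\<^esub> r \<odot>\<^bsub>N\<^esub> t \<in> L (max n1 n2)" by (auto simp: L2_def)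
        have c: "v \<in> carrier N" "w \<in> carrier N" "r \<odot>\<^bsub>N\<^esub> t \<in> carrier N" using v w Wc t by auto
        have e: "y \<ominus>\<^bsub>N\<^esub> (w \<oplus>\<^bsub>N\<^esub> r \<odot>\<^bsub>N\<^esub> t) = v \<ominus>\<^bsub>N\<^esub> w"
          unfolding v(3) using c
          by (simp add: N.M.minus_eq N.M.minus_add N.M.a_ac N.M.r_neg N.M.r_neg1 N.M.r_neg2)
        have "y \<ominus>\<^bsub>N\<^esub> (w \<oplus>\<^bsub>N\<^esub> r \<odot>\<^bsub>N\<^esub> t) \<in> L n"
          using N.submodule_minus[OF sL y, of "w \<oplus>\<^bsub>N\<^esub> r \<odot>\<^bsub>N\<^esub> t"] w(2) Lmono[OF n] by auto
        moreover have "v \<ominus>\<^bsub>N\<^esub> w \<in> W" using N.submodule_minus[OF W(1) v(1) w(1)] .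
        ultimately have "v \<ominus>\<^bsub>N\<^esub> w \<in> L1 n" using e by (simp add: L1_def)
        then have "v \<ominus>\<^bsub>N\<^esub> w \<in> L1 (max n1 n2)" using n1[of n] n1[of "max n1 n2"] n by auto
        then have "(v \<ominus>\<^bsub>N\<^esub> w) \<oplus>\<^bsub>N\<^esub> (w \<oplus>\<^bsub>N\<^esub> r \<odot>\<^bsub>N\<^esub> t) \<in> L (max n1 n2)" using La w(2) by (simp add: L1_def)
        moreover have "(v \<ominus>\<^bsub>N\<^esub> w) \<oplus>\<^bsub>N\<^esub> (w \<oplus>\<^bsub>N\<^esub> r \<odot>\<^bsub>N\<^esub> t) = y"
          unfolding v(3) using c by (simp add: N.M.minus_eq N.M.a_assoc N.M.r_neg1)
        ultimately show "y \<in> L (max n1 n2)" by simp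
      qed
    qed
    then have "\<forall>n\<ge>max n1 n2. L n = L (max n1 n2)" by (intro allI impI)
    then show "\<exists>n0. \<forall>n\<ge>n0. L n = L n0" by (rule exI)
  qed
  have "\<exists>W. submodule W R N \<and> ?acc W \<and> (\<forall>c\<in>T \<rightarrow> carrier R. (\<Oplus>\<^bsub>N\<^esub>s\<in>T. c s \<odot>\<^bsub>N\<^esub> s) \<in> W)"
    if "finite T" "T \<subseteq> carrier N" for T
    using that
  proof (induction T rule: finite_induct)
    case empty
    have "submodule {\<zero>\<^bsub>N\<^esub>} R N" by (simp add: N.submodule_iff)
    moreover have "?acc {\<zero>\<^bsub>N\<^esub>}"
    proof (intro allI impI)
      fix L :: "nat \<Rightarrow> 'c set"
      assume L: "\<forall>n. submodule (L n) R N \<and> L n \<subseteq> {\<zero>\<^bsub>N\<^esub>} \<and> L n \<subseteq> L (Suc n)"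
      then have "L n = {\<zero>\<^bsub>N\<^esub>}" for n using N.submoduleD(2)[of "L n"] by auto
      then show "\<exists>n0. \<forall>n\<ge>n0. L n = L n0" by simp
    qed
    ultimately show ?case by (intro exI[of _ "{\<zero>\<^bsub>N\<^esub>}"]) simp
  next
    case (insert t T)
    then obtain W where W: "submodule W R N" "?acc W"
      "\<And>c. c \<in> T \<rightarrow> carrier R \<Longrightarrow> (\<Oplus>\<^bsub>N\<^esub>s\<in>T. c s \<odot>\<^bsub>N\<^esub> s) \<in> W"
      by auto
    have t: "t \<in> carrier N" using insert by auto
    have "(\<Oplus>\<^bsub>N\<^esub>s\<in>insert t T. c s \<odot>\<^bsub>N\<^esub> s) \<in> {v \<oplus>\<^bsub>N\<^esub> r \<odot>\<^bsub>N\<^esub> t | v r. v \<in> W \<and> r \<in> carrier R}"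
      if c: "c \<in> insert t T \<rightarrow> carrier R" for c
    proof -
      have f: "(\<lambda>s. c s \<odot>\<^bsub>N\<^esub> s) \<in> T \<rightarrow> carrier N" "c t \<odot>\<^bsub>N\<^esub> t \<in> carrier N"
        using c insert.prems by auto
      have "(\<Oplus>\<^bsub>N\<^esub>s\<in>insert t T. c s \<odot>\<^bsub>N\<^esub> s) = c t \<odot>\<^bsub>N\<^esub> t \<oplus>\<^bsub>N\<^esub> (\<Oplus>\<^bsub>N\<^esub>s\<in>T. c s \<odot>\<^bsub>N\<^esub> s)"
        using insert f by (intro N.M.finsum_insert) auto
      also have "\<dots> = (\<Oplus>\<^bsub>N\<^esub>s\<in>T. c s \<odot>\<^bsub>N\<^esub> s) \<oplus>\<^bsub>N\<^esub> c t \<odot>\<^bsub>N\<^esub> t"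
        using f by (intro N.M.a_comm N.M.finsum_closed)
      finally show ?thesis using W(3)[of c] c by blast
    qed
    then show ?case using step[OF W(1,2) t] N.submodule_adjoin(1)[OF W(1) t]
      by (intro exI[of _ "{v \<oplus>\<^bsub>N\<^esub> r \<odot>\<^bsub>N\<^esub> t | v r. v \<in> W \<and> r \<in> carrier R}"] conjI) auto
  qed
  from this[OF S(2,1)] obtain W where W: "?acc W"
    "\<forall>c\<in>S \<rightarrow> carrier R. (\<Oplus>\<^bsub>N\<^esub>s\<in>S. c s \<odot>\<^bsub>N\<^esub> s) \<in> W" by (elim exE conjE)
  have "carrier N \<subseteq> W" using S(3) W(2) by auto
  then have "L \<subseteq> W" if "submodule L R N" for L
    using N.submoduleD(1)[OF that] by auto
  then show ?thesis
    unfolding noetherian_module_def using W(1) N.module_axioms by simp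
qed

text \<open>The chain condition is what passes to a localization, while the definition of a
  noetherian DG-ring asks for generators. Without finitely many generators, adjoining elements
  outside the span reached so far would never stop.\<close>

lemma noetherian_imp_finitely_generated_module:
  assumes "noetherian_module R N"
  shows "finitely_generated_module R N"
proof (rule ccontr)
  assume nfg: "\<not> ?thesis"
  interpret N: module R N using assms by (simp add: noetherian_module_def)
  let ?span = "\<lambda>W S. submodule W R N \<and> finite S \<and> S \<subseteq> W \<and>
    (\<forall>x\<in>W. \<exists>c\<in>S \<rightarrow> carrier R. x = (\<Oplus>\<^bsub>N\<^esub>s\<in>S. c s \<odot>\<^bsub>N\<^esub> s))"
  have "\<exists>f. \<forall>n::nat. ?span (fst (f n)) (snd (f n)) \<and> fst (f n) \<subset> fst (f (Suc n))"
  proof (rule dependent_nat_choice)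
    show "\<exists>x. ?span (fst x) (snd x)"
      by (rule exI[of _ "({\<zero>\<^bsub>N\<^esub>}, {})"]) (simp add: N.submodule_iff)
    fix x :: "'c set \<times> 'c set" and n :: nat assume x: "?span (fst x) (snd x)"
    define W S where "W = fst x" and "S = snd x"
    have sW: "submodule W R N" and S: "finite S" "S \<subseteq> W"
      and gen: "\<And>x. x \<in> W \<Longrightarrow> \<exists>c\<in>S \<rightarrow> carrier R. x = (\<Oplus>\<^bsub>N\<^esub>s\<in>S. c s \<odot>\<^bsub>N\<^esub> s)"
      using x by (simp_all add: W_def S_def)
    note Wc = N.submoduleD(1)[OF sW]
    have "W \<noteq> carrier N"
    proof
      assume "W = carrier N"
      then have "finitely_generated_module R N"
        unfolding finitely_generated_module_def using S gen N.module_axioms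
        by (intro conjI exI[of _ S] ballI) simp_all
      then show False using nfg by contradiction
    qed
    then obtain t where t: "t \<in> carrier N" "t \<notin> W" using Wc by blast
    have tS: "t \<notin> S" using t S by auto
    let ?W = "{v \<oplus>\<^bsub>N\<^esub> r \<odot>\<^bsub>N\<^esub> t | v r. v \<in> W \<and> r \<in> carrier R}"
    note W' = N.submodule_adjoin[OF sW t(1)]
    have gen': "\<exists>c\<in>insert t S \<rightarrow> carrier R. x = (\<Oplus>\<^bsub>N\<^esub>s\<in>insert t S. c s \<odot>\<^bsub>N\<^esub> s)" if "x \<in> ?W" for x
    proof -
      from that obtain v r where v: "v \<in> W" and r: "r \<in> carrier R" and xv: "x = v \<oplus>\<^bsub>N\<^esub> r \<odot>\<^bsub>N\<^esub> t" by blast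
      obtain c where c: "c \<in> S \<rightarrow> carrier R" "v = (\<Oplus>\<^bsub>N\<^esub>s\<in>S. c s \<odot>\<^bsub>N\<^esub> s)" using gen[OF v] by blast
      define c' where "c' = c(t := r)"
      have c': "c' \<in> insert t S \<rightarrow> carrier R" using c r by (auto simp: c'_def)
      have Sc: "S \<subseteq> carrier N" using S Wc by auto
      have f: "(\<lambda>s. c' s \<odot>\<^bsub>N\<^esub> s) \<in> S \<rightarrow> carrier N" using c' Sc by auto
      have eq: "c s \<odot>\<^bsub>N\<^esub> s = c' s \<odot>\<^bsub>N\<^esub> s" if "s \<in> S" for s
        using that tS by (auto simp: c'_def)
      have "(\<Oplus>\<^bsub>N\<^esub>s\<in>S. c s \<odot>\<^bsub>N\<^esub> s) = (\<Oplus>\<^bsub>N\<^esub>s\<in>S. c' s \<odot>\<^bsub>N\<^esub> s)"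
        by (rule N.M.finsum_cong') (use f eq in auto)
      moreover have "(\<Oplus>\<^bsub>N\<^esub>s\<in>insert t S. c' s \<odot>\<^bsub>N\<^esub> s) = c' t \<odot>\<^bsub>N\<^esub> t \<oplus>\<^bsub>N\<^esub> (\<Oplus>\<^bsub>N\<^esub>s\<in>S. c' s \<odot>\<^bsub>N\<^esub> s)"
        using S(1) tS f r t by (intro N.M.finsum_insert) (auto simp: c'_def)
      moreover have "c' t = r" by (simp add: c'_def)
      ultimately have "x = (\<Oplus>\<^bsub>N\<^esub>s\<in>insert t S. c' s \<odot>\<^bsub>N\<^esub> s)"
        unfolding xv c(2) using f r t by (simp add: N.M.a_comm)
      then show ?thesis using c' by blast
    qed
    show "\<exists>y. ?span (fst y) (snd y) \<and> fst x \<subset> fst y"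
    proof (rule exI[of _ "(?W, insert t S)"], intro conjI)
      show "snd (?W, insert t S) \<subseteq> fst (?W, insert t S)"
        using W'(2,3) S(2) by auto
      show "\<forall>x\<in>fst (?W, insert t S). \<exists>c\<in>snd (?W, insert t S) \<rightarrow> carrier R.
          x = (\<Oplus>\<^bsub>N\<^esub>s\<in>snd (?W, insert t S). c s \<odot>\<^bsub>N\<^esub> s)"
        unfolding fst_conv snd_conv by (intro ballI gen')
      show "fst x \<subset> fst (?W, insert t S)"
        using W'(2,3) t by (auto simp only: W_def[symmetric] fst_conv psubset_eq)
    qed (use W'(1) S(1) in simp_all)
  qed
  then obtain f where f: "\<forall>n::nat. ?span (fst (f n)) (snd (f n)) \<and> fst (f n) \<subset> fst (f (Suc n))" ..
  have f1: "submodule (fst (f n)) R N" and f2: "fst (f n) \<subset> fst (f (Suc n))" for n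
    using f[THEN spec, of n] by simp_all
  have "\<exists>n0. \<forall>n\<ge>n0. fst (f n) = fst (f n0)"
    using assms[unfolded noetherian_module_def, THEN conjunct2, THEN spec, of "\<lambda>n. fst (f n)"] f1 f2
    by (simp add: psubset_imp_subset)
  then obtain n0 where "\<forall>n\<ge>n0. fst (f n) = fst (f n0)" ..
  then have "fst (f (Suc n0)) = fst (f n0)" by (metis le_Suc_eq order_refl)
  then show False using f2[of n0] by simp
qed

end

section \<open>Complexes over the degree-zero part of a DG-ring\<close>

lemma (in abelian_subgroup) rcos_eqI: "x \<in> H +> y \<Longrightarrow> y \<in> carrier G \<Longrightarrow> H +> x = H +> y"
  by (rule a_repr_independence[symmetric, OF _ _ a_subgroup])

lemma (in abelian_subgroup) rcos_eq_iff:
  assumes "x \<in> carrier G" "y \<in> carrier G"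
  shows "H +> x = H +> y \<longleftrightarrow> (\<exists>h\<in>H. x = h \<oplus> y)"
proof -
  have "H +> x = H +> y \<longleftrightarrow> x \<in> H +> y"
    using rcos_eqI assms(2) a_rcos_self[OF assms(1)] by metis
  then show ?thesis by (simp add: a_r_coset_def')
qed

section \<open>The degree-zero part and its quotient H^0\<close>

context dg_ring
begin

abbreviation S0 :: "('a, 'b) cochain_scheme" where "S0 \<equiv> A\<lparr>carrier := cocycles A 0\<rparr>"

lemma gr_carrier: "a \<in> gr A n \<Longrightarrow> a \<in> carrier A"
  using gr_subgroup[of n] additive_subgroup.a_subset by blast

lemma gr_add: "a \<in> gr A n \<Longrightarrow> b \<in> gr A n \<Longrightarrow> a \<oplus> b \<in> gr A n"
  by (rule additive_subgroup.a_closed[OF gr_subgroup])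

lemma gr_zero: "\<zero> \<in> gr A n"
  by (rule additive_subgroup.zero_closed[OF gr_subgroup])

lemma gr_neg: "a \<in> gr A n \<Longrightarrow> \<ominus> a \<in> gr A n"
  by (rule additive_subgroup.a_inv_closed[OF gr_subgroup])

lemma dif_zero: "dif A \<zero> = \<zero>"
proof -
  have "dif A \<zero> \<in> carrier A" using dif_gr[OF gr_zero[of 0]] gr_carrier by blast
  moreover have "dif A \<zero> \<oplus> dif A \<zero> = dif A \<zero>" using dif_add[of \<zero> \<zero>] by simp
  ultimately show ?thesis by simp
qed

lemma dif_gr0: "a \<in> gr A 0 \<Longrightarrow> dif A a = \<zero>"
  using dif_gr[of a 0] gr_nonpos[of 1] by simp

lemma cocycles_0: "cocycles A 0 = gr A 0"
  by (auto simp: cocycles_def dif_gr0)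

lemma gr0_mult: "a \<in> gr A 0 \<Longrightarrow> b \<in> gr A n \<Longrightarrow> a \<otimes> b \<in> gr A n"
  using mult_gr[of a 0 b n] by simp

lemma gr0_comm: "a \<in> gr A 0 \<Longrightarrow> b \<in> gr A n \<Longrightarrow> b \<otimes> a = a \<otimes> b"
  using graded_comm[of a 0 b n] by (simp add: koszul_sign_def)

lemma dif_gr0_mult: "a \<in> gr A 0 \<Longrightarrow> b \<in> gr A n \<Longrightarrow> dif A (a \<otimes> b) = a \<otimes> dif A b"
  using leibniz[of a 0 b n] dif_gr0 dif_gr[of b n] gr_carrier
  by (simp add: koszul_sign_def)

lemma S0_cring: "cring S0"
proof -
  have c: "\<And>a. a \<in> gr A 0 \<Longrightarrow> a \<in> carrier A" using gr_carrier by blast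
  have m: "\<And>a b. a \<in> gr A 0 \<Longrightarrow> b \<in> gr A 0 \<Longrightarrow> a \<otimes> b \<in> gr A 0" using gr0_mult by blast
  show ?thesis
    unfolding cocycles_0
  proof (intro cringI abelian_groupI comm_monoidI)
    show "\<exists>y\<in>carrier (A\<lparr>carrier := gr A 0\<rparr>). y \<oplus>\<^bsub>A\<lparr>carrier := gr A 0\<rparr>\<^esub> x = \<zero>\<^bsub>A\<lparr>carrier := gr A 0\<rparr>\<^esub>"
      if "x \<in> carrier (A\<lparr>carrier := gr A 0\<rparr>)" for x
      using that gr_neg[of x 0] c by (auto simp: l_neg intro!: bexI[of _ "\<ominus> x"])
  qed (use c m gr_add gr_zero one_gr gr0_comm in \<open>auto simp: a_ac m_assoc l_distr\<close>)
qed

lemma coboundaries_carrier: "coboundaries A 0 \<subseteq> gr A 0"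
  using dif_gr[of _ "-1"] by (auto simp: coboundaries_def)

lemma coboundaries_ideal: "ideal (coboundaries A 0) S0"
proof -
  interpret S0: cring S0 by (rule S0_cring)
  show ?thesis
    unfolding S0.ideal_iff
  proof (intro conjI ballI)
    show "coboundaries A 0 \<subseteq> carrier S0" using coboundaries_carrier cocycles_0 by simp
    show "\<zero>\<^bsub>S0\<^esub> \<in> coboundaries A 0"
      using gr_zero[of "-1"] dif_zero by (force simp: coboundaries_def)
    fix a assume "a \<in> coboundaries A 0"
    then obtain b where b: "b \<in> gr A (-1)" "a = dif A b" by (auto simp: coboundaries_def)
    show "a \<oplus>\<^bsub>S0\<^esub> a' \<in> coboundaries A 0" if "a' \<in> coboundaries A 0" for a'
    proof -
      obtain b' where b': "b' \<in> gr A (-1)" "a' = dif A b'"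
        using \<open>a' \<in> coboundaries A 0\<close> by (auto simp: coboundaries_def)
      then have "a \<oplus> a' = dif A (b \<oplus> b')" using b dif_add gr_carrier by simp
      then show ?thesis using gr_add b b' by (auto simp: coboundaries_def)
    qed
    show "r \<otimes>\<^bsub>S0\<^esub> a \<in> coboundaries A 0" if "r \<in> carrier S0" for r
    proof -
      have r: "r \<in> gr A 0" using that cocycles_0 by simp
      then have "r \<otimes> a = dif A (r \<otimes> b)" using b dif_gr0_mult by simp
      then show ?thesis using gr0_mult[OF r b(1)] by (auto simp: coboundaries_def)
    qed
    then show "a \<otimes>\<^bsub>S0\<^esub> r \<in> coboundaries A 0" if "r \<in> carrier S0" for r
      using that S0.m_comm[of a r] \<open>a \<in> coboundaries A 0\<close> coboundaries_carrier cocycles_0 by auto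
  qed
qed

lemma H0_cring: "cring (H0 A)"
  unfolding H0_def by (rule ideal.quotient_is_cring[OF coboundaries_ideal S0_cring])

definition rcls :: "'a \<Rightarrow> 'a set" where "rcls a = coboundaries A 0 +> a"

lemma rcls_S0: "rcls a = coboundaries A 0 +>\<^bsub>S0\<^esub> a"
  by (simp add: rcls_def a_r_coset_def')

lemma H0_carrier: "carrier (H0 A) = rcls ` gr A 0"
  by (auto simp: H0_def FactRing_def A_RCOSETS_def' rcls_S0 cocycles_0)

lemma rcls_closed: "a \<in> gr A 0 \<Longrightarrow> rcls a \<in> carrier (H0 A)"
  by (simp add: H0_carrier)

lemma rcls_hom:
  assumes "a \<in> gr A 0" "b \<in> gr A 0"
  shows "rcls (a \<oplus> b) = rcls a \<oplus>\<^bsub>H0 A\<^esub> rcls b" "rcls (a \<otimes> b) = rcls a \<otimes>\<^bsub>H0 A\<^esub> rcls b"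
    and "rcls \<one> = \<one>\<^bsub>H0 A\<^esub>" "rcls \<zero> = \<zero>\<^bsub>H0 A\<^esub>"
proof -
  interpret h: ring_hom_ring S0 "H0 A" rcls
    using ideal.rcos_ring_hom_ring[OF coboundaries_ideal]
    unfolding H0_def rcls_S0 .
  show "rcls (a \<oplus> b) = rcls a \<oplus>\<^bsub>H0 A\<^esub> rcls b" "rcls (a \<otimes> b) = rcls a \<otimes>\<^bsub>H0 A\<^esub> rcls b"
    and "rcls \<one> = \<one>\<^bsub>H0 A\<^esub>" "rcls \<zero> = \<zero>\<^bsub>H0 A\<^esub>"
    using h.hom_add[of a b] h.hom_mult[of a b] h.hom_one h.hom_zero assms by (simp_all add: cocycles_0)
qed

lemma rcls_eq_iff:
  assumes "a \<in> gr A 0" "b \<in> gr A 0"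
  shows "rcls a = rcls b \<longleftrightarrow> (\<exists>c\<in>gr A (-1). a = dif A c \<oplus> b)"
proof -
  interpret I: ideal "coboundaries A 0" S0 by (rule coboundaries_ideal)
  from I.rcos_eq_iff[of a b] assms
  have "rcls a = rcls b \<longleftrightarrow> (\<exists>h\<in>coboundaries A 0. a = h \<oplus> b)"
    unfolding rcls_S0 by (simp add: cocycles_0)
  also have "\<dots> \<longleftrightarrow> (\<exists>c\<in>gr A (-1). a = dif A c \<oplus> b)"
    by (auto simp: coboundaries_def)
  finally show ?thesis .
qed

lemma rcls_mem:
  assumes "X \<in> carrier (H0 A)" "a \<in> X"
  shows "a \<in> gr A 0" "rcls a = X"
proof -
  from assms(1)[unfolded H0_carrier] obtain b where b: "X = rcls b" "b \<in> gr A 0" by (rule imageE)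
  interpret I: ideal "coboundaries A 0" S0 by (rule coboundaries_ideal)
  show "rcls a = X"
    using I.rcos_eqI[of a b] assms(2) b(2) unfolding b(1) rcls_S0 by (simp add: cocycles_0)
  obtain c where "c \<in> coboundaries A 0" "a = c \<oplus> b" using assms(2) unfolding b(1) rcls_def a_r_coset_def' by auto
  then show "a \<in> gr A 0" using coboundaries_carrier gr_add[OF _ b(2)] by auto
qed

lemma some_rcls:
  assumes "X \<in> carrier (H0 A)"
  shows "(SOME a. a \<in> X) \<in> gr A 0" "rcls (SOME a. a \<in> X) = X"
proof -
  from assms(1)[unfolded H0_carrier] obtain b where b: "X = rcls b" "b \<in> gr A 0" by (rule imageE)
  interpret I: ideal "coboundaries A 0" S0 by (rule coboundaries_ideal)
  have "b \<in> X" using I.a_rcos_self[of b] b(2) unfolding b(1) rcls_S0 by (simp add: cocycles_0)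
  then have "(SOME a. a \<in> X) \<in> X" by (rule someI)
  then show "(SOME a. a \<in> X) \<in> gr A 0" "rcls (SOME a. a \<in> X) = X" using rcls_mem[OF assms] by auto
qed

lemma graded_decomp_gr0:
  assumes "b \<in> gr A 0"
  shows "(THE f. graded_decomp A b f) = (\<lambda>n. if n = 0 then b else \<zero>)"
proof -
  have c: "b \<in> carrier A" using gr_carrier assms by blast
  have "{n. (if n = (0::int) then b else \<zero>) \<noteq> \<zero>} = (if b = \<zero> then {} else {0})"
    by auto
  then have "graded_decomp A b (\<lambda>n. if n = 0 then b else \<zero>)"
    unfolding graded_decomp_def using assms gr_zero c by auto
  then show ?thesis using gr_direct_sum[OF c] by (blast intro: the1_equality)
qed

text \<open>Consequently A^0 acts on a Koszul complex componentwise, without signs.\<close>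

lemma degree_involution_gr0:
  assumes "b \<in> gr A 0"
  shows "degree_involution A b = b"
proof -
  have c: "b \<in> carrier A" using gr_carrier assms by blast
  have e: "{n. (if n = (0::int) then b else \<zero>) \<noteq> \<zero>} = (if b = \<zero> then {} else {0})"
    by auto
  show ?thesis
    unfolding degree_involution_def Let_def graded_decomp_gr0[OF assms] e
    using c by (simp add: koszul_sign_def)
qed

end

text \<open>
  Only the action of the degree-zero part of \<open>A\<close> on a DG-module matters for its Koszul complexes
  and its cohomology.  The elements of negative degree are needed only to make the action of the
  coboundaries null-homotopic.
\<close>

definition null_homotopy ::
    "('a, 'b) cochain_scheme \<Rightarrow> ('a, 'm) dg_mod \<Rightarrow> 'a \<Rightarrow> ('m \<Rightarrow> 'm) \<Rightarrow> bool" where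
  "null_homotopy A M c h \<longleftrightarrow>
     (\<forall>n. \<forall>x\<in>gr M n. h x \<in> gr M (n - 1) \<and>
        dif M (h x) \<oplus>\<^bsub>M\<^esub> h (dif M x) = act M c x \<and>
        (\<forall>y\<in>gr M n. h (x \<oplus>\<^bsub>M\<^esub> y) = h x \<oplus>\<^bsub>M\<^esub> h y) \<and>
        (\<forall>a\<in>gr A 0. h (act M a x) = act M a (h x)))"

text \<open>The conditions concern homogeneous elements, which is all that cohomology sees. The last
  one makes the action of H^0(A) on cohomology well defined, and it is inherited by Koszul
  complexes.\<close>

locale dg_complex = A: dg_ring A + M: abelian_group M
  for A :: "('a, 'b) cochain_scheme" and M :: "('a, 'm) dg_mod" +
  assumes gr_carrier: "x \<in> gr M n \<Longrightarrow> x \<in> carrier M"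
    and gr_zero: "\<zero>\<^bsub>M\<^esub> \<in> gr M n"
    and gr_add: "x \<in> gr M n \<Longrightarrow> y \<in> gr M n \<Longrightarrow> x \<oplus>\<^bsub>M\<^esub> y \<in> gr M n"
    and gr_neg: "x \<in> gr M n \<Longrightarrow> \<ominus>\<^bsub>M\<^esub> x \<in> gr M n"
    and dif_gr: "x \<in> gr M n \<Longrightarrow> dif M x \<in> gr M (n + 1)"
    and dif_add: "x \<in> gr M n \<Longrightarrow> y \<in> gr M n \<Longrightarrow> dif M (x \<oplus>\<^bsub>M\<^esub> y) = dif M x \<oplus>\<^bsub>M\<^esub> dif M y"
    and dif_dif: "x \<in> gr M n \<Longrightarrow> dif M (dif M x) = \<zero>\<^bsub>M\<^esub>"
    and act_gr: "a \<in> gr A 0 \<Longrightarrow> x \<in> gr M n \<Longrightarrow> act M a x \<in> gr M n"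
    and act_add: "a \<in> gr A 0 \<Longrightarrow> x \<in> gr M n \<Longrightarrow> y \<in> gr M n \<Longrightarrow>
      act M a (x \<oplus>\<^bsub>M\<^esub> y) = act M a x \<oplus>\<^bsub>M\<^esub> act M a y"
    and add_act: "a \<in> gr A 0 \<Longrightarrow> b \<in> gr A 0 \<Longrightarrow> x \<in> gr M n \<Longrightarrow>
      act M (a \<oplus>\<^bsub>A\<^esub> b) x = act M a x \<oplus>\<^bsub>M\<^esub> act M b x"
    and mult_act: "a \<in> gr A 0 \<Longrightarrow> b \<in> gr A 0 \<Longrightarrow> x \<in> gr M n \<Longrightarrow>
      act M (a \<otimes>\<^bsub>A\<^esub> b) x = act M a (act M b x)"
    and one_act: "x \<in> gr M n \<Longrightarrow> act M \<one>\<^bsub>A\<^esub> x = x"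
    and dif_act: "a \<in> gr A 0 \<Longrightarrow> x \<in> gr M n \<Longrightarrow> dif M (act M a x) = act M a (dif M x)"
    and null_homotopic: "b \<in> gr A (-1) \<Longrightarrow> \<exists>h. null_homotopy A M (dif A b) h"
begin

lemma dif_zero: "dif M \<zero>\<^bsub>M\<^esub> = \<zero>\<^bsub>M\<^esub>"
proof -
  have "dif M \<zero>\<^bsub>M\<^esub> \<in> carrier M" using dif_gr[OF gr_zero[of 0]] gr_carrier by blast
  moreover have "dif M \<zero>\<^bsub>M\<^esub> \<oplus>\<^bsub>M\<^esub> dif M \<zero>\<^bsub>M\<^esub> = dif M \<zero>\<^bsub>M\<^esub>"
    using dif_add[OF gr_zero gr_zero] by simp
  ultimately show ?thesis by simp
qed

lemma dif_neg: "x \<in> gr M n \<Longrightarrow> dif M (\<ominus>\<^bsub>M\<^esub> x) = \<ominus>\<^bsub>M\<^esub> dif M x"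
proof -
  assume x: "x \<in> gr M n"
  have c: "dif M (\<ominus>\<^bsub>M\<^esub> x) \<in> carrier M" "dif M x \<in> carrier M"
    using dif_gr gr_carrier gr_neg x by blast+
  have "dif M (\<ominus>\<^bsub>M\<^esub> x) \<oplus>\<^bsub>M\<^esub> dif M x = \<zero>\<^bsub>M\<^esub>"
    using dif_add[OF gr_neg[OF x] x] gr_carrier[OF x] by (simp add: M.l_neg dif_zero)
  then show ?thesis using c by (metis M.minus_equality)
qed

lemma act_zero: "a \<in> gr A 0 \<Longrightarrow> act M a \<zero>\<^bsub>M\<^esub> = \<zero>\<^bsub>M\<^esub>"
proof -
  assume a: "a \<in> gr A 0"
  have "act M a \<zero>\<^bsub>M\<^esub> \<in> carrier M" using act_gr[OF a gr_zero[of 0]] gr_carrier by blast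
  moreover have "act M a \<zero>\<^bsub>M\<^esub> \<oplus>\<^bsub>M\<^esub> act M a \<zero>\<^bsub>M\<^esub> = act M a \<zero>\<^bsub>M\<^esub>"
    using act_add[OF a gr_zero gr_zero] by simp
  ultimately show ?thesis by simp
qed

lemma act_neg: "a \<in> gr A 0 \<Longrightarrow> x \<in> gr M n \<Longrightarrow> act M a (\<ominus>\<^bsub>M\<^esub> x) = \<ominus>\<^bsub>M\<^esub> act M a x"
proof -
  assume a: "a \<in> gr A 0" and x: "x \<in> gr M n"
  have c: "act M a (\<ominus>\<^bsub>M\<^esub> x) \<in> carrier M" "act M a x \<in> carrier M"
    using act_gr[OF a] gr_carrier gr_neg x by blast+
  have "act M a (\<ominus>\<^bsub>M\<^esub> x) \<oplus>\<^bsub>M\<^esub> act M a x = \<zero>\<^bsub>M\<^esub>"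
    using act_add[OF a gr_neg[OF x] x] gr_carrier[OF x] by (simp add: M.l_neg act_zero[OF a])
  then show ?thesis using c by (metis M.minus_equality)
qed

lemma act_act_comm:
  assumes "a \<in> gr A 0" "b \<in> gr A 0" "x \<in> gr M n"
  shows "act M a (act M b x) = act M b (act M a x)"
  using mult_act[OF assms] mult_act[OF assms(2,1,3)] A.gr0_comm[OF assms(1,2)] by simp

lemma cocycle_iff: "z \<in> cocycles M n \<longleftrightarrow> z \<in> gr M n \<and> dif M z = \<zero>\<^bsub>M\<^esub>"
  by (simp add: cocycles_def)

lemma cocycle_gr: "z \<in> cocycles M n \<Longrightarrow> z \<in> gr M n"
  by (simp add: cocycles_def)

lemma cocycle_carrier: "z \<in> cocycles M n \<Longrightarrow> z \<in> carrier M"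
  using cocycle_gr gr_carrier by blast

lemma cocycle_zero: "\<zero>\<^bsub>M\<^esub> \<in> cocycles M n"
  by (simp add: cocycle_iff gr_zero dif_zero)

lemma cocycle_add: "z \<in> cocycles M n \<Longrightarrow> w \<in> cocycles M n \<Longrightarrow> z \<oplus>\<^bsub>M\<^esub> w \<in> cocycles M n"
  by (auto simp: cocycle_iff gr_add dif_add[of _ n])

lemma cocycle_neg: "z \<in> cocycles M n \<Longrightarrow> \<ominus>\<^bsub>M\<^esub> z \<in> cocycles M n"
  by (auto simp: cocycle_iff gr_neg dif_neg[of _ n])

lemma cocycle_act: "a \<in> gr A 0 \<Longrightarrow> z \<in> cocycles M n \<Longrightarrow> act M a z \<in> cocycles M n"
  by (auto simp: cocycle_iff act_gr dif_act[of _ _ n] act_zero)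

lemma coboundaryI: "v \<in> gr M (n - 1) \<Longrightarrow> dif M v \<in> coboundaries M n"
  by (simp add: coboundaries_def)

lemma coboundaryI': "v \<in> gr M n \<Longrightarrow> dif M v \<in> coboundaries M (n + 1)"
  by (simp add: coboundaries_def)

lemma coboundaryE:
  assumes "b \<in> coboundaries M n"
  obtains v where "v \<in> gr M (n - 1)" "b = dif M v"
  using assms by (auto simp: coboundaries_def)

lemma coboundary_cocycle: "b \<in> coboundaries M n \<Longrightarrow> b \<in> cocycles M n"
  using dif_gr[of _ "n - 1"] dif_dif by (auto elim!: coboundaryE simp: cocycle_iff)

lemma coboundary_zero: "\<zero>\<^bsub>M\<^esub> \<in> coboundaries M n"
  using coboundaryI[OF gr_zero] by (simp add: dif_zero)

lemma coboundary_add: "b \<in> coboundaries M n \<Longrightarrow> c \<in> coboundaries M n \<Longrightarrow> b \<oplus>\<^bsub>M\<^esub> c \<in> coboundaries M n"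
  using coboundaryI[OF gr_add] by (force elim!: coboundaryE simp: dif_add[symmetric])

lemma coboundary_neg: "b \<in> coboundaries M n \<Longrightarrow> \<ominus>\<^bsub>M\<^esub> b \<in> coboundaries M n"
  using coboundaryI[OF gr_neg] by (force elim!: coboundaryE simp: dif_neg[symmetric])

lemma coboundary_act: "a \<in> gr A 0 \<Longrightarrow> b \<in> coboundaries M n \<Longrightarrow> act M a b \<in> coboundaries M n"
  using coboundaryI[OF act_gr] by (force elim!: coboundaryE simp: dif_act[symmetric])

lemma coboundary_carrier: "b \<in> coboundaries M n \<Longrightarrow> b \<in> carrier M"
  using coboundary_cocycle cocycle_carrier by blast

lemma coboundary_cancel:
  assumes "b \<in> coboundaries M n" "z \<in> carrier M"
  shows "b \<oplus>\<^bsub>M\<^esub> z \<in> coboundaries M n \<longleftrightarrow> z \<in> coboundaries M n"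
proof
  assume "b \<oplus>\<^bsub>M\<^esub> z \<in> coboundaries M n"
  then have "\<ominus>\<^bsub>M\<^esub> b \<oplus>\<^bsub>M\<^esub> (b \<oplus>\<^bsub>M\<^esub> z) \<in> coboundaries M n"
    using assms coboundary_add coboundary_neg by blast
  then show "z \<in> coboundaries M n"
    using assms coboundary_carrier[OF assms(1)] by (simp add: M.r_neg1)
qed (use assms coboundary_add in blast)

text \<open>On a cocycle \<open>z\<close> the null-homotopy formula leaves only the differential of
  \<open>h z\<close>.\<close>

lemma cob_act:
  assumes "c \<in> gr A (-1)" "z \<in> cocycles M n"
  shows "act M (dif A c) z \<in> coboundaries M n"
proof -
  obtain h where h: "null_homotopy A M (dif A c) h" using null_homotopic assms by blast
  have z: "z \<in> gr M n" "dif M z = \<zero>\<^bsub>M\<^esub>" using assms by (auto simp: cocycle_iff)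
  have hx: "h x \<in> gr M (k - 1)" "dif M (h x) \<oplus>\<^bsub>M\<^esub> h (dif M x) = act M (dif A c) x"
    "h (x \<oplus>\<^bsub>M\<^esub> x) = h x \<oplus>\<^bsub>M\<^esub> h x" if "x \<in> gr M k" for x k
    using h that unfolding null_homotopy_def by auto
  have hz: "h z \<in> gr M (n - 1)" and e: "dif M (h z) \<oplus>\<^bsub>M\<^esub> h \<zero>\<^bsub>M\<^esub> = act M (dif A c) z"
    using hx(1,2)[OF z(1)] z(2) by simp_all
  have "h \<zero>\<^bsub>M\<^esub> \<in> carrier M" "h \<zero>\<^bsub>M\<^esub> \<oplus>\<^bsub>M\<^esub> h \<zero>\<^bsub>M\<^esub> = h \<zero>\<^bsub>M\<^esub>"
    using hx(1)[OF gr_zero[of 0]] gr_carrier hx(3)[OF gr_zero[of 0]] by auto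
  then have "h \<zero>\<^bsub>M\<^esub> = \<zero>\<^bsub>M\<^esub>" by simp
  then have "act M (dif A c) z = dif M (h z)"
    using e z(2) gr_carrier[OF dif_gr[OF hz]] by simp
  then show ?thesis using coboundaryI[OF hz] by simp
qed

lemma act_rcls:
  assumes "a \<in> gr A 0" "b \<in> gr A 0" "A.rcls a = A.rcls b" "z \<in> cocycles M n"
  shows "\<exists>w\<in>coboundaries M n. act M a z = w \<oplus>\<^bsub>M\<^esub> act M b z"
proof -
  obtain c where c: "c \<in> gr A (-1)" "a = dif A c \<oplus>\<^bsub>A\<^esub> b" using A.rcls_eq_iff assms by blast
  have "dif A c \<in> gr A 0" using A.dif_gr[OF c(1)] by simp
  then have "act M a z = act M (dif A c) z \<oplus>\<^bsub>M\<^esub> act M b z"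
    using add_act assms cocycle_gr c by blast
  then show ?thesis using cob_act[OF c(1) assms(4)] by blast
qed

definition hcls :: "int \<Rightarrow> 'm \<Rightarrow> 'm set" where "hcls n z = coboundaries M n +>\<^bsub>M\<^esub> z"

lemma coboundaries_subgroup: "abelian_subgroup (coboundaries M n) M"
  by (intro abelian_subgroupI3 additive_subgroupI subgroup.intro M.abelian_group_axioms)
    (auto simp: coboundary_carrier coboundary_add coboundary_zero coboundary_neg a_inv_def[symmetric])

lemma hcls_eq_iff:
  assumes "z \<in> carrier M" "w \<in> carrier M"
  shows "hcls n z = hcls n w \<longleftrightarrow> (\<exists>b\<in>coboundaries M n. z = b \<oplus>\<^bsub>M\<^esub> w)"
proof -
  interpret B: abelian_subgroup "coboundaries M n" M by (rule coboundaries_subgroup)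
  show ?thesis
    using B.rcos_eq_iff[of z w] assms unfolding hcls_def by simp
qed

lemma hcls_add:
  "z \<in> carrier M \<Longrightarrow> w \<in> carrier M \<Longrightarrow> set_add M (hcls n z) (hcls n w) = hcls n (z \<oplus>\<^bsub>M\<^esub> w)"
  unfolding hcls_def by (rule abelian_subgroup.a_rcos_sum[OF coboundaries_subgroup])

lemma hcls_zero: "hcls n \<zero>\<^bsub>M\<^esub> = coboundaries M n"
  unfolding hcls_def by (rule M.a_coset_add_zero) (use coboundary_carrier in blast)

lemma cohomology_carrier: "carrier (cohomology M n) = hcls n ` cocycles M n"
  by (auto simp: cohomology_def hcls_def)

lemma cohomology_simps:
  "add (cohomology M n) = set_add M" "zero (cohomology M n) = hcls n \<zero>\<^bsub>M\<^esub>"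
  by (simp_all add: cohomology_def hcls_zero)

lemma hcls_eq_zero_iff:
  assumes "z \<in> carrier M"
  shows "hcls n z = \<zero>\<^bsub>cohomology M n\<^esub> \<longleftrightarrow> z \<in> coboundaries M n"
  using hcls_eq_iff[OF assms M.zero_closed, of n] coboundary_carrier assms
  by (auto simp: cohomology_simps)

text \<open>The union in the definition of the scalar multiplication collapses, because all pairs of
  representatives lead to the same coset.\<close>

lemma hcls_act:
  assumes a: "a \<in> gr A 0" and z: "z \<in> cocycles M n"
  shows "A.rcls a \<odot>\<^bsub>cohomology M n\<^esub> hcls n z = hcls n (act M a z)"
proof -
  interpret B: abelian_subgroup "coboundaries M n" M by (rule coboundaries_subgroup)
  interpret I: ideal "coboundaries A 0" A.S0 by (rule A.coboundaries_ideal)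
  have eq: "hcls n (act M a' z') = hcls n (act M a z)" if "a' \<in> A.rcls a" "z' \<in> hcls n z" for a' z'
  proof -
    have a': "a' \<in> gr A 0" "A.rcls a' = A.rcls a"
      using A.rcls_mem[OF A.rcls_closed[OF a] that(1)] by auto
    from that(2) obtain b where b: "b \<in> coboundaries M n" "z' = b \<oplus>\<^bsub>M\<^esub> z"
      unfolding hcls_def a_r_coset_def' by auto
    obtain w where w: "w \<in> coboundaries M n" "act M a' z = w \<oplus>\<^bsub>M\<^esub> act M a z"
      using act_rcls[OF a'(1) a a'(2) z] by blast
    have c: "w \<in> carrier M" "act M a z \<in> carrier M" "act M a' b \<in> carrier M"
      using w coboundary_carrier cocycle_carrier[OF cocycle_act[OF a z]] coboundary_act[OF a'(1) b(1)]
      by auto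
    have "act M a' z' = act M a' b \<oplus>\<^bsub>M\<^esub> act M a' z"
      unfolding b using act_add a' coboundary_cocycle[OF b(1)] z cocycle_gr by blast
    also have "\<dots> = (act M a' b \<oplus>\<^bsub>M\<^esub> w) \<oplus>\<^bsub>M\<^esub> act M a z"
      unfolding w using c by (simp add: M.a_assoc)
    finally have e: "act M a' z' = (act M a' b \<oplus>\<^bsub>M\<^esub> w) \<oplus>\<^bsub>M\<^esub> act M a z" .
    have "act M a' b \<oplus>\<^bsub>M\<^esub> w \<in> coboundaries M n"
      using coboundary_add coboundary_act[OF a'(1) b(1)] w by blast
    then show ?thesis using e c by (subst hcls_eq_iff) auto
  qed
  have "a \<in> A.rcls a" using I.a_rcos_self[of a] a unfolding A.rcls_S0 by (simp add: A.cocycles_0)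
  moreover have "z \<in> hcls n z" using B.a_rcos_self[of z] cocycle_carrier[OF z] unfolding hcls_def by simp
  ultimately have "(\<Union>a'\<in>A.rcls a. \<Union>z'\<in>hcls n z. hcls n (act M a' z')) = hcls n (act M a z)"
    using eq by blast
  then show ?thesis by (simp add: cohomology_def hcls_def)
qed

lemma cohomology_module: "module (H0 A) (cohomology M n)"
proof (rule moduleI)
  show "cring (H0 A)" by (rule A.H0_cring)
  note [simp] = cohomology_carrier cohomology_simps hcls_add cocycle_carrier
  show "abelian_group (cohomology M n)"
  proof (rule abelian_groupI)
    show "\<exists>y\<in>carrier (cohomology M n). y \<oplus>\<^bsub>cohomology M n\<^esub> x = \<zero>\<^bsub>cohomology M n\<^esub>"
      if "x \<in> carrier (cohomology M n)" for x
    proof -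
      from that obtain z where z: "z \<in> cocycles M n" "x = hcls n z" by auto
      then show ?thesis
        using cocycle_neg[OF z(1)] by (auto simp: M.l_neg intro!: bexI[of _ "\<ominus>\<^bsub>M\<^esub> z"])
    qed
  qed (auto simp: cocycle_add cocycle_zero M.a_ac)
  note [simp] = A.H0_carrier hcls_act cocycle_carrier[OF cocycle_act, of _ _ n]
  show "a \<odot>\<^bsub>cohomology M n\<^esub> x \<in> carrier (cohomology M n)"
    if "a \<in> carrier (H0 A)" "x \<in> carrier (cohomology M n)" for a x
    using that by (auto simp: cocycle_act)
  show "(a \<oplus>\<^bsub>H0 A\<^esub> b) \<odot>\<^bsub>cohomology M n\<^esub> x =
      a \<odot>\<^bsub>cohomology M n\<^esub> x \<oplus>\<^bsub>cohomology M n\<^esub> b \<odot>\<^bsub>cohomology M n\<^esub> x"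
    if "a \<in> carrier (H0 A)" "b \<in> carrier (H0 A)" "x \<in> carrier (cohomology M n)" for a b x
    using that by (auto simp: A.rcls_hom(1)[symmetric] A.gr_add add_act[OF _ _ cocycle_gr] cocycle_act)
  show "a \<odot>\<^bsub>cohomology M n\<^esub> (x \<oplus>\<^bsub>cohomology M n\<^esub> y) =
      a \<odot>\<^bsub>cohomology M n\<^esub> x \<oplus>\<^bsub>cohomology M n\<^esub> a \<odot>\<^bsub>cohomology M n\<^esub> y"
    if "a \<in> carrier (H0 A)" "x \<in> carrier (cohomology M n)" "y \<in> carrier (cohomology M n)" for a x y
    using that by (auto simp: cocycle_act cocycle_add act_add[OF _ cocycle_gr cocycle_gr])
  show "(a \<otimes>\<^bsub>H0 A\<^esub> b) \<odot>\<^bsub>cohomology M n\<^esub> x = a \<odot>\<^bsub>cohomology M n\<^esub> (b \<odot>\<^bsub>cohomology M n\<^esub> x)"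
    if "a \<in> carrier (H0 A)" "b \<in> carrier (H0 A)" "x \<in> carrier (cohomology M n)" for a b x
    using that by (auto simp: A.rcls_hom(2)[symmetric] A.gr0_mult mult_act[OF _ _ cocycle_gr] cocycle_act)
  show "\<one>\<^bsub>H0 A\<^esub> \<odot>\<^bsub>cohomology M n\<^esub> x = x" if "x \<in> carrier (cohomology M n)" for x
    using that A.one_gr by (auto simp: A.rcls_hom(3)[OF A.gr_zero A.gr_zero, symmetric] one_act[OF cocycle_gr])
qed

lemma cohomology_zero_iff: "cohomology_zero M n \<longleftrightarrow> cocycles M n \<subseteq> coboundaries M n"
proof -
  have "cohomology_zero M n \<longleftrightarrow> (\<forall>z\<in>cocycles M n. hcls n z = \<zero>\<^bsub>cohomology M n\<^esub>)"
    unfolding cohomology_zero_def cohomology_carrier using cocycle_zero[of n]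
    by (auto simp: cohomology_simps)
  also have "\<dots> \<longleftrightarrow> cocycles M n \<subseteq> coboundaries M n"
    using hcls_eq_zero_iff cocycle_carrier by blast
  finally show ?thesis .
qed

end

section \<open>Koszul complexes\<close>

lemma koszul_lift_simps [simp]:
  "carrier (koszul_lift A M a) = {Node x y | x y. x \<in> carrier M \<and> y \<in> carrier M}"
  "zero (koszul_lift A M a) = Node \<zero>\<^bsub>M\<^esub> \<zero>\<^bsub>M\<^esub>"
  "add (koszul_lift A M a) = (\<lambda>u v. Node (left u \<oplus>\<^bsub>M\<^esub> left v) (right u \<oplus>\<^bsub>M\<^esub> right v))"
  "gr (koszul_lift A M a) n = {Node x y | x y. x \<in> gr M n \<and> y \<in> gr M (n + 1)}"
  "dif (koszul_lift A M a) = (\<lambda>u. Node (dif M (left u) \<oplus>\<^bsub>M\<^esub> act M a (right u)) (\<ominus>\<^bsub>M\<^esub> dif M (right u)))"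
  "act (koszul_lift A M a) = (\<lambda>b u. Node (act M b (left u)) (act M (degree_involution A b) (right u)))"
  by (simp_all add: koszul_lift_def)

locale koszul_complex = dg_complex A M
  for A :: "('a, 'b) cochain_scheme" and M :: "('a, 'm tree) dg_mod" +
  fixes a :: 'a
  assumes a_gr: "a \<in> gr A 0"
begin

abbreviation K :: "('a, 'm tree) dg_mod" where "K \<equiv> koszul_lift A M a"

lemma neg_eq_zero_iff: "x \<in> carrier M \<Longrightarrow> \<ominus>\<^bsub>M\<^esub> x = \<zero>\<^bsub>M\<^esub> \<longleftrightarrow> x = \<zero>\<^bsub>M\<^esub>"
  using M.minus_minus[of x] M.minus_equality[of "\<zero>\<^bsub>M\<^esub>" "\<zero>\<^bsub>M\<^esub>"] by force

lemma K_abelian_group: "abelian_group K"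
proof (rule abelian_groupI)
  show "\<exists>y\<in>carrier K. y \<oplus>\<^bsub>K\<^esub> x = \<zero>\<^bsub>K\<^esub>" if "x \<in> carrier K" for x
  proof -
    from that obtain u v where x: "x = Node u v" "u \<in> carrier M" "v \<in> carrier M" by auto
    then show ?thesis
      by (intro bexI[of _ "Node (\<ominus>\<^bsub>M\<^esub> u) (\<ominus>\<^bsub>M\<^esub> v)"]) (auto simp: M.l_neg)
  qed
qed (auto simp: M.a_ac)

lemma K_neg:
  assumes "u \<in> carrier M" "v \<in> carrier M"
  shows "\<ominus>\<^bsub>K\<^esub> (Node u v) = Node (\<ominus>\<^bsub>M\<^esub> u) (\<ominus>\<^bsub>M\<^esub> v)"
  using assms by (intro abelian_group.minus_equality[OF K_abelian_group]) (auto simp: M.l_neg)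

lemma K_dg_complex: "dg_complex A K"
proof (intro dg_complex.intro dg_complex_axioms.intro)
  show "dg_ring A" by (rule A.dg_ring_axioms)
  show "abelian_group K" by (rule K_abelian_group)
  note [simp] = gr_carrier gr_zero gr_add gr_neg a_gr
  have n1: "n - 1 + 1 = n" "n + 1 - 1 = n" for n :: int by simp_all
  fix n
  have d1: "dif M y \<in> gr M (2 + n)" if "y \<in> gr M (n + 1)" for y using dif_gr[OF that] by (simp add: add.commute)
  show "x \<in> carrier K" if "x \<in> gr K n" for x using that by auto
  show "\<zero>\<^bsub>K\<^esub> \<in> gr K n" by simp
  show "x \<oplus>\<^bsub>K\<^esub> y \<in> gr K n" if "x \<in> gr K n" "y \<in> gr K n" for x y using that by auto
  show "\<ominus>\<^bsub>K\<^esub> x \<in> gr K n" if "x \<in> gr K n" for x using that by (auto simp: K_neg)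
  show "dif K x \<in> gr K (n + 1)" if "x \<in> gr K n" for x
    using that d1 by (auto intro!: gr_add gr_neg dif_gr act_gr)
  show "dif K (x \<oplus>\<^bsub>K\<^esub> y) = dif K x \<oplus>\<^bsub>K\<^esub> dif K y" if x: "x \<in> gr K n" and y: "y \<in> gr K n" for x y
  proof -
    from x y obtain u v u' v' where *: "x = Node u v" "u \<in> gr M n" "v \<in> gr M (n + 1)"
      "y = Node u' v'" "u' \<in> gr M n" "v' \<in> gr M (n + 1)" by auto
    have c: "dif M u \<in> carrier M" "dif M u' \<in> carrier M" "dif M v \<in> carrier M" "dif M v' \<in> carrier M"
      "act M a v \<in> carrier M" "act M a v' \<in> carrier M"
      using * dif_gr act_gr[OF a_gr] gr_carrier by blast+
    show ?thesis using * c
      by (simp add: dif_add[of _ n] dif_add[of _ "n + 1"] act_add[OF a_gr, of _ "n + 1"] M.a_ac M.minus_add)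
  qed
  show "dif K (dif K x) = \<zero>\<^bsub>K\<^esub>" if "x \<in> gr K n" for x
  proof -
    from \<open>x \<in> gr K n\<close> obtain u v where *: "x = Node u v" "u \<in> gr M n" "v \<in> gr M (n + 1)" by auto
    have g: "dif M u \<in> gr M (n + 1)" "act M a v \<in> gr M (n + 1)" "dif M v \<in> gr M (2 + n)"
      using *(1) dif_gr[OF *(2)] act_gr[OF a_gr *(3)] dif_gr[OF *(3)] by (simp_all add: add.commute)
    have c: "act M a (dif M v) \<in> carrier M" using act_gr[OF a_gr g(3)] gr_carrier by blast
    show ?thesis using * g c
      by (simp add: dif_add[of _ "n + 1"] dif_dif[of _ n] dif_act[OF a_gr, of _ "n + 1"]
          act_neg[OF a_gr, of _ "2 + n"] dif_neg[of _ "2 + n"] dif_dif[of _ "n + 1"] M.r_neg)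
  qed
  fix b assume b: "b \<in> gr A 0"
  note [simp] = A.degree_involution_gr0
  show "act K b x \<in> gr K n" if "x \<in> gr K n" for x
    using that b by (auto intro: act_gr)
  show "act K b (x \<oplus>\<^bsub>K\<^esub> y) = act K b x \<oplus>\<^bsub>K\<^esub> act K b y" if "x \<in> gr K n" "y \<in> gr K n" for x y
    using that b by (auto simp: act_add[of _ _ n] act_add[of _ _ "n + 1"])
  show "dif K (act K b x) = act K b (dif K x)" if "x \<in> gr K n" for x
  proof -
    from \<open>x \<in> gr K n\<close> obtain u v where *: "x = Node u v" "u \<in> gr M n" "v \<in> gr M (n + 1)" by auto
    have g: "dif M u \<in> gr M (n + 1)" "act M a v \<in> gr M (n + 1)" "dif M v \<in> gr M (2 + n)"
      using *(1) dif_gr[OF *(2)] act_gr[OF a_gr *(3)] dif_gr[OF *(3)] by (simp_all add: add.commute)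
    show ?thesis using * g b
      by (simp add: dif_act[of _ _ n] dif_act[of _ _ "n + 1"] act_add[of _ _ "n + 1"]
          act_act_comm[OF a_gr b, of _ "n + 1"] act_neg[of _ _ "2 + n"])
  qed
  fix c assume c: "c \<in> gr A 0"
  show "act K (b \<oplus>\<^bsub>A\<^esub> c) x = act K b x \<oplus>\<^bsub>K\<^esub> act K c x" if "x \<in> gr K n" for x
    using that b c by (auto simp: A.gr_add add_act[of _ _ _ n] add_act[of _ _ _ "n + 1"])
  show "act K (b \<otimes>\<^bsub>A\<^esub> c) x = act K b (act K c x)" if "x \<in> gr K n" for x
    using that b c by (auto simp: A.gr0_mult mult_act[of _ _ _ n] mult_act[of _ _ _ "n + 1"])
next
  show "act K \<one>\<^bsub>A\<^esub> x = x" if "x \<in> gr K n" for x n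
    using that A.one_gr by (auto simp: A.degree_involution_gr0 one_act)
  fix b assume b: "b \<in> gr A (-1)"
  obtain h where h: "null_homotopy A M (dif A b) h" using null_homotopic[OF b] by blast
  have hg: "h x \<in> gr M (n - 1)" and hd: "dif M (h x) \<oplus>\<^bsub>M\<^esub> h (dif M x) = act M (dif A b) x"
    and hadd: "y \<in> gr M n \<Longrightarrow> h (x \<oplus>\<^bsub>M\<^esub> y) = h x \<oplus>\<^bsub>M\<^esub> h y"
    and hact: "c \<in> gr A 0 \<Longrightarrow> h (act M c x) = act M c (h x)" if "x \<in> gr M n" for n x y c
    using h that unfolding null_homotopy_def by blast+
  have h0: "h \<zero>\<^bsub>M\<^esub> = \<zero>\<^bsub>M\<^esub>"
  proof -
    have "h \<zero>\<^bsub>M\<^esub> \<in> carrier M" using hg[OF gr_zero[of 0]] gr_carrier by blast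
    moreover have "h \<zero>\<^bsub>M\<^esub> \<oplus>\<^bsub>M\<^esub> h \<zero>\<^bsub>M\<^esub> = h \<zero>\<^bsub>M\<^esub>"
      using hadd[OF gr_zero gr_zero] by simp
    ultimately show ?thesis by simp
  qed
  have hneg: "h (\<ominus>\<^bsub>M\<^esub> x) = \<ominus>\<^bsub>M\<^esub> h x" if x: "x \<in> gr M n" for x n
  proof -
    have "h (\<ominus>\<^bsub>M\<^esub> x) \<oplus>\<^bsub>M\<^esub> h x = \<zero>\<^bsub>M\<^esub>"
      using hadd[OF gr_neg[OF x] x] gr_carrier[OF x] by (simp add: M.l_neg h0)
    moreover have "h (\<ominus>\<^bsub>M\<^esub> x) \<in> carrier M" "h x \<in> carrier M"
      using hg gr_neg x gr_carrier by blast+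
    ultimately show ?thesis by (metis M.minus_equality)
  qed
  \<comment> \<open>The sign arises from moving \<open>h\<close>, of degree -1, past e. It makes the
    two terms \<open>act M a (h v)\<close> cancel in the homotopy formula.\<close>
  define hK where "hK u = Node (h (left u)) (\<ominus>\<^bsub>M\<^esub> h (right u))" for u
  have "null_homotopy A K (dif A b) hK"
    unfolding null_homotopy_def
  proof (intro allI ballI conjI)
    fix n x assume x: "x \<in> gr K n"
    then obtain u v where *: "x = Node u v" "u \<in> gr M n" "v \<in> gr M (n + 1)" by auto
    have hu: "h u \<in> gr M (n - 1)" and hv: "h v \<in> gr M n" using hg[OF *(2)] hg[OF *(3)] by simp_all
    show "hK x \<in> gr K (n - 1)" using * hu hv by (auto simp: hK_def intro: gr_neg)
    have db: "dif A b \<in> gr A 0" using A.dif_gr[OF b] by simp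
    have g: "dif M u \<in> gr M (n + 1)" "act M a v \<in> gr M (n + 1)" "dif M v \<in> gr M (2 + n)"
      using *(1) dif_gr[OF *(2)] act_gr[OF a_gr *(3)] dif_gr[OF *(3)] by (simp_all add: add.commute)
    have c: "dif M (h u) \<in> carrier M" "h (dif M u) \<in> carrier M" "act M a (h v) \<in> carrier M"
      "dif M (h v) \<in> carrier M" "h (dif M v) \<in> carrier M"
      using dif_gr[OF hu] dif_gr[OF hv] hg[OF g(1)] act_gr[OF a_gr hv] hg[OF g(3)] gr_carrier by blast+
    have "dif K (hK x) \<oplus>\<^bsub>K\<^esub> hK (dif K x) =
        Node ((dif M (h u) \<oplus>\<^bsub>M\<^esub> \<ominus>\<^bsub>M\<^esub> act M a (h v)) \<oplus>\<^bsub>M\<^esub> (h (dif M u) \<oplus>\<^bsub>M\<^esub> act M a (h v)))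
          (dif M (h v) \<oplus>\<^bsub>M\<^esub> h (dif M v))"
      using * g c hact[OF *(3) a_gr]
      by (simp add: hK_def act_neg[OF a_gr hv] dif_neg[OF hv] hadd[OF g(1,2)] hneg[OF g(3)])
    also have "(dif M (h u) \<oplus>\<^bsub>M\<^esub> \<ominus>\<^bsub>M\<^esub> act M a (h v)) \<oplus>\<^bsub>M\<^esub> (h (dif M u) \<oplus>\<^bsub>M\<^esub> act M a (h v))
        = dif M (h u) \<oplus>\<^bsub>M\<^esub> h (dif M u)"
      using c by (simp add: M.a_ac M.r_neg M.r_neg1 M.r_neg2 M.l_neg)
    finally show "dif K (hK x) \<oplus>\<^bsub>K\<^esub> hK (dif K x) = act K (dif A b) x"
      using * db by (simp add: hd[OF *(2)] hd[OF *(3)] A.degree_involution_gr0)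
    show "hK (x \<oplus>\<^bsub>K\<^esub> y) = hK x \<oplus>\<^bsub>K\<^esub> hK y" if y: "y \<in> gr K n" for y
    proof -
      obtain u' v' where y: "y = Node u' v'" "u' \<in> gr M n" "v' \<in> gr M (n + 1)" using y by auto
      have "h v' \<in> carrier M" "h v \<in> carrier M" using hg[OF y(3)] hv gr_carrier by blast+
      then show ?thesis using * y by (simp add: hK_def hadd[OF *(2)] hadd[OF *(3)] M.minus_add M.a_comm)
    qed
    show "hK (act K c x) = act K c (hK x)" if c: "c \<in> gr A 0" for c
      using * c by (simp add: hK_def A.degree_involution_gr0 hact[OF *(2)] hact[OF *(3)] act_neg[OF _ hv])
  qed
  then show "\<exists>h. null_homotopy A K (dif A b) h" by blast
qed

sublocale K: dg_complex A K by (rule K_dg_complex)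

lemma K_cocycle_iff:
  "Node x y \<in> cocycles K n \<longleftrightarrow>
     x \<in> gr M n \<and> y \<in> cocycles M (n + 1) \<and> dif M x \<oplus>\<^bsub>M\<^esub> act M a y = \<zero>\<^bsub>M\<^esub>"
proof -
  have "\<ominus>\<^bsub>M\<^esub> dif M y = \<zero>\<^bsub>M\<^esub> \<longleftrightarrow> dif M y = \<zero>\<^bsub>M\<^esub>" if "y \<in> gr M (n + 1)"
    using neg_eq_zero_iff gr_carrier[OF dif_gr[OF that]] by simp
  then show ?thesis unfolding K.cocycle_iff by (auto simp: cocycle_iff)
qed

lemma K_cocycle_Node:
  assumes "u \<in> cocycles K n"
  obtains x y where "u = Node x y" "Node x y \<in> cocycles K n"
  using assms K.cocycle_gr[OF assms] by auto

lemma K_coboundary_iff: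
  "u \<in> coboundaries K n \<longleftrightarrow> (\<exists>v\<in>gr M (n - 1). \<exists>w\<in>gr M n.
     u = Node (dif M v \<oplus>\<^bsub>M\<^esub> act M a w) (\<ominus>\<^bsub>M\<^esub> dif M w))"
  unfolding coboundaries_def by force

lemma K_cocycle_left: "z \<in> cocycles M n \<Longrightarrow> Node z \<zero>\<^bsub>M\<^esub> \<in> cocycles K n"
  using a_gr by (simp add: K_cocycle_iff cocycle_zero act_zero) (simp add: cocycle_iff)

text \<open>The long exact sequence at H^n(M): the kernel of the map to H^n(K) is \<open>a\<close>
  times H^n(M).\<close>

lemma K_coboundary_left:
  assumes "z \<in> cocycles M n"
  shows "Node z \<zero>\<^bsub>M\<^esub> \<in> coboundaries K n \<longleftrightarrow>
    (\<exists>w\<in>cocycles M n. \<exists>b\<in>coboundaries M n. z = b \<oplus>\<^bsub>M\<^esub> act M a w)"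
proof
  assume "Node z \<zero>\<^bsub>M\<^esub> \<in> coboundaries K n"
  then obtain v w where *: "v \<in> gr M (n - 1)" "w \<in> gr M n" "z = dif M v \<oplus>\<^bsub>M\<^esub> act M a w"
    "\<ominus>\<^bsub>M\<^esub> dif M w = \<zero>\<^bsub>M\<^esub>" unfolding K_coboundary_iff by auto
  have "dif M w = \<zero>\<^bsub>M\<^esub>"
    using *(4) neg_eq_zero_iff gr_carrier[OF dif_gr[OF *(2)]] by simp
  then show "\<exists>w\<in>cocycles M n. \<exists>b\<in>coboundaries M n. z = b \<oplus>\<^bsub>M\<^esub> act M a w"
    using * coboundaryI[OF *(1)] by (auto simp: cocycle_iff)
next
  assume "\<exists>w\<in>cocycles M n. \<exists>b\<in>coboundaries M n. z = b \<oplus>\<^bsub>M\<^esub> act M a w"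
  then obtain w v where *: "w \<in> gr M n" "dif M w = \<zero>\<^bsub>M\<^esub>" "v \<in> gr M (n - 1)"
    "z = dif M v \<oplus>\<^bsub>M\<^esub> act M a w" by (auto elim!: coboundaryE simp: cocycle_iff)
  then have "Node z \<zero>\<^bsub>M\<^esub> = Node (dif M v \<oplus>\<^bsub>M\<^esub> act M a w) (\<ominus>\<^bsub>M\<^esub> dif M w)"
    using neg_eq_zero_iff[of "\<zero>\<^bsub>M\<^esub>"] M.zero_closed by metis
  then show "Node z \<zero>\<^bsub>M\<^esub> \<in> coboundaries K n"
    unfolding K_coboundary_iff using * by blast
qed

lemma K_coboundary_left_coboundary:
  assumes "b \<in> coboundaries M n"
  shows "Node b \<zero>\<^bsub>M\<^esub> \<in> coboundaries K n"
proof -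
  have "b = b \<oplus>\<^bsub>M\<^esub> act M a \<zero>\<^bsub>M\<^esub>" using coboundary_carrier[OF assms] a_gr by (simp add: act_zero)
  then show ?thesis
    using K_coboundary_left[OF coboundary_cocycle[OF assms]] assms cocycle_zero by blast
qed

text \<open>The projection to H^{n+1}(M) lands in the \<open>a\<close>-torsion, the left component
  \<open>x\<close> being a primitive of \<open>act M a y\<close> up to sign.\<close>

lemma K_cocycle_right:
  assumes "Node x y \<in> cocycles K n"
  shows "y \<in> cocycles M (n + 1)" "act M a y \<in> coboundaries M (n + 1)"
proof -
  have *: "x \<in> gr M n" "y \<in> cocycles M (n + 1)" "dif M x \<oplus>\<^bsub>M\<^esub> act M a y = \<zero>\<^bsub>M\<^esub>"
    using assms unfolding K_cocycle_iff by auto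
  show "y \<in> cocycles M (n + 1)" by fact
  have "dif M x \<oplus>\<^bsub>M\<^esub> act M a y \<in> coboundaries M (n + 1)" using * coboundary_zero by simp
  then show "act M a y \<in> coboundaries M (n + 1)"
    using coboundary_cancel[OF coboundaryI'[OF *(1)]] cocycle_carrier[OF cocycle_act[OF a_gr *(2)]] by simp
qed

text \<open>The projection reaches all of the \<open>a\<close>-torsion: a primitive \<open>v\<close>
  of \<open>act M a y\<close> supplies the left component, with a minus sign.\<close>

lemma K_cocycle_lift:
  assumes "y \<in> cocycles M (n + 1)" "act M a y \<in> coboundaries M (n + 1)"
  shows "\<exists>x. Node x y \<in> cocycles K n"
proof -
  obtain v where v: "v \<in> gr M (n + 1 - 1)" "act M a y = dif M v" using assms(2) by (rule coboundaryE)
  then have v': "v \<in> gr M n" by simp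
  have "Node (\<ominus>\<^bsub>M\<^esub> v) y \<in> cocycles K n"
    using assms(1) v(2) v' gr_carrier[OF dif_gr[OF v']]
    by (simp add: K_cocycle_iff gr_neg dif_neg[OF v'] M.l_neg)
  then show ?thesis by blast
qed

lemma K_coboundary_right:
  assumes "Node x y \<in> coboundaries K n"
  shows "y \<in> coboundaries M (n + 1)"
  using assms unfolding K_coboundary_iff
  by (auto intro!: coboundary_neg coboundaryI')

text \<open>Exactness at H^n(K). If \<open>w\<close> is a primitive of \<open>y\<close>, adding the
  coboundary of \<open>Node\<close> with components zero and \<open>w\<close> clears the right
  component.\<close>

lemma K_cocycle_reduce:
  assumes "Node x y \<in> cocycles K n" "y \<in> coboundaries M (n + 1)"
  shows "\<exists>z\<in>cocycles M n. \<exists>w\<in>gr M n. y = dif M w \<and> z = x \<oplus>\<^bsub>M\<^esub> act M a w \<and>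
    Node z \<zero>\<^bsub>M\<^esub> = Node (act M a w) (\<ominus>\<^bsub>M\<^esub> dif M w) \<oplus>\<^bsub>K\<^esub> Node x y \<and>
    Node (act M a w) (\<ominus>\<^bsub>M\<^esub> dif M w) \<in> coboundaries K n"
proof -
  obtain w where "w \<in> gr M (n + 1 - 1)" and yw: "y = dif M w" using assms(2) by (rule coboundaryE)
  then have w: "w \<in> gr M n" by simp
  have x: "x \<in> gr M n" "dif M x \<oplus>\<^bsub>M\<^esub> act M a y = \<zero>\<^bsub>M\<^esub>" using assms(1) unfolding K_cocycle_iff by auto
  have aw: "act M a w \<in> gr M n" using act_gr[OF a_gr w] .
  have "x \<oplus>\<^bsub>M\<^esub> act M a w \<in> cocycles M n"
    using x aw yw by (simp add: cocycle_iff gr_add dif_add[OF x(1) aw] dif_act[OF a_gr w])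
  moreover have "Node (x \<oplus>\<^bsub>M\<^esub> act M a w) \<zero>\<^bsub>M\<^esub> = Node (act M a w) (\<ominus>\<^bsub>M\<^esub> dif M w) \<oplus>\<^bsub>K\<^esub> Node x y"
    using x aw yw gr_carrier[OF dif_gr[OF w]] by (simp add: M.l_neg M.r_neg M.a_comm gr_carrier)
  moreover have "Node (act M a w) (\<ominus>\<^bsub>M\<^esub> dif M w) \<in> coboundaries K n"
    unfolding K_coboundary_iff using w aw
    by (intro bexI[of _ "\<zero>\<^bsub>M\<^esub>"] bexI[of _ w]) (auto simp: dif_zero gr_zero gr_carrier)
  ultimately show ?thesis using w yw by blast
qed

text \<open>When H^n(M) vanishes, H^n(K) is isomorphic to the \<open>a\<close>-torsion of H^{n+1}(M)
  by the long exact sequence.\<close>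

lemma K_cohomology_zero:
  assumes "cohomology_zero M n"
  shows "cohomology_zero K n \<longleftrightarrow>
    (\<forall>y\<in>cocycles M (n + 1). act M a y \<in> coboundaries M (n + 1) \<longrightarrow> y \<in> coboundaries M (n + 1))"
proof
  assume "cohomology_zero K n"
  then show "\<forall>y\<in>cocycles M (n + 1). act M a y \<in> coboundaries M (n + 1) \<longrightarrow> y \<in> coboundaries M (n + 1)"
    unfolding K.cohomology_zero_iff using K_cocycle_lift K_coboundary_right by blast
next
  assume r: "\<forall>y\<in>cocycles M (n + 1). act M a y \<in> coboundaries M (n + 1) \<longrightarrow> y \<in> coboundaries M (n + 1)"
  show "cohomology_zero K n"
    unfolding K.cohomology_zero_iff
  proof
    fix u assume "u \<in> cocycles K n"
    then obtain x y where u: "u = Node x y" "Node x y \<in> cocycles K n" by (rule K_cocycle_Node)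
    then have "y \<in> coboundaries M (n + 1)" using r K_cocycle_right[OF u(2)] by blast
    from K_cocycle_reduce[OF u(2) this] obtain z b where z: "z \<in> cocycles M n"
      "Node z \<zero>\<^bsub>M\<^esub> = b \<oplus>\<^bsub>K\<^esub> Node x y" "b \<in> coboundaries K n" by blast
    have "Node z \<zero>\<^bsub>M\<^esub> \<in> coboundaries K n"
      using z(1) assms K_coboundary_left_coboundary unfolding cohomology_zero_iff by blast
    then show "u \<in> coboundaries K n"
      using z u K.coboundary_cancel[OF z(3) K.cocycle_carrier[OF u(2)]] by metis
  qed
qed

lemma K_cohomology_zeroI:
  "cohomology_zero M n \<Longrightarrow> cohomology_zero M (n + 1) \<Longrightarrow> cohomology_zero K n"
  using K_cohomology_zero cohomology_zero_iff by blast

end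

context koszul_complex
begin

lemma K_hcls_left_cong:
  assumes "z \<in> cocycles M n" "w \<in> cocycles M n" "hcls n z = hcls n w"
  shows "K.hcls n (Node z \<zero>\<^bsub>M\<^esub>) = K.hcls n (Node w \<zero>\<^bsub>M\<^esub>)"
proof -
  obtain b where b: "b \<in> coboundaries M n" "z = b \<oplus>\<^bsub>M\<^esub> w"
    using assms hcls_eq_iff[of z w n] cocycle_carrier by blast
  have "Node z \<zero>\<^bsub>M\<^esub> = Node b \<zero>\<^bsub>M\<^esub> \<oplus>\<^bsub>K\<^esub> Node w \<zero>\<^bsub>M\<^esub>" using b by simp
  then show ?thesis
    using K.hcls_eq_iff[of "Node z \<zero>\<^bsub>M\<^esub>" "Node w \<zero>\<^bsub>M\<^esub>" n] K_coboundary_left_coboundary[OF b(1)]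
      K.cocycle_carrier[OF K_cocycle_left] assms(1,2) by blast
qed

text \<open>H^n(K) is an extension of a submodule of H^{n+1}(M) by a quotient of H^n(M), and the
  chain condition passes to such extensions.\<close>

lemma K_noetherian:
  assumes noeth: "\<And>n. noetherian_module (H0 A) (cohomology M n)"
  shows "noetherian_module (H0 A) (cohomology K n)"
proof -
  interpret H: module "H0 A" "cohomology M n" by (rule cohomology_module)
  interpret H1: module "H0 A" "cohomology M (n + 1)" by (rule cohomology_module)
  interpret HK: module "H0 A" "cohomology K n" by (rule K.cohomology_module)
  have "\<exists>n0. \<forall>k\<ge>n0. L k = L n0"
    if L: "\<forall>k. submodule (L k) (H0 A) (cohomology K n) \<and> L k \<subseteq> L (Suc k)" for L :: "nat \<Rightarrow> _"
  proof -
    have sL: "submodule (L k) (H0 A) (cohomology K n)" and Ls: "L k \<subseteq> L (Suc k)" for k using L by auto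
    note Lc = HK.submoduleD(1)[OF sL] and L0 = HK.submoduleD(2)[OF sL]
      and La = HK.submoduleD(3)[OF sL] and Lm = HK.submoduleD(4)[OF sL]
    have Lmono: "L i \<subseteq> L j" if "i \<le> j" for i j
      using that by (rule lift_Suc_mono_le[of L, OF Ls])
    \<comment> \<open>The preimage of \<open>L k\<close> in H^n(M), followed by its image in
      H^{n+1}(M). Both become stationary.\<close>
    define L1 where "L1 k = {hcls n z | z. z \<in> cocycles M n \<and> K.hcls n (Node z \<zero>\<^bsub>M\<^esub>) \<in> L k}" for k
    define L2 where "L2 k = {hcls (n + 1) y | x y. Node x y \<in> cocycles K n \<and> K.hcls n (Node x y) \<in> L k}" for k
    have K0: "Node \<zero>\<^bsub>M\<^esub> \<zero>\<^bsub>M\<^esub> \<in> cocycles K n" "K.hcls n (Node \<zero>\<^bsub>M\<^esub> \<zero>\<^bsub>M\<^esub>) \<in> L k" for k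
      using K.cocycle_zero[of n] L0[of k] by (simp_all add: K.cohomology_simps del: koszul_lift_simps(4-6))
    have K1: "u \<oplus>\<^bsub>K\<^esub> v \<in> cocycles K n" "K.hcls n (u \<oplus>\<^bsub>K\<^esub> v) \<in> L k"
      if "u \<in> cocycles K n" "v \<in> cocycles K n" "K.hcls n u \<in> L k" "K.hcls n v \<in> L k" for u v k
      using K.cocycle_add[OF that(1,2)] La[OF that(3,4)] that(1,2)
      by (simp_all add: K.cohomology_simps K.hcls_add K.cocycle_carrier del: koszul_lift_simps)
    have K2: "act K b u \<in> cocycles K n" "K.hcls n (act K b u) \<in> L k"
      if "u \<in> cocycles K n" "b \<in> gr A 0" "K.hcls n u \<in> L k" for u b k
      using K.cocycle_act[OF that(2,1)] Lm[OF A.rcls_closed[OF that(2)] that(3)] that(1,2)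
      by (simp_all add: K.hcls_act del: koszul_lift_simps)
    have "submodule (L1 k) (H0 A) (cohomology M n)" for k
      unfolding H.submodule_iff
    proof (intro conjI ballI)
      show "L1 k \<subseteq> carrier (cohomology M n)" by (auto simp: L1_def cohomology_carrier)
      show "\<zero>\<^bsub>cohomology M n\<^esub> \<in> L1 k"
        unfolding L1_def cohomology_simps using K0 cocycle_zero by blast
      fix X assume "X \<in> L1 k"
      then obtain z where z: "X = hcls n z" "z \<in> cocycles M n" "K.hcls n (Node z \<zero>\<^bsub>M\<^esub>) \<in> L k"
        unfolding L1_def by auto
      {
        fix Y assume "Y \<in> L1 k"
        then obtain w where w: "Y = hcls n w" "w \<in> cocycles M n" "K.hcls n (Node w \<zero>\<^bsub>M\<^esub>) \<in> L k"
          unfolding L1_def by auto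
        have "K.hcls n (Node (z \<oplus>\<^bsub>M\<^esub> w) \<zero>\<^bsub>M\<^esub>) \<in> L k"
          using K1(2)[OF K_cocycle_left[OF z(2)] K_cocycle_left[OF w(2)] z(3) w(3)] by simp
        then show "X \<oplus>\<^bsub>cohomology M n\<^esub> Y \<in> L1 k"
          unfolding L1_def z(1) w(1) cohomology_simps
            hcls_add[OF cocycle_carrier[OF z(2)] cocycle_carrier[OF w(2)]]
          using cocycle_add z(2) w(2) by blast
      }
      fix r assume "r \<in> carrier (H0 A)"
      then obtain b where b: "b \<in> gr A 0" "r = A.rcls b" unfolding A.H0_carrier by auto
      have "K.hcls n (Node (act M b z) \<zero>\<^bsub>M\<^esub>) \<in> L k"
        using K2(2)[OF K_cocycle_left[OF z(2)] b(1) z(3)] b(1) by (simp add: A.degree_involution_gr0 act_zero)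
      then show "r \<odot>\<^bsub>cohomology M n\<^esub> X \<in> L1 k"
        unfolding z(1) b(2) hcls_act[OF b(1) z(2)] L1_def using cocycle_act[OF b(1) z(2)] by blast
    qed
    moreover have "L1 k \<subseteq> L1 (Suc k)" for k using Ls unfolding L1_def by blast
    ultimately obtain n1 where n1: "\<And>k. k \<ge> n1 \<Longrightarrow> L1 k = L1 n1"
      using noeth[of n, unfolded noetherian_module_def, THEN conjunct2, THEN spec, of L1] by auto
    have "submodule (L2 k) (H0 A) (cohomology M (n + 1))" for k
      unfolding H1.submodule_iff
    proof (intro conjI ballI)
      show "L2 k \<subseteq> carrier (cohomology M (n + 1))"
        using K_cocycle_right(1) by (auto simp: L2_def cohomology_carrier)
      show "\<zero>\<^bsub>cohomology M (n + 1)\<^esub> \<in> L2 k"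
        unfolding L2_def cohomology_simps using K0 by blast
      fix X assume "X \<in> L2 k"
      then obtain x y where xy: "X = hcls (n + 1) y" "Node x y \<in> cocycles K n" "K.hcls n (Node x y) \<in> L k"
        unfolding L2_def by auto
      note y = K_cocycle_right(1)[OF xy(2)]
      {
        fix Y assume "Y \<in> L2 k"
        then obtain x' y' where w: "Y = hcls (n + 1) y'" "Node x' y' \<in> cocycles K n" "K.hcls n (Node x' y') \<in> L k"
          unfolding L2_def by auto
        note y' = K_cocycle_right(1)[OF w(2)]
        have "Node (x \<oplus>\<^bsub>M\<^esub> x') (y \<oplus>\<^bsub>M\<^esub> y') \<in> cocycles K n \<and> K.hcls n (Node (x \<oplus>\<^bsub>M\<^esub> x') (y \<oplus>\<^bsub>M\<^esub> y')) \<in> L k"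
          using K1[OF xy(2) w(2) xy(3) w(3)] by simp
        then show "X \<oplus>\<^bsub>cohomology M (n + 1)\<^esub> Y \<in> L2 k"
          unfolding L2_def xy(1) w(1) cohomology_simps
            hcls_add[OF cocycle_carrier[OF y] cocycle_carrier[OF y']]
          by blast
      }
      fix r assume "r \<in> carrier (H0 A)"
      then obtain b where b: "b \<in> gr A 0" "r = A.rcls b" unfolding A.H0_carrier by auto
      have "Node (act M b x) (act M b y) \<in> cocycles K n \<and> K.hcls n (Node (act M b x) (act M b y)) \<in> L k"
        using K2[OF xy(2) b(1) xy(3)] b(1) by (simp add: A.degree_involution_gr0)
      then show "r \<odot>\<^bsub>cohomology M (n + 1)\<^esub> X \<in> L2 k"
        unfolding xy(1) b(2) hcls_act[OF b(1) y] L2_def by blast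
    qed
    moreover have "L2 k \<subseteq> L2 (Suc k)" for k using Ls unfolding L2_def by blast
    ultimately obtain n2 where n2: "\<And>k. k \<ge> n2 \<Longrightarrow> L2 k = L2 n2"
      using noeth[of "n + 1", unfolded noetherian_module_def, THEN conjunct2, THEN spec, of L2] by auto
    define n0 where "n0 = max n1 n2"
    have "L k = L n0" if k: "k \<ge> n0" for k
    proof
      show "L n0 \<subseteq> L k" using Lmono k by blast
      show "L k \<subseteq> L n0"
      proof
        fix X assume X: "X \<in> L k"
        then have "X \<in> carrier (cohomology K n)" using Lc by auto
        then obtain u where "u \<in> cocycles K n" "X = K.hcls n u" unfolding K.cohomology_carrier by blast
        then obtain x y where xy: "Node x y \<in> cocycles K n" "X = K.hcls n (Node x y)"
          using K_cocycle_Node by metis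
        have "hcls (n + 1) y \<in> L2 k" using X xy unfolding L2_def by blast
        then have "hcls (n + 1) y \<in> L2 n0" using n2[of k] n2[of n0] k by (simp add: n0_def)
        then obtain x' y' where xy': "Node x' y' \<in> cocycles K n" "hcls (n + 1) y = hcls (n + 1) y'"
          "K.hcls n (Node x' y') \<in> L n0" unfolding L2_def by auto
        note yc = cocycle_carrier[OF K_cocycle_right(1)[OF xy(1)]]
        note yc' = cocycle_carrier[OF K_cocycle_right(1)[OF xy'(1)]]
        have xc: "x \<in> carrier M" "x' \<in> carrier M"
          using xy(1) xy'(1) gr_carrier unfolding K_cocycle_iff by blast+
        obtain b where b: "b \<in> coboundaries M (n + 1)" "y = b \<oplus>\<^bsub>M\<^esub> y'"
          using xy'(2) hcls_eq_iff[OF yc yc'] by blast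
        \<comment> \<open>The two cocycles have the same image in H^{n+1}(M). Hence the right
          component of their difference is a coboundary, and the class of the difference comes from
          H^n(M), where \<open>L1\<close> controls it.\<close>
        define W where "W = Node (x \<oplus>\<^bsub>M\<^esub> \<ominus>\<^bsub>M\<^esub> x') b"
        have WK: "W = Node x y \<oplus>\<^bsub>K\<^esub> \<ominus>\<^bsub>K\<^esub> Node x' y'"
          unfolding W_def K_neg[OF xc(2) yc'] using b yc' coboundary_carrier[OF b(1)]
          by (simp add: M.a_assoc M.r_neg)
        have Wz: "W \<in> cocycles K n" unfolding WK by (intro K.cocycle_add K.cocycle_neg xy xy')
        have e: "W \<oplus>\<^bsub>K\<^esub> Node x' y' = Node x y"
          unfolding W_def using xc b coboundary_carrier[OF b(1)] yc' by (simp add: M.a_assoc M.l_neg)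
        have c: "K.hcls n W \<in> carrier (cohomology K n)" "K.hcls n (Node x' y') \<in> carrier (cohomology K n)"
          using Wz xy' unfolding K.cohomology_carrier by blast+
        have Xe: "X = K.hcls n W \<oplus>\<^bsub>cohomology K n\<^esub> K.hcls n (Node x' y')"
          unfolding K.cohomology_simps
            K.hcls_add[OF K.cocycle_carrier[OF Wz] K.cocycle_carrier[OF xy'(1)]] e xy(2) ..
        have "X \<ominus>\<^bsub>cohomology K n\<^esub> K.hcls n (Node x' y') \<in> L k"
          using HK.submodule_minus[OF sL X, of "K.hcls n (Node x' y')"] xy'(3) Lmono[OF k] by auto
        moreover have "X \<ominus>\<^bsub>cohomology K n\<^esub> K.hcls n (Node x' y') = K.hcls n W"
          unfolding Xe using c by (simp add: HK.M.minus_eq HK.M.a_assoc HK.M.r_neg)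
        ultimately have WL: "K.hcls n W \<in> L k" by simp
        obtain z v where z: "z \<in> cocycles M n" "Node z \<zero>\<^bsub>M\<^esub> = v \<oplus>\<^bsub>K\<^esub> W" "v \<in> coboundaries K n"
          using K_cocycle_reduce[of "x \<oplus>\<^bsub>M\<^esub> \<ominus>\<^bsub>M\<^esub> x'" b n] Wz b(1) unfolding W_def by blast
        have Wh: "K.hcls n W = K.hcls n (Node z \<zero>\<^bsub>M\<^esub>)"
          using K.hcls_eq_iff[OF K.cocycle_carrier[OF K_cocycle_left[OF z(1)]] K.cocycle_carrier[OF Wz], of n] z(2,3)
          by blast
        then have "hcls n z \<in> L1 k" using WL z(1) unfolding L1_def by auto
        then have "hcls n z \<in> L1 n0" using n1[of k] n1[of n0] k by (simp add: n0_def)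
        then obtain z' where z': "z' \<in> cocycles M n" "hcls n z = hcls n z'" "K.hcls n (Node z' \<zero>\<^bsub>M\<^esub>) \<in> L n0"
          unfolding L1_def by auto
        then have "K.hcls n W \<in> L n0" using K_hcls_left_cong[OF z(1) z'(1,2)] Wh by simp
        then show "X \<in> L n0" unfolding Xe using La xy'(3) by blast
      qed
    qed
    then have "\<forall>k\<ge>n0. L k = L n0" by (intro allI impI)
    then show ?thesis by (rule exI)
  qed
  then show ?thesis unfolding noetherian_module_def using HK.module_axioms by simp
qed

end

section \<open>Regular elements on coherent complexes\<close>

locale local_dg_ring = dg_ring A for A :: "('a, 'b) cochain_scheme" (structure) +
  fixes m :: "'a set set"
  assumes H0_noetherian: "noetherian_ring (H0 A)" and H0_local: "local_ring (H0 A) m"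
begin

sublocale R: noetherian_local "H0 A" m
  by (intro noetherian_local.intro noetherian_cring.intro noetherian_local_axioms.intro
      H0_noetherian H0_cring H0_local)

text \<open>Bounded below and nonzero cohomology make \<open>dg_inf\<close> a true infimum; the
  chain condition gives Nakayama's lemma and the finiteness that prime avoidance needs.\<close>

definition coherent :: "('a, 'm) dg_mod \<Rightarrow> bool" where
  "coherent M \<longleftrightarrow> dg_complex A M \<and> (\<forall>n. noetherian_module (H0 A) (cohomology M n)) \<and>
     (\<exists>N. \<forall>n<N. cohomology_zero M n) \<and> (\<exists>n. \<not> cohomology_zero M n)"

lemma coherent_complex: "coherent M \<Longrightarrow> dg_complex A M" by (simp add: coherent_def)

lemma coherent_noetherian: "coherent M \<Longrightarrow> noetherian_module (H0 A) (cohomology M n)"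
  by (simp add: coherent_def)

lemma dg_inf_eqI:
  assumes "\<not> cohomology_zero M i" "\<And>j. j < i \<Longrightarrow> cohomology_zero M j"
  shows "dg_inf M = i"
  unfolding dg_inf_def using assms by (intro cInf_eq_minimum) (auto intro: leI)

lemma coherent_inf:
  assumes "coherent M"
  shows "\<not> cohomology_zero M (dg_inf M)" "j < dg_inf M \<Longrightarrow> cohomology_zero M j"
proof -
  obtain N n where N: "\<And>j. j < N \<Longrightarrow> cohomology_zero M j" and n: "\<not> cohomology_zero M n"
    using assms unfolding coherent_def by auto
  \<comment> \<open>Measuring the degree from the lower bound \<open>N\<close> turns the infimum
    into a least natural number.\<close>
  define k where "k = (LEAST k. \<not> cohomology_zero M (N + int k))"
  have "N \<le> n" using N n by (meson not_le)
  then have "\<not> cohomology_zero M (N + int (nat (n - N)))" using n by simp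
  then have k: "\<not> cohomology_zero M (N + int k)" unfolding k_def by (rule LeastI)
  have less: "cohomology_zero M j" if "j < N + int k" for j
  proof (cases "j < N")
    case False
    then have "j = N + int (nat (j - N))" "nat (j - N) < k" using that by auto
    then show ?thesis unfolding k_def using not_less_Least by metis
  qed (use N in simp)
  have "dg_inf M = N + int k" by (rule dg_inf_eqI[OF k less])
  then show "\<not> cohomology_zero M (dg_inf M)" "j < dg_inf M \<Longrightarrow> cohomology_zero M j"
    using k less by auto
qed

lemma m_rcls: "x \<in> m \<Longrightarrow> \<exists>a\<in>gr A 0. x = rcls a"
  using R.m_carrier H0_carrier by blast

text \<open>If H^n(K) were zero, the map from H^n(M) would have full kernel, so that H^n(M) is
  \<open>a\<close> times itself; Nakayama's lemma then makes it zero.\<close>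

lemma coherent_koszul_nonzero:
  assumes "coherent M" "a \<in> gr A 0" "rcls a \<in> m" "\<not> cohomology_zero M n"
  shows "\<not> cohomology_zero (koszul_lift A M a) n"
proof
  assume zero: "cohomology_zero (koszul_lift A M a) n"
  interpret koszul_complex A M a
    using assms coherent_complex by (intro koszul_complex.intro koszul_complex_axioms.intro)
  have "carrier (cohomology M n) \<subseteq> {\<zero>\<^bsub>cohomology M n\<^esub>}"
  proof (rule R.module_nakayama[OF coherent_noetherian[OF assms(1)] assms(3) order_refl])
    fix v assume "v \<in> carrier (cohomology M n)"
    then obtain z where z: "z \<in> cocycles M n" "v = hcls n z" unfolding cohomology_carrier by blast
    have "Node z \<zero>\<^bsub>M\<^esub> \<in> coboundaries K n"
      using zero K_cocycle_left[OF z(1)] unfolding K.cohomology_zero_iff by blast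
    then obtain w b where w: "w \<in> cocycles M n" "b \<in> coboundaries M n" "z = b \<oplus>\<^bsub>M\<^esub> act M a w"
      unfolding K_coboundary_left[OF z(1)] by blast
    then have "hcls n z = hcls n (act M a w)"
      using hcls_eq_iff[of z "act M a w" n] z(1) cocycle_carrier cocycle_act[OF assms(2)] by blast
    then have "v = rcls a \<odot>\<^bsub>cohomology M n\<^esub> hcls n w" using z hcls_act[OF assms(2) w(1)] by simp
    then show "\<exists>w\<in>carrier (cohomology M n). v = rcls a \<odot>\<^bsub>cohomology M n\<^esub> w"
      using w(1) unfolding cohomology_carrier by blast
  qed
  then have "cohomology_zero M n"
    using cocycle_zero[of n] unfolding cohomology_zero_def cohomology_carrier by (auto simp: cohomology_simps)
  then show False using assms by simp
qed

lemma coherent_koszul_lift: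
  assumes "coherent M" "a \<in> gr A 0" "rcls a \<in> m"
  shows "coherent (koszul_lift A M a)"
proof -
  interpret koszul_complex A M a
    using assms coherent_complex by (intro koszul_complex.intro koszul_complex_axioms.intro)
  obtain N where N: "\<And>n. n < N \<Longrightarrow> cohomology_zero M n" using assms(1) unfolding coherent_def by auto
  have "cohomology_zero K n" if "n < N - 1" for n
    using N[of n] N[of "n + 1"] that by (intro K_cohomology_zeroI) auto
  then show ?thesis
    unfolding coherent_def using K_dg_complex K_noetherian coherent_noetherian[OF assms(1)]
      coherent_koszul_nonzero[OF assms] coherent_inf(1)[OF assms(1)] by blast
qed

lemma regular_element_iff:
  assumes "coherent M" "a \<in> gr A 0" "rcls a \<in> m"
  shows "regular_element m M (rcls a) \<longleftrightarrow>
    (\<forall>z\<in>cocycles M (dg_inf M). act M a z \<in> coboundaries M (dg_inf M) \<longrightarrow> z \<in> coboundaries M (dg_inf M))"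
    (is "_ \<longleftrightarrow> ?R")
proof -
  interpret dg_complex A M using assms(1) by (rule coherent_complex)
  define i where "i = dg_inf M"
  interpret H: module "H0 A" "cohomology M i" by (rule cohomology_module)
  have r: "rcls a \<in> carrier (H0 A)" using assms rcls_closed by simp
  have "inj_on (\<lambda>y. rcls a \<odot>\<^bsub>cohomology M i\<^esub> y) (carrier (cohomology M i)) \<longleftrightarrow>
    (\<forall>y\<in>carrier (cohomology M i). rcls a \<odot>\<^bsub>cohomology M i\<^esub> y = \<zero>\<^bsub>cohomology M i\<^esub> \<longrightarrow> y = \<zero>\<^bsub>cohomology M i\<^esub>)"
    (is "?I \<longleftrightarrow> ?Z")
  proof
    assume ?I
    show ?Z
    proof (intro ballI impI)
      fix y assume "y \<in> carrier (cohomology M i)" "rcls a \<odot>\<^bsub>cohomology M i\<^esub> y = \<zero>\<^bsub>cohomology M i\<^esub>"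
      then show "y = \<zero>\<^bsub>cohomology M i\<^esub>"
        using inj_onD[OF \<open>?I\<close>, of y "\<zero>\<^bsub>cohomology M i\<^esub>"] r by simp
    qed
  next
    assume Z: ?Z
    show ?I
    proof (rule inj_onI)
      fix x y assume *: "x \<in> carrier (cohomology M i)" "y \<in> carrier (cohomology M i)"
        "rcls a \<odot>\<^bsub>cohomology M i\<^esub> x = rcls a \<odot>\<^bsub>cohomology M i\<^esub> y"
      have "rcls a \<odot>\<^bsub>cohomology M i\<^esub> (x \<ominus>\<^bsub>cohomology M i\<^esub> y) = \<zero>\<^bsub>cohomology M i\<^esub>"
        using * r by (simp add: H.M.minus_eq H.smult_r_distr H.smult_r_minus H.M.r_neg)
      then have "x \<ominus>\<^bsub>cohomology M i\<^esub> y = \<zero>\<^bsub>cohomology M i\<^esub>" using Z * by simp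
      then have "x \<oplus>\<^bsub>cohomology M i\<^esub> \<ominus>\<^bsub>cohomology M i\<^esub> y = \<zero>\<^bsub>cohomology M i\<^esub>" by (simp add: H.M.minus_eq)
      then show "x = y" using * H.M.minus_equality[of x "\<ominus>\<^bsub>cohomology M i\<^esub> y"] H.M.minus_minus[of y] by simp
    qed
  qed
  also have "?Z \<longleftrightarrow> (\<forall>z\<in>cocycles M i. act M a z \<in> coboundaries M i \<longrightarrow> z \<in> coboundaries M i)"
    unfolding cohomology_carrier using assms(2)
    by (auto simp: hcls_act hcls_eq_zero_iff cocycle_carrier cocycle_carrier[OF cocycle_act, of _ _ i])
  finally show ?thesis unfolding regular_element_def i_def[symmetric] using assms(3) by simp
qed

text \<open>One degree below the infimum, the cohomology of the Koszul complex is the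
  \<open>a\<close>-torsion of the lowest cohomology of \<open>M\<close>. In this form regularity can
  be moved along isomorphisms of iterated Koszul complexes.\<close>

lemma regular_iff_koszul_zero:
  assumes "coherent M" "a \<in> gr A 0" "rcls a \<in> m"
  shows "regular_element m M (rcls a) \<longleftrightarrow> cohomology_zero (koszul_lift A M a) (dg_inf M - 1)"
proof -
  interpret koszul_complex A M a
    using assms coherent_complex by (intro koszul_complex.intro koszul_complex_axioms.intro)
  show ?thesis
    unfolding regular_element_iff[OF assms]
    using K_cohomology_zero[of "dg_inf M - 1"] coherent_inf(2)[OF assms(1), of "dg_inf M - 1"] by simp
qed

lemma regular_koszul_inf:
  assumes "coherent M" "a \<in> gr A 0" "rcls a \<in> m" "regular_element m M (rcls a)"
  shows "dg_inf (koszul_lift A M a) = dg_inf M"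
proof (rule dg_inf_eqI)
  interpret koszul_complex A M a
    using assms coherent_complex by (intro koszul_complex.intro koszul_complex_axioms.intro)
  show "\<not> cohomology_zero K (dg_inf M)"
    by (rule coherent_koszul_nonzero[OF assms(1-3) coherent_inf(1)[OF assms(1)]])
  show "cohomology_zero K j" if "j < dg_inf M" for j
  proof (cases "j = dg_inf M - 1")
    case True
    then show ?thesis using regular_iff_koszul_zero[OF assms(1-3)] assms(4) by simp
  next
    case False
    then show ?thesis using that coherent_inf(2)[OF assms(1)] by (intro K_cohomology_zeroI) auto
  qed
qed

text \<open>The lift chosen in \<open>koszul\<close> depends on \<open>x\<close> only, so one lift
  serves all complexes \<open>M\<close>.\<close>

lemma koszul_lift_of:
  assumes "x \<in> m"
  obtains a where "a \<in> gr A 0" "x = rcls a" "\<And>M. koszul A M x = koszul_lift A M a"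
  using some_rcls[of x] assms R.m_carrier unfolding koszul_def by blast

lemma coherent_koszul: "coherent M \<Longrightarrow> x \<in> m \<Longrightarrow> coherent (koszul A M x)"
  by (metis koszul_lift_of coherent_koszul_lift)

lemma koszul_inf: "coherent M \<Longrightarrow> regular_element m M x \<Longrightarrow> dg_inf (koszul A M x) = dg_inf M"
  by (metis koszul_lift_of regular_koszul_inf regular_element_def)

text \<open>Each element of the sequence contributes one strict step, by
  \<open>associated_prime_step\<close> for the inclusion of \<open>M\<close> into its Koszul
  complex. The chain can start at any associated prime of the lowest cohomology, a freedom that
  \<open>regular_sequence_in_prime\<close> exploits.\<close>

lemma regular_sequence_chain:
  assumes "coherent M" "regular_tree_sequence A m M xs"
    and "u \<in> carrier (cohomology M (dg_inf M))" "u \<noteq> \<zero>\<^bsub>cohomology M (dg_inf M)\<^esub>"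
    and "primeideal (annihilator (H0 A) (cohomology M (dg_inf M)) u) (H0 A)"
  shows "\<exists>p. prime_chain (H0 A) p (length xs) \<and>
    p 0 = annihilator (H0 A) (cohomology M (dg_inf M)) u \<and> (\<forall>k<length xs. xs ! k \<in> p (Suc k) - p k)"
  using assms
proof (induction xs arbitrary: M u)
  case Nil
  then show ?case
    by (intro exI[of _ "\<lambda>_. annihilator (H0 A) (cohomology M (dg_inf M)) u"]) (simp add: prime_chain_def)
next
  case (Cons x xs)
  define i where "i = dg_inf M"
  have xm: "x \<in> m" and reg: "regular_element m M x" using Cons.prems(2) by (auto simp: regular_element_def)
  obtain a where a: "a \<in> gr A 0" "x = rcls a" "koszul A M x = koszul_lift A M a"
    using koszul_lift_of[OF xm] by metis
  interpret koszul_complex A M a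
    using a Cons.prems(1) coherent_complex by (intro koszul_complex.intro koszul_complex_axioms.intro)
  interpret H: module "H0 A" "cohomology M i" by (rule cohomology_module)
  have infK: "dg_inf K = i" using koszul_inf[OF Cons.prems(1) reg] a(3) by (simp add: i_def)
  \<comment> \<open>The map on lowest cohomology induced by the inclusion of \<open>M\<close> into
    \<open>K\<close>, given through a chosen cocycle in each class.\<close>
  define \<alpha> where "\<alpha> X = K.hcls i (Node (SOME z. z \<in> cocycles M i \<and> hcls i z = X) \<zero>\<^bsub>M\<^esub>)" for X
  have \<alpha>: "\<alpha> (hcls i z) = K.hcls i (Node z \<zero>\<^bsub>M\<^esub>)" if z: "z \<in> cocycles M i" for z
  proof -
    have "(SOME w. w \<in> cocycles M i \<and> hcls i w = hcls i z) \<in> cocycles M i \<and>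
        hcls i (SOME w. w \<in> cocycles M i \<and> hcls i w = hcls i z) = hcls i z"
      by (rule someI[of _ z]) (use z in simp)
    then show ?thesis unfolding \<alpha>_def using K_hcls_left_cong z by blast
  qed
  have "\<exists>u'\<in>carrier (cohomology K i). u' \<noteq> \<zero>\<^bsub>cohomology K i\<^esub> \<and>
      primeideal (annihilator (H0 A) (cohomology K i) u') (H0 A) \<and>
      annihilator (H0 A) (cohomology M i) u \<subset> annihilator (H0 A) (cohomology K i) u' \<and>
      x \<in> annihilator (H0 A) (cohomology K i) u'"
  proof (rule R.associated_prime_step[where \<alpha> = \<alpha>])
    show "noetherian_module (H0 A) (cohomology M i)" by (rule coherent_noetherian[OF Cons.prems(1)])
    show "module (H0 A) (cohomology K i)" by (rule K.cohomology_module)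
    show "x \<in> m" by fact
    show "u \<in> carrier (cohomology M i)" "u \<noteq> \<zero>\<^bsub>cohomology M i\<^esub>" using Cons.prems by (auto simp: i_def)
    fix v assume "v \<in> carrier (cohomology M i)"
    then obtain z where z: "z \<in> cocycles M i" "v = hcls i z" unfolding cohomology_carrier by blast
    show "v = \<zero>\<^bsub>cohomology M i\<^esub>" if "x \<odot>\<^bsub>cohomology M i\<^esub> v = \<zero>\<^bsub>cohomology M i\<^esub>"
      using that reg inj_onD[of "\<lambda>y. x \<odot>\<^bsub>cohomology M i\<^esub> y" "carrier (cohomology M i)" v "\<zero>\<^bsub>cohomology M i\<^esub>"]
        \<open>v \<in> _\<close> xm R.m_carrier unfolding regular_element_def i_def[symmetric] by auto
    show "\<alpha> v \<in> carrier (cohomology K i)"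
      unfolding z \<alpha>[OF z(1)] K.cohomology_carrier using K_cocycle_left[OF z(1)] by blast
    show "\<alpha> (r \<odot>\<^bsub>cohomology M i\<^esub> v) = r \<odot>\<^bsub>cohomology K i\<^esub> \<alpha> v" if r: "r \<in> carrier (H0 A)" for r
    proof -
      obtain b where b: "b \<in> gr A 0" "r = rcls b" using r unfolding H0_carrier by blast
      show ?thesis
        unfolding z b hcls_act[OF b(1) z(1)] \<alpha>[OF z(1)] \<alpha>[OF cocycle_act[OF b(1) z(1)]]
          K.hcls_act[OF b(1) K_cocycle_left[OF z(1)]]
        using b(1) by (simp add: degree_involution_gr0 act_zero)
    qed
    have "\<alpha> v = \<zero>\<^bsub>cohomology K i\<^esub> \<longleftrightarrow>
        (\<exists>w\<in>cocycles M i. \<exists>b\<in>coboundaries M i. z = b \<oplus>\<^bsub>M\<^esub> act M a w)"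
      unfolding z \<alpha>[OF z(1)] K.hcls_eq_zero_iff[OF K.cocycle_carrier[OF K_cocycle_left[OF z(1)]]]
        K_coboundary_left[OF z(1)] ..
    also have "\<dots> \<longleftrightarrow> (\<exists>w\<in>cocycles M i. hcls i z = hcls i (act M a w))"
      using hcls_eq_iff[of z "act M a _" i] z(1) cocycle_carrier cocycle_act[OF a(1)] by blast
    also have "\<dots> \<longleftrightarrow> (\<exists>w\<in>carrier (cohomology M i). v = x \<odot>\<^bsub>cohomology M i\<^esub> w)"
      unfolding cohomology_carrier z a(2) using hcls_act[OF a(1)] by auto
    finally show "\<alpha> v = \<zero>\<^bsub>cohomology K i\<^esub> \<longleftrightarrow> (\<exists>w\<in>carrier (cohomology M i). v = x \<odot>\<^bsub>cohomology M i\<^esub> w)" .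
  qed
  then obtain u' where u': "u' \<in> carrier (cohomology K i)" "u' \<noteq> \<zero>\<^bsub>cohomology K i\<^esub>"
      "primeideal (annihilator (H0 A) (cohomology K i) u') (H0 A)"
      "annihilator (H0 A) (cohomology M i) u \<subset> annihilator (H0 A) (cohomology K i) u'"
      "x \<in> annihilator (H0 A) (cohomology K i) u'" by blast
  have "coherent K" "regular_tree_sequence A m K xs"
    using coherent_koszul[OF Cons.prems(1) xm] Cons.prems(2) a(3) by simp_all
  from Cons.IH[OF this, of u', unfolded infK, OF u'(1-3)] obtain p where
    p: "prime_chain (H0 A) p (length xs)" "p 0 = annihilator (H0 A) (cohomology K i) u'"
    "\<forall>k<length xs. xs ! k \<in> p (Suc k) - p k" by blast
  define q where "q = (\<lambda>k. case k of 0 \<Rightarrow> annihilator (H0 A) (cohomology M i) u | Suc k \<Rightarrow> p k)"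
  have xu: "x \<notin> annihilator (H0 A) (cohomology M i) u"
  proof
    assume "x \<in> annihilator (H0 A) (cohomology M i) u"
    then have "x \<odot>\<^bsub>cohomology M i\<^esub> u = x \<odot>\<^bsub>cohomology M i\<^esub> \<zero>\<^bsub>cohomology M i\<^esub>"
      using xm R.m_carrier by (auto simp: annihilator_def)
    then show False
      using reg Cons.prems(3,4) inj_onD[of "\<lambda>y. x \<odot>\<^bsub>cohomology M i\<^esub> y" "carrier (cohomology M i)" u "\<zero>\<^bsub>cohomology M i\<^esub>"]
      unfolding regular_element_def i_def[symmetric] by simp
  qed
  have "prime_chain (H0 A) q (length (x # xs))"
    unfolding prime_chain_def
  proof (intro conjI allI impI)
    show "primeideal (q k) (H0 A)" if "k \<le> length (x # xs)" for k
      using that p(1) Cons.prems(5) by (cases k) (auto simp: q_def prime_chain_def i_def)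
    show "q k \<subset> q (Suc k)" if "k < length (x # xs)" for k
      using that p(1,2) u'(4) by (cases k) (auto simp: q_def prime_chain_def)
  qed
  moreover have "(x # xs) ! k \<in> q (Suc k) - q k" if "k < length (x # xs)" for k
    using that p(2,3) u'(5) xu by (cases k) (auto simp: q_def)
  moreover have "q 0 = annihilator (H0 A) (cohomology M (dg_inf M)) u" by (simp add: q_def i_def)
  ultimately show ?case by blast
qed

end

section \<open>Comparison maps\<close>

text \<open>Only degree zero is mapped, as complexes are compared over A^0. \<open>T\<close> holds
  the denominators: it is trivial for isomorphisms over one DG-ring, and the complement of a prime
  for a localization.\<close>

locale base_change = A: dg_ring A + A': dg_ring A'
  for A :: "('a, 'b) cochain_scheme" and A' :: "('c, 'd) cochain_scheme" +
  fixes \<phi> :: "'a \<Rightarrow> 'c" and T :: "'a set"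
  assumes \<phi>_gr: "a \<in> gr A 0 \<Longrightarrow> \<phi> a \<in> gr A' 0"
    and \<phi>_add: "a \<in> gr A 0 \<Longrightarrow> b \<in> gr A 0 \<Longrightarrow> \<phi> (a \<oplus>\<^bsub>A\<^esub> b) = \<phi> a \<oplus>\<^bsub>A'\<^esub> \<phi> b"
    and \<phi>_mult: "a \<in> gr A 0 \<Longrightarrow> b \<in> gr A 0 \<Longrightarrow> \<phi> (a \<otimes>\<^bsub>A\<^esub> b) = \<phi> a \<otimes>\<^bsub>A'\<^esub> \<phi> b"
    and \<phi>_one: "\<phi> \<one>\<^bsub>A\<^esub> = \<one>\<^bsub>A'\<^esub>"
    and \<phi>_coboundaries: "a \<in> coboundaries A 0 \<Longrightarrow> \<phi> a \<in> coboundaries A' 0"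
    and T_gr: "T \<subseteq> gr A 0"
    and T_one: "\<one>\<^bsub>A\<^esub> \<in> T"
    and T_mult: "s \<in> T \<Longrightarrow> t \<in> T \<Longrightarrow> s \<otimes>\<^bsub>A\<^esub> t \<in> T"

locale chain_map = base_change A A' \<phi> T + M: dg_complex A M + M': dg_complex A' M'
  for A :: "('a, 'b) cochain_scheme" and A' :: "('c, 'd) cochain_scheme" and \<phi> T
    and M :: "('a, 'm) dg_mod" and M' :: "('c, 'n) dg_mod" +
  fixes f :: "'m \<Rightarrow> 'n"
  assumes f_gr: "x \<in> gr M n \<Longrightarrow> f x \<in> gr M' n"
    and f_dif: "x \<in> gr M n \<Longrightarrow> f (dif M x) = dif M' (f x)"
    and f_add: "x \<in> gr M n \<Longrightarrow> y \<in> gr M n \<Longrightarrow> f (x \<oplus>\<^bsub>M\<^esub> y) = f x \<oplus>\<^bsub>M'\<^esub> f y"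
    and f_act: "a \<in> gr A 0 \<Longrightarrow> x \<in> gr M n \<Longrightarrow> f (act M a x) = act M' (\<phi> a) (f x)"
begin

lemma T_gr0: "t \<in> T \<Longrightarrow> t \<in> gr A 0" using T_gr by auto

lemma f_zero: "f \<zero>\<^bsub>M\<^esub> = \<zero>\<^bsub>M'\<^esub>"
proof -
  have "f \<zero>\<^bsub>M\<^esub> \<in> carrier M'" using f_gr[OF M.gr_zero[of 0]] M'.gr_carrier by blast
  moreover have "f \<zero>\<^bsub>M\<^esub> \<oplus>\<^bsub>M'\<^esub> f \<zero>\<^bsub>M\<^esub> = f \<zero>\<^bsub>M\<^esub>" using f_add[OF M.gr_zero M.gr_zero] by simp
  ultimately show ?thesis by simp
qed

lemma f_neg: "x \<in> gr M n \<Longrightarrow> f (\<ominus>\<^bsub>M\<^esub> x) = \<ominus>\<^bsub>M'\<^esub> f x"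
proof -
  assume x: "x \<in> gr M n"
  have c: "f (\<ominus>\<^bsub>M\<^esub> x) \<in> carrier M'" "f x \<in> carrier M'"
    using f_gr M'.gr_carrier M.gr_neg x by blast+
  have "f (\<ominus>\<^bsub>M\<^esub> x) \<oplus>\<^bsub>M'\<^esub> f x = \<zero>\<^bsub>M'\<^esub>"
    using f_add[OF M.gr_neg[OF x] x] M.gr_carrier[OF x] by (simp add: M.M.l_neg f_zero)
  then show ?thesis using c by (metis M'.M.minus_equality)
qed

lemma f_cocycle: "z \<in> cocycles M n \<Longrightarrow> f z \<in> cocycles M' n"
  using f_gr f_dif f_zero unfolding M.cocycle_iff M'.cocycle_iff by metis

lemma f_coboundary: "b \<in> coboundaries M n \<Longrightarrow> f b \<in> coboundaries M' n"
  using f_gr f_dif M'.coboundaryI by (metis M.coboundaryE)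

end

text \<open>
  A comparison map identifies the cohomology of \<open>M'\<close> with the localization of the cohomology of
  \<open>M\<close> at the multiplicative set \<open>T\<close>.
\<close>

locale comparison_map = chain_map +
  assumes f_inj: "z \<in> cocycles M n \<Longrightarrow> f z \<in> coboundaries M' n \<Longrightarrow> \<exists>t\<in>T. act M t z \<in> coboundaries M n"
    and f_surj: "z' \<in> cocycles M' n \<Longrightarrow> \<exists>t\<in>T. \<exists>z\<in>cocycles M n. \<exists>b\<in>coboundaries M' n.
      f z = b \<oplus>\<^bsub>M'\<^esub> act M' (\<phi> t) z'"

text \<open>The cancellations in the diagram chases of \<open>koszul_comparison\<close>: in the
  first identity \<open>q\<close> occurs with both signs, in the second \<open>p\<close>
  does.\<close>

lemma (in abelian_group) minus_cancel_lemmas: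
  assumes "p \<in> carrier G" "q \<in> carrier G" "u \<in> carrier G" "v \<in> carrier G"
  shows "(u \<oplus> q) \<oplus> \<ominus> (v \<oplus> (p \<oplus> q)) = u \<oplus> \<ominus> (v \<oplus> p)"
    and "(p \<oplus> \<ominus> (u \<oplus> (v \<oplus> (p \<oplus> \<ominus> q)))) = \<ominus> (u \<oplus> v) \<oplus> q"
proof -
  have "(u \<oplus> q) \<oplus> (x \<oplus> \<ominus> q) = (u \<oplus> x) \<oplus> (q \<oplus> \<ominus> q)" if "x \<in> carrier G" for x
    using assms that by (simp add: a_ac)
  then have "(u \<oplus> q) \<oplus> (\<ominus> (v \<oplus> p) \<oplus> \<ominus> q) = u \<oplus> \<ominus> (v \<oplus> p)"
    using assms by (simp add: r_neg)
  moreover have "\<ominus> (v \<oplus> (p \<oplus> q)) = \<ominus> (v \<oplus> p) \<oplus> \<ominus> q"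
    using assms by (simp add: minus_add a_ac)
  ultimately show "(u \<oplus> q) \<oplus> \<ominus> (v \<oplus> (p \<oplus> q)) = u \<oplus> \<ominus> (v \<oplus> p)" by simp
  have "p \<oplus> (y \<oplus> \<ominus> p) = y \<oplus> (p \<oplus> \<ominus> p)" if "y \<in> carrier G" for y
    using assms that by (simp add: a_ac)
  then have "p \<oplus> ((\<ominus> (u \<oplus> v) \<oplus> q) \<oplus> \<ominus> p) = \<ominus> (u \<oplus> v) \<oplus> q"
    using assms by (simp add: r_neg)
  moreover have "\<ominus> (u \<oplus> (v \<oplus> (p \<oplus> \<ominus> q))) = (\<ominus> (u \<oplus> v) \<oplus> q) \<oplus> \<ominus> p"
    using assms by (simp add: minus_add a_ac)
  ultimately show "(p \<oplus> \<ominus> (u \<oplus> (v \<oplus> (p \<oplus> \<ominus> q)))) = \<ominus> (u \<oplus> v) \<oplus> q" by simp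
qed

text \<open>
  A lift \<open>a'\<close> of the class of \<open>\<phi> a\<close> differs from \<open>\<phi> a\<close> by a coboundary, and the correction term of
  the map between the Koszul complexes is a null-homotopy of the action of that coboundary.
\<close>

lemma koszul_comparison:
  fixes M :: "('a, 'm tree) dg_mod" and M' :: "('c, 'n tree) dg_mod"
  assumes "comparison_map A A' \<phi> T M M' f"
    and a: "a \<in> gr A 0" and a': "a' \<in> gr A' 0" and cls: "dg_ring.rcls A' a' = dg_ring.rcls A' (\<phi> a)"
  shows "\<exists>g. comparison_map A A' \<phi> T (koszul_lift A M a) (koszul_lift A' M' a') g"
proof -
  interpret F: comparison_map A A' \<phi> T M M' f by fact
  interpret K: koszul_complex A M a
    by (intro koszul_complex.intro koszul_complex_axioms.intro F.M.dg_complex_axioms a)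
  interpret K': koszul_complex A' M' a'
    by (intro koszul_complex.intro koszul_complex_axioms.intro F.M'.dg_complex_axioms a')
  let ?K = "koszul_lift A M a" and ?K' = "koszul_lift A' M' a'"
  have \<phi>a: "\<phi> a \<in> gr A' 0" using F.\<phi>_gr a .
  obtain c where c: "c \<in> gr A' (-1)" "\<phi> a = dif A' c \<oplus>\<^bsub>A'\<^esub> a'"
    using F.A'.rcls_eq_iff[OF \<phi>a a'] cls by auto
  have dc: "dif A' c \<in> gr A' 0" using F.A'.dif_gr[OF c(1)] by simp
  obtain h where h: "null_homotopy A' M' (dif A' c) h" using F.M'.null_homotopic[OF c(1)] by blast
  have hg: "h x \<in> gr M' (n - 1)" and hd: "dif M' (h x) \<oplus>\<^bsub>M'\<^esub> h (dif M' x) = act M' (dif A' c) x"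
    and hadd: "y \<in> gr M' n \<Longrightarrow> h (x \<oplus>\<^bsub>M'\<^esub> y) = h x \<oplus>\<^bsub>M'\<^esub> h y"
    and hact: "b \<in> gr A' 0 \<Longrightarrow> h (act M' b x) = act M' b (h x)" if "x \<in> gr M' n" for n x y b
    using h that unfolding null_homotopy_def by blast+
  have h0: "h \<zero>\<^bsub>M'\<^esub> = \<zero>\<^bsub>M'\<^esub>"
  proof -
    have "h \<zero>\<^bsub>M'\<^esub> \<in> carrier M'" using hg[OF F.M'.gr_zero[of 0]] F.M'.gr_carrier by blast
    moreover have "h \<zero>\<^bsub>M'\<^esub> \<oplus>\<^bsub>M'\<^esub> h \<zero>\<^bsub>M'\<^esub> = h \<zero>\<^bsub>M'\<^esub>" using hadd[OF F.M'.gr_zero F.M'.gr_zero] by simp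
    ultimately show ?thesis by simp
  qed
  have hneg: "h (\<ominus>\<^bsub>M'\<^esub> x) = \<ominus>\<^bsub>M'\<^esub> h x" if x: "x \<in> gr M' n" for x n
  proof -
    have "h (\<ominus>\<^bsub>M'\<^esub> x) \<oplus>\<^bsub>M'\<^esub> h x = \<zero>\<^bsub>M'\<^esub>"
      using hadd[OF F.M'.gr_neg[OF x] x] F.M'.gr_carrier[OF x] by (simp add: F.M'.M.l_neg h0)
    moreover have "h (\<ominus>\<^bsub>M'\<^esub> x) \<in> carrier M'" "h x \<in> carrier M'"
      using hg F.M'.gr_neg x F.M'.gr_carrier by blast+
    ultimately show ?thesis by (metis F.M'.M.minus_equality)
  qed
  define g where "g u = Node (f (left u) \<oplus>\<^bsub>M'\<^esub> h (f (right u))) (f (right u))" for u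
  have chain: "chain_map A A' \<phi> T ?K ?K' g"
  proof (intro chain_map.intro chain_map_axioms.intro F.base_change_axioms K.K_dg_complex K'.K_dg_complex)
    fix n x assume "x \<in> gr ?K n"
    then obtain u v where x: "x = Node u v" "u \<in> gr M n" "v \<in> gr M (n + 1)" by auto
    have fu: "f u \<in> gr M' n" and fv: "f v \<in> gr M' (n + 1)" using F.f_gr x by auto
    have hv: "h (f v) \<in> gr M' n" using hg[OF fv] by simp
    show "g x \<in> gr ?K' n" using x fu fv hv by (auto simp: g_def intro: F.M'.gr_add)
    show "g (dif ?K x) = dif ?K' (g x)"
    proof -
      have gd: "dif M u \<in> gr M (n + 1)" "act M a v \<in> gr M (n + 1)" "dif M v \<in> gr M (n + 1 + 1)"
        using F.M.dif_gr[OF x(2)] F.M.act_gr[OF a x(3)] F.M.dif_gr[OF x(3)] by simp_all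
      have gd': "dif M' (f v) \<in> gr M' (n + 1 + 1)" using F.M'.dif_gr[OF fv] .
      have "act M' (\<phi> a) (f v) = (dif M' (h (f v)) \<oplus>\<^bsub>M'\<^esub> h (dif M' (f v))) \<oplus>\<^bsub>M'\<^esub> act M' a' (f v)"
        unfolding hd[OF fv] c(2) by (rule F.M'.add_act[OF dc a' fv])
      moreover have "dif M' (f u) \<in> carrier M'" "dif M' (h (f v)) \<in> carrier M'" "act M' a' (f v) \<in> carrier M'"
          "h (dif M' (f v)) \<in> carrier M'"
        using F.M'.dif_gr[OF fu] F.M'.dif_gr[OF hv] F.M'.act_gr[OF a' fv] hg[OF gd'] F.M'.gr_carrier by blast+
      ultimately have "(dif M' (f u) \<oplus>\<^bsub>M'\<^esub> act M' (\<phi> a) (f v)) \<oplus>\<^bsub>M'\<^esub> \<ominus>\<^bsub>M'\<^esub> h (dif M' (f v)) =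
          (dif M' (f u) \<oplus>\<^bsub>M'\<^esub> dif M' (h (f v))) \<oplus>\<^bsub>M'\<^esub> act M' a' (f v)"
        by (simp add: F.M'.M.a_ac F.M'.M.r_neg F.M'.M.r_neg1 F.M'.M.r_neg2)
      then show ?thesis
        unfolding x(1) g_def
        by (simp add: F.f_add[OF gd(1,2)] F.f_dif[OF x(2)] F.f_act[OF a x(3)] F.f_neg[OF gd(3)]
            F.f_dif[OF x(3)] hneg[OF gd'] F.M'.dif_add[OF fu hv])
    qed
    show "g (x \<oplus>\<^bsub>?K\<^esub> y) = g x \<oplus>\<^bsub>?K'\<^esub> g y" if y: "y \<in> gr ?K n" for y
    proof -
      from y obtain u' v' where y: "y = Node u' v'" "u' \<in> gr M n" "v' \<in> gr M (n + 1)" by auto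
      have fu': "f u' \<in> gr M' n" and fv': "f v' \<in> gr M' (n + 1)" using F.f_gr y by auto
      have "f u \<in> carrier M'" "f u' \<in> carrier M'" "h (f v) \<in> carrier M'" "h (f v') \<in> carrier M'"
        using fu fu' hv hg[OF fv'] F.M'.gr_carrier by blast+
      then show ?thesis
        unfolding x(1) y(1) g_def
        by (simp add: F.f_add[OF x(2) y(2)] F.f_add[OF x(3) y(3)] hadd[OF fv fv'] F.M'.M.a_ac)
    qed
    show "g (act ?K b x) = act ?K' (\<phi> b) (g x)" if b: "b \<in> gr A 0" for b
      unfolding x(1) g_def using b F.\<phi>_gr[OF b]
      by (simp add: F.A.degree_involution_gr0 F.A'.degree_involution_gr0 F.f_act[OF b x(2)] F.f_act[OF b x(3)]
          hact[OF fv] F.M'.act_add[OF _ fu hv])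
  qed
  interpret G: chain_map A A' \<phi> T ?K ?K' g by (rule chain)
  have gNode: "g (Node z \<zero>\<^bsub>M\<^esub>) = Node (f z) \<zero>\<^bsub>M'\<^esub>" if "z \<in> cocycles M n" for z n
    using F.M'.cocycle_carrier[OF F.f_cocycle[OF that]] by (simp add: g_def F.f_zero h0)
  have inj: "\<exists>t\<in>T. act ?K t u \<in> coboundaries ?K n"
    if u: "u \<in> cocycles ?K n" and gu: "g u \<in> coboundaries ?K' n" for u n
  proof -
    from u obtain x y where ux: "u = Node x y" and xy: "Node x y \<in> cocycles ?K n" by (rule K.K_cocycle_Node)
    note y = K.K_cocycle_right(1)[OF xy]
    \<comment> \<open>A chase as in the five lemma, with one denominator per step: \<open>t1\<close>
      turns the right component into a coboundary, \<open>t2\<close> lifts the witness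
      \<open>w'\<close> from \<open>M'\<close> to \<open>M\<close>, and \<open>t3\<close> kills the
      remaining difference.\<close>
    have "f y \<in> coboundaries M' (n + 1)"
      using gu K'.K_coboundary_right unfolding ux g_def by simp
    then obtain t1 where t1: "t1 \<in> T" "act M t1 y \<in> coboundaries M (n + 1)" using F.f_inj[OF y] by blast
    note t1g = F.T_gr0[OF t1(1)]
    have u1: "act ?K t1 u = Node (act M t1 x) (act M t1 y)"
      using ux t1g by (simp add: F.A.degree_involution_gr0)
    have u1z: "act ?K t1 u \<in> cocycles ?K n" by (rule K.K.cocycle_act[OF t1g u])
    obtain z b where z: "z \<in> cocycles M n" "b \<in> coboundaries ?K n" "Node z \<zero>\<^bsub>M\<^esub> = b \<oplus>\<^bsub>?K\<^esub> act ?K t1 u"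
      using K.K_cocycle_reduce[of "act M t1 x" "act M t1 y" n] u1z t1(2) unfolding u1 by blast
    have "Node (f z) \<zero>\<^bsub>M'\<^esub> = g b \<oplus>\<^bsub>?K'\<^esub> act ?K' (\<phi> t1) (g u)"
      unfolding gNode[OF z(1), symmetric] z(3)
      using G.f_add[OF K.K.cocycle_gr[OF K.K.coboundary_cocycle[OF z(2)]] K.K.cocycle_gr[OF u1z]]
        G.f_act[OF t1g K.K.cocycle_gr[OF u]] by simp
    then have "Node (f z) \<zero>\<^bsub>M'\<^esub> \<in> coboundaries ?K' n"
      using K'.K.coboundary_add[OF G.f_coboundary[OF z(2)] K'.K.coboundary_act[OF F.\<phi>_gr[OF t1g] gu]] by simp
    then obtain w' b' where w': "w' \<in> cocycles M' n" "b' \<in> coboundaries M' n" "f z = b' \<oplus>\<^bsub>M'\<^esub> act M' a' w'"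
      unfolding K'.K_coboundary_left[OF F.f_cocycle[OF z(1)]] by blast
    obtain t2 w b'' where t2: "t2 \<in> T" and w: "w \<in> cocycles M n" and b'': "b'' \<in> coboundaries M' n"
      and fw: "f w = b'' \<oplus>\<^bsub>M'\<^esub> act M' (\<phi> t2) w'" using F.f_surj[OF w'(1)] by blast
    note t2g = F.T_gr0[OF t2]
    note \<phi>t2 = F.\<phi>_gr[OF t2g]
    obtain e where e: "e \<in> coboundaries M' n" "act M' (\<phi> a) (f w) = e \<oplus>\<^bsub>M'\<^esub> act M' a' (f w)"
      using F.M'.act_rcls[OF \<phi>a a' cls[symmetric] F.f_cocycle[OF w]] by blast
    \<comment> \<open>The only summand of the image of \<open>t2\<close> times \<open>z\<close>
      minus \<open>a\<close> times \<open>w\<close> that is not visibly a coboundary. It occurs with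
      both signs.\<close>
    define Q where "Q = act M' (\<phi> t2) (act M' a' w')"
    note gb = F.M'.cocycle_gr[OF F.M'.coboundary_cocycle]
    have w'g: "w' \<in> gr M' n" "act M' a' w' \<in> gr M' n" "act M' (\<phi> t2) w' \<in> gr M' n"
      using F.M'.cocycle_gr[OF w'(1)] F.M'.act_gr a' \<phi>t2 by auto
    have "act M' (\<phi> t2) (f z) = act M' (\<phi> t2) b' \<oplus>\<^bsub>M'\<^esub> Q"
      unfolding w'(3) Q_def by (rule F.M'.act_add[OF \<phi>t2 gb[OF w'(2)] w'g(2)])
    moreover have "act M' a' (f w) = act M' a' b'' \<oplus>\<^bsub>M'\<^esub> Q"
      unfolding fw Q_def F.M'.act_act_comm[OF \<phi>t2 a' w'g(1)] by (rule F.M'.act_add[OF a' gb[OF b''] w'g(3)])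
    ultimately have "f (act M t2 z \<oplus>\<^bsub>M\<^esub> \<ominus>\<^bsub>M\<^esub> act M a w) =
        (act M' (\<phi> t2) b' \<oplus>\<^bsub>M'\<^esub> Q) \<oplus>\<^bsub>M'\<^esub> \<ominus>\<^bsub>M'\<^esub> (e \<oplus>\<^bsub>M'\<^esub> (act M' a' b'' \<oplus>\<^bsub>M'\<^esub> Q))"
      using F.f_add[OF F.M.act_gr[OF t2g F.M.cocycle_gr[OF z(1)]] F.M.gr_neg[OF F.M.act_gr[OF a F.M.cocycle_gr[OF w]]]]
        F.f_neg[OF F.M.act_gr[OF a F.M.cocycle_gr[OF w]]] F.f_act[OF t2g F.M.cocycle_gr[OF z(1)]]
        F.f_act[OF a F.M.cocycle_gr[OF w]] e(2) by simp
    also have "\<dots> = act M' (\<phi> t2) b' \<oplus>\<^bsub>M'\<^esub> \<ominus>\<^bsub>M'\<^esub> (e \<oplus>\<^bsub>M'\<^esub> act M' a' b'')"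
    proof (rule F.M'.M.minus_cancel_lemmas(1))
      show "Q \<in> carrier M'" unfolding Q_def using F.M'.act_gr[OF \<phi>t2 w'g(2)] F.M'.gr_carrier by blast
    qed (use F.M'.coboundary_carrier F.M'.coboundary_act \<phi>t2 a' w'(2) b'' e(1) in blast)+
    also have "\<dots> \<in> coboundaries M' n"
      by (intro F.M'.coboundary_add F.M'.coboundary_neg F.M'.coboundary_act \<phi>t2 a' w'(2) b'' e(1))
    finally have in': "f (act M t2 z \<oplus>\<^bsub>M\<^esub> \<ominus>\<^bsub>M\<^esub> act M a w) \<in> coboundaries M' n" .
    have tz: "act M t2 z \<in> cocycles M n" "act M a w \<in> cocycles M n"
      using F.M.cocycle_act t2g z(1) a w by auto
    obtain t3 where t3: "t3 \<in> T" "act M t3 (act M t2 z \<oplus>\<^bsub>M\<^esub> \<ominus>\<^bsub>M\<^esub> act M a w) \<in> coboundaries M n"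
      using F.f_inj[OF F.M.cocycle_add[OF tz(1) F.M.cocycle_neg[OF tz(2)]] in'] by blast
    note t3g = F.T_gr0[OF t3(1)]
    define B where "B = act M t3 (act M t2 z \<oplus>\<^bsub>M\<^esub> \<ominus>\<^bsub>M\<^esub> act M a w)"
    have tz3: "act M t3 (act M t2 z) \<in> cocycles M n" "act M t3 (act M a w) \<in> cocycles M n" "act M t3 w \<in> cocycles M n"
      using F.M.cocycle_act[OF t3g] tz w by auto
    have "B = act M t3 (act M t2 z) \<oplus>\<^bsub>M\<^esub> \<ominus>\<^bsub>M\<^esub> act M t3 (act M a w)"
      unfolding B_def using F.M.act_add[OF t3g F.M.cocycle_gr[OF tz(1)] F.M.gr_neg[OF F.M.cocycle_gr[OF tz(2)]]]
        F.M.act_neg[OF t3g F.M.cocycle_gr[OF tz(2)]] by simp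
    then have "act M t3 (act M t2 z) = B \<oplus>\<^bsub>M\<^esub> act M t3 (act M a w)"
      using F.M.cocycle_carrier[OF tz3(1)] F.M.cocycle_carrier[OF tz3(2)] by (simp add: F.M.M.a_assoc F.M.M.l_neg)
    then have "act M t3 (act M t2 z) = B \<oplus>\<^bsub>M\<^esub> act M a (act M t3 w)"
      using F.M.act_act_comm[OF t3g a F.M.cocycle_gr[OF w]] by simp
    then have "Node (act M t3 (act M t2 z)) \<zero>\<^bsub>M\<^esub> \<in> coboundaries ?K n"
      unfolding K.K_coboundary_left[OF tz3(1)] using t3(2) tz3(3) unfolding B_def[symmetric] by blast
    moreover have "Node (act M t3 (act M t2 z)) \<zero>\<^bsub>M\<^esub> = act ?K (t3 \<otimes>\<^bsub>A\<^esub> t2) (Node z \<zero>\<^bsub>M\<^esub>)"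
      using F.A.gr0_mult[OF t3g t2g] F.M.mult_act[OF t3g t2g F.M.cocycle_gr[OF z(1)]]
      by (simp add: F.A.degree_involution_gr0 F.M.act_zero)
    moreover have t32: "t3 \<otimes>\<^bsub>A\<^esub> t2 \<in> gr A 0" using F.A.gr0_mult[OF t3g t2g] .
    moreover have "act ?K (t3 \<otimes>\<^bsub>A\<^esub> t2) (Node z \<zero>\<^bsub>M\<^esub>) =
        act ?K (t3 \<otimes>\<^bsub>A\<^esub> t2) b \<oplus>\<^bsub>?K\<^esub> act ?K (t3 \<otimes>\<^bsub>A\<^esub> t2) (act ?K t1 u)"
      unfolding z(3) by (rule K.K.act_add[OF t32 K.K.cocycle_gr[OF K.K.coboundary_cocycle[OF z(2)]] K.K.cocycle_gr[OF u1z]])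
    ultimately have "act ?K (t3 \<otimes>\<^bsub>A\<^esub> t2) b \<oplus>\<^bsub>?K\<^esub> act ?K (t3 \<otimes>\<^bsub>A\<^esub> t2) (act ?K t1 u) \<in> coboundaries ?K n" by metis
    then have "act ?K (t3 \<otimes>\<^bsub>A\<^esub> t2) (act ?K t1 u) \<in> coboundaries ?K n"
      using K.K.coboundary_cancel[OF K.K.coboundary_act[OF t32 z(2)] K.K.cocycle_carrier[OF K.K.cocycle_act[OF t32 u1z]]]
      by blast
    then have "act ?K ((t3 \<otimes>\<^bsub>A\<^esub> t2) \<otimes>\<^bsub>A\<^esub> t1) u \<in> coboundaries ?K n"
      using K.K.mult_act[OF t32 t1g K.K.cocycle_gr[OF u]] by metis
    then show ?thesis using F.T_mult[OF F.T_mult[OF t3(1) t2] t1(1)] by blast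
  qed
  have surj: "\<exists>t\<in>T. \<exists>w\<in>cocycles ?K n. \<exists>b\<in>coboundaries ?K' n. g w = b \<oplus>\<^bsub>?K'\<^esub> act ?K' (\<phi> t) u'"
    if u': "u' \<in> cocycles ?K' n" for u' n
  proof -
    from u' obtain x' y' where ux: "u' = Node x' y'" and xy: "Node x' y' \<in> cocycles ?K' n" by (rule K'.K_cocycle_Node)
    note y' = K'.K_cocycle_right[OF xy]
    obtain t1 y b1 where t1: "t1 \<in> T" and y: "y \<in> cocycles M (n + 1)" and b1: "b1 \<in> coboundaries M' (n + 1)"
      and fy: "f y = b1 \<oplus>\<^bsub>M'\<^esub> act M' (\<phi> t1) y'" using F.f_surj[OF y'(1)] by blast
    note t1g = F.T_gr0[OF t1]
    note \<phi>t1 = F.\<phi>_gr[OF t1g]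
    note gb = F.M'.cocycle_gr[OF F.M'.coboundary_cocycle]
    obtain e where e: "e \<in> coboundaries M' (n + 1)" "act M' (\<phi> a) (f y) = e \<oplus>\<^bsub>M'\<^esub> act M' a' (f y)"
      using F.M'.act_rcls[OF \<phi>a a' cls[symmetric] F.f_cocycle[OF y]] by blast
    have "act M' a' (f y) = act M' a' b1 \<oplus>\<^bsub>M'\<^esub> act M' (\<phi> t1) (act M' a' y')"
      unfolding fy F.M'.act_act_comm[OF \<phi>t1 a' F.M'.cocycle_gr[OF y'(1)]]
      by (rule F.M'.act_add[OF a' gb[OF b1] F.M'.act_gr[OF \<phi>t1 F.M'.cocycle_gr[OF y'(1)]]])
    then have "f (act M a y) \<in> coboundaries M' (n + 1)"
      using e F.f_act[OF a F.M.cocycle_gr[OF y]]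
        F.M'.coboundary_add[OF e(1) F.M'.coboundary_add[OF F.M'.coboundary_act[OF a' b1] F.M'.coboundary_act[OF \<phi>t1 y'(2)]]]
      by simp
    \<comment> \<open>\<open>a\<close> times \<open>y\<close> need not be a coboundary, but its
      image under \<open>f\<close> is. A further denominator repairs this, and then
      \<open>y2\<close> can be completed to a cocycle of the Koszul complex.\<close>
    then obtain t2 where t2: "t2 \<in> T" "act M t2 (act M a y) \<in> coboundaries M (n + 1)"
      using F.f_inj[OF F.M.cocycle_act[OF a y]] by blast
    note t2g = F.T_gr0[OF t2(1)]
    note \<phi>t2 = F.\<phi>_gr[OF t2g]
    define y2 where "y2 = act M t2 y"
    have y2: "y2 \<in> cocycles M (n + 1)" unfolding y2_def by (rule F.M.cocycle_act[OF t2g y])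
    have "act M a y2 \<in> coboundaries M (n + 1)"
      unfolding y2_def using t2(2) F.M.act_act_comm[OF a t2g F.M.cocycle_gr[OF y]] by simp
    then obtain x where x: "Node x y2 \<in> cocycles ?K n" using K.K_cocycle_lift[OF y2] by blast
    define G where "G = g (Node x y2)"
    have Gz: "G \<in> cocycles ?K' n" unfolding G_def by (rule G.f_cocycle[OF x])
    define s where "s = t2 \<otimes>\<^bsub>A\<^esub> t1"
    have sT: "s \<in> T" unfolding s_def by (rule F.T_mult[OF t2(1) t1])
    note sg = F.T_gr0[OF sT]
    note \<phi>s = F.\<phi>_gr[OF sg]
    define X where "X = act ?K' (\<phi> s) u'"
    have Xz: "X \<in> cocycles ?K' n" unfolding X_def by (rule K'.K.cocycle_act[OF \<phi>s u'])
    have Xe: "X = Node (act M' (\<phi> s) x') (act M' (\<phi> s) y')"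
      unfolding X_def ux using \<phi>s by (simp add: F.A'.degree_involution_gr0)
    have fy2: "f y2 = act M' (\<phi> t2) b1 \<oplus>\<^bsub>M'\<^esub> act M' (\<phi> s) y'"
      unfolding y2_def s_def F.f_act[OF t2g F.M.cocycle_gr[OF y]] fy F.\<phi>_mult[OF t2g t1g]
        F.M'.mult_act[OF \<phi>t2 \<phi>t1 F.M'.cocycle_gr[OF y'(1)]]
      by (rule F.M'.act_add[OF \<phi>t2 gb[OF b1] F.M'.act_gr[OF \<phi>t1 F.M'.cocycle_gr[OF y'(1)]]])
    \<comment> \<open>The right components of \<open>G\<close> and \<open>X\<close> agree up to a
      coboundary. So the error \<open>V\<close> comes from a cocycle of \<open>M'\<close>, which is
      lifted in turn and subtracted.\<close>
    define V where "V = G \<oplus>\<^bsub>?K'\<^esub> \<ominus>\<^bsub>?K'\<^esub> X"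
    have Vz: "V \<in> cocycles ?K' n" unfolding V_def by (rule K'.K.cocycle_add[OF Gz K'.K.cocycle_neg[OF Xz]])
    from Vz obtain v1 v2 where V: "V = Node v1 v2" and Vn: "Node v1 v2 \<in> cocycles ?K' n" by (rule K'.K_cocycle_Node)
    have cc: "act M' (\<phi> s) x' \<in> carrier M'" "act M' (\<phi> s) y' \<in> carrier M'"
      using K'.K.cocycle_carrier[OF Xz] unfolding Xe by auto
    have "v2 = f y2 \<oplus>\<^bsub>M'\<^esub> \<ominus>\<^bsub>M'\<^esub> act M' (\<phi> s) y'"
      using V unfolding V_def G_def g_def Xe K'.K_neg[OF cc] by simp
    also have "\<dots> = act M' (\<phi> t2) b1"
      unfolding fy2 using cc F.M'.coboundary_carrier[OF F.M'.coboundary_act[OF \<phi>t2 b1]]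
      by (simp add: F.M'.M.a_assoc F.M'.M.r_neg)
    finally have "v2 \<in> coboundaries M' (n + 1)" using F.M'.coboundary_act[OF \<phi>t2 b1] by simp
    then obtain z' b2 where z': "z' \<in> cocycles M' n" "b2 \<in> coboundaries ?K' n" "Node z' \<zero>\<^bsub>M'\<^esub> = b2 \<oplus>\<^bsub>?K'\<^esub> V"
      using K'.K_cocycle_reduce[OF Vn] unfolding V by blast
    obtain t3 z b3 where t3: "t3 \<in> T" and z: "z \<in> cocycles M n" and b3: "b3 \<in> coboundaries M' n"
      and fz: "f z = b3 \<oplus>\<^bsub>M'\<^esub> act M' (\<phi> t3) z'" using F.f_surj[OF z'(1)] by blast
    note t3g = F.T_gr0[OF t3]
    note \<phi>t3 = F.\<phi>_gr[OF t3g]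
    define w where "w = act ?K t3 (Node x y2) \<oplus>\<^bsub>?K\<^esub> \<ominus>\<^bsub>?K\<^esub> Node z \<zero>\<^bsub>M\<^esub>"
    note tx = K.K.cocycle_act[OF t3g x]
    note zK = K.K_cocycle_left[OF z]
    have wz: "w \<in> cocycles ?K n" unfolding w_def by (rule K.K.cocycle_add[OF tx K.K.cocycle_neg[OF zK]])
    define U where "U = Node b3 \<zero>\<^bsub>M'\<^esub>"
    have Ub: "U \<in> coboundaries ?K' n" unfolding U_def by (rule K'.K_coboundary_left_coboundary[OF b3])
    have "g w = act ?K' (\<phi> t3) G \<oplus>\<^bsub>?K'\<^esub> \<ominus>\<^bsub>?K'\<^esub> Node (f z) \<zero>\<^bsub>M'\<^esub>"
      unfolding w_def G_def
        G.f_add[OF K.K.cocycle_gr[OF tx] K.K.gr_neg[OF K.K.cocycle_gr[OF zK]]]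
        G.f_neg[OF K.K.cocycle_gr[OF zK]] G.f_act[OF t3g K.K.cocycle_gr[OF x]] gNode[OF z] ..
    also have "Node (f z) \<zero>\<^bsub>M'\<^esub> = U \<oplus>\<^bsub>?K'\<^esub> act ?K' (\<phi> t3) (Node z' \<zero>\<^bsub>M'\<^esub>)"
      unfolding U_def fz using \<phi>t3 by (simp add: F.A'.degree_involution_gr0 F.M'.act_zero)
    also have "act ?K' (\<phi> t3) (Node z' \<zero>\<^bsub>M'\<^esub>) =
        act ?K' (\<phi> t3) b2 \<oplus>\<^bsub>?K'\<^esub> (act ?K' (\<phi> t3) G \<oplus>\<^bsub>?K'\<^esub> \<ominus>\<^bsub>?K'\<^esub> act ?K' (\<phi> t3) X)"
      unfolding z'(3) K'.K.act_add[OF \<phi>t3 K'.K.cocycle_gr[OF K'.K.coboundary_cocycle[OF z'(2)]] K'.K.cocycle_gr[OF Vz]]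
      unfolding V_def K'.K.act_add[OF \<phi>t3 K'.K.cocycle_gr[OF Gz] K'.K.gr_neg[OF K'.K.cocycle_gr[OF Xz]]]
        K'.K.act_neg[OF \<phi>t3 K'.K.cocycle_gr[OF Xz]] ..
    also have "act ?K' (\<phi> t3) G \<oplus>\<^bsub>?K'\<^esub> \<ominus>\<^bsub>?K'\<^esub> (U \<oplus>\<^bsub>?K'\<^esub> (act ?K' (\<phi> t3) b2 \<oplus>\<^bsub>?K'\<^esub>
        (act ?K' (\<phi> t3) G \<oplus>\<^bsub>?K'\<^esub> \<ominus>\<^bsub>?K'\<^esub> act ?K' (\<phi> t3) X))) =
        \<ominus>\<^bsub>?K'\<^esub> (U \<oplus>\<^bsub>?K'\<^esub> act ?K' (\<phi> t3) b2) \<oplus>\<^bsub>?K'\<^esub> act ?K' (\<phi> t3) X"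
      by (rule abelian_group.minus_cancel_lemmas(2)[OF K'.K_abelian_group
          K'.K.cocycle_carrier[OF K'.K.cocycle_act[OF \<phi>t3 Gz]]
          K'.K.cocycle_carrier[OF K'.K.cocycle_act[OF \<phi>t3 Xz]] K'.K.coboundary_carrier[OF Ub]
          K'.K.coboundary_carrier[OF K'.K.coboundary_act[OF \<phi>t3 z'(2)]]])
    also have "act ?K' (\<phi> t3) X = act ?K' (\<phi> (t3 \<otimes>\<^bsub>A\<^esub> s)) u'"
      unfolding X_def F.\<phi>_mult[OF t3g sg] K'.K.mult_act[OF \<phi>t3 \<phi>s K'.K.cocycle_gr[OF u']] ..
    finally have "g w = \<ominus>\<^bsub>?K'\<^esub> (U \<oplus>\<^bsub>?K'\<^esub> act ?K' (\<phi> t3) b2) \<oplus>\<^bsub>?K'\<^esub> act ?K' (\<phi> (t3 \<otimes>\<^bsub>A\<^esub> s)) u'" .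
    moreover have "\<ominus>\<^bsub>?K'\<^esub> (U \<oplus>\<^bsub>?K'\<^esub> act ?K' (\<phi> t3) b2) \<in> coboundaries ?K' n"
      by (intro K'.K.coboundary_neg K'.K.coboundary_add Ub K'.K.coboundary_act[OF \<phi>t3 z'(2)])
    ultimately show ?thesis using wz F.T_mult[OF t3 sT] by blast
  qed
  show ?thesis
    by (intro exI[of _ g] comparison_map.intro comparison_map_axioms.intro chain inj surj)
qed

section \<open>Invariance of the depth\<close>

lemma (in dg_ring) unit_base_change:
  "base_change A A (\<lambda>a. a) {\<one>}"
  by (intro base_change.intro base_change_axioms.intro dg_ring_axioms) (use one_gr in auto)

lemma (in dg_ring) inverse_comparison:
  assumes "chain_map A A (\<lambda>a. a) {\<one>} M M' f" "chain_map A A (\<lambda>a. a) {\<one>} M' M g"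
    and "\<And>n x. x \<in> gr M n \<Longrightarrow> g (f x) = x" "\<And>n x. x \<in> gr M' n \<Longrightarrow> f (g x) = x"
  shows "comparison_map A A (\<lambda>a. a) {\<one>} M M' f"
proof -
  interpret F: chain_map A A "\<lambda>a. a" "{\<one>}" M M' f by fact
  interpret G: chain_map A A "\<lambda>a. a" "{\<one>}" M' M g by fact
  show ?thesis
  proof (intro comparison_map.intro comparison_map_axioms.intro assms(1))
    fix z n assume z: "z \<in> cocycles M n" and "f z \<in> coboundaries M' n"
    then have "g (f z) \<in> coboundaries M n" using G.f_coboundary by blast
    then show "\<exists>t\<in>{\<one>}. act M t z \<in> coboundaries M n"
      using assms(3)[OF F.M.cocycle_gr[OF z]] F.M.one_act[OF F.M.cocycle_gr[OF z]] by simp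
  next
    fix z' n assume z': "z' \<in> cocycles M' n"
    have "f (g z') = \<zero>\<^bsub>M'\<^esub> \<oplus>\<^bsub>M'\<^esub> act M' \<one> z'"
      using assms(4)[OF F.M'.cocycle_gr[OF z']] F.M'.one_act[OF F.M'.cocycle_gr[OF z']]
        F.M'.cocycle_carrier[OF z'] by simp
    then show "\<exists>t\<in>{\<one>}. \<exists>z\<in>cocycles M n. \<exists>b\<in>coboundaries M' n. f z = b \<oplus>\<^bsub>M'\<^esub> act M' t z'"
      using G.f_cocycle[OF z'] F.M'.coboundary_zero by blast
  qed
qed

text \<open>The sign is the Koszul sign of interchanging two elements of degree \<open>-1\<close>.\<close>

lemma (in dg_ring) koszul_swap_chain_map:
  fixes M :: "('a, 'm tree) dg_mod"
  assumes "dg_complex A M" and a: "a \<in> gr A 0" and b: "b \<in> gr A 0"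
  defines "sw \<equiv> \<lambda>u. Node (Node (left (left u)) (left (right u)))
      (Node (right (left u)) (\<ominus>\<^bsub>M\<^esub> right (right u)))"
  shows "chain_map A A (\<lambda>a. a) {\<one>} (koszul_lift A (koszul_lift A M a) b) (koszul_lift A (koszul_lift A M b) a) sw"
proof -
  interpret M: dg_complex A M by fact
  interpret Ka: koszul_complex A M a
    by (intro koszul_complex.intro koszul_complex_axioms.intro assms(1) a)
  interpret Kb: koszul_complex A M b
    by (intro koszul_complex.intro koszul_complex_axioms.intro assms(1) b)
  interpret Kab: koszul_complex A "koszul_lift A M a" b
    by (intro koszul_complex.intro koszul_complex_axioms.intro Ka.K_dg_complex b)
  interpret Kba: koszul_complex A "koszul_lift A M b" a
    by (intro koszul_complex.intro koszul_complex_axioms.intro Kb.K_dg_complex a)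
  let ?Kab = "koszul_lift A (koszul_lift A M a) b" and ?Kba = "koszul_lift A (koszul_lift A M b) a"
  show ?thesis
  proof (intro chain_map.intro chain_map_axioms.intro unit_base_change Kab.K_dg_complex Kba.K_dg_complex)
    fix n x assume "x \<in> gr ?Kab n"
    then obtain p q r s where x: "x = Node (Node p q) (Node r s)" and p: "p \<in> gr M n"
      and q: "q \<in> gr M (n + 1)" and r: "r \<in> gr M (n + 1)" and s: "s \<in> gr M (n + 1 + 1)" by auto
    show "sw x \<in> gr ?Kba n" using p q r M.gr_neg[OF s] by (simp add: x sw_def)
    have c: "p \<in> carrier M" "q \<in> carrier M" "r \<in> carrier M" "s \<in> carrier M"
      "dif M p \<in> carrier M" "dif M q \<in> carrier M" "dif M r \<in> carrier M" "dif M s \<in> carrier M"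
      "act M a q \<in> carrier M" "act M b r \<in> carrier M" "act M a s \<in> carrier M" "act M b s \<in> carrier M"
      using p q r s M.dif_gr M.act_gr[OF a] M.act_gr[OF b] M.gr_carrier by blast+
    show "sw (dif ?Kab x) = dif ?Kba (sw x)"
      using a b c
      by (simp add: x sw_def degree_involution_gr0 Ka.K_neg Kb.K_neg M.dif_neg[OF s] M.act_neg[OF _ s]
          M.M.minus_add M.M.a_ac)
    show "sw (x \<oplus>\<^bsub>?Kab\<^esub> y) = sw x \<oplus>\<^bsub>?Kba\<^esub> sw y" if "y \<in> gr ?Kab n" for y
    proof -
      from \<open>y \<in> gr ?Kab n\<close> obtain p' q' r' s' where y: "y = Node (Node p' q') (Node r' s')"
        and s': "s' \<in> gr M (n + 1 + 1)" by auto
      show ?thesis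
        using c M.gr_carrier[OF s'] by (simp add: x y sw_def M.M.minus_add M.M.a_comm)
    qed
    show "sw (act ?Kab d x) = act ?Kba d (sw x)" if "d \<in> gr A 0" for d
      using that by (simp add: x sw_def degree_involution_gr0 M.act_neg[OF that s])
  qed
qed

text \<open>The sign squares to one, so the swap for \<open>b\<close> and \<open>a\<close> inverts
  the swap for \<open>a\<close> and \<open>b\<close>.\<close>

lemma (in dg_ring) koszul_swap_comparison:
  fixes M :: "('a, 'm tree) dg_mod"
  assumes "dg_complex A M" and a: "a \<in> gr A 0" and b: "b \<in> gr A 0"
  shows "\<exists>g. comparison_map A A (\<lambda>a. a) {\<one>}
    (koszul_lift A (koszul_lift A M a) b) (koszul_lift A (koszul_lift A M b) a) g"
proof -
  interpret M: dg_complex A M by fact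
  note sw = koszul_swap_chain_map[OF assms] koszul_swap_chain_map[OF assms(1) b a]
  show ?thesis
    by (rule exI, rule inverse_comparison[OF sw]) (auto simp: M.gr_carrier)
qed

text \<open>\<open>T_unit\<close> allows cancelling denominators in the cohomology over
  \<open>A'\<close>, and \<open>m'_lift\<close> transports classes killed by the maximal ideal.
  Nothing sends \<open>m\<close> into \<open>m'\<close>, because localization at a smaller prime
  turns some elements of \<open>m\<close> into units.\<close>

locale local_base_change = base_change A A' \<phi> T + L: local_dg_ring A m + L': local_dg_ring A' m'
  for A :: "('a, 'b) cochain_scheme" and A' :: "('c, 'd) cochain_scheme" and \<phi> T m m' +
  assumes T_unit: "t \<in> T \<Longrightarrow> A'.rcls (\<phi> t) \<notin> m'"
    and m'_lift: "a' \<in> gr A' 0 \<Longrightarrow> A'.rcls a' \<in> m' \<Longrightarrow>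
      \<exists>t\<in>T. \<exists>a\<in>gr A 0. A.rcls a \<in> m \<and> A'.rcls (\<phi> t \<otimes>\<^bsub>A'\<^esub> a') = A'.rcls (\<phi> a)"

section \<open>Socles and common regular elements\<close>

context local_dg_ring
begin

text \<open>With trivial denominators, comparison maps are quasi-isomorphisms over \<open>A\<close>,
  so the results on base change also serve for isomorphic Koszul complexes.\<close>

lemma unit_local_base_change: "local_base_change A A (\<lambda>a. a) {\<one>} m m"
proof (intro local_base_change.intro local_base_change_axioms.intro unit_base_change local_dg_ring_axioms)
  show "rcls t \<notin> m" if "t \<in> {\<one>}" for t
    using that R.one_notin_m rcls_hom(3)[OF gr_zero gr_zero] by simp
  show "\<exists>t\<in>{\<one>}. \<exists>a\<in>gr A 0. rcls a \<in> m \<and> rcls (t \<otimes> a') = rcls a"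
    if "a' \<in> gr A 0" "rcls a' \<in> m" for a'
    using that gr_carrier by auto
qed

text \<open>The class of \<open>t\<close> is a unit of H^0(A). A lift of its inverse undoes the
  action of \<open>t\<close> up to coboundaries.\<close>

lemma unit_act_coboundary:
  assumes "dg_complex A M" and t: "t \<in> gr A 0" "rcls t \<notin> m"
    and z: "z \<in> cocycles M n" "act M t z \<in> coboundaries M n"
  shows "z \<in> coboundaries M n"
proof -
  interpret dg_complex A M by fact
  obtain y where "y \<in> carrier (H0 A)" "y \<otimes>\<^bsub>H0 A\<^esub> rcls t = \<one>\<^bsub>H0 A\<^esub>"
    using R.not_m_unit[OF rcls_closed[OF t(1)] t(2)] by blast
  then obtain s where s: "s \<in> gr A 0" "rcls (s \<otimes> t) = rcls \<one>"
    using rcls_hom t(1) by (auto simp: H0_carrier)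
  have st: "s \<otimes> t \<in> gr A 0" using gr0_mult s(1) t(1) by blast
  obtain w where w: "w \<in> coboundaries M n" "act M \<one> z = w \<oplus>\<^bsub>M\<^esub> act M (s \<otimes> t) z"
    using act_rcls[OF one_gr st s(2)[symmetric] z(1)] by blast
  have "act M (s \<otimes> t) z \<in> coboundaries M n"
    using mult_act[OF s(1) t(1) cocycle_gr[OF z(1)]] coboundary_act[OF s(1) z(2)] by simp
  then show ?thesis using w coboundary_add one_act[OF cocycle_gr[OF z(1)]] by metis
qed

text \<open>The residue field embeds into H^n(M). For a coherent complex at its infimum, the absence
  of a socle is equivalent to the existence of a regular element.\<close>

definition has_socle :: "('a, 'm) dg_mod \<Rightarrow> int \<Rightarrow> bool" where
  "has_socle M n \<longleftrightarrow> (\<exists>z\<in>cocycles M n. z \<notin> coboundaries M n \<and>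
     (\<forall>a\<in>gr A 0. rcls a \<in> m \<longrightarrow> act M a z \<in> coboundaries M n))"

lemma regular_no_socle:
  assumes "coherent M" "regular_element m M x"
  shows "\<not> has_socle M (dg_inf M)"
proof -
  obtain a where a: "a \<in> gr A 0" "x = rcls a" "x \<in> m"
    using assms(2) m_rcls unfolding regular_element_def by blast
  then show ?thesis
    using regular_element_iff[OF assms(1) a(1)] assms(2) unfolding has_socle_def by blast
qed

lemma regular_if_avoids:
  assumes "coherent M" "x \<in> m"
    and "\<And>P. P \<in> maximal_annihilators (H0 A) (cohomology M (dg_inf M)) \<Longrightarrow> x \<notin> P"
  shows "regular_element m M x"
proof -
  interpret dg_complex A M by (rule coherent_complex[OF assms(1)])
  obtain a where a: "a \<in> gr A 0" "x = rcls a" using assms(2) m_rcls by blast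
  have "z \<in> coboundaries M (dg_inf M)"
    if z: "z \<in> cocycles M (dg_inf M)" "act M a z \<in> coboundaries M (dg_inf M)" for z
  proof (rule ccontr)
    assume "z \<notin> coboundaries M (dg_inf M)"
    then have "hcls (dg_inf M) z \<noteq> \<zero>\<^bsub>cohomology M (dg_inf M)\<^esub>"
      using hcls_eq_zero_iff[OF cocycle_carrier[OF z(1)]] by simp
    moreover have "x \<odot>\<^bsub>cohomology M (dg_inf M)\<^esub> hcls (dg_inf M) z = \<zero>\<^bsub>cohomology M (dg_inf M)\<^esub>"
      unfolding a(2) hcls_act[OF a(1) z(1)] using hcls_eq_zero_iff[OF coboundary_carrier[OF z(2)]] z(2) by simp
    moreover have "hcls (dg_inf M) z \<in> carrier (cohomology M (dg_inf M))"
      using z(1) unfolding cohomology_carrier by blast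
    ultimately obtain P where "P \<in> maximal_annihilators (H0 A) (cohomology M (dg_inf M))" "x \<in> P"
      using R.zero_divisor_in_maximal_annihilator[OF cohomology_module, of "hcls (dg_inf M) z" "dg_inf M" x]
        R.m_carrier assms(2) by blast
    then show False using assms(3) by blast
  qed
  then show ?thesis using regular_element_iff[OF assms(1) a(1)] a(2) assms(2) by blast
qed

lemma maximal_annihilator_contains_m:
  assumes "coherent M" "P \<in> maximal_annihilators (H0 A) (cohomology M n)" "m \<subseteq> P"
  shows "has_socle M n"
proof -
  interpret dg_complex A M by (rule coherent_complex[OF assms(1)])
  obtain v where v: "P = annihilator (H0 A) (cohomology M n) v" "v \<in> carrier (cohomology M n)"
    "v \<noteq> \<zero>\<^bsub>cohomology M n\<^esub>" using assms(2) unfolding maximal_annihilators_def by blast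
  from v(2) obtain z where z: "z \<in> cocycles M n" "v = hcls n z" unfolding cohomology_carrier by blast
  have "act M a z \<in> coboundaries M n" if "a \<in> gr A 0" "rcls a \<in> m" for a
  proof -
    have "rcls a \<odot>\<^bsub>cohomology M n\<^esub> v = \<zero>\<^bsub>cohomology M n\<^esub>" using that(2) assms(3) v(1) by (auto simp: annihilator_def)
    then show ?thesis
      unfolding z(2) hcls_act[OF that(1) z(1)]
      using hcls_eq_zero_iff[OF cocycle_carrier[OF cocycle_act[OF that(1) z(1)]]] by simp
  qed
  moreover have "z \<notin> coboundaries M n" using v(3) z hcls_eq_zero_iff[OF cocycle_carrier[OF z(1)]] by blast
  ultimately show ?thesis using z(1) unfolding has_socle_def by blast
qed

lemma maximal_annihilators_prime:
  "P \<in> maximal_annihilators R' N \<Longrightarrow> primeideal P R'"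
  unfolding maximal_annihilators_def by blast

text \<open>By \<open>gen\<close> the element \<open>z\<close> and the ideal \<open>J\<close>
  generate \<open>m\<close>. So a maximal annihilator containing both would contain \<open>m\<close>
  and produce a socle, and prime avoidance in the coset of \<open>z\<close> applies to all complexes
  at once. Taking \<open>z\<close> zero and \<open>J\<close> equal to \<open>m\<close> gives
  ordinary prime avoidance.\<close>

lemma exists_common_regular:
  fixes \<M> :: "('a, 'm) dg_mod set"
  assumes "finite \<M>" "\<And>M. M \<in> \<M> \<Longrightarrow> coherent M \<and> \<not> has_socle M (dg_inf M)"
    and J: "ideal J (H0 A)" "J \<subseteq> m" and z: "z \<in> m"
    and gen: "\<And>P. ideal P (H0 A) \<Longrightarrow> J \<subseteq> P \<Longrightarrow> z \<in> P \<Longrightarrow> m \<subseteq> P"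
  shows "\<exists>c\<in>J. z \<oplus>\<^bsub>H0 A\<^esub> c \<in> m \<and> (\<forall>M\<in>\<M>. regular_element m M (z \<oplus>\<^bsub>H0 A\<^esub> c))"
proof -
  define F where "F = (\<Union>M\<in>\<M>. maximal_annihilators (H0 A) (cohomology M (dg_inf M)))"
  have "\<exists>c\<in>J. \<forall>P\<in>F. z \<oplus>\<^bsub>H0 A\<^esub> c \<notin> P"
  proof (rule R.coset_prime_avoidance)
    show "finite F" unfolding F_def
      using assms(1,2) R.finite_maximal_annihilators coherent_noetherian by blast
    show "primeideal P (H0 A)" if "P \<in> F" for P
      using that maximal_annihilators_prime unfolding F_def by blast
    show "\<not> J \<subseteq> P" if "P \<in> F" "z \<in> P" for P
    proof
      assume "J \<subseteq> P"
      from that(1) obtain M where M: "M \<in> \<M>" "P \<in> maximal_annihilators (H0 A) (cohomology M (dg_inf M))"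
        unfolding F_def by blast
      have "m \<subseteq> P"
        using gen[OF _ \<open>J \<subseteq> P\<close> that(2)] maximal_annihilators_prime[OF M(2)] by (simp add: primeideal_def)
      then show False using maximal_annihilator_contains_m[OF _ M(2)] assms(2)[OF M(1)] by blast
    qed
    show "z \<in> carrier (H0 A)" using z R.m_carrier by blast
  qed (rule J(1))
  then obtain c where c: "c \<in> J" "\<And>P. P \<in> F \<Longrightarrow> z \<oplus>\<^bsub>H0 A\<^esub> c \<notin> P" by blast
  have zc: "z \<oplus>\<^bsub>H0 A\<^esub> c \<in> m" using z c(1) J(2) R.m_ideal by (auto simp: R.ideal_iff)
  have "regular_element m M (z \<oplus>\<^bsub>H0 A\<^esub> c)" if "M \<in> \<M>" for M
    by (rule regular_if_avoids) (use assms(2)[OF that] zc c(2) that in \<open>auto simp: F_def\<close>)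
  then show ?thesis using c(1) zc by blast
qed

end

lemma (in base_change) rcls_cong:
  assumes "a \<in> gr A 0" "b \<in> gr A 0" "A.rcls a = A.rcls b"
  shows "A'.rcls (\<phi> a) = A'.rcls (\<phi> b)"
proof -
  obtain c where c: "c \<in> gr A (-1)" "a = dif A c \<oplus>\<^bsub>A\<^esub> b" using A.rcls_eq_iff assms by blast
  have dc: "dif A c \<in> coboundaries A 0" using c(1) by (auto simp: coboundaries_def)
  have "\<phi> a = \<phi> (dif A c) \<oplus>\<^bsub>A'\<^esub> \<phi> b"
    unfolding c(2) by (rule \<phi>_add) (use dc A.coboundaries_carrier assms(2) in auto)
  moreover obtain c' where c': "c' \<in> gr A' (-1)" "\<phi> (dif A c) = dif A' c'"
    using \<phi>_coboundaries[OF dc] by (auto simp: coboundaries_def)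
  ultimately have "\<phi> a = dif A' c' \<oplus>\<^bsub>A'\<^esub> \<phi> b" by simp
  then show ?thesis
    unfolding A'.rcls_eq_iff[OF \<phi>_gr[OF assms(1)] \<phi>_gr[OF assms(2)]] using c'(1) by (rule bexI)
qed

section \<open>Transport of vanishing, socles and regularity along comparison maps\<close>

context local_base_change
begin

lemma comparison_zero:
  assumes "comparison_map A A' \<phi> T M M' f" "cohomology_zero M n"
  shows "cohomology_zero M' n"
proof -
  interpret comparison_map A A' \<phi> T M M' f by fact
  show ?thesis
    unfolding M'.cohomology_zero_iff
  proof
    fix z' assume z': "z' \<in> cocycles M' n"
    obtain t z b where t: "t \<in> T" and z: "z \<in> cocycles M n" and b: "b \<in> coboundaries M' n"
      and e: "f z = b \<oplus>\<^bsub>M'\<^esub> act M' (\<phi> t) z'" using f_surj[OF z'] by blast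
    have "z \<in> coboundaries M n" using z assms(2) unfolding M.cohomology_zero_iff by blast
    then have "b \<oplus>\<^bsub>M'\<^esub> act M' (\<phi> t) z' \<in> coboundaries M' n" using f_coboundary e by metis
    then have "act M' (\<phi> t) z' \<in> coboundaries M' n"
      using M'.coboundary_cancel[OF b M'.cocycle_carrier[OF M'.cocycle_act[OF \<phi>_gr[OF T_gr0[OF t]] z']]] by blast
    then show "z' \<in> coboundaries M' n"
      using L'.unit_act_coboundary[OF M'.dg_complex_axioms \<phi>_gr[OF T_gr0[OF t]] T_unit[OF t] z'] by blast
  qed
qed

lemma comparison_zero_iff:
  assumes "comparison_map A A' \<phi> T M M' f" and units: "\<And>t. t \<in> T \<Longrightarrow> A.rcls t \<notin> m"
  shows "cohomology_zero M' n \<longleftrightarrow> cohomology_zero M n"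
proof
  interpret comparison_map A A' \<phi> T M M' f by fact
  assume zero: "cohomology_zero M' n"
  show "cohomology_zero M n"
    unfolding M.cohomology_zero_iff
  proof
    fix z assume z: "z \<in> cocycles M n"
    then obtain t where t: "t \<in> T" "act M t z \<in> coboundaries M n"
      using f_inj[OF z] f_cocycle[OF z] zero unfolding M'.cohomology_zero_iff by blast
    then show "z \<in> coboundaries M n"
      using L.unit_act_coboundary[OF M.dg_complex_axioms T_gr0[OF t(1)] units[OF t(1)] z] by blast
  qed
qed (rule comparison_zero[OF assms(1)])

lemma comparison_inf:
  assumes "comparison_map A A' \<phi> T M M' f" and "\<And>t. t \<in> T \<Longrightarrow> A.rcls t \<notin> m"
  shows "dg_inf M' = dg_inf M"
proof -
  have "cohomology_zero M' n \<longleftrightarrow> cohomology_zero M n" for n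
    by (rule comparison_zero_iff[OF assms])
  then show ?thesis unfolding dg_inf_def by simp
qed

text \<open>Elements of \<open>T\<close> are units of H^0(A), so no denominator kills the given
  class. An element of \<open>m'\<close> becomes, after multiplication by the image of some
  \<open>t\<close>, the image of an element of \<open>m\<close>.\<close>

lemma comparison_socle:
  assumes "comparison_map A A' \<phi> T M M' f" and units: "\<And>t. t \<in> T \<Longrightarrow> A.rcls t \<notin> m"
    and "L.has_socle M n"
  shows "L'.has_socle M' n"
proof -
  interpret comparison_map A A' \<phi> T M M' f by fact
  obtain z where z: "z \<in> cocycles M n" "z \<notin> coboundaries M n"
    and soc: "\<And>a. a \<in> gr A 0 \<Longrightarrow> A.rcls a \<in> m \<Longrightarrow> act M a z \<in> coboundaries M n"
    using assms(3) unfolding L.has_socle_def by blast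
  have "f z \<notin> coboundaries M' n"
  proof
    assume "f z \<in> coboundaries M' n"
    then obtain t where t: "t \<in> T" "act M t z \<in> coboundaries M n" using f_inj[OF z(1)] by blast
    then show False
      using L.unit_act_coboundary[OF M.dg_complex_axioms T_gr0[OF t(1)] units[OF t(1)] z(1)] z(2) by blast
  qed
  moreover have "act M' a' (f z) \<in> coboundaries M' n" if a': "a' \<in> gr A' 0" "A'.rcls a' \<in> m'" for a'
  proof -
    obtain t a where t: "t \<in> T" and a: "a \<in> gr A 0" "A.rcls a \<in> m"
      and e: "A'.rcls (\<phi> t \<otimes>\<^bsub>A'\<^esub> a') = A'.rcls (\<phi> a)" using m'_lift[OF a'] by blast
    note \<phi>t = \<phi>_gr[OF T_gr0[OF t]]
    have "act M' (\<phi> a) (f z) \<in> coboundaries M' n"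
      using f_coboundary[OF soc[OF a]] f_act[OF a(1) M.cocycle_gr[OF z(1)]] by simp
    then have "act M' (\<phi> t \<otimes>\<^bsub>A'\<^esub> a') (f z) \<in> coboundaries M' n"
      using M'.act_rcls[OF A'.gr0_mult[OF \<phi>t a'(1)] \<phi>_gr[OF a(1)] e f_cocycle[OF z(1)]] M'.coboundary_add by metis
    then have "act M' (\<phi> t) (act M' a' (f z)) \<in> coboundaries M' n"
      using M'.mult_act[OF \<phi>t a'(1) M'.cocycle_gr[OF f_cocycle[OF z(1)]]] by simp
    then show ?thesis
      using L'.unit_act_coboundary[OF M'.dg_complex_axioms \<phi>t T_unit[OF t] M'.cocycle_act[OF a'(1) f_cocycle[OF z(1)]]]
      by blast
  qed
  ultimately show ?thesis using f_cocycle[OF z(1)] unfolding L'.has_socle_def by blast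
qed

text \<open>Exactness of localization, chased with denominators: if \<open>a\<close> kills
  \<open>z'\<close>, then up to denominators it kills a lift of \<open>z'\<close>, which is
  therefore zero up to a denominator. Equality of the infima makes both statements concern the same
  degree.\<close>

lemma comparison_regular:
  assumes "comparison_map A A' \<phi> T M M' f" "L.coherent M" "L'.coherent M'" "dg_inf M' = dg_inf M"
    and a: "a \<in> gr A 0" "A.rcls a \<in> m" "A'.rcls (\<phi> a) \<in> m'" and reg: "regular_element m M (A.rcls a)"
  shows "regular_element m' M' (A'.rcls (\<phi> a))"
proof -
  interpret comparison_map A A' \<phi> T M M' f by fact
  define i where "i = dg_inf M"
  have reg': "z \<in> coboundaries M i" if "z \<in> cocycles M i" "act M a z \<in> coboundaries M i" for z
    using reg that unfolding L.regular_element_iff[OF assms(2) a(1,2)] i_def by blast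
  note \<phi>a = \<phi>_gr[OF a(1)]
  have "z' \<in> coboundaries M' i"
    if z': "z' \<in> cocycles M' i" and az': "act M' (\<phi> a) z' \<in> coboundaries M' i" for z'
  proof -
    obtain t z b where t: "t \<in> T" and z: "z \<in> cocycles M i" and b: "b \<in> coboundaries M' i"
      and e: "f z = b \<oplus>\<^bsub>M'\<^esub> act M' (\<phi> t) z'" using f_surj[OF z'] by blast
    note \<phi>t = \<phi>_gr[OF T_gr0[OF t]]
    have "f (act M a z) = act M' (\<phi> a) b \<oplus>\<^bsub>M'\<^esub> act M' (\<phi> t) (act M' (\<phi> a) z')"
      unfolding f_act[OF a(1) M.cocycle_gr[OF z]] e M'.act_act_comm[OF \<phi>t \<phi>a M'.cocycle_gr[OF z']]
      by (rule M'.act_add[OF \<phi>a M'.cocycle_gr[OF M'.coboundary_cocycle[OF b]]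
            M'.cocycle_gr[OF M'.cocycle_act[OF \<phi>t z']]])
    then have "f (act M a z) \<in> coboundaries M' i"
      using M'.coboundary_add[OF M'.coboundary_act[OF \<phi>a b] M'.coboundary_act[OF \<phi>t az']] by simp
    then obtain s where s: "s \<in> T" "act M s (act M a z) \<in> coboundaries M i"
      using f_inj[OF M.cocycle_act[OF a(1) z]] by blast
    note sg = T_gr0[OF s(1)]
    have "act M s z \<in> coboundaries M i"
      using reg'[OF M.cocycle_act[OF sg z]] s(2) M.act_act_comm[OF sg a(1) M.cocycle_gr[OF z]] by simp
    then have "act M' (\<phi> s) (f z) \<in> coboundaries M' i"
      using f_coboundary f_act[OF sg M.cocycle_gr[OF z]] by metis
    then have "f z \<in> coboundaries M' i"
      using L'.unit_act_coboundary[OF M'.dg_complex_axioms \<phi>_gr[OF sg] T_unit[OF s(1)] f_cocycle[OF z]] by blast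
    then have "act M' (\<phi> t) z' \<in> coboundaries M' i"
      unfolding e using M'.coboundary_cancel[OF b M'.cocycle_carrier[OF M'.cocycle_act[OF \<phi>t z']]] by blast
    then show ?thesis
      using L'.unit_act_coboundary[OF M'.dg_complex_axioms \<phi>t T_unit[OF t] z'] by blast
  qed
  then show ?thesis
    unfolding L'.regular_element_iff[OF assms(3) \<phi>a a(3)] assms(4) i_def by blast
qed

text \<open>The two Koszul complexes choose their lifts independently, so only the classes of the
  lifts match. This is the generality in which \<open>koszul_comparison\<close> is stated.\<close>

lemma koszul_comparison':
  fixes M :: "('a, 'm tree) dg_mod" and M' :: "('c, 'n tree) dg_mod"
  assumes "comparison_map A A' \<phi> T M M' f" "a \<in> gr A 0" "A.rcls a \<in> m" "A'.rcls (\<phi> a) \<in> m'"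
  shows "\<exists>g. comparison_map A A' \<phi> T (koszul A M (A.rcls a)) (koszul A' M' (A'.rcls (\<phi> a))) g"
proof -
  obtain b where b: "b \<in> gr A 0" "A.rcls a = A.rcls b" "koszul A M (A.rcls a) = koszul_lift A M b"
    using L.koszul_lift_of[OF assms(3)] by metis
  obtain b' where b': "b' \<in> gr A' 0" "A'.rcls (\<phi> a) = A'.rcls b'"
    "koszul A' M' (A'.rcls (\<phi> a)) = koszul_lift A' M' b'"
    using L'.koszul_lift_of[OF assms(4)] by metis
  show ?thesis
    unfolding b(3) b'(3)
    by (rule koszul_comparison[OF assms(1) b(1) b'(1)])
      (use rcls_cong[OF assms(2) b(1,2)] b'(2) in simp)
qed

end

section \<open>Isomorphic complexes and the exchange of regular elements\<close>

context local_dg_ring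
begin

lemma koszul_iso:
  fixes M M' :: "('a, 'm tree) dg_mod"
  assumes "comparison_map A A (\<lambda>a. a) {\<one>} M M' f" "x \<in> m"
  shows "\<exists>g. comparison_map A A (\<lambda>a. a) {\<one>} (koszul A M x) (koszul A M' x) g"
proof -
  interpret U: local_base_change A A "\<lambda>a. a" "{\<one>}" m m by (rule unit_local_base_change)
  obtain a where "a \<in> gr A 0" "x = rcls a" using m_rcls[OF assms(2)] by blast
  then show ?thesis using U.koszul_comparison'[OF assms(1)] assms(2) by simp
qed

lemma one_unit: "t \<in> {\<one>} \<Longrightarrow> rcls t \<notin> m"
  using R.one_notin_m rcls_hom(3)[OF gr_zero gr_zero] by simp

lemma iso_regular:
  fixes M M' :: "('a, 'm tree) dg_mod"
  assumes "comparison_map A A (\<lambda>a. a) {\<one>} M M' f" "coherent M" "coherent M'" "regular_element m M x"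
  shows "regular_element m M' x"
proof -
  interpret U: local_base_change A A "\<lambda>a. a" "{\<one>}" m m by (rule unit_local_base_change)
  obtain a where "a \<in> gr A 0" "x = rcls a" "x \<in> m" using m_rcls assms(4) unfolding regular_element_def by blast
  then show ?thesis
    using U.comparison_regular[OF assms(1-3) U.comparison_inf[OF assms(1) one_unit]] assms(4) by simp
qed

lemma iso_regular_sequence:
  fixes M M' :: "('a, 'm tree) dg_mod"
  assumes "comparison_map A A (\<lambda>a. a) {\<one>} M M' f" "coherent M" "coherent M'" "regular_tree_sequence A m M xs"
  shows "regular_tree_sequence A m M' xs"
  using assms
proof (induction xs arbitrary: M M' f)
  case (Cons x xs)
  have x: "x \<in> m" "regular_element m M x" using Cons.prems(4) by (auto simp: regular_element_def)
  obtain g where g: "comparison_map A A (\<lambda>a. a) {\<one>} (koszul A M x) (koszul A M' x) g"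
    using koszul_iso[OF Cons.prems(1) x(1)] by blast
  have "regular_tree_sequence A m (koszul A M' x) xs"
    by (rule Cons.IH[OF g coherent_koszul[OF Cons.prems(2) x(1)] coherent_koszul[OF Cons.prems(3) x(1)]])
      (use Cons.prems(4) in simp)
  then show ?case using iso_regular[OF Cons.prems(1-3) x(2)] by simp
qed simp

lemma koszul_swap_iso:
  fixes M :: "('a, 'm tree) dg_mod"
  assumes "coherent M" "x \<in> m" "y \<in> m"
  shows "\<exists>g. comparison_map A A (\<lambda>a. a) {\<one>} (koszul A (koszul A M x) y) (koszul A (koszul A M y) x) g"
proof -
  obtain a where a: "a \<in> gr A 0" "\<And>M :: ('a, 'm tree) dg_mod. koszul A M x = koszul_lift A M a"
    using koszul_lift_of[OF assms(2)] by metis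
  obtain b where b: "b \<in> gr A 0" "\<And>M :: ('a, 'm tree) dg_mod. koszul A M y = koszul_lift A M b"
    using koszul_lift_of[OF assms(3)] by metis
  show ?thesis unfolding a(2) b(2) by (rule koszul_swap_comparison[OF coherent_complex[OF assms(1)] a(1) b(1)])
qed

lemma regular_iff_koszul:
  assumes "coherent M" "x \<in> m"
  shows "regular_element m M x \<longleftrightarrow> cohomology_zero (koszul A M x) (dg_inf M - 1)"
proof -
  obtain a where "a \<in> gr A 0" "x = rcls a" "koszul A M x = koszul_lift A M a"
    using koszul_lift_of[OF assms(2)] by metis
  then show ?thesis using regular_iff_koszul_zero[OF assms(1)] assms(2) by simp
qed

text \<open>Since both elements are \<open>M\<close>-regular, neither one-element Koszul complex
  changes the infimum. Regularity of the second element is then the vanishing of one cohomology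
  module of the double Koszul complex, which is symmetric.\<close>

lemma koszul_regular_swap:
  fixes M :: "('a, 'm tree) dg_mod"
  assumes "coherent M" "regular_element m M x" "regular_element m M y" "regular_element m (koszul A M x) y"
  shows "regular_element m (koszul A M y) x"
proof -
  interpret U: local_base_change A A "\<lambda>a. a" "{\<one>}" m m by (rule unit_local_base_change)
  have xy: "x \<in> m" "y \<in> m" using assms by (auto simp: regular_element_def)
  obtain g where "comparison_map A A (\<lambda>a. a) {\<one>} (koszul A (koszul A M x) y) (koszul A (koszul A M y) x) g"
    using koszul_swap_iso[OF assms(1) xy] by blast
  then have "cohomology_zero (koszul A (koszul A M y) x) (dg_inf M - 1)"
    using U.comparison_zero regular_iff_koszul[OF coherent_koszul[OF assms(1) xy(1)] xy(2)] assms(4)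
      koszul_inf[OF assms(1,2)] by simp
  then show ?thesis
    using regular_iff_koszul[OF coherent_koszul[OF assms(1) xy(2)] xy(1)] koszul_inf[OF assms(1,3)] by simp
qed

text \<open>H^n of the Koszul complex is the \<open>x\<close>-torsion of H^{n+1}(M). As
  \<open>x\<close> lies in \<open>m\<close>, this torsion contains all elements killed by
  \<open>m\<close>.\<close>

lemma koszul_socle:
  fixes M :: "('a, 'm tree) dg_mod"
  assumes "coherent M" "x \<in> m" "cohomology_zero M n"
  shows "has_socle (koszul A M x) n \<longleftrightarrow> has_socle M (n + 1)"
proof -
  obtain a where a: "a \<in> gr A 0" "x = rcls a" "koszul A M x = koszul_lift A M a"
    using koszul_lift_of[OF assms(2)] by metis
  interpret koszul_complex A M a
    by (intro koszul_complex.intro koszul_complex_axioms.intro coherent_complex[OF assms(1)] a(1))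
  have left: "u \<in> coboundaries K n" if u: "u = Node p q" "u \<in> cocycles K n" "q \<in> coboundaries M (n + 1)" for u p q
  proof -
    obtain z b where z: "z \<in> cocycles M n" "Node z \<zero>\<^bsub>M\<^esub> = b \<oplus>\<^bsub>K\<^esub> u" "b \<in> coboundaries K n"
      using K_cocycle_reduce[of p q n] u by blast
    have "Node z \<zero>\<^bsub>M\<^esub> \<in> coboundaries K n"
      using z(1) assms(3) K_coboundary_left_coboundary unfolding cohomology_zero_iff by blast
    then show ?thesis using K.coboundary_cancel[OF z(3) K.cocycle_carrier[OF u(2)]] z(2) by metis
  qed
  have act_Node: "act K b (Node p q) = Node (act M b p) (act M b q)" if "b \<in> gr A 0" for b p q
    using that by (simp add: degree_involution_gr0)
  show ?thesis
    unfolding a(3)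
  proof
    assume "has_socle K n"
    then obtain u where u: "u \<in> cocycles K n" "u \<notin> coboundaries K n"
      "\<And>b. b \<in> gr A 0 \<Longrightarrow> rcls b \<in> m \<Longrightarrow> act K b u \<in> coboundaries K n"
      unfolding has_socle_def by blast
    from u(1) obtain p q where pq: "u = Node p q" "Node p q \<in> cocycles K n" by (rule K_cocycle_Node)
    have "q \<notin> coboundaries M (n + 1)" using left[OF pq(1) u(1)] u(2) by blast
    moreover have "act M b q \<in> coboundaries M (n + 1)" if "b \<in> gr A 0" "rcls b \<in> m" for b
      using u(3)[OF that] K_coboundary_right unfolding pq(1) act_Node[OF that(1)] by blast
    ultimately show "has_socle M (n + 1)"
      unfolding has_socle_def using K_cocycle_right(1)[OF pq(2)] by blast
  next
    assume "has_socle M (n + 1)"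
    then obtain z where z: "z \<in> cocycles M (n + 1)" "z \<notin> coboundaries M (n + 1)"
      "\<And>b. b \<in> gr A 0 \<Longrightarrow> rcls b \<in> m \<Longrightarrow> act M b z \<in> coboundaries M (n + 1)"
      unfolding has_socle_def by blast
    obtain p where p: "Node p z \<in> cocycles K n"
      using K_cocycle_lift[OF z(1)] z(3)[OF a(1)] a(2) assms(2) by blast
    have "act K b (Node p z) \<in> coboundaries K n" if "b \<in> gr A 0" "rcls b \<in> m" for b
      by (rule left[OF act_Node[OF that(1)] K.cocycle_act[OF that(1) p] z(3)[OF that]])
    moreover have "Node p z \<notin> coboundaries K n" using K_coboundary_right z(2) by blast
    ultimately show "has_socle K n" unfolding has_socle_def using p by blast
  qed
qed

text \<open>\<open>koszul_socle\<close> is applied twice, down one degree by adjoining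
  \<open>x\<close> and back up by removing \<open>y\<close>. Regularity of \<open>y\<close> and of
  \<open>x\<close> supplies the vanishing that it requires, one degree below the infimum.\<close>

lemma koszul_socle_exchange:
  fixes M :: "('a, 'm tree) dg_mod"
  assumes "coherent M" "regular_element m M x" "regular_element m M y"
    and "has_socle (koszul A M y) (dg_inf M)"
  shows "has_socle (koszul A M x) (dg_inf M)"
proof -
  interpret U: local_base_change A A "\<lambda>a. a" "{\<one>}" m m by (rule unit_local_base_change)
  have xy: "x \<in> m" "y \<in> m" using assms by (auto simp: regular_element_def)
  note cx = coherent_koszul[OF assms(1) xy(1)] and cy = coherent_koszul[OF assms(1) xy(2)]
  have "has_socle (koszul A (koszul A M y) x) (dg_inf M - 1)"
    using koszul_socle[OF cy xy(1), of "dg_inf M - 1"] assms(3,4) regular_iff_koszul[OF assms(1) xy(2)] by simp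
  then have "has_socle (koszul A (koszul A M x) y) (dg_inf M - 1)"
    using koszul_swap_iso[OF assms(1) xy(2,1)] U.comparison_socle[OF _ one_unit] by blast
  then show ?thesis
    using koszul_socle[OF cx xy(2), of "dg_inf M - 1"] assms(2) regular_iff_koszul[OF assms(1) xy(1)] by simp
qed

text \<open>An auxiliary element \<open>z\<close>, regular on M, K(M; x1) and K(M; y), mediates
  between x1 and y. By induction over K(M; x1), there is a sequence \<open>zs\<close> on K(M; x1,
  z); swapping makes \<open>x1 # zs\<close> regular on K(M; z). By induction over K(M; z), there is
  a sequence on K(M; z, y), and after another swap \<open>z\<close> can be put in front of it over
  K(M; y).\<close>

theorem regular_sequence_exchange:
  fixes M :: "('a, 'm tree) dg_mod"
  assumes "coherent M" "regular_tree_sequence A m M xs" "length xs = Suc n" "regular_element m M y"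
  shows "\<exists>ys. length ys = n \<and> regular_tree_sequence A m (koszul A M y) ys"
  using assms
proof (induction n arbitrary: M xs y)
  case 0
  show ?case by (rule exI[of _ "[]"]) simp
next
  case (Suc n)
  note coh = Suc.prems(1)
  obtain x1 x2 xs' where xs: "xs = x1 # x2 # xs'" "length xs' = n"
    using Suc.prems(3) by (metis length_Suc_conv)
  have x1: "regular_element m M x1" "x1 \<in> m" and x2: "regular_element m (koszul A M x1) x2" "x2 \<in> m"
    and seq: "regular_tree_sequence A m (koszul A M x1) (x2 # xs')"
    using Suc.prems(2) xs by (auto simp: regular_element_def)
  have y: "regular_element m M y" "y \<in> m" using Suc.prems(4) by (auto simp: regular_element_def)
  note c1 = coherent_koszul[OF coh x1(2)] and cy = coherent_koszul[OF coh y(2)]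
  \<comment> \<open>The second element of the sequence rules out a socle for K(M; x1), and the
    exchange of socles then rules it out for K(M; y).\<close>
  have soc: "\<not> has_socle (koszul A M x1) (dg_inf M)"
    using regular_no_socle[OF c1 x2(1)] koszul_inf[OF coh x1(1)] by simp
  then have socy: "\<not> has_socle (koszul A M y) (dg_inf M)"
    using koszul_socle_exchange[OF coh x1(1) y(1)] by blast
  \<comment> \<open>The coset is that of zero modulo \<open>m\<close>, so the element found is an
    arbitrary element of \<open>m\<close>.\<close>
  have "\<exists>c\<in>m. \<zero>\<^bsub>H0 A\<^esub> \<oplus>\<^bsub>H0 A\<^esub> c \<in> m \<and>
      (\<forall>N\<in>{M, koszul A M x1, koszul A M y}. regular_element m N (\<zero>\<^bsub>H0 A\<^esub> \<oplus>\<^bsub>H0 A\<^esub> c))"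
  proof (rule exists_common_regular)
    show "coherent N \<and> \<not> has_socle N (dg_inf N)" if "N \<in> {M, koszul A M x1, koszul A M y}" for N
      using that coh c1 cy soc socy koszul_inf[OF coh x1(1)] koszul_inf[OF coh y(1)]
        regular_no_socle[OF coh x1(1)] by auto
    show "\<zero>\<^bsub>H0 A\<^esub> \<in> m" using R.m_ideal by (simp add: R.ideal_iff)
  qed (use R.m_ideal in auto)
  then obtain z where z: "z \<in> m" "regular_element m M z" "regular_element m (koszul A M x1) z"
    "regular_element m (koszul A M y) z" by auto
  note cz = coherent_koszul[OF coh z(1)]
  obtain zs where zs: "length zs = n" "regular_tree_sequence A m (koszul A (koszul A M x1) z) zs"
    using Suc.IH[OF c1 seq _ z(3)] xs(2) by auto
  obtain g where g: "comparison_map A A (\<lambda>a. a) {\<one>} (koszul A (koszul A M x1) z) (koszul A (koszul A M z) x1) g"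
    using koszul_swap_iso[OF coh x1(2) z(1)] by blast
  have "regular_tree_sequence A m (koszul A (koszul A M z) x1) zs"
    by (rule iso_regular_sequence[OF g coherent_koszul[OF c1 z(1)] coherent_koszul[OF cz x1(2)] zs(2)])
  then have "regular_tree_sequence A m (koszul A M z) (x1 # zs)"
    using koszul_regular_swap[OF coh x1(1) z(2,3)] by simp
  moreover have "regular_element m (koszul A M z) y" by (rule koszul_regular_swap[OF coh y(1) z(2,4)])
  ultimately obtain ys where ys: "length ys = n" "regular_tree_sequence A m (koszul A (koszul A M z) y) ys"
    using Suc.IH[OF cz, of "x1 # zs" y] zs(1) by auto
  obtain g' where g': "comparison_map A A (\<lambda>a. a) {\<one>} (koszul A (koszul A M z) y) (koszul A (koszul A M y) z) g'"
    using koszul_swap_iso[OF coh z(1) y(2)] by blast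
  have "regular_tree_sequence A m (koszul A (koszul A M y) z) ys"
    by (rule iso_regular_sequence[OF g' coherent_koszul[OF cz y(2)] coherent_koszul[OF cy z(1)] ys(2)])
  then have "regular_tree_sequence A m (koszul A M y) (z # ys)" using z(4) by simp
  then show ?case using ys(1) by (intro exI[of _ "z # ys"]) simp
qed

end

section \<open>Localization of DG-rings\<close>

context dg_ring
begin

lemma graded_decomp_ex:
  assumes "x \<in> carrier A"
  obtains f F where "\<And>n. f n \<in> gr A n" "finite F" "{n. f n \<noteq> \<zero>} \<subseteq> F" "x = (\<Oplus>n\<in>F. f n)"
proof -
  obtain f where "graded_decomp A x f" using gr_direct_sum[OF assms] by blast
  then show thesis using that[of f "{n. f n \<noteq> \<zero>}"] unfolding graded_decomp_def by blast
qed

lemma graded_decompI: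
  assumes "\<And>n. f n \<in> gr A n" "finite F" "{n. f n \<noteq> \<zero>} \<subseteq> F" "x = (\<Oplus>n\<in>F. f n)"
  shows "graded_decomp A x f"
proof -
  have "(\<Oplus>n\<in>{n. f n \<noteq> \<zero>}. f n) = (\<Oplus>n\<in>F. f n)"
    using assms(1-3) gr_carrier by (intro add.finprod_mono_neutral_cong_left) auto
  then show ?thesis unfolding graded_decomp_def using assms finite_subset[OF assms(3,2)] by auto
qed

text \<open>Extends to all of \<open>A\<close> the identities that the axioms state for homogeneous
  elements only.\<close>

lemma graded_induct [consumes 1, case_names homogeneous add]:
  assumes "x \<in> carrier A" "\<And>n a. a \<in> gr A n \<Longrightarrow> P a"
    "\<And>a b. a \<in> carrier A \<Longrightarrow> b \<in> carrier A \<Longrightarrow> P a \<Longrightarrow> P b \<Longrightarrow> P (a \<oplus> b)"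
  shows "P x"
proof -
  obtain f F where f: "\<And>n. f n \<in> gr A n" "finite F" "x = (\<Oplus>n\<in>F. f n)"
    using graded_decomp_ex[OF assms(1)] by metis
  have "P (\<Oplus>n\<in>F. f n) \<and> (\<Oplus>n\<in>F. f n) \<in> carrier A"
    using f(2)
  proof (induction F rule: finite_induct)
    case empty
    then show ?case using assms(2)[OF gr_zero] by simp
  next
    case (insert n F)
    have "f n \<in> carrier A" for n using f(1) gr_carrier by blast
    then have "(\<Oplus>n\<in>insert n F. f n) = f n \<oplus> (\<Oplus>n\<in>F. f n)"
      using insert by (intro finsum_insert) auto
    then show ?case using insert assms(2)[OF f(1)] assms(3) \<open>\<And>n. f n \<in> carrier A\<close> by auto
  qed
  then show ?thesis using f(3) by simp
qed

lemma central0: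
  assumes "s \<in> gr A 0" "x \<in> carrier A"
  shows "x \<otimes> s = s \<otimes> x"
  using assms(2)
proof (induction rule: graded_induct)
  case (homogeneous n a)
  then show ?case using gr0_comm[OF assms(1)] by blast
next
  case (add a b)
  then show ?case using gr_carrier[OF assms(1)] by (simp add: l_distr r_distr)
qed

lemma dif_carrier: "x \<in> carrier A \<Longrightarrow> dif A x \<in> carrier A"
  by (induction rule: graded_induct) (use dif_gr gr_carrier dif_add in \<open>blast, auto\<close>)

lemma dif_scale:
  assumes "s \<in> gr A 0" "x \<in> carrier A"
  shows "dif A (s \<otimes> x) = s \<otimes> dif A x"
  using assms(2)
proof (induction rule: graded_induct)
  case (homogeneous n a)
  then show ?case using dif_gr0_mult[OF assms(1)] by blast
next
  case (add a b)
  then show ?case using gr_carrier[OF assms(1)] dif_carrier by (simp add: r_distr dif_add)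
qed

definition component :: "int \<Rightarrow> 'a \<Rightarrow> 'a" where
  "component n x = (THE f. graded_decomp A x f) n"

lemma component_eq:
  assumes "graded_decomp A x f" "x \<in> carrier A"
  shows "component n x = f n"
  unfolding component_def using gr_direct_sum[OF assms(2)] assms(1) by (metis the1_equality)

lemma component_add:
  assumes "x \<in> carrier A" "y \<in> carrier A"
  shows "component n (x \<oplus> y) = component n x \<oplus> component n y"
proof -
  obtain f g where f: "graded_decomp A x f" and g: "graded_decomp A y g"
    using gr_direct_sum assms by metis
  let ?F = "{n. f n \<noteq> \<zero>} \<union> {n. g n \<noteq> \<zero>}"
  have fg: "f n \<in> gr A n" "g n \<in> gr A n" "f n \<in> carrier A" "g n \<in> carrier A" for n
    using f g gr_carrier unfolding graded_decomp_def by blast+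
  have fin: "finite ?F" using f g unfolding graded_decomp_def by blast
  have "x = (\<Oplus>n\<in>?F. f n)" "y = (\<Oplus>n\<in>?F. g n)"
    using f g fg fin unfolding graded_decomp_def
    by (auto intro!: add.finprod_mono_neutral_cong_left)
  then have "x \<oplus> y = (\<Oplus>n\<in>?F. f n \<oplus> g n)"
    using fg by (simp add: finsum_addf)
  then have "graded_decomp A (x \<oplus> y) (\<lambda>n. f n \<oplus> g n)"
    using fg gr_add by (intro graded_decompI[OF _ fin]) auto
  then show ?thesis using component_eq f g assms by simp
qed

lemma component_scale:
  assumes "s \<in> gr A 0" "x \<in> carrier A"
  shows "component n (s \<otimes> x) = s \<otimes> component n x"
proof -
  obtain f where f: "graded_decomp A x f" using gr_direct_sum assms by metis
  have fg: "f n \<in> gr A n" "f n \<in> carrier A" for n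
    using f gr_carrier unfolding graded_decomp_def by blast+
  have sc: "s \<in> carrier A" using gr_carrier assms by blast
  have fin: "finite {n. f n \<noteq> \<zero>}" and x: "x = (\<Oplus>n\<in>{n. f n \<noteq> \<zero>}. f n)"
    using f unfolding graded_decomp_def by blast+
  have "s \<otimes> x = (\<Oplus>n\<in>{n. f n \<noteq> \<zero>}. s \<otimes> f n)"
    by (subst x) (use fg sc fin in \<open>auto intro!: finsum_rdistr\<close>)
  then have "graded_decomp A (s \<otimes> x) (\<lambda>n. s \<otimes> f n)"
    using fg sc gr0_mult[OF assms(1)] by (intro graded_decompI[OF _ fin]) auto
  then show ?thesis using component_eq[OF _ ring.ring_simprules(5)] component_eq[OF f] assms sc by (simp add: component_eq)
qed

lemma component_gr:
  assumes "a \<in> gr A m"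
  shows "component n a = (if n = m then a else \<zero>)"
proof -
  have "graded_decomp A a (\<lambda>n. if n = m then a else \<zero>)"
    using assms gr_zero gr_carrier[OF assms] by (intro graded_decompI[where F = "{m}"]) auto
  then show ?thesis using component_eq gr_carrier[OF assms] by simp
qed

lemma component_carrier: "x \<in> carrier A \<Longrightarrow> component n x \<in> carrier A"
  by (induction rule: graded_induct) (auto simp: component_gr component_add gr_carrier)

end

section \<open>Fractions with denominators in degree zero\<close>

locale dg_localization = dg_ring A for A :: "('a, 'b) cochain_scheme" (structure) +
  fixes S :: "'a set"
  assumes S_gr: "S \<subseteq> gr A 0" and S_one: "\<one> \<in> S"
    and S_mult: "s \<in> S \<Longrightarrow> t \<in> S \<Longrightarrow> s \<otimes> t \<in> S"
begin

abbreviation L :: "('a \<times> 'a) set cochain" where "L \<equiv> localization A S"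
abbreviation fr :: "'a \<Rightarrow> 'a \<Rightarrow> ('a \<times> 'a) set" where "fr \<equiv> fraction A S"

lemma S_gr0 [simp]: "s \<in> S \<Longrightarrow> s \<in> gr A 0" using S_gr by auto
lemma S_carrier [simp]: "s \<in> S \<Longrightarrow> s \<in> carrier A" using S_gr0 gr_carrier by blast

text \<open>Multiplication in \<open>A\<close> is commutative only up to sign, so rewriting modulo
  commutativity is restricted to factors from \<open>S\<close>.\<close>

lemma lcomm0: "s \<in> S \<Longrightarrow> t \<in> S \<Longrightarrow> x \<in> carrier A \<Longrightarrow> s \<otimes> (t \<otimes> x) = t \<otimes> (s \<otimes> x)"
  using central0[of s t] by (simp flip: m_assoc)

lemma comm0: "s \<in> S \<Longrightarrow> t \<in> S \<Longrightarrow> s \<otimes> t = t \<otimes> s"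
  using central0[of s t] by simp

lemmas ac0 = m_assoc lcomm0 comm0

lemma fr_mem: "(b, t) \<in> fr a s \<longleftrightarrow> b \<in> carrier A \<and> t \<in> S \<and> (\<exists>u\<in>S. u \<otimes> (t \<otimes> a) = u \<otimes> (s \<otimes> b))"
  by (simp add: fraction_def)

lemma fr_self: "a \<in> carrier A \<Longrightarrow> s \<in> S \<Longrightarrow> (a, s) \<in> fr a s"
  using S_one by (auto simp: fr_mem)

text \<open>Transitivity of equality of fractions: the factor
  \<open>u \<otimes> (v \<otimes> t)\<close> makes both given relations applicable.\<close>

lemma fr_trans:
  assumes "a \<in> carrier A" "b \<in> carrier A" "c \<in> carrier A" "s \<in> S" "t \<in> S" "r \<in> S" "u \<in> S" "v \<in> S"
    and "u \<otimes> (t \<otimes> a) = u \<otimes> (s \<otimes> b)" "v \<otimes> (r \<otimes> b) = v \<otimes> (t \<otimes> c)"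
  shows "(u \<otimes> (v \<otimes> t)) \<otimes> (r \<otimes> a) = (u \<otimes> (v \<otimes> t)) \<otimes> (s \<otimes> c)"
proof -
  have "(u \<otimes> (v \<otimes> t)) \<otimes> (r \<otimes> a) = v \<otimes> (r \<otimes> (u \<otimes> (t \<otimes> a)))"
    using assms(1-8) S_mult by (simp add: ac0)
  also have "\<dots> = u \<otimes> (s \<otimes> (v \<otimes> (r \<otimes> b)))"
    unfolding assms(9) using assms(1-8) by (simp add: ac0)
  also have "\<dots> = (u \<otimes> (v \<otimes> t)) \<otimes> (s \<otimes> c)"
    unfolding assms(10) using assms(1-8) S_mult by (simp add: ac0)
  finally show ?thesis .
qed

lemma fr_eq_iff:
  assumes "a \<in> carrier A" "b \<in> carrier A" "s \<in> S" "t \<in> S"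
  shows "fr a s = fr b t \<longleftrightarrow> (\<exists>u\<in>S. u \<otimes> (t \<otimes> a) = u \<otimes> (s \<otimes> b))"
proof
  assume "fr a s = fr b t"
  then have "(b, t) \<in> fr a s" using fr_self assms by blast
  then show "\<exists>u\<in>S. u \<otimes> (t \<otimes> a) = u \<otimes> (s \<otimes> b)" by (simp add: fr_mem)
next
  assume "\<exists>u\<in>S. u \<otimes> (t \<otimes> a) = u \<otimes> (s \<otimes> b)"
  then obtain u where u: "u \<in> S" "u \<otimes> (t \<otimes> a) = u \<otimes> (s \<otimes> b)" by blast
  have "(c, r) \<in> fr a s \<longleftrightarrow> (c, r) \<in> fr b t" for c r
  proof
    assume "(c, r) \<in> fr b t"
    then obtain v where v: "c \<in> carrier A" "r \<in> S" "v \<in> S" "v \<otimes> (r \<otimes> b) = v \<otimes> (t \<otimes> c)" by (auto simp: fr_mem)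
    have "(u \<otimes> (v \<otimes> t)) \<otimes> (r \<otimes> a) = (u \<otimes> (v \<otimes> t)) \<otimes> (s \<otimes> c)"
      using fr_trans[OF assms(1,2) v(1) assms(3,4) v(2) u(1) v(3) u(2) v(4)] .
    moreover have "u \<otimes> (v \<otimes> t) \<in> S" using S_mult u v assms by blast
    ultimately show "(c, r) \<in> fr a s" using v by (auto simp: fr_mem)
  next
    assume "(c, r) \<in> fr a s"
    then obtain v where v: "c \<in> carrier A" "r \<in> S" "v \<in> S" "v \<otimes> (r \<otimes> a) = v \<otimes> (s \<otimes> c)" by (auto simp: fr_mem)
    have "(u \<otimes> (v \<otimes> s)) \<otimes> (r \<otimes> b) = (u \<otimes> (v \<otimes> s)) \<otimes> (t \<otimes> c)"
      using fr_trans[OF assms(2,1) v(1) assms(4,3) v(2) u(1) v(3) u(2)[symmetric] v(4)] .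
    moreover have "u \<otimes> (v \<otimes> s) \<in> S" using S_mult u v assms by blast
    ultimately show "(c, r) \<in> fr b t" using v by (auto simp: fr_mem)
  qed
  then show "fr a s = fr b t" by auto
qed

lemma fr_eqI:
  "a \<in> carrier A \<Longrightarrow> b \<in> carrier A \<Longrightarrow> s \<in> S \<Longrightarrow> t \<in> S \<Longrightarrow> t \<otimes> a = s \<otimes> b \<Longrightarrow> fr a s = fr b t"
  using S_one by (subst fr_eq_iff) auto

lemma fr_memD:
  assumes "(b, t) \<in> fr a s" "a \<in> carrier A" "s \<in> S"
  shows "b \<in> carrier A" "t \<in> S" "fr b t = fr a s"
proof -
  show bt: "b \<in> carrier A" "t \<in> S" using assms by (auto simp: fr_mem)
  show "fr b t = fr a s"
    using fr_eq_iff[OF assms(2) bt(1) assms(3) bt(2)] assms(1) by (auto simp: fr_mem)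
qed

lemma fr_cancel: "a \<in> carrier A \<Longrightarrow> s \<in> S \<Longrightarrow> t \<in> S \<Longrightarrow> fr (t \<otimes> a) (t \<otimes> s) = fr a s"
  using S_mult by (intro fr_eqI) (auto simp: ac0)

lemma L_carrierE:
  assumes "X \<in> carrier L" obtains a s where "a \<in> carrier A" "s \<in> S" "X = fr a s"
  using assms by (auto simp: localization_def)

lemma L_grE:
  assumes "X \<in> gr L n" obtains a s where "a \<in> gr A n" "s \<in> S" "X = fr a s"
  using assms by (auto simp: localization_def)

lemma fr_carrier: "a \<in> carrier A \<Longrightarrow> s \<in> S \<Longrightarrow> fr a s \<in> carrier L"
  by (auto simp: localization_def)

lemma fr_gr: "a \<in> gr A n \<Longrightarrow> s \<in> S \<Longrightarrow> fr a s \<in> gr L n"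
  by (auto simp: localization_def)

lemma L_one: "\<one>\<^bsub>L\<^esub> = fr \<one> \<one>" and L_zero: "\<zero>\<^bsub>L\<^esub> = fr \<zero> \<one>"
  by (simp_all add: localization_def)

lemma fr_zero: "s \<in> S \<Longrightarrow> fr \<zero> s = \<zero>\<^bsub>L\<^esub>"
  unfolding L_zero using S_one by (intro fr_eqI) auto

lemma fr_one: "s \<in> S \<Longrightarrow> fr s s = \<one>\<^bsub>L\<^esub>"
  unfolding L_one using S_one by (intro fr_eqI) auto

text \<open>The operations on fractions are unions over all representatives. Such a union collapses
  as soon as every representative gives the same value.\<close>

lemma UNION_fr:
  assumes "a \<in> carrier A" "s \<in> S"
    and "\<And>b t. (b, t) \<in> fr a s \<Longrightarrow> g b t = X"
  shows "(\<Union>(b, t)\<in>fr a s. g b t) = X"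
  using fr_self[OF assms(1,2)] assms(3) by blast

lemma fr_mult:
  assumes a: "a \<in> carrier A" "s \<in> S" and b: "b \<in> carrier A" "t \<in> S"
  shows "fr a s \<otimes>\<^bsub>L\<^esub> fr b t = fr (a \<otimes> b) (s \<otimes> t)"
proof -
  have "fr (a' \<otimes> b') (s' \<otimes> t') = fr (a \<otimes> b) (s \<otimes> t)"
    if a': "(a', s') \<in> fr a s" and b': "(b', t') \<in> fr b t" for a' s' b' t'
  proof -
    obtain u where u: "u \<in> S" "u \<otimes> (s' \<otimes> a) = u \<otimes> (s \<otimes> a')" using a' by (auto simp: fr_mem)
    obtain v where v: "v \<in> S" "v \<otimes> (t' \<otimes> b) = v \<otimes> (t \<otimes> b')" using b' by (auto simp: fr_mem)
    note c = fr_memD(1,2)[OF a' a] fr_memD(1,2)[OF b' b]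
    have quad: "(u \<otimes> v) \<otimes> ((p \<otimes> q) \<otimes> (x \<otimes> y)) = (u \<otimes> (p \<otimes> x)) \<otimes> (v \<otimes> (q \<otimes> y))"
      if "p \<in> S" "q \<in> S" "x \<in> carrier A" "y \<in> carrier A" for p q x y
    proof -
      have "(u \<otimes> (p \<otimes> x)) \<otimes> (v \<otimes> (q \<otimes> y)) = u \<otimes> (p \<otimes> ((x \<otimes> (v \<otimes> q)) \<otimes> y))"
        using that u v by (simp add: m_assoc)
      \<comment> \<open>\<open>x\<close> is an arbitrary element of \<open>A\<close>, so this
        interchange relies on the centrality of degree zero.\<close>
      also have "x \<otimes> (v \<otimes> q) = (v \<otimes> q) \<otimes> x"
        using central0[of "v \<otimes> q" x] S_mult[OF v(1) that(2)] that by simp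
      also have "u \<otimes> (p \<otimes> (((v \<otimes> q) \<otimes> x) \<otimes> y)) = (u \<otimes> v) \<otimes> ((p \<otimes> q) \<otimes> (x \<otimes> y))"
        using that u v by (simp add: ac0)
      finally show ?thesis by simp
    qed
    have "(u \<otimes> v) \<otimes> ((s \<otimes> t) \<otimes> (a' \<otimes> b')) = (u \<otimes> v) \<otimes> ((s' \<otimes> t') \<otimes> (a \<otimes> b))"
      using quad[of s t a' b'] quad[of s' t' a b] u v a b c by simp
    then show ?thesis
      using fr_eq_iff[of "a' \<otimes> b'" "a \<otimes> b" "s' \<otimes> t'" "s \<otimes> t"] a b c S_mult u(1) v(1) by auto
  qed
  then have "(\<Union>(a', s')\<in>fr a s. \<Union>(b', t')\<in>fr b t. fr (a' \<otimes> b') (s' \<otimes> t')) = fr (a \<otimes> b) (s \<otimes> t)"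
    by (intro UNION_fr a b) auto
  then show ?thesis by (simp add: localization_def)
qed

lemma fr_add_general:
  assumes a: "a \<in> carrier A" "s \<in> S" and b: "b \<in> carrier A" "t \<in> S"
  shows "fr a s \<oplus>\<^bsub>L\<^esub> fr b t = fr (t \<otimes> a \<oplus> s \<otimes> b) (s \<otimes> t)"
proof -
  have "fr (t' \<otimes> a' \<oplus> s' \<otimes> b') (s' \<otimes> t') = fr (t \<otimes> a \<oplus> s \<otimes> b) (s \<otimes> t)"
    if a': "(a', s') \<in> fr a s" and b': "(b', t') \<in> fr b t" for a' s' b' t'
  proof -
    obtain u where u: "u \<in> S" "u \<otimes> (s' \<otimes> a) = u \<otimes> (s \<otimes> a')" using a' by (auto simp: fr_mem)
    obtain v where v: "v \<in> S" "v \<otimes> (t' \<otimes> b) = v \<otimes> (t \<otimes> b')" using b' by (auto simp: fr_mem)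
    note c = fr_memD(1,2)[OF a' a] fr_memD(1,2)[OF b' b]
    have "(u \<otimes> v) \<otimes> ((s \<otimes> t) \<otimes> (t' \<otimes> a' \<oplus> s' \<otimes> b')) =
        v \<otimes> (t \<otimes> (t' \<otimes> (u \<otimes> (s \<otimes> a')))) \<oplus> u \<otimes> (s \<otimes> (s' \<otimes> (v \<otimes> (t \<otimes> b'))))"
      using a b c u v by (simp add: ac0 r_distr)
    also have "\<dots> = (u \<otimes> v) \<otimes> ((s' \<otimes> t') \<otimes> (t \<otimes> a \<oplus> s \<otimes> b))"
      unfolding u(2)[symmetric] v(2)[symmetric] using a b c u(1) v(1) by (simp add: ac0 r_distr)
    finally show ?thesis
      using fr_eq_iff[of "t' \<otimes> a' \<oplus> s' \<otimes> b'" "t \<otimes> a \<oplus> s \<otimes> b" "s' \<otimes> t'" "s \<otimes> t"] a b c S_mult u(1) v(1) by auto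
  qed
  then have "(\<Union>(a', s')\<in>fr a s. \<Union>(b', t')\<in>fr b t. fr (t' \<otimes> a' \<oplus> s' \<otimes> b') (s' \<otimes> t')) =
      fr (t \<otimes> a \<oplus> s \<otimes> b) (s \<otimes> t)"
    by (intro UNION_fr a b) auto
  then show ?thesis by (simp add: localization_def)
qed

lemma fr_add:
  assumes "a \<in> carrier A" "b \<in> carrier A" "s \<in> S"
  shows "fr a s \<oplus>\<^bsub>L\<^esub> fr b s = fr (a \<oplus> b) s"
  using fr_add_general[of a s b s] fr_cancel[of "a \<oplus> b" s s] assms by (simp add: r_distr)

lemma fr_dif:
  assumes a: "a \<in> carrier A" "s \<in> S"
  shows "dif L (fr a s) = fr (dif A a) s"
proof -
  have "fr (dif A a') s' = fr (dif A a) s" if a': "(a', s') \<in> fr a s" for a' s'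
  proof -
    obtain u where u: "u \<in> S" "u \<otimes> (s' \<otimes> a) = u \<otimes> (s \<otimes> a')" using a' by (auto simp: fr_mem)
    note c = fr_memD(1,2)[OF a' a]
    have "dif A (u \<otimes> (s' \<otimes> a)) = dif A (u \<otimes> (s \<otimes> a'))" using u by simp
    then have "u \<otimes> (s \<otimes> dif A a') = u \<otimes> (s' \<otimes> dif A a)" using a c u(1) by (simp add: dif_scale)
    then have "\<exists>u\<in>S. u \<otimes> (s \<otimes> dif A a') = u \<otimes> (s' \<otimes> dif A a)" using u(1) by (rule bexI)
    then show ?thesis
      using fr_eq_iff[of "dif A a'" "dif A a" s' s] a c dif_carrier by simp
  qed
  then have "(\<Union>(a', s')\<in>fr a s. fr (dif A a') s') = fr (dif A a) s" by (intro UNION_fr a) auto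
  then show ?thesis by (simp add: localization_def)
qed

lemma common_denominator:
  assumes "X \<in> carrier L" "Y \<in> carrier L"
  obtains a b s where "a \<in> carrier A" "b \<in> carrier A" "s \<in> S" "X = fr a s" "Y = fr b s"
proof -
  obtain a s where a: "a \<in> carrier A" "s \<in> S" "X = fr a s" using assms(1) by (rule L_carrierE)
  obtain b t where b: "b \<in> carrier A" "t \<in> S" "Y = fr b t" using assms(2) by (rule L_carrierE)
  have "X = fr (t \<otimes> a) (t \<otimes> s)" "Y = fr (s \<otimes> b) (t \<otimes> s)"
    using a b fr_cancel[of a s t] fr_cancel[of b t s] comm0[of s t] by auto
  then show thesis using that[of "t \<otimes> a" "s \<otimes> b" "t \<otimes> s"] a b S_mult by auto
qed

lemma common_denominator_gr:
  assumes "X \<in> gr L n" "Y \<in> gr L k"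
  obtains a b s where "a \<in> gr A n" "b \<in> gr A k" "s \<in> S" "X = fr a s" "Y = fr b s"
proof -
  obtain a s where a: "a \<in> gr A n" "s \<in> S" "X = fr a s" using assms(1) by (rule L_grE)
  obtain b t where b: "b \<in> gr A k" "t \<in> S" "Y = fr b t" using assms(2) by (rule L_grE)
  have "X = fr (t \<otimes> a) (t \<otimes> s)" "Y = fr (s \<otimes> b) (t \<otimes> s)"
    using a b gr_carrier fr_cancel[of a s t] fr_cancel[of b t s] comm0[of s t] by auto
  then show thesis using that[of "t \<otimes> a" "s \<otimes> b" "t \<otimes> s"] a b S_mult gr0_mult by auto
qed

lemma L_gr_carrier: "X \<in> gr L n \<Longrightarrow> X \<in> carrier L"
  by (metis L_grE fr_carrier gr_carrier)

lemma L_abelian_group: "abelian_group L"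
proof (rule abelian_groupI)
  fix X Y assume X: "X \<in> carrier L" and Y: "Y \<in> carrier L"
  obtain a b s where ab: "a \<in> carrier A" "b \<in> carrier A" "s \<in> S" "X = fr a s" "Y = fr b s"
    using common_denominator[OF X Y] by metis
  show "X \<oplus>\<^bsub>L\<^esub> Y \<in> carrier L" using ab by (simp add: fr_add fr_carrier)
  show "X \<oplus>\<^bsub>L\<^esub> Y = Y \<oplus>\<^bsub>L\<^esub> X" using ab by (simp add: fr_add a_comm)
  fix Z assume Z: "Z \<in> carrier L"
  obtain c t where c: "c \<in> carrier A" "t \<in> S" "Z = fr c t" using Z by (rule L_carrierE)
  have "X = fr (t \<otimes> a) (t \<otimes> s)" "Y = fr (t \<otimes> b) (t \<otimes> s)" "Z = fr (s \<otimes> c) (t \<otimes> s)"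
    using ab c fr_cancel[of a s t] fr_cancel[of b s t] fr_cancel[of c t s] comm0[of s t] by auto
  then show "(X \<oplus>\<^bsub>L\<^esub> Y) \<oplus>\<^bsub>L\<^esub> Z = X \<oplus>\<^bsub>L\<^esub> (Y \<oplus>\<^bsub>L\<^esub> Z)"
    using ab c S_mult by (simp add: fr_add a_assoc)
next
  show "\<zero>\<^bsub>L\<^esub> \<in> carrier L" unfolding L_zero using S_one by (simp add: fr_carrier)
  fix X assume "X \<in> carrier L"
  then obtain a s where a: "a \<in> carrier A" "s \<in> S" "X = fr a s" by (rule L_carrierE)
  show "\<zero>\<^bsub>L\<^esub> \<oplus>\<^bsub>L\<^esub> X = X" using a by (simp add: fr_zero[OF a(2), symmetric] fr_add)
  show "\<exists>Y\<in>carrier L. Y \<oplus>\<^bsub>L\<^esub> X = \<zero>\<^bsub>L\<^esub>"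
    by (rule bexI[of _ "fr (\<ominus> a) s"]) (use a in \<open>auto simp: fr_add l_neg fr_zero fr_carrier\<close>)
qed

lemma L_ring: "ring L"
proof (rule ringI)
  show "abelian_group L" by (rule L_abelian_group)
  show "monoid L"
  proof (rule monoidI)
    fix X Y assume "X \<in> carrier L" "Y \<in> carrier L"
    then show "X \<otimes>\<^bsub>L\<^esub> Y \<in> carrier L"
      by (metis L_carrierE fr_mult fr_carrier m_closed S_mult)
  next
    show "\<one>\<^bsub>L\<^esub> \<in> carrier L" unfolding L_one using S_one by (simp add: fr_carrier)
    fix X assume X: "X \<in> carrier L"
    then obtain a s where a: "a \<in> carrier A" "s \<in> S" "X = fr a s" by (rule L_carrierE)
    show "\<one>\<^bsub>L\<^esub> \<otimes>\<^bsub>L\<^esub> X = X" "X \<otimes>\<^bsub>L\<^esub> \<one>\<^bsub>L\<^esub> = X" unfolding L_one using a S_one by (simp_all add: fr_mult)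
    fix Y Z assume Y: "Y \<in> carrier L" and Z: "Z \<in> carrier L"
    obtain b t where b: "b \<in> carrier A" "t \<in> S" "Y = fr b t" using Y by (rule L_carrierE)
    obtain c r where c: "c \<in> carrier A" "r \<in> S" "Z = fr c r" using Z by (rule L_carrierE)
    show "(X \<otimes>\<^bsub>L\<^esub> Y) \<otimes>\<^bsub>L\<^esub> Z = X \<otimes>\<^bsub>L\<^esub> (Y \<otimes>\<^bsub>L\<^esub> Z)"
      using a b c S_mult by (simp add: fr_mult m_assoc)
  qed
  fix X Y Z assume X: "X \<in> carrier L" and Y: "Y \<in> carrier L" and Z: "Z \<in> carrier L"
  obtain a b s where ab: "a \<in> carrier A" "b \<in> carrier A" "s \<in> S" "X = fr a s" "Y = fr b s"
    using common_denominator[OF X Y] by metis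
  obtain c t where c: "c \<in> carrier A" "t \<in> S" "Z = fr c t" using Z by (rule L_carrierE)
  show "(X \<oplus>\<^bsub>L\<^esub> Y) \<otimes>\<^bsub>L\<^esub> Z = X \<otimes>\<^bsub>L\<^esub> Z \<oplus>\<^bsub>L\<^esub> Y \<otimes>\<^bsub>L\<^esub> Z"
    using ab c S_mult by (simp add: fr_add fr_mult l_distr)
  show "Z \<otimes>\<^bsub>L\<^esub> (X \<oplus>\<^bsub>L\<^esub> Y) = Z \<otimes>\<^bsub>L\<^esub> X \<oplus>\<^bsub>L\<^esub> Z \<otimes>\<^bsub>L\<^esub> Y"
    using ab c S_mult by (simp add: fr_add fr_mult r_distr)
qed

lemma fr_neg:
  assumes "a \<in> carrier A" "s \<in> S" shows "\<ominus>\<^bsub>L\<^esub> fr a s = fr (\<ominus> a) s"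
  by (rule abelian_group.minus_equality[OF L_abelian_group])
    (use assms in \<open>simp_all add: fr_add fr_carrier l_neg fr_zero\<close>)

lemma fr_koszul_sign:
  assumes "a \<in> carrier A" "s \<in> S" shows "koszul_sign L i (fr a s) = fr (koszul_sign A i a) s"
  using assms by (simp add: koszul_sign_def fr_neg)

lemma fr_finsum:
  assumes "finite F" "\<And>n. f n \<in> carrier A" "s \<in> S"
  shows "fr (\<Oplus>n\<in>F. f n) s = (\<Oplus>\<^bsub>L\<^esub>n\<in>F. fr (f n) s)"
  using assms(1)
proof (induction F rule: finite_induct)
  case empty
  interpret L: ring L by (rule L_ring)
  show ?case using assms by (simp add: fr_zero)
next
  case (insert n F)
  interpret L: ring L by (rule L_ring)
  have "(\<Oplus>n\<in>insert n F. f n) = f n \<oplus> (\<Oplus>n\<in>F. f n)"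
    using insert assms by (intro finsum_insert) auto
  moreover have "(\<Oplus>\<^bsub>L\<^esub>n\<in>insert n F. fr (f n) s) = fr (f n) s \<oplus>\<^bsub>L\<^esub> (\<Oplus>\<^bsub>L\<^esub>n\<in>F. fr (f n) s)"
    using insert assms fr_carrier by (intro L.finsum_insert) auto
  moreover have "(\<Oplus>n\<in>F. f n) \<in> carrier A" using assms by (intro finsum_closed) auto
  ultimately show ?case using insert.IH assms by (simp add: fr_add[symmetric])
qed

text \<open>The projection to degree n descends to fractions because it is linear over A^0. It
  determines the components of every decomposition and so gives uniqueness.\<close>

definition Lcomponent :: "int \<Rightarrow> ('a \<times> 'a) set \<Rightarrow> ('a \<times> 'a) set" where
  "Lcomponent n X = (\<Union>(a, s)\<in>X. fr (component n a) s)"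

lemma Lcomponent_fr:
  assumes a: "a \<in> carrier A" "s \<in> S"
  shows "Lcomponent n (fr a s) = fr (component n a) s"
  unfolding Lcomponent_def
proof (intro UNION_fr a)
  fix a' s' assume a': "(a', s') \<in> fr a s"
  obtain u where u: "u \<in> S" "u \<otimes> (s' \<otimes> a) = u \<otimes> (s \<otimes> a')" using a' by (auto simp: fr_mem)
  note c = fr_memD(1,2)[OF a' a]
  have "component n (u \<otimes> (s' \<otimes> a)) = component n (u \<otimes> (s \<otimes> a'))" using u by simp
  then have "u \<otimes> (s \<otimes> component n a') = u \<otimes> (s' \<otimes> component n a)" using a c u(1) by (simp add: component_scale)
  then have "\<exists>u\<in>S. u \<otimes> (s \<otimes> component n a') = u \<otimes> (s' \<otimes> component n a)" using u(1) by (rule bexI)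
  then show "fr (component n a') s' = fr (component n a) s"
    using fr_eq_iff[of "component n a'" "component n a" s' s] a c component_carrier by simp
qed

lemma L_gr_direct_sum:
  assumes X: "X \<in> carrier L"
  shows "\<exists>!f. graded_decomp L X f"
proof -
  interpret L: ring L by (rule L_ring)
  have unique: "f n = Lcomponent n X" if f: "graded_decomp L X f" for f n
  proof -
    have fg: "f n \<in> gr L n" "f n \<in> carrier L" for n
      using f L_gr_carrier unfolding graded_decomp_def by blast+
    have Lc: "Lcomponent n (f k) = (if n = k then f k else \<zero>\<^bsub>L\<^esub>)" for k
    proof -
      obtain a s where "a \<in> gr A k" "s \<in> S" "f k = fr a s" using fg(1)[of k] by (rule L_grE)
      then show ?thesis using gr_carrier by (simp add: Lcomponent_fr component_gr fr_zero)
    qed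
    have add: "Lcomponent n (Y \<oplus>\<^bsub>L\<^esub> Z) = Lcomponent n Y \<oplus>\<^bsub>L\<^esub> Lcomponent n Z"
      if YZ: "Y \<in> carrier L" "Z \<in> carrier L" for Y Z
    proof -
      obtain a b s where "a \<in> carrier A" "b \<in> carrier A" "s \<in> S" "Y = fr a s" "Z = fr b s"
        using common_denominator[OF YZ] by metis
      then show ?thesis by (simp add: fr_add Lcomponent_fr component_add component_carrier)
    qed
    have "Lcomponent n (\<Oplus>\<^bsub>L\<^esub>k\<in>F. f k) = (if n \<in> F then f n else \<zero>\<^bsub>L\<^esub>)" if "finite F" for F
      using that
    proof (induction F rule: finite_induct)
      case empty
      then show ?case
        using Lcomponent_fr[of \<zero> \<one> n] component_gr[OF gr_zero, of n 0] S_one by (simp add: fr_zero split: if_splits)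
    next
      case (insert k F)
      have "(\<Oplus>\<^bsub>L\<^esub>k\<in>insert k F. f k) = f k \<oplus>\<^bsub>L\<^esub> (\<Oplus>\<^bsub>L\<^esub>k\<in>F. f k)"
        using insert fg by (intro L.finsum_insert) auto
      moreover have "(\<Oplus>\<^bsub>L\<^esub>k\<in>F. f k) \<in> carrier L" using fg by (intro L.finsum_closed) auto
      ultimately show ?case using insert fg(2) by (auto simp: add Lc)
    qed
    from this[of "{n. f n \<noteq> \<zero>\<^bsub>L\<^esub>}"] show ?thesis using f unfolding graded_decomp_def by auto
  qed
  obtain x s where x: "x \<in> carrier A" "s \<in> S" "X = fr x s" using X by (rule L_carrierE)
  obtain f F where f: "\<And>n. f n \<in> gr A n" "finite F" "x = (\<Oplus>n\<in>F. f n)"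
    using graded_decomp_ex[OF x(1)] by metis
  have fc: "f n \<in> carrier A" for n using f(1) gr_carrier by blast
  \<comment> \<open>A decomposition is summed over its support, which can be smaller than
    \<open>F\<close>: a fraction may vanish although its numerator does not.\<close>
  define h where "h n = (if n \<in> F then fr (f n) s else \<zero>\<^bsub>L\<^esub>)" for n
  have hg: "h n \<in> gr L n" for n
    using fr_gr[OF f(1) x(2)] fr_gr[OF gr_zero x(2)] fr_zero[OF x(2)] by (simp add: h_def)
  have hc: "h n \<in> carrier L" for n using hg L_gr_carrier by blast
  have "X = (\<Oplus>\<^bsub>L\<^esub>n\<in>F. fr (f n) s)" unfolding x(3) f(3) by (rule fr_finsum[OF f(2) fc x(2)])
  also have "\<dots> = (\<Oplus>\<^bsub>L\<^esub>n\<in>F. h n)"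
    by (rule L.finsum_cong') (use hc in \<open>auto simp: h_def\<close>)
  also have "\<dots> = (\<Oplus>\<^bsub>L\<^esub>n\<in>{n. h n \<noteq> \<zero>\<^bsub>L\<^esub>}. h n)"
    by (rule L.add.finprod_mono_neutral_cong_right) (use f(2) hc in \<open>auto simp: h_def\<close>)
  finally have "X = (\<Oplus>\<^bsub>L\<^esub>n\<in>{n. h n \<noteq> \<zero>\<^bsub>L\<^esub>}. h n)" .
  moreover have "finite {n. h n \<noteq> \<zero>\<^bsub>L\<^esub>}"
    by (rule finite_subset[OF _ f(2)]) (auto simp: h_def)
  ultimately have "graded_decomp L X h" unfolding graded_decomp_def using hg by blast
  then show ?thesis using unique by (metis ext)
qed

lemma L_gr_subgroup: "additive_subgroup (gr L n) L"
proof (intro additive_subgroupI subgroup.intro)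
  show "gr L n \<subseteq> carrier (add_monoid L)" using L_gr_carrier by auto
  show "x \<otimes>\<^bsub>add_monoid L\<^esub> y \<in> gr L n" if xy: "x \<in> gr L n" "y \<in> gr L n" for x y
  proof -
    obtain a b s where "a \<in> gr A n" "b \<in> gr A n" "s \<in> S" "x = fr a s" "y = fr b s"
      using common_denominator_gr[OF xy] by metis
    then show ?thesis using gr_carrier gr_add by (simp add: fr_add fr_gr)
  qed
  show "\<one>\<^bsub>add_monoid L\<^esub> \<in> gr L n" using fr_gr[OF gr_zero S_one] by (simp add: L_zero)
  show "inv\<^bsub>add_monoid L\<^esub> x \<in> gr L n" if "x \<in> gr L n" for x
    using that gr_carrier by (auto elim!: L_grE simp: a_inv_def[symmetric] fr_neg fr_gr gr_neg)
qed

lemma L_gr_nonpos: "n > 0 \<Longrightarrow> gr L n = {\<zero>\<^bsub>L\<^esub>}"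
proof
  assume n: "n > 0"
  show "gr L n \<subseteq> {\<zero>\<^bsub>L\<^esub>}" using gr_nonpos[OF n] by (auto elim!: L_grE simp: fr_zero)
  show "{\<zero>\<^bsub>L\<^esub>} \<subseteq> gr L n" using fr_gr[OF gr_zero S_one] by (simp add: L_zero)
qed

lemma L_one_gr: "\<one>\<^bsub>L\<^esub> \<in> gr L 0"
  unfolding L_one by (rule fr_gr[OF one_gr S_one])

lemma
  assumes XY: "X \<in> gr L i" "Y \<in> gr L j"
  shows L_mult_gr: "X \<otimes>\<^bsub>L\<^esub> Y \<in> gr L (i + j)"
    and L_leibniz: "dif L (X \<otimes>\<^bsub>L\<^esub> Y) = dif L X \<otimes>\<^bsub>L\<^esub> Y \<oplus>\<^bsub>L\<^esub> koszul_sign L i (X \<otimes>\<^bsub>L\<^esub> dif L Y)"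
    and L_graded_comm: "Y \<otimes>\<^bsub>L\<^esub> X = koszul_sign L (i * j) (X \<otimes>\<^bsub>L\<^esub> Y)"
proof -
  obtain a b s where ab: "a \<in> gr A i" "b \<in> gr A j" "s \<in> S" "X = fr a s" "Y = fr b s"
    using common_denominator_gr[OF XY] by metis
  have c: "a \<in> carrier A" "b \<in> carrier A" "dif A a \<in> carrier A" "dif A b \<in> carrier A"
    using ab gr_carrier dif_carrier by blast+
  have ss: "s \<otimes> s \<in> S" using S_mult ab by blast
  show "X \<otimes>\<^bsub>L\<^esub> Y \<in> gr L (i + j)" using ab c ss mult_gr[OF ab(1,2)] by (simp add: fr_mult fr_gr)
  have kc: "koszul_sign A i (a \<otimes> dif A b) \<in> carrier A" using c by (simp add: koszul_sign_def)
  show "dif L (X \<otimes>\<^bsub>L\<^esub> Y) = dif L X \<otimes>\<^bsub>L\<^esub> Y \<oplus>\<^bsub>L\<^esub> koszul_sign L i (X \<otimes>\<^bsub>L\<^esub> dif L Y)"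
    using ab(3) c ss kc leibniz[OF ab(1,2)] unfolding ab(4,5)
    by (simp add: fr_mult fr_dif fr_koszul_sign fr_add)
  show "Y \<otimes>\<^bsub>L\<^esub> X = koszul_sign L (i * j) (X \<otimes>\<^bsub>L\<^esub> Y)"
    using ab(3) c ss unfolding ab(4,5) by (simp add: fr_mult fr_koszul_sign graded_comm[OF ab(1,2)])
qed

lemma L_dif_gr: "X \<in> gr L i \<Longrightarrow> dif L X \<in> gr L (i + 1)"
  by (elim L_grE) (use gr_carrier in \<open>simp add: fr_dif fr_gr dif_gr\<close>)

lemma L_odd_square: "X \<in> gr L i \<Longrightarrow> odd i \<Longrightarrow> X \<otimes>\<^bsub>L\<^esub> X = \<zero>\<^bsub>L\<^esub>"
  by (elim L_grE) (use gr_carrier S_mult in \<open>simp add: fr_mult odd_square fr_zero\<close>)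

lemma L_dif_dif: "X \<in> carrier L \<Longrightarrow> dif L (dif L X) = \<zero>\<^bsub>L\<^esub>"
  by (elim L_carrierE) (simp add: fr_dif dif_carrier dif_dif fr_zero)

lemma L_dif_add:
  assumes "X \<in> carrier L" "Y \<in> carrier L"
  shows "dif L (X \<oplus>\<^bsub>L\<^esub> Y) = dif L X \<oplus>\<^bsub>L\<^esub> dif L Y"
proof -
  obtain a b s where "a \<in> carrier A" "b \<in> carrier A" "s \<in> S" "X = fr a s" "Y = fr b s"
    using common_denominator[OF assms] by metis
  then show ?thesis by (simp add: fr_add fr_dif dif_add dif_carrier)
qed

lemma L_dg_ring: "dg_ring L"
  by (intro dg_ring.intro dg_ring_axioms.intro; fact L_ring L_gr_subgroup L_gr_direct_sum L_gr_nonpos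
      L_one_gr L_mult_gr L_dif_add L_dif_gr L_dif_dif L_leibniz L_graded_comm L_odd_square)

lemma L_base_change: "base_change A L (\<lambda>a. fr a \<one>) S"
proof (intro base_change.intro base_change_axioms.intro dg_ring_axioms L_dg_ring)
  show "fr a \<one> \<in> coboundaries L 0" if "a \<in> coboundaries A 0" for a
  proof -
    from that obtain b where b: "b \<in> gr A (-1)" "a = dif A b" by (auto simp: coboundaries_def)
    then show ?thesis using fr_dif[of b \<one>] gr_carrier fr_gr[OF b(1) S_one] S_one by (auto simp: coboundaries_def)
  qed
qed (use S_one S_mult S_gr gr_carrier in \<open>auto simp: fr_gr fr_add fr_mult L_one\<close>)

end

section \<open>A DG-ring as a complex over itself\<close>

lemma self_module_simps [simp]:
  "carrier (self_module A) = carrier A" "zero (self_module A) = zero A" "add (self_module A) = add A"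
  "gr (self_module A) = gr A" "dif (self_module A) = dif A" "act (self_module A) = mult A"
  by (simp_all add: self_module_def)

lemma leaf_module_simps [simp]:
  "carrier (leaf_module M) = Leaf ` carrier M" "zero (leaf_module M) = Leaf \<zero>\<^bsub>M\<^esub>"
  "add (leaf_module M) = (\<lambda>x y. Leaf (leaf x \<oplus>\<^bsub>M\<^esub> leaf y))" "gr (leaf_module M) = (\<lambda>n. Leaf ` gr M n)"
  "dif (leaf_module M) = (\<lambda>x. Leaf (dif M (leaf x)))" "act (leaf_module M) = (\<lambda>b x. Leaf (act M b (leaf x)))"
  by (simp_all add: leaf_module_def)

context dg_ring
begin

lemma self_module_abelian_group: "abelian_group (self_module A)"
  by (intro abelian_groupI) (auto simp: a_ac intro!: bexI[of _ "\<ominus> _"] l_neg)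

lemma self_module_neg: "x \<in> carrier A \<Longrightarrow> \<ominus>\<^bsub>self_module A\<^esub> x = \<ominus> x"
  by (rule abelian_group.minus_equality[OF self_module_abelian_group]) (auto simp: l_neg)

lemma self_module_complex: "dg_complex A (self_module A)"
proof (intro dg_complex.intro dg_complex_axioms.intro dg_ring_axioms self_module_abelian_group)
  fix b assume b: "b \<in> gr A (-1)"
  have bc: "b \<in> carrier A" using gr_carrier b by blast
  \<comment> \<open>Left multiplication by \<open>b\<close>. As \<open>b\<close> has odd degree,
    Leibniz gives d(b x) = d(b) x - b d(x), which is the homotopy formula.\<close>
  have "null_homotopy A (self_module A) (dif A b) (\<lambda>x. b \<otimes> x)"
    unfolding null_homotopy_def self_module_simps
  proof (intro allI ballI conjI)
    fix n x assume x: "x \<in> gr A n"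
    have c: "x \<in> carrier A" "dif A x \<in> carrier A" "dif A b \<in> carrier A"
      using gr_carrier x dif_gr b by blast+
    show "b \<otimes> x \<in> gr A (n - 1)" using mult_gr[OF b x] by simp
    show "dif A (b \<otimes> x) \<oplus> b \<otimes> dif A x = dif A b \<otimes> x"
      using leibniz[OF b x] c bc by (simp add: koszul_sign_def a_assoc l_neg)
    show "b \<otimes> (x \<oplus> y) = b \<otimes> x \<oplus> b \<otimes> y" if "y \<in> gr A n" for y
      using c bc gr_carrier[OF that] by (simp add: r_distr)
    show "b \<otimes> (a \<otimes> x) = a \<otimes> (b \<otimes> x)" if "a \<in> gr A 0" for a
      using central0[OF that bc] gr_carrier[OF that] c bc by (simp flip: m_assoc)
  qed
  then show "\<exists>h. null_homotopy A (self_module A) (dif A b) h" by blast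
qed (auto simp: gr_carrier gr_zero gr_add gr_neg self_module_neg dif_gr dif_add dif_dif gr0_mult
    r_distr l_distr m_assoc dif_gr0_mult)

lemma leaf_module_complex:
  assumes "dg_complex A M"
  shows "dg_complex A (leaf_module M)"
proof -
  interpret M: dg_complex A M by fact
  have ab: "abelian_group (leaf_module M)"
  proof (rule abelian_groupI)
    show "\<exists>y\<in>carrier (leaf_module M). y \<oplus>\<^bsub>leaf_module M\<^esub> x = \<zero>\<^bsub>leaf_module M\<^esub>"
      if "x \<in> carrier (leaf_module M)" for x
    proof -
      from that obtain u where "x = Leaf u" "u \<in> carrier M" by auto
      then show ?thesis by (intro bexI[of _ "Leaf (\<ominus>\<^bsub>M\<^esub> u)"]) (auto simp: M.M.l_neg)
    qed
  qed (auto simp: M.M.a_ac)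
  have neg: "\<ominus>\<^bsub>leaf_module M\<^esub> Leaf u = Leaf (\<ominus>\<^bsub>M\<^esub> u)" if "u \<in> carrier M" for u
    by (rule abelian_group.minus_equality[OF ab]) (use that in \<open>auto simp: M.M.l_neg\<close>)
  show ?thesis
  proof (intro dg_complex.intro dg_complex_axioms.intro dg_ring_axioms ab)
    fix b assume "b \<in> gr A (-1)"
    then obtain h where h: "null_homotopy A M (dif A b) h" using M.null_homotopic by blast
    have "null_homotopy A (leaf_module M) (dif A b) (\<lambda>x. Leaf (h (leaf x)))"
      using h unfolding null_homotopy_def by auto
    then show "\<exists>h. null_homotopy A (leaf_module M) (dif A b) h" by blast
  qed (auto simp: neg M.gr_carrier M.gr_zero M.gr_add M.gr_neg M.dif_gr M.dif_add M.dif_dif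
      M.act_gr M.act_add M.add_act M.mult_act M.one_act M.dif_act)
qed

lemma leaf_comparison:
  assumes "dg_complex A M"
  shows "comparison_map A A (\<lambda>a. a) {\<one>} M (leaf_module M) Leaf"
  by (rule inverse_comparison[where g = leaf])
    (auto intro!: chain_map.intro chain_map_axioms.intro unit_base_change assms leaf_module_complex)

end

lemma leaf_comparison_map:
  assumes "comparison_map A A' \<phi> T M M' f"
  shows "comparison_map A A' \<phi> T (leaf_module M) (leaf_module M') (\<lambda>u. Leaf (f (leaf u)))"
proof -
  interpret F: comparison_map A A' \<phi> T M M' f by fact
  have cob: "coboundaries (leaf_module M') n = Leaf ` coboundaries M' n" for n
    by (force simp: coboundaries_def)
  have coc: "cocycles (leaf_module M) n = Leaf ` cocycles M n" for n
    by (auto simp: cocycles_def)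
  show ?thesis
  proof (intro comparison_map.intro chain_map.intro chain_map_axioms.intro comparison_map_axioms.intro
      F.base_change_axioms F.A.leaf_module_complex F.A'.leaf_module_complex F.M.dg_complex_axioms F.M'.dg_complex_axioms)
    fix z n assume "z \<in> cocycles (leaf_module M) n" "Leaf (f (leaf z)) \<in> coboundaries (leaf_module M') n"
    then obtain w where w: "z = Leaf w" "w \<in> cocycles M n" "f w \<in> coboundaries M' n"
      by (auto simp: coboundaries_def cocycles_def)
    then obtain t where "t \<in> T" "act M t w \<in> coboundaries M n" using F.f_inj by blast
    then show "\<exists>t\<in>T. act (leaf_module M) t z \<in> coboundaries (leaf_module M) n"
      using w by (force simp: coboundaries_def)
  next
    fix z' n assume "z' \<in> cocycles (leaf_module M') n"
    then obtain w where w: "z' = Leaf w" "w \<in> cocycles M' n" by (auto simp: cocycles_def)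
    then obtain t z b where "t \<in> T" "z \<in> cocycles M n" "b \<in> coboundaries M' n"
      "f z = b \<oplus>\<^bsub>M'\<^esub> act M' (\<phi> t) w" using F.f_surj by blast
    moreover from this have "Leaf z \<in> cocycles (leaf_module M) n" "Leaf b \<in> coboundaries (leaf_module M') n"
      using coc[of n] cob[of n] by blast+
    ultimately show "\<exists>t\<in>T. \<exists>z\<in>cocycles (leaf_module M) n. \<exists>b\<in>coboundaries (leaf_module M') n.
        Leaf (f (leaf z)) = b \<oplus>\<^bsub>leaf_module M'\<^esub> act (leaf_module M') (\<phi> t) z'"
      using w by (intro bexI[of _ t] bexI[of _ "Leaf z"] bexI[of _ "Leaf b"]) auto
  qed (auto simp: F.f_gr F.f_dif F.f_add F.f_act)
qed

section \<open>Transfer of noetherian properties along a base change\<close>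

context base_change
begin

definition H0_map :: "'a set \<Rightarrow> 'c set" where
  "H0_map X = A'.rcls (\<phi> (SOME a. a \<in> X))"

lemma H0_map_rcls: "a \<in> gr A 0 \<Longrightarrow> H0_map (A.rcls a) = A'.rcls (\<phi> a)"
  unfolding H0_map_def using A.some_rcls[OF A.rcls_closed] by (intro rcls_cong) auto

lemma H0_map_hom: "ring_hom_ring (H0 A) (H0 A') H0_map"
proof (rule ring_hom_ringI)
  show "ring (H0 A)" "ring (H0 A')" using A.H0_cring A'.H0_cring by (simp_all add: cring_def)
  show "H0_map x \<in> carrier (H0 A')" if "x \<in> carrier (H0 A)" for x
    using that by (auto simp: A.H0_carrier H0_map_rcls A'.rcls_closed \<phi>_gr)
  show "H0_map \<one>\<^bsub>H0 A\<^esub> = \<one>\<^bsub>H0 A'\<^esub>"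
    using H0_map_rcls[OF A.one_gr] \<phi>_one A.rcls_hom(3)[OF A.gr_zero A.gr_zero]
      A'.rcls_hom(3)[OF A'.gr_zero A'.gr_zero] by simp
  fix x y assume "x \<in> carrier (H0 A)" "y \<in> carrier (H0 A)"
  then obtain a b where "a \<in> gr A 0" "b \<in> gr A 0" "x = A.rcls a" "y = A.rcls b" unfolding A.H0_carrier by blast
  then show "H0_map (x \<otimes>\<^bsub>H0 A\<^esub> y) = H0_map x \<otimes>\<^bsub>H0 A'\<^esub> H0_map y"
    "H0_map (x \<oplus>\<^bsub>H0 A\<^esub> y) = H0_map x \<oplus>\<^bsub>H0 A'\<^esub> H0_map y"
    by (simp_all add: A.rcls_hom(1,2)[symmetric] A'.rcls_hom(1,2)[symmetric] H0_map_rcls A.gr0_mult A.gr_add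
        \<phi>_mult \<phi>_add \<phi>_gr)
qed

text \<open>An ideal of H^0(A') is determined by its preimage in H^0(A), since each of its elements
  becomes the image of an element of H^0(A) after multiplication by a unit. So chains of ideals can
  be pulled back.\<close>

lemma H0_noetherian_transfer:
  assumes "noetherian_ring (H0 A)"
    and unit: "\<And>t. t \<in> T \<Longrightarrow> \<exists>y\<in>carrier (H0 A'). y \<otimes>\<^bsub>H0 A'\<^esub> A'.rcls (\<phi> t) = \<one>\<^bsub>H0 A'\<^esub>"
    and surj: "\<And>X. X \<in> carrier (H0 A') \<Longrightarrow> \<exists>t\<in>T. \<exists>a\<in>gr A 0. A'.rcls (\<phi> t) \<otimes>\<^bsub>H0 A'\<^esub> X = A'.rcls (\<phi> a)"
  shows "noetherian_ring (H0 A')"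
proof -
  interpret R: noetherian_ring "H0 A" by fact
  interpret R': cring "H0 A'" by (rule A'.H0_cring)
  interpret h: ring_hom_ring "H0 A" "H0 A'" H0_map by (rule H0_map_hom)
  define pull where "pull J = {r \<in> carrier (H0 A). H0_map r \<in> J}" for J
  have pull_inj: "X \<in> J" if J: "ideal J (H0 A')" and J': "ideal J' (H0 A')" "X \<in> J'" "pull J' \<subseteq> pull J" for J J' X
  proof -
    have Xc: "X \<in> carrier (H0 A')" using J' by (auto simp: R'.ideal_iff)
    obtain t a where t: "t \<in> T" and a: "a \<in> gr A 0" and e: "A'.rcls (\<phi> t) \<otimes>\<^bsub>H0 A'\<^esub> X = A'.rcls (\<phi> a)"
      using surj[OF Xc] by blast
    have tc: "A'.rcls (\<phi> t) \<in> carrier (H0 A')" using T_gr t by (intro A'.rcls_closed \<phi>_gr) auto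
    have "A'.rcls (\<phi> a) \<in> J'" using e J' tc by (metis R'.ideal_iff)
    then have "A.rcls a \<in> pull J'" using a by (simp add: pull_def H0_map_rcls A.rcls_closed)
    then have "A'.rcls (\<phi> a) \<in> J" using J'(3) a by (auto simp: pull_def H0_map_rcls)
    moreover obtain y where y: "y \<in> carrier (H0 A')" "y \<otimes>\<^bsub>H0 A'\<^esub> A'.rcls (\<phi> t) = \<one>\<^bsub>H0 A'\<^esub>"
      using unit[OF t] by blast
    ultimately have "y \<otimes>\<^bsub>H0 A'\<^esub> (A'.rcls (\<phi> t) \<otimes>\<^bsub>H0 A'\<^esub> X) \<in> J" using J e by (simp add: R'.ideal_iff)
    then show ?thesis using y Xc tc by (simp flip: R'.m_assoc)
  qed
  have pull_ideal: "ideal (pull J) (H0 A)" if "ideal J (H0 A')" for J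
    unfolding pull_def by (rule h.ideal_vimage[OF that])
  show ?thesis
  proof (rule R'.trivial_ideal_chain_imp_noetherian)
    fix C assume C: "C \<noteq> {}" "subset.chain {I. ideal I (H0 A')} C"
    have idC: "ideal J (H0 A')" if "J \<in> C" for J using C(2) that by (auto simp: subset_chain_def)
    have "subset.chain {I. ideal I (H0 A)} (pull ` C)"
      using C(2) pull_ideal idC unfolding subset_chain_def pull_def by (auto 0 3)
    then have "\<Union>(pull ` C) \<in> pull ` C" using C(1) by (intro R.ideal_chain_is_trivial) auto
    then obtain J where J: "J \<in> C" "\<Union>(pull ` C) = pull J" by auto
    have "J' \<subseteq> J" if "J' \<in> C" for J'
      using pull_inj[OF idC[OF J(1)] idC[OF that]] J(2) that by blast
    then have "\<Union>C = J" using J(1) by blast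
    then show "\<Union>C \<in> C" using J(1) by simp
  qed
qed

end

text \<open>The module version of the previous argument: a submodule of H^n(M') is recovered from
  its preimage in H^n(M), because denominators act invertibly.\<close>

lemma (in comparison_map) noetherian_transfer:
  assumes unit: "\<And>t. t \<in> T \<Longrightarrow> \<exists>y\<in>carrier (H0 A'). y \<otimes>\<^bsub>H0 A'\<^esub> A'.rcls (\<phi> t) = \<one>\<^bsub>H0 A'\<^esub>"
    and N: "noetherian_module (H0 A) (cohomology M n)"
  shows "noetherian_module (H0 A') (cohomology M' n)"
proof -
  interpret H: module "H0 A" "cohomology M n" by (rule M.cohomology_module)
  interpret H': module "H0 A'" "cohomology M' n" by (rule M'.cohomology_module)
  have hcls_f: "M'.hcls n (f z) = M'.hcls n (f w)" if zw: "z \<in> cocycles M n" "w \<in> cocycles M n" "M.hcls n z = M.hcls n w" for z w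
  proof -
    obtain b where b: "b \<in> coboundaries M n" "z = b \<oplus>\<^bsub>M\<^esub> w"
      using M.hcls_eq_iff[OF M.cocycle_carrier[OF zw(1)] M.cocycle_carrier[OF zw(2)]] zw(3) by blast
    have "f z = f b \<oplus>\<^bsub>M'\<^esub> f w"
      unfolding b(2) by (rule f_add[OF M.cocycle_gr[OF M.coboundary_cocycle[OF b(1)]] M.cocycle_gr[OF zw(2)]])
    then show ?thesis
      using M'.hcls_eq_iff[OF M'.cocycle_carrier[OF f_cocycle[OF zw(1)]] M'.cocycle_carrier[OF f_cocycle[OF zw(2)]]]
        f_coboundary[OF b(1)] by blast
  qed
  have "\<exists>n0. \<forall>k\<ge>n0. L' k = L' n0"
    if L': "\<forall>k. submodule (L' k) (H0 A') (cohomology M' n) \<and> L' k \<subseteq> L' (Suc k)" for L' :: "nat \<Rightarrow> _"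
  proof -
    have sL: "submodule (L' k) (H0 A') (cohomology M' n)" and Ls: "L' k \<subseteq> L' (Suc k)" for k using L' by auto
    note Lc = H'.submoduleD(1)[OF sL] and L0 = H'.submoduleD(2)[OF sL]
      and La = H'.submoduleD(3)[OF sL] and Lm = H'.submoduleD(4)[OF sL]
    have Lmono: "L' i \<subseteq> L' j" if "i \<le> j" for i j
      using that by (rule lift_Suc_mono_le[of L', OF Ls])
    define L where "L k = {M.hcls n z | z. z \<in> cocycles M n \<and> M'.hcls n (f z) \<in> L' k}" for k
    have "submodule (L k) (H0 A) (cohomology M n)" for k
      unfolding H.submodule_iff
    proof (intro conjI ballI)
      show "L k \<subseteq> carrier (cohomology M n)" by (auto simp: L_def M.cohomology_carrier)
      have "M'.hcls n (f \<zero>\<^bsub>M\<^esub>) \<in> L' k" using L0[of k] by (simp add: f_zero M'.cohomology_simps)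
      then show "\<zero>\<^bsub>cohomology M n\<^esub> \<in> L k"
        unfolding L_def M.cohomology_simps using M.cocycle_zero by blast
      fix X assume "X \<in> L k"
      then obtain z where z: "X = M.hcls n z" "z \<in> cocycles M n" "M'.hcls n (f z) \<in> L' k"
        unfolding L_def by auto
      {
        fix Y assume "Y \<in> L k"
        then obtain w where w: "Y = M.hcls n w" "w \<in> cocycles M n" "M'.hcls n (f w) \<in> L' k"
          unfolding L_def by auto
        have "M'.hcls n (f (z \<oplus>\<^bsub>M\<^esub> w)) \<in> L' k"
          using La[OF z(3) w(3)] f_add[OF M.cocycle_gr[OF z(2)] M.cocycle_gr[OF w(2)]]
            M'.hcls_add[OF M'.cocycle_carrier[OF f_cocycle[OF z(2)]] M'.cocycle_carrier[OF f_cocycle[OF w(2)]]]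
          by (simp add: M'.cohomology_simps)
        then show "X \<oplus>\<^bsub>cohomology M n\<^esub> Y \<in> L k"
          unfolding L_def z(1) w(1) M.cohomology_simps
            M.hcls_add[OF M.cocycle_carrier[OF z(2)] M.cocycle_carrier[OF w(2)]]
          using M.cocycle_add z(2) w(2) by blast
      }
      fix r assume "r \<in> carrier (H0 A)"
      then obtain b where b: "b \<in> gr A 0" "r = A.rcls b" unfolding A.H0_carrier by auto
      have "M'.hcls n (f (act M b z)) \<in> L' k"
        using Lm[OF A'.rcls_closed[OF \<phi>_gr[OF b(1)]] z(3)] f_act[OF b(1) M.cocycle_gr[OF z(2)]]
          M'.hcls_act[OF \<phi>_gr[OF b(1)] f_cocycle[OF z(2)]] by simp
      then show "r \<odot>\<^bsub>cohomology M n\<^esub> X \<in> L k"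
        unfolding z(1) b(2) M.hcls_act[OF b(1) z(2)] L_def using M.cocycle_act[OF b(1) z(2)] by blast
    qed
    moreover have "L k \<subseteq> L (Suc k)" for k using Ls unfolding L_def by blast
    ultimately obtain n0 where n0: "\<And>k. k \<ge> n0 \<Longrightarrow> L k = L n0"
      using N[unfolded noetherian_module_def, THEN conjunct2, THEN spec, of L] by auto
    have "L' k = L' n0" if k: "k \<ge> n0" for k
    proof
      show "L' n0 \<subseteq> L' k" using Lmono k by blast
      show "L' k \<subseteq> L' n0"
      proof
        fix X assume X: "X \<in> L' k"
        then have Xc: "X \<in> carrier (cohomology M' n)" using Lc by blast
        then obtain z' where z': "z' \<in> cocycles M' n" "X = M'.hcls n z'" unfolding M'.cohomology_carrier by blast
        obtain t z b where t: "t \<in> T" and z: "z \<in> cocycles M n" and b: "b \<in> coboundaries M' n"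
          and e: "f z = b \<oplus>\<^bsub>M'\<^esub> act M' (\<phi> t) z'" using f_surj[OF z'(1)] by blast
        note \<phi>t = \<phi>_gr[OF T_gr0[OF t]]
        have fz: "M'.hcls n (f z) = A'.rcls (\<phi> t) \<odot>\<^bsub>cohomology M' n\<^esub> X"
          unfolding z'(2) M'.hcls_act[OF \<phi>t z'(1)]
          using M'.hcls_eq_iff[OF M'.cocycle_carrier[OF f_cocycle[OF z]] M'.cocycle_carrier[OF M'.cocycle_act[OF \<phi>t z'(1)]]]
            b e by blast
        then have "M'.hcls n (f z) \<in> L' k" using Lm[OF A'.rcls_closed[OF \<phi>t] X] by simp
        then have "M.hcls n z \<in> L k" using z unfolding L_def by auto
        then have "M.hcls n z \<in> L n0" using n0[OF k] by simp
        then obtain w where w: "M.hcls n z = M.hcls n w" "w \<in> cocycles M n" "M'.hcls n (f w) \<in> L' n0"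
          unfolding L_def by auto
        then have tX: "A'.rcls (\<phi> t) \<odot>\<^bsub>cohomology M' n\<^esub> X \<in> L' n0" using fz hcls_f[OF z w(2,1)] by simp
        obtain y where y: "y \<in> carrier (H0 A')" "y \<otimes>\<^bsub>H0 A'\<^esub> A'.rcls (\<phi> t) = \<one>\<^bsub>H0 A'\<^esub>"
          using unit[OF t] by blast
        have "y \<odot>\<^bsub>cohomology M' n\<^esub> (A'.rcls (\<phi> t) \<odot>\<^bsub>cohomology M' n\<^esub> X) = X"
          using H'.smult_assoc1[OF y(1) A'.rcls_closed[OF \<phi>t] Xc] y(2) H'.smult_one[OF Xc] by simp
        then show "X \<in> L' n0" using Lm[OF y(1) tX] by simp
      qed
    qed
    then have "\<forall>k\<ge>n0. L' k = L' n0" by (intro allI impI)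
    then show ?thesis by (rule exI)
  qed
  then show ?thesis unfolding noetherian_module_def using H'.module_axioms by simp
qed

section \<open>Coherence of the DG-ring itself\<close>

context dg_ring
begin

lemma one_act_unit:
  "t \<in> {\<one>} \<Longrightarrow> \<exists>y\<in>carrier (H0 A). y \<otimes>\<^bsub>H0 A\<^esub> rcls t = \<one>\<^bsub>H0 A\<^esub>"
proof -
  interpret R: cring "H0 A" by (rule H0_cring)
  show "t \<in> {\<one>} \<Longrightarrow> \<exists>y\<in>carrier (H0 A). y \<otimes>\<^bsub>H0 A\<^esub> rcls t = \<one>\<^bsub>H0 A\<^esub>"
    using rcls_hom(3)[OF gr_zero gr_zero] R.one_closed by (intro bexI[of _ "\<one>\<^bsub>H0 A\<^esub>"]) auto
qed

text \<open>The definition of a noetherian DG-ring speaks of negative degrees. In degree zero the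
  submodules are ideals of H^0(A), and in positive degrees the cohomology is zero.\<close>

lemma self_cohomology_noetherian:
  assumes "noetherian_dg_ring A"
  shows "noetherian_module (H0 A) (cohomology (self_module A) i)"
proof -
  interpret M: dg_complex A "self_module A" by (rule self_module_complex)
  interpret R: noetherian_cring "H0 A"
    using assms H0_cring by (simp add: noetherian_cring_def noetherian_dg_ring_def)
  interpret H: module "H0 A" "cohomology (self_module A) i" by (rule M.cohomology_module)
  consider "i < 0" | "i = 0" | "i > 0" by linarith
  then show ?thesis
  proof cases
    case 1
    then show ?thesis
      using assms R.finitely_generated_imp_noetherian_module by (auto simp: noetherian_dg_ring_def)
  next
    case 2
    have hcls: "M.hcls 0 z = rcls z" for z
      by (simp add: M.hcls_def rcls_def coboundaries_def a_r_coset_def')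
    have coc: "cocycles (self_module A) 0 = gr A 0"
      using cocycles_0 by (simp add: cocycles_def)
    have "\<exists>n0. \<forall>k\<ge>n0. L k = L n0"
      if L: "\<forall>k. submodule (L k) (H0 A) (cohomology (self_module A) i) \<and> L k \<subseteq> L (Suc k)" for L :: "nat \<Rightarrow> _"
    proof (rule R.ideals_acc)
      show "L k \<subseteq> L (Suc k)" for k using L by simp
      show "ideal (L k) (H0 A)" for k
      proof -
        have sL: "submodule (L k) (H0 A) (cohomology (self_module A) i)" using L by simp
        note D = H.submoduleD[OF sL]
        have Lc: "L k \<subseteq> carrier (H0 A)"
          using D(1) unfolding 2 M.cohomology_carrier hcls coc H0_carrier .
        have mult: "r \<otimes>\<^bsub>H0 A\<^esub> a \<in> L k" if ra: "r \<in> carrier (H0 A)" "a \<in> L k" for r a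
        proof -
          obtain b z where b: "b \<in> gr A 0" "r = rcls b" and z: "z \<in> gr A 0" "a = rcls z"
            using ra Lc unfolding H0_carrier by blast
          have "r \<odot>\<^bsub>cohomology (self_module A) 0\<^esub> a = r \<otimes>\<^bsub>H0 A\<^esub> a"
            using M.hcls_act[OF b(1), of z 0] b z coc by (simp add: hcls rcls_hom(2))
          then show ?thesis using D(4)[OF ra] 2 by simp
        qed
        have "a \<oplus>\<^bsub>H0 A\<^esub> b \<in> L k" if ab: "a \<in> L k" "b \<in> L k" for a b
        proof -
          obtain x z where x: "x \<in> gr A 0" "a = rcls x" and z: "z \<in> gr A 0" "b = rcls z"
            using ab Lc unfolding H0_carrier by blast
          have "a \<oplus>\<^bsub>cohomology (self_module A) 0\<^esub> b = a \<oplus>\<^bsub>H0 A\<^esub> b"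
            using M.hcls_add[of x z 0] x z gr_carrier by (simp add: hcls rcls_hom(1) M.cohomology_simps)
          then show ?thesis using D(3)[OF ab] 2 by simp
        qed
        moreover have "\<zero>\<^bsub>H0 A\<^esub> \<in> L k"
          using D(2) rcls_hom(4)[OF gr_zero gr_zero] 2 by (simp add: M.cohomology_simps hcls)
        ultimately show ?thesis
          unfolding R.ideal_iff using Lc mult R.m_comm by (metis subsetD)
      qed
    qed
    then show ?thesis unfolding noetherian_module_def using H.module_axioms by simp
  next
    case 3
    have z: "z = \<zero>" if "z \<in> cocycles (self_module A) i" for z
      using M.cocycle_gr[OF that] gr_nonpos[OF 3] by simp
    have "cocycles (self_module A) i = {\<zero>}" using z M.cocycle_zero[of i] unfolding self_module_simps by fast
    then have "carrier (cohomology (self_module A) i) = {\<zero>\<^bsub>cohomology (self_module A) i\<^esub>}"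
      by (simp add: M.cohomology_carrier M.cohomology_simps)
    then have L: "L = {\<zero>\<^bsub>cohomology (self_module A) i\<^esub>}" if "submodule L (H0 A) (cohomology (self_module A) i)" for L
      using H.submoduleD(1)[OF that] H.submoduleD(2)[OF that] by auto
    have "L k = L 0"
      if "\<forall>k. submodule (L k) (H0 A) (cohomology (self_module A) i) \<and> L k \<subseteq> L (Suc k)" for L :: "nat \<Rightarrow> _" and k
      by (rule trans[OF L L[symmetric]]) (use that in blast)+
    then have "\<exists>n0. \<forall>k\<ge>n0. L k = L n0"
      if "\<forall>k. submodule (L k) (H0 A) (cohomology (self_module A) i) \<and> L k \<subseteq> L (Suc k)" for L :: "nat \<Rightarrow> _"
      using that by (intro exI[of _ 0]) (intro allI impI)
    then show ?thesis unfolding noetherian_module_def using H.module_axioms by (intro conjI allI impI)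
  qed
qed

end

lemma noetherian_local_dg_ring_locale: "noetherian_local_dg_ring A m \<Longrightarrow> local_dg_ring A m"
  by (simp add: noetherian_local_dg_ring_def noetherian_dg_ring_def local_dg_ring_def local_dg_ring_axioms_def)

context local_dg_ring
begin

abbreviation leafA :: "('a, 'a tree) dg_mod" where "leafA \<equiv> leaf_module (self_module A)"

lemma leafA_comparison: "comparison_map A A (\<lambda>a. a) {\<one>} (self_module A) leafA Leaf"
  by (rule leaf_comparison[OF self_module_complex])

lemma coherent_leafA:
  assumes "noetherian_dg_ring A" "bounded_cohomology A"
  shows "coherent leafA"
proof -
  interpret U: local_base_change A A "\<lambda>a. a" "{\<one>}" m m by (rule unit_local_base_change)
  interpret M: dg_complex A "self_module A" by (rule self_module_complex)
  have "noetherian_module (H0 A) (cohomology leafA n)" for n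
    by (rule comparison_map.noetherian_transfer[OF leafA_comparison one_act_unit self_cohomology_noetherian[OF assms(1)]])
  moreover have "dg_complex A leafA" by (rule leaf_module_complex[OF self_module_complex])
  moreover have zero: "cohomology_zero leafA n \<longleftrightarrow> cohomology_zero (self_module A) n" for n
    by (rule U.comparison_zero_iff[OF leafA_comparison one_unit])
  \<comment> \<open>One differs from zero in the local ring H^0(A), so the cohomology is not all
    zero and the infimum is meaningful.\<close>
  moreover have "\<not> cohomology_zero (self_module A) 0"
  proof
    assume "cohomology_zero (self_module A) 0"
    moreover have "\<one> \<in> cocycles (self_module A) 0" using one_gr dif_gr0 by (simp add: cocycles_def)
    ultimately have "\<one> \<in> coboundaries (self_module A) 0" unfolding M.cohomology_zero_iff by blast
    then obtain c where c: "c \<in> gr A (-1)" "\<one> = dif A c" by (auto simp: coboundaries_def)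
    have "rcls \<one> = rcls \<zero>" unfolding rcls_eq_iff[OF one_gr gr_zero] using c one_closed by (intro bexI[of _ c]) auto
    then have "\<one>\<^bsub>H0 A\<^esub> = \<zero>\<^bsub>H0 A\<^esub>" using rcls_hom(3,4)[OF gr_zero gr_zero] by simp
    then show False using R.one_notin_m R.m_ideal by (simp add: R.ideal_iff)
  qed
  ultimately show ?thesis using assms(2) unfolding coherent_def bounded_cohomology_def by blast
qed

end

section \<open>Localization at a prime\<close>

locale prime_localization = local_dg_ring A m for A :: "('a, 'b) cochain_scheme" (structure) and m +
  fixes p :: "'a set set"
  assumes p_prime: "primeideal p (H0 A)"
begin

definition S :: "'a set" where "S = {a \<in> gr A 0. rcls a \<notin> p}"

lemma localization_at_eq: "localization_at A p = localization A S"
proof -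
  have "gr A 0 - prime_preimage A p = S" by (auto simp: S_def prime_preimage_def rcls_def)
  then show ?thesis by (simp add: localization_at_def)
qed

sublocale dg_localization A S
proof
  show "S \<subseteq> gr A 0" by (auto simp: S_def)
  show "\<one> \<in> S"
    using one_gr p_prime rcls_hom(3)[OF gr_zero gr_zero] by (simp add: S_def R.primeideal_iff)
  show "s \<otimes> t \<in> S" if "s \<in> S" "t \<in> S" for s t
    using that p_prime gr0_mult rcls_closed[of s] rcls_closed[of t]
    unfolding S_def R.primeideal_iff by (auto simp: rcls_hom(2))
qed

sublocale L: dg_ring L by (rule L_dg_ring)
sublocale B: base_change A L "\<lambda>a. fr a \<one>" S by (rule L_base_change)

lemma S_rcls: "s \<in> S \<Longrightarrow> rcls s \<notin> p" unfolding S_def by blast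

lemma Lrcls_ex:
  assumes "X \<in> carrier (H0 L)"
  obtains a s where "a \<in> gr A 0" "s \<in> S" "X = L.rcls (fr a s)"
  using assms unfolding L.H0_carrier by (auto elim!: L_grE)

lemma Lrcls_unit:
  assumes "s \<in> S"
  shows "L.rcls (fr \<one> s) \<in> carrier (H0 L)" "L.rcls (fr \<one> s) \<otimes>\<^bsub>H0 L\<^esub> L.rcls (fr s \<one>) = \<one>\<^bsub>H0 L\<^esub>"
proof -
  show "L.rcls (fr \<one> s) \<in> carrier (H0 L)" by (intro L.rcls_closed fr_gr one_gr assms)
  have "L.rcls (fr \<one> s) \<otimes>\<^bsub>H0 L\<^esub> L.rcls (fr s \<one>) = L.rcls (fr \<one> s \<otimes>\<^bsub>L\<^esub> fr s \<one>)"
    using assms S_one by (simp add: L.rcls_hom(2) fr_gr one_gr)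
  also have "fr \<one> s \<otimes>\<^bsub>L\<^esub> fr s \<one> = \<one>\<^bsub>L\<^esub>" using assms S_one by (simp add: fr_mult fr_one)
  finally show "L.rcls (fr \<one> s) \<otimes>\<^bsub>H0 L\<^esub> L.rcls (fr s \<one>) = \<one>\<^bsub>H0 L\<^esub>"
    using L.rcls_hom(3)[OF L.gr_zero L.gr_zero] by simp
qed

lemma Lrcls_scale:
  assumes "a \<in> gr A 0" "s \<in> S"
  shows "L.rcls (fr s \<one>) \<otimes>\<^bsub>H0 L\<^esub> L.rcls (fr a s) = L.rcls (fr a \<one>)"
proof -
  have "fr s \<one> \<otimes>\<^bsub>L\<^esub> fr a s = fr a \<one>"
    using assms S_one gr_carrier[OF assms(1)] fr_cancel[of a \<one> s] by (simp add: fr_mult)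
  then show ?thesis using assms S_one by (simp add: L.rcls_hom(2)[symmetric] fr_gr)
qed

text \<open>For a prime \<open>q\<close> inside \<open>p\<close>, the extension of \<open>q\<close>
  to H^0 of the localization.\<close>

definition push :: "'a set set \<Rightarrow> ('a \<times> 'a) set set set" where
  "push q = {L.rcls (fr a s) | a s. a \<in> gr A 0 \<and> rcls a \<in> q \<and> s \<in> S}"

text \<open>A fraction and its class have many representatives. Clearing all denominators in an
  equality of classes leaves a relation in A^0; modulo coboundaries it places a multiple of
  \<open>a\<close> in \<open>q\<close>, with factors outside \<open>p\<close> and hence outside
  \<open>q\<close>.\<close>

lemma push_iff:
  assumes q: "primeideal q (H0 A)" "q \<subseteq> p" and a: "a \<in> gr A 0" "s \<in> S"
  shows "L.rcls (fr a s) \<in> push q \<longleftrightarrow> rcls a \<in> q"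
proof
  assume "L.rcls (fr a s) \<in> push q"
  then obtain b t where b: "b \<in> gr A 0" "rcls b \<in> q" "t \<in> S" and e: "L.rcls (fr a s) = L.rcls (fr b t)"
    unfolding push_def by auto
  obtain C where C: "C \<in> gr L (-1)" "fr a s = dif L C \<oplus>\<^bsub>L\<^esub> fr b t"
    using e L.rcls_eq_iff[OF fr_gr[OF a] fr_gr[OF b(1,3)]] by blast
  obtain c r where c: "c \<in> gr A (-1)" "r \<in> S" "C = fr c r" using C(1) by (rule L_grE)
  have dc: "dif A c \<in> gr A 0" using dif_gr[OF c(1)] by simp
  have car: "a \<in> carrier A" "b \<in> carrier A" "c \<in> carrier A" "dif A c \<in> carrier A"
    using a b c dc gr_carrier by blast+
  have rt: "r \<otimes> t \<in> S" using S_mult c b by blast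
  have "fr a s = fr (t \<otimes> dif A c \<oplus> r \<otimes> b) (r \<otimes> t)"
    using C(2) c b car by (simp add: fr_dif fr_add_general)
  \<comment> \<open>On the right, \<open>dif A c\<close> has class zero and \<open>b\<close> has
    class in \<open>q\<close>; on the left, \<open>u\<close> and \<open>r \<otimes> t\<close> have
    classes outside \<open>q\<close>.\<close>
  then obtain u where u: "u \<in> S" "u \<otimes> ((r \<otimes> t) \<otimes> a) = u \<otimes> (s \<otimes> (t \<otimes> dif A c \<oplus> r \<otimes> b))"
    using fr_eq_iff[of a "t \<otimes> dif A c \<oplus> r \<otimes> b" s "r \<otimes> t"] car a(2) b(3) c(2) rt by auto
  have g: "u \<in> gr A 0" "r \<otimes> t \<in> gr A 0" "s \<in> gr A 0" "t \<in> gr A 0" "r \<in> gr A 0"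
    using u(1) rt a(2) b(3) c(2) by simp_all
  have g2: "t \<otimes> dif A c \<in> gr A 0" "r \<otimes> b \<in> gr A 0" "t \<otimes> dif A c \<oplus> r \<otimes> b \<in> gr A 0"
    using gr0_mult g dc b(1) gr_add by auto
  have g3: "s \<otimes> (t \<otimes> dif A c \<oplus> r \<otimes> b) \<in> gr A 0" "(r \<otimes> t) \<otimes> a \<in> gr A 0" using gr0_mult g g2 a by auto
  have idq: "ideal q (H0 A)" using q(1) by (simp add: primeideal_def)
  have "rcls (dif A c) = rcls \<zero>"
    unfolding rcls_eq_iff[OF dc gr_zero] using c(1) car by (intro bexI[of _ c]) auto
  then have "rcls (dif A c) \<in> q" using idq rcls_hom(4)[OF gr_zero gr_zero] by (simp add: R.ideal_iff)
  then have "rcls (t \<otimes> dif A c) \<in> q" "rcls (r \<otimes> b) \<in> q"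
    using idq b(1,2) g dc by (simp_all add: rcls_hom(2) R.ideal_iff rcls_closed)
  then have "rcls (t \<otimes> dif A c \<oplus> r \<otimes> b) \<in> q" using idq g2 by (simp add: rcls_hom(1) R.ideal_iff)
  then have "rcls (u \<otimes> (s \<otimes> (t \<otimes> dif A c \<oplus> r \<otimes> b))) \<in> q"
    using idq g g2 g3 by (simp add: rcls_hom(2) R.ideal_iff rcls_closed)
  then have "rcls (u \<otimes> ((r \<otimes> t) \<otimes> a)) \<in> q" using u(2) by simp
  then have "rcls u \<otimes>\<^bsub>H0 A\<^esub> (rcls (r \<otimes> t) \<otimes>\<^bsub>H0 A\<^esub> rcls a) \<in> q"
    using g g3 a(1) by (simp add: rcls_hom(2))
  moreover have "rcls u \<notin> q" "rcls (r \<otimes> t) \<notin> q" using S_rcls u(1) rt q(2) by blast+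
  ultimately show "rcls a \<in> q"
    using q(1) g a(1) unfolding R.primeideal_iff by (meson R.m_closed rcls_closed)
qed (use a in \<open>auto simp: push_def\<close>)

lemma push_prime:
  assumes q: "primeideal q (H0 A)" "q \<subseteq> p"
  shows "primeideal (push q) (H0 L)"
proof -
  interpret R': cring "H0 L" by (rule L.H0_cring)
  have idq: "ideal q (H0 A)" and oneq: "\<one>\<^bsub>H0 A\<^esub> \<notin> q" using q(1) by (simp_all add: R.primeideal_iff)
  have q_zero: "rcls \<zero> \<in> q" and q_add: "x \<in> q \<Longrightarrow> y \<in> q \<Longrightarrow> x \<oplus>\<^bsub>H0 A\<^esub> y \<in> q"
    and q_mult: "x \<in> carrier (H0 A) \<Longrightarrow> y \<in> q \<Longrightarrow> x \<otimes>\<^bsub>H0 A\<^esub> y \<in> q" for x y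
    using idq rcls_hom(4)[OF gr_zero gr_zero] unfolding R.ideal_iff by auto
  have "ideal (push q) (H0 L)"
    unfolding R'.ideal_iff
  proof (intro conjI ballI)
    show "push q \<subseteq> carrier (H0 L)" unfolding push_def using L.rcls_closed[OF fr_gr] by blast
    have "L.rcls (fr \<zero> \<one>) \<in> push q"
      unfolding push_iff[OF q gr_zero S_one] by (rule q_zero)
    then show "\<zero>\<^bsub>H0 L\<^esub> \<in> push q" using L.rcls_hom(4)[OF L.gr_zero L.gr_zero] by (simp add: L_zero)
    fix X assume "X \<in> push q"
    then obtain a s where a: "a \<in> gr A 0" "rcls a \<in> q" "s \<in> S" "X = L.rcls (fr a s)" by (auto simp: push_def)
    {
      fix Y assume "Y \<in> push q"
      then obtain b t where b: "b \<in> gr A 0" "rcls b \<in> q" "t \<in> S" "Y = L.rcls (fr b t)" by (auto simp: push_def)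
      have c: "a \<in> carrier A" "b \<in> carrier A" using a b gr_carrier by blast+
      have "X \<oplus>\<^bsub>H0 L\<^esub> Y = L.rcls (fr (t \<otimes> a \<oplus> s \<otimes> b) (s \<otimes> t))"
        using a b c fr_gr by (simp add: L.rcls_hom(1)[symmetric] fr_add_general)
      moreover have "rcls (t \<otimes> a \<oplus> s \<otimes> b) \<in> q"
        using q_add[OF q_mult q_mult, OF rcls_closed a(2) rcls_closed b(2), of t s] a b gr0_mult
        by (simp add: rcls_hom(1,2))
      ultimately show "X \<oplus>\<^bsub>H0 L\<^esub> Y \<in> push q"
        using push_iff[OF q, of "t \<otimes> a \<oplus> s \<otimes> b" "s \<otimes> t"] gr0_mult gr_add S_mult a b by simp
    }
    fix Y assume Y: "Y \<in> carrier (H0 L)"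
    obtain b t where b: "b \<in> gr A 0" "t \<in> S" "Y = L.rcls (fr b t)" using Y by (rule Lrcls_ex)
    have c: "a \<in> carrier A" "b \<in> carrier A" using a b gr_carrier by blast+
    have "Y \<otimes>\<^bsub>H0 L\<^esub> X = L.rcls (fr (b \<otimes> a) (t \<otimes> s))"
      using a b c fr_gr by (simp add: L.rcls_hom(2)[symmetric] fr_mult)
    moreover have "rcls (b \<otimes> a) \<in> q"
      using q_mult[OF rcls_closed[OF b(1)] a(2)] a(1) b(1) by (simp add: rcls_hom(2))
    ultimately show YX: "Y \<otimes>\<^bsub>H0 L\<^esub> X \<in> push q"
      using push_iff[OF q, of "b \<otimes> a" "t \<otimes> s"] gr0_mult S_mult a b by simp
    have "X \<in> carrier (H0 L)" unfolding a(4) by (intro L.rcls_closed fr_gr a)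
    then show "X \<otimes>\<^bsub>H0 L\<^esub> Y \<in> push q" using YX R'.m_comm Y by simp
  qed
  moreover have "\<one>\<^bsub>H0 L\<^esub> \<notin> push q"
    using push_iff[OF q one_gr S_one] oneq rcls_hom(3)[OF gr_zero gr_zero]
      L.rcls_hom(3)[OF L.gr_zero L.gr_zero] by (simp add: L_one)
  moreover have "X \<in> push q \<or> Y \<in> push q"
    if X: "X \<in> carrier (H0 L)" and Y: "Y \<in> carrier (H0 L)" and XY: "X \<otimes>\<^bsub>H0 L\<^esub> Y \<in> push q" for X Y
  proof -
    obtain a s where a: "a \<in> gr A 0" "s \<in> S" "X = L.rcls (fr a s)" using X by (rule Lrcls_ex)
    obtain b t where b: "b \<in> gr A 0" "t \<in> S" "Y = L.rcls (fr b t)" using Y by (rule Lrcls_ex)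
    have c: "a \<in> carrier A" "b \<in> carrier A" using a b gr_carrier by blast+
    have "X \<otimes>\<^bsub>H0 L\<^esub> Y = L.rcls (fr (a \<otimes> b) (s \<otimes> t))"
      using a b c fr_gr by (simp add: L.rcls_hom(2)[symmetric] fr_mult)
    then have "rcls a \<otimes>\<^bsub>H0 A\<^esub> rcls b \<in> q"
      using XY push_iff[OF q, of "a \<otimes> b" "s \<otimes> t"] gr0_mult S_mult a b by (simp add: rcls_hom(2))
    then have "rcls a \<in> q \<or> rcls b \<in> q"
      using q(1) rcls_closed a(1) b(1) unfolding R.primeideal_iff by blast
    then show ?thesis using push_iff[OF q a(1,2)] push_iff[OF q b(1,2)] a(3) b(3) by simp
  qed
  ultimately show ?thesis unfolding R'.primeideal_iff by blast
qed

abbreviation n where "n \<equiv> push p"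

text \<open>A class outside \<open>push p\<close> has a numerator in \<open>S\<close>, so the
  reversed fraction is an inverse. Hence every proper ideal lies in \<open>push p\<close>.\<close>

lemma L_local: "local_ring (H0 L) n"
proof -
  interpret R': cring "H0 L" by (rule L.H0_cring)
  have n: "primeideal n (H0 L)" by (rule push_prime[OF p_prime order_refl])
  then have idn: "ideal n (H0 L)" and one: "\<one>\<^bsub>H0 L\<^esub> \<notin> n" by (simp_all add: R'.primeideal_iff)
  have sub: "I \<subseteq> n" if I: "ideal I (H0 L)" "\<one>\<^bsub>H0 L\<^esub> \<notin> I" for I
  proof
    fix X assume X: "X \<in> I"
    then have "X \<in> carrier (H0 L)" using I by (auto simp: R'.ideal_iff)
    then obtain a s where a: "a \<in> gr A 0" "s \<in> S" "X = L.rcls (fr a s)" by (rule Lrcls_ex)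
    show "X \<in> n"
    proof (rule ccontr)
      assume "X \<notin> n"
      then have aS: "a \<in> S" using push_iff[OF p_prime order_refl a(1,2)] a unfolding S_def by blast
      have "L.rcls (fr s a) \<otimes>\<^bsub>H0 L\<^esub> X = L.rcls (fr (s \<otimes> a) (a \<otimes> s))"
        using a aS by (simp add: L.rcls_hom(2)[symmetric] fr_gr fr_mult)
      also have "fr (s \<otimes> a) (a \<otimes> s) = \<one>\<^bsub>L\<^esub>" using fr_one[of "a \<otimes> s"] S_mult comm0[of s a] a(2) aS by simp
      finally have "L.rcls (fr s a) \<otimes>\<^bsub>H0 L\<^esub> X = \<one>\<^bsub>H0 L\<^esub>" using L.rcls_hom(3)[OF L.gr_zero L.gr_zero] by simp
      moreover have "L.rcls (fr s a) \<in> carrier (H0 L)" using a aS by (intro L.rcls_closed fr_gr) auto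
      ultimately show False using I X by (metis R'.ideal_iff)
    qed
  qed
  have "maximalideal n (H0 L)"
  proof (rule maximalidealI[OF idn])
    show "carrier (H0 L) \<noteq> n" using one R'.one_closed by metis
    fix J assume J: "ideal J (H0 L)" "n \<subseteq> J" "J \<subseteq> carrier (H0 L)"
    show "J = n \<or> J = carrier (H0 L)"
      by (cases "\<one>\<^bsub>H0 L\<^esub> \<in> J") (use ideal.one_imp_carrier[OF J(1)] equalityI[OF sub[OF J(1)] J(2)] in simp_all)
  qed
  moreover have "I = n" if I: "maximalideal I (H0 L)" for I
  proof -
    have idI: "ideal I (H0 L)" using I by (simp add: maximalideal_def)
    have "\<one>\<^bsub>H0 L\<^esub> \<notin> I" using ideal.one_imp_carrier[OF idI] maximalideal.I_notcarr[OF I] by metis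
    then have "I \<subseteq> n" by (rule sub[OF idI])
    then have "n = I \<or> n = carrier (H0 L)"
      using maximalideal.I_maximal[OF I idn] idn unfolding R'.ideal_iff by metis
    then show ?thesis using one R'.one_closed by metis
  qed
  ultimately show ?thesis unfolding local_ring_def using R'.cring_axioms by blast
qed

lemma L_H0_noetherian: "noetherian_ring (H0 L)"
proof (rule B.H0_noetherian_transfer[OF H0_noetherian])
  show "\<exists>y\<in>carrier (H0 L). y \<otimes>\<^bsub>H0 L\<^esub> L.rcls (fr t \<one>) = \<one>\<^bsub>H0 L\<^esub>" if "t \<in> S" for t
    using Lrcls_unit[OF that] by blast
  show "\<exists>t\<in>S. \<exists>a\<in>gr A 0. L.rcls (fr t \<one>) \<otimes>\<^bsub>H0 L\<^esub> X = L.rcls (fr a \<one>)" if X: "X \<in> carrier (H0 L)" for X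
  proof -
    obtain a s where a: "a \<in> gr A 0" "s \<in> S" "X = L.rcls (fr a s)" using X by (rule Lrcls_ex)
    then show ?thesis using Lrcls_scale by blast
  qed
qed

sublocale L: local_dg_ring L n
  by (intro local_dg_ring.intro local_dg_ring_axioms.intro L_dg_ring L_H0_noetherian L_local)

sublocale B: local_base_change A L "\<lambda>a. fr a \<one>" S m n
proof (intro local_base_change.intro local_base_change_axioms.intro L_base_change local_dg_ring_axioms L.local_dg_ring_axioms)
  show "L.rcls (fr t \<one>) \<notin> n" if "t \<in> S" for t
    using push_iff[OF p_prime order_refl, of t \<one>] that S_rcls S_one by simp
  show "\<exists>t\<in>S. \<exists>a\<in>gr A 0. rcls a \<in> m \<and> L.rcls (fr t \<one> \<otimes>\<^bsub>L\<^esub> a') = L.rcls (fr a \<one>)"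
    if a': "a' \<in> gr L 0" "L.rcls a' \<in> n" for a'
  proof -
    obtain b t where b: "b \<in> gr A 0" "rcls b \<in> p" "t \<in> S" "L.rcls a' = L.rcls (fr b t)"
      using a'(2) by (auto simp: push_def)
    have "L.rcls (fr t \<one> \<otimes>\<^bsub>L\<^esub> a') = L.rcls (fr t \<one>) \<otimes>\<^bsub>H0 L\<^esub> L.rcls (fr b t)"
      using a'(1) b S_one by (simp add: L.rcls_hom(2) fr_gr)
    also have "\<dots> = L.rcls (fr b \<one>)" by (rule Lrcls_scale[OF b(1,3)])
    finally show ?thesis using b R.prime_le_m[OF p_prime] by blast
  qed
qed

lemma self_comparison: "comparison_map A L (\<lambda>a. fr a \<one>) S (self_module A) (self_module L) (\<lambda>a. fr a \<one>)"
proof (intro comparison_map.intro chain_map.intro chain_map_axioms.intro comparison_map_axioms.intro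
    L_base_change self_module_complex L.self_module_complex)
  fix z k assume z: "z \<in> cocycles (self_module A) k" and fz: "fr z \<one> \<in> coboundaries (self_module L) k"
  have zg: "z \<in> gr A k" using z by (simp add: cocycles_def)
  from fz obtain C where C: "C \<in> gr L (k - 1)" "fr z \<one> = dif L C" by (auto simp: coboundaries_def)
  obtain c s where c: "c \<in> gr A (k - 1)" "s \<in> S" "C = fr c s" using C(1) by (rule L_grE)
  have car: "z \<in> carrier A" "c \<in> carrier A" using zg c gr_carrier by blast+
  have "fr z \<one> = fr (dif A c) s" using C(2) c car by (simp add: fr_dif)
  then obtain u where u: "u \<in> S" "u \<otimes> (s \<otimes> z) = u \<otimes> (\<one> \<otimes> dif A c)"
    using fr_eq_iff[OF car(1) dif_carrier[OF car(2)] S_one c(2)] by blast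
  have "(u \<otimes> s) \<otimes> z = dif A (u \<otimes> c)"
    using u car c(2) dif_carrier[OF car(2)] by (simp add: m_assoc dif_scale)
  then have "act (self_module A) (u \<otimes> s) z \<in> coboundaries (self_module A) k"
    using gr0_mult[OF S_gr0[OF u(1)] c(1)] by (auto simp: coboundaries_def)
  then show "\<exists>t\<in>S. act (self_module A) t z \<in> coboundaries (self_module A) k"
    using S_mult[OF u(1) c(2)] by blast
next
  fix z' k assume z': "z' \<in> cocycles (self_module L) k"
  then have "z' \<in> gr L k" by (simp add: cocycles_def)
  then obtain z s where z: "z \<in> gr A k" "s \<in> S" "z' = fr z s" by (rule L_grE)
  have zc: "z \<in> carrier A" using z gr_carrier by blast
  have "dif L z' = \<zero>\<^bsub>L\<^esub>" using z' by (simp add: cocycles_def)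
  then have "fr (dif A z) s = fr \<zero> \<one>" using z zc by (simp add: fr_dif L_zero)
  \<comment> \<open>The numerator of a cocycle is a cocycle only after multiplication by some
    \<open>u\<close> in \<open>S\<close>, so \<open>u \<otimes> z\<close> is lifted instead of
    \<open>z\<close>.\<close>
  then obtain u where u: "u \<in> S" "u \<otimes> (\<one> \<otimes> dif A z) = u \<otimes> (s \<otimes> \<zero>)"
    using fr_eq_iff[OF dif_carrier[OF zc] zero_closed z(2) S_one] by blast
  have "dif A (u \<otimes> z) = \<zero>" using u z(2) zc dif_carrier by (simp add: dif_scale)
  then have uz: "u \<otimes> z \<in> cocycles (self_module A) k" using gr0_mult[OF S_gr0[OF u(1)] z(1)] by (simp add: cocycles_def)
  have us: "u \<otimes> s \<in> S" using S_mult u z by blast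
  have "fr (u \<otimes> s) \<one> \<otimes>\<^bsub>L\<^esub> z' = fr (u \<otimes> z) \<one>"
    unfolding z(3) using fr_cancel[of "u \<otimes> z" \<one> s] us u(1) z(2) zc S_one by (simp add: fr_mult ac0)
  moreover have "fr (u \<otimes> z) \<one> \<in> carrier L" using u zc S_one by (intro fr_carrier) auto
  moreover have "\<zero>\<^bsub>L\<^esub> \<in> coboundaries (self_module L) k"
    unfolding coboundaries_def self_module_simps by (rule image_eqI, rule L.dif_zero[symmetric], rule L.gr_zero)
  ultimately show "\<exists>t\<in>S. \<exists>z\<in>cocycles (self_module A) k. \<exists>b\<in>coboundaries (self_module L) k.
      fr z \<one> = b \<oplus>\<^bsub>self_module L\<^esub> act (self_module L) (fr t \<one>) z'"
    unfolding self_module_simps using us uz L.l_zero by metis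
qed (use S_one gr_carrier in \<open>auto simp: fr_gr fr_dif fr_add fr_mult\<close>)

lemma leaf_localization_comparison:
  "comparison_map A L (\<lambda>a. fr a \<one>) S leafA (leaf_module (self_module L)) (\<lambda>u. Leaf (fr (leaf u) \<one>))"
  by (rule leaf_comparison_map[OF self_comparison])

lemma L_noetherian_dg_ring:
  assumes "noetherian_dg_ring A"
  shows "noetherian_dg_ring L"
proof -
  have "noetherian_module (H0 L) (cohomology (self_module L) i)" for i
    by (rule comparison_map.noetherian_transfer[OF self_comparison _ self_cohomology_noetherian[OF assms]])
      (use Lrcls_unit in blast)
  then show ?thesis
    unfolding noetherian_dg_ring_def
    using L_dg_ring L_H0_noetherian L.R.noetherian_imp_finitely_generated_module by blast
qed

lemma L_bounded:
  assumes "bounded_cohomology A"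
  shows "bounded_cohomology L"
  using assms B.comparison_zero[OF self_comparison] unfolding bounded_cohomology_def by blast

lemma L_noetherian_local_dg_ring:
  "noetherian_dg_ring A \<Longrightarrow> noetherian_local_dg_ring L n"
  using L_noetherian_dg_ring L_local by (simp add: noetherian_local_dg_ring_def)

lemma push_chain:
  assumes "prime_chain (H0 A) q k" "q k \<subseteq> p"
  shows "prime_chain (H0 L) (\<lambda>i. push (q i)) k"
proof -
  have sub: "q i \<subseteq> p" "primeideal (q i) (H0 A)" if "i \<le> k" for i
    using prime_chain_mono[OF assms(1) that order_refl] assms that by (auto simp: prime_chain_def)
  show ?thesis
    unfolding prime_chain_def
  proof (intro conjI allI impI)
    show "primeideal (push (q i)) (H0 L)" if "i \<le> k" for i using push_prime sub[OF that] by blast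
    fix i assume i: "i < k"
    have qi: "q i \<subset> q (Suc i)" using assms(1) i by (simp add: prime_chain_def)
    then obtain X where X: "X \<in> q (Suc i)" "X \<notin> q i" by blast
    have "X \<in> carrier (H0 A)" using X(1) sub(2)[of "Suc i"] i by (auto simp: R.primeideal_iff R.ideal_iff)
    then obtain a where a: "a \<in> gr A 0" "X = rcls a" unfolding H0_carrier by blast
    have "L.rcls (fr a \<one>) \<in> push (q (Suc i))" "L.rcls (fr a \<one>) \<notin> push (q i)"
      using push_iff[OF sub(2,1) a(1) S_one, of "Suc i"] push_iff[OF sub(2,1) a(1) S_one, of i] i X a(2) by auto
    moreover have "push (q i) \<subseteq> push (q (Suc i))" using qi by (auto simp: push_def)
    ultimately show "push (q i) \<subset> push (q (Suc i))" by blast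
  qed
qed

text \<open>The denominator of a fraction has a unit as its class. Multiplying by it turns an
  element that separates two primes of H^0 of the localization into the image of an element of
  H^0(A), so inclusions stay strict.\<close>

lemma pull_chain:
  assumes Q: "prime_chain (H0 L) Q k"
  shows "\<exists>q. prime_chain (H0 A) q k \<and> q k \<subseteq> p"
proof -
  interpret h: ring_hom_ring "H0 A" "H0 L" B.H0_map by (rule B.H0_map_hom)
  define q where "q i = {r \<in> carrier (H0 A). B.H0_map r \<in> Q i}" for i
  have q_rcls: "rcls a \<in> q i \<longleftrightarrow> L.rcls (fr a \<one>) \<in> Q i" if "a \<in> gr A 0" for a i
    using that by (simp add: q_def B.H0_map_rcls rcls_closed)
  have QP: "primeideal (Q i) (H0 L)" "Q i \<subseteq> n" if "i \<le> k" for i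
    using Q that L.R.prime_le_m by (auto simp: prime_chain_def)
  have sub: "q i \<subseteq> p" if "i \<le> k" for i
  proof
    fix X assume X: "X \<in> q i"
    then have "X \<in> carrier (H0 A)" by (simp add: q_def)
    then obtain a where a: "a \<in> gr A 0" "X = rcls a" unfolding H0_carrier by blast
    then have "L.rcls (fr a \<one>) \<in> n" using X q_rcls QP(2)[OF that] by auto
    then show "X \<in> p" using push_iff[OF p_prime order_refl a(1) S_one] a(2) by simp
  qed
  have "prime_chain (H0 A) q k"
    unfolding prime_chain_def
  proof (intro conjI allI impI)
    show "primeideal (q i) (H0 A)" if "i \<le> k" for i
      unfolding q_def by (rule h.primeideal_vimage[OF H0_cring QP(1)[OF that]])
    fix i assume i: "i < k"
    have Qi: "Q i \<subset> Q (Suc i)" using Q i by (simp add: prime_chain_def)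
    then obtain X where X: "X \<in> Q (Suc i)" "X \<notin> Q i" by blast
    have idQ: "ideal (Q i) (H0 L)" "ideal (Q (Suc i)) (H0 L)" using QP i by (simp_all add: primeideal_def)
    have Xc: "X \<in> carrier (H0 L)" using X(1) idQ(2) by (auto simp: L.R.ideal_iff)
    obtain a s where a: "a \<in> gr A 0" "s \<in> S" "X = L.rcls (fr a s)" using Xc by (rule Lrcls_ex)
    have sc: "L.rcls (fr s \<one>) \<in> carrier (H0 L)" using a(2) S_one by (intro L.rcls_closed fr_gr) auto
    have "L.rcls (fr a \<one>) \<in> Q (Suc i)"
      using Lrcls_scale[OF a(1,2)] X(1) idQ(2) sc a(3) by (metis L.R.ideal_iff)
    moreover have "L.rcls (fr a \<one>) \<notin> Q i"
    proof
      assume "L.rcls (fr a \<one>) \<in> Q i"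
      then have "L.rcls (fr \<one> s) \<otimes>\<^bsub>H0 L\<^esub> (L.rcls (fr s \<one>) \<otimes>\<^bsub>H0 L\<^esub> X) \<in> Q i"
        using Lrcls_scale[OF a(1,2)] Lrcls_unit(1)[OF a(2)] idQ(1) a(3) by (metis L.R.ideal_iff)
      then have "X \<in> Q i"
        using Lrcls_unit[OF a(2)] sc Xc by (simp flip: L.R.m_assoc)
      then show False using X(2) by simp
    qed
    ultimately have "rcls a \<in> q (Suc i)" "rcls a \<notin> q i" using q_rcls[OF a(1)] by simp_all
    moreover have "q i \<subseteq> q (Suc i)" using Qi by (auto simp: q_def)
    ultimately show "q i \<subset> q (Suc i)" by blast
  qed
  then show ?thesis using sub[of k] by blast
qed

end

section \<open>Regular sequences and chains of primes\<close>

lemma prime_chain_prefix: "prime_chain R p n \<Longrightarrow> d \<le> n \<Longrightarrow> prime_chain R p d"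
  by (auto simp: prime_chain_def)

lemma local_ring_unique: "local_ring R m \<Longrightarrow> local_ring R m' \<Longrightarrow> m = m'"
  by (simp add: local_ring_def)

section \<open>Dimension and generators of a noetherian local ring\<close>

context noetherian_local
begin

lemma krull_dim_attained:
  assumes "enat d \<le> krull_dim R"
  shows "\<exists>p. prime_chain R p d"
proof (rule ccontr)
  assume none: "\<nexists>p. prime_chain R p d"
  have less: "n < d" if "prime_chain R p n" for p n
    using none prime_chain_prefix[OF that] by (meson not_le)
  \<comment> \<open>The chain consisting of \<open>m\<close> alone excludes d = 0, so the
    subtraction in d - 1 is not truncated.\<close>
  have "prime_chain R (\<lambda>_. m) 0" using m_prime by (simp add: prime_chain_def)
  then have "0 < d" by (rule less)
  moreover have "n \<le> d - 1" if "prime_chain R p n" for p n using less[OF that] by simp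
  then have "krull_dim R \<le> enat (d - 1)" by (rule krull_dim_le)
  ultimately show False using order.trans[OF assms, of "enat (d - 1)"] by simp
qed

text \<open>Let J be generated by the first k elements and x be the next one. By the induction,
  every z in \<open>p k\<close> has the form j + r x with j in J. As J lies in \<open>p k\<close>
  and x does not, r lies in \<open>p k\<close>. So p k = J + x p k, and Nakayama's lemma gives p k =
  J.\<close>

lemma chain_of_generators:
  assumes p: "prime_chain R p (length xs)" and x: "\<And>k. k < length xs \<Longrightarrow> xs ! k \<in> p (Suc k) - p k"
    and m: "m = Idl (set xs)" and k: "k \<le> length xs"
  shows "p k = Idl (set (take k xs))"
  using k
proof (induction k rule: inc_induct)
  case base
  have idp: "ideal (p (length xs)) R" using p by (simp add: prime_chain_def primeideal_def)
  have "set xs \<subseteq> p (length xs)"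
  proof
    fix y assume "y \<in> set xs"
    then obtain k where k: "k < length xs" "y = xs ! k" by (auto simp: in_set_conv_nth)
    then show "y \<in> p (length xs)" using x[OF k(1)] prime_chain_mono[OF p, of "Suc k" "length xs"] by auto
  qed
  then have "m \<subseteq> p (length xs)" using genideal_minimal[OF idp] m by simp
  moreover have "p (length xs) \<subseteq> m" using p by (intro prime_le_m) (simp add: prime_chain_def)
  ultimately show ?case using m by simp
next
  case (step k)
  define J where "J = Idl (set (take k xs))"
  have pk: "primeideal (p k) R" using p step(2) by (simp add: prime_chain_def)
  then have idp: "ideal (p k) R" by (simp add: primeideal_def)
  have pc: "p k \<subseteq> carrier R" using idp by (simp add: ideal_iff)
  have xk: "xs ! k \<in> p (Suc k)" "xs ! k \<notin> p k" using x[OF step(2)] by auto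
  have pm: "p i \<subseteq> m" if "i \<le> length xs" for i using p that by (intro prime_le_m) (simp add: prime_chain_def)
  have xm: "xs ! k \<in> m" using xk(1) pm[of "Suc k"] step(2) by auto
  then have xc: "xs ! k \<in> carrier R" using m_carrier by blast
  have sub: "set (take k xs) \<subseteq> p k"
  proof
    fix y assume "y \<in> set (take k xs)"
    then obtain i where i: "i < k" "i < length xs" "y = xs ! i" by (auto simp: in_set_conv_nth)
    then show "y \<in> p k" using x[OF i(2)] prime_chain_mono[OF p, of "Suc i" k] step(2) by auto
  qed
  have J: "ideal J R" unfolding J_def using sub pc by (intro genideal_ideal) blast
  have Jp: "J \<subseteq> p k" unfolding J_def by (rule genideal_minimal[OF idp sub])
  have Jc: "J \<subseteq> carrier R" using J by (simp add: ideal_iff)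
  have "p k \<subseteq> J"
  \<comment> \<open>At the maximal ideal every ideal is saturated, because the elements outside
    \<open>m\<close> are units.\<close>
  proof (rule prime_local_nakayama[OF m_prime J _ xm pc])
    fix t r assume t: "t \<in> carrier R - m" and r: "r \<in> carrier R" "t \<otimes> r \<in> J"
    obtain y where y: "y \<in> carrier R" "y \<otimes> t = \<one>" using not_m_unit t by auto
    have "y \<otimes> (t \<otimes> r) \<in> J" using J y(1) r(2) unfolding ideal_iff by blast
    then show "r \<in> J" using y t r(1) by (simp flip: m_assoc)
  next
    fix z assume z: "z \<in> p k"
    have "set (take (Suc k) xs) \<subseteq> J <+>\<^bsub>R\<^esub> PIdl (xs ! k)"
    proof
      fix y assume "y \<in> set (take (Suc k) xs)"
      then have "y \<in> set (take k xs) \<or> y = xs ! k" using step(2) by (auto simp: take_Suc_conv_app_nth)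
      then show "y \<in> J <+>\<^bsub>R\<^esub> PIdl (xs ! k)"
      proof
        assume y: "y \<in> set (take k xs)"
        then have "y \<in> J" unfolding J_def using genideal_self[of "set (take k xs)"] sub pc by blast
        moreover have "\<zero> \<in> PIdl (xs ! k)" using cgenideal_ideal[OF xc] by (simp add: ideal_iff)
        moreover have "y = y \<oplus> \<zero>" using y sub pc by auto
        ultimately show ?thesis unfolding set_add_def' by blast
      next
        assume y: "y = xs ! k"
        have "\<zero> \<in> J" using J by (simp add: ideal_iff)
        moreover have "y \<in> PIdl (xs ! k)" using cgenideal_self[OF xc] y by simp
        moreover have "y = \<zero> \<oplus> y" using y xc by simp
        ultimately show ?thesis unfolding set_add_def' by blast
      qed
    qed
    then have "p (Suc k) \<subseteq> J <+>\<^bsub>R\<^esub> PIdl (xs ! k)"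
      unfolding step(3) by (intro genideal_minimal add_ideals J cgenideal_ideal xc)
    moreover have "z \<in> p (Suc k)" using z prime_chain_mono[OF p, of k "Suc k"] step(2) by auto
    ultimately obtain j r where j: "j \<in> J" and r: "r \<in> carrier R" and e: "z = j \<oplus> r \<otimes> xs ! k"
      unfolding set_add_def' cgenideal_def by blast
    have jc: "j \<in> carrier R" using j Jc by blast
    have "\<ominus> j \<in> p k" using additive_subgroup.a_inv_closed[OF ideal.axioms(1)[OF idp]] j Jp by blast
    then have "\<ominus> j \<oplus> z \<in> p k" using z idp unfolding ideal_iff by blast
    moreover have "\<ominus> j \<oplus> z = r \<otimes> xs ! k" using e jc r xc by (simp flip: a_assoc add: l_neg)
    ultimately have "r \<in> p k" using pk xk(2) r xc unfolding primeideal_iff by metis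
    moreover have "\<one> \<in> carrier R - m" using one_notin_m by simp
    moreover have "\<one> \<otimes> z = j \<oplus> r \<otimes> xs ! k" using e z pc by auto
    ultimately show "\<exists>t\<in>carrier R - m. \<exists>j\<in>J. \<exists>r\<in>p k. t \<otimes> z = j \<oplus> r \<otimes> xs ! k" using j by blast
  qed
  then show ?case using Jp unfolding J_def by blast
qed

lemma exists_minimal_generators:
  "\<exists>S\<subseteq>carrier R. finite S \<and> card S = min_generators R m \<and> m = Idl S"
proof -
  obtain S where "S \<subseteq> carrier R" "finite S" "m = Idl S" using finetely_gen[OF m_ideal] by blast
  then have "\<exists>n. \<exists>S\<subseteq>carrier R. finite S \<and> card S = n \<and> m = Idl S" by blast
  then show ?thesis unfolding min_generators_def by (rule LeastI_ex)
qed

text \<open>The inequalities close up: dimension \<le> minimal number of generators \<le> length of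
  \<open>xs\<close> \<le> dimension, the first one by the height theorem.\<close>

lemma regular_local_ringI:
  assumes "set xs \<subseteq> carrier R" "m = Idl (set xs)" "enat (length xs) \<le> krull_dim R"
  shows "regular_local_ring R m" "krull_dim R = enat (length xs)"
proof -
  have "min_generators R m \<le> card (set xs)"
    unfolding min_generators_def using assms(1,2) by (intro Least_le exI[of _ "set xs"]) simp
  then have le: "enat (min_generators R m) \<le> enat (length xs)" using card_length[of xs] by simp
  obtain S where "S \<subseteq> carrier R" "finite S" "card S = min_generators R m" "m = Idl S"
    using exists_minimal_generators by blast
  then have ge: "krull_dim R \<le> enat (min_generators R m)" using krull_dim_le_generators[of S] by simp
  show "krull_dim R = enat (length xs)" using le ge assms(3) by (meson order.antisym order.trans)
  moreover have "enat (min_generators R m) = krull_dim R" using le ge assms(3) by (meson order.antisym order.trans)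
  ultimately show "regular_local_ring R m"
    unfolding regular_local_ring_def using local noetherian_ring_axioms by simp
qed

end

section \<open>Regular sequences, depth and chains of primes\<close>

context local_dg_ring
begin

lemma dg_regular_sequence_iff: "dg_regular_sequence A m xs \<longleftrightarrow> regular_tree_sequence A m leafA xs"
  by (simp add: dg_regular_sequence_def regular_sequence_def)

lemma regular_sequence_prefix:
  "regular_tree_sequence A m M (xs @ ys) \<Longrightarrow> regular_tree_sequence A m M xs"
  by (induction xs arbitrary: M) auto

lemma regular_sequence_m: "regular_tree_sequence A m M xs \<Longrightarrow> set xs \<subseteq> m"
  by (induction xs arbitrary: M) (auto simp: regular_element_def)

lemma exists_associated_prime:
  assumes "coherent M"
  obtains u where "u \<in> carrier (cohomology M (dg_inf M))" "u \<noteq> \<zero>\<^bsub>cohomology M (dg_inf M)\<^esub>"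
    "primeideal (annihilator (H0 A) (cohomology M (dg_inf M)) u) (H0 A)"
proof -
  interpret dg_complex A M by (rule coherent_complex[OF assms])
  interpret H: module "H0 A" "cohomology M (dg_inf M)" by (rule cohomology_module)
  have "carrier (cohomology M (dg_inf M)) \<noteq> {\<zero>\<^bsub>cohomology M (dg_inf M)\<^esub>}"
    using coherent_inf(1)[OF assms] by (simp add: cohomology_zero_def)
  then obtain v where "v \<in> carrier (cohomology M (dg_inf M))" "v \<noteq> \<zero>\<^bsub>cohomology M (dg_inf M)\<^esub>"
    using H.M.zero_closed by blast
  from R.annihilator_in_associated_prime[OF H.module_axioms H.carrier_is_submodule this] that
  show ?thesis by blast
qed

lemma regular_sequence_length_le:
  assumes "coherent M" "regular_tree_sequence A m M xs"
  shows "enat (length xs) \<le> krull_dim (H0 A)"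
proof -
  obtain u where "u \<in> carrier (cohomology M (dg_inf M))" "u \<noteq> \<zero>\<^bsub>cohomology M (dg_inf M)\<^esub>"
    "primeideal (annihilator (H0 A) (cohomology M (dg_inf M)) u) (H0 A)"
    using exists_associated_prime[OF assms(1)] .
  from regular_sequence_chain[OF assms this] show ?thesis using prime_chain_le_krull_dim by blast
qed

lemma seq_depth_ge: "dg_regular_sequence A m xs \<Longrightarrow> enat (length xs) \<le> seq_depth A m"
  unfolding seq_depth_def by (rule Sup_upper) blast

lemma seq_depth_le: "coherent leafA \<Longrightarrow> seq_depth A m \<le> krull_dim (H0 A)"
  unfolding seq_depth_def by (rule Sup_least) (auto simp: dg_regular_sequence_iff intro: regular_sequence_length_le)

lemma seq_depth_attained:
  assumes "enat d \<le> seq_depth A m"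
  shows "\<exists>xs. length xs = d \<and> dg_regular_sequence A m xs"
proof (rule ccontr)
  assume none: "\<nexists>xs. length xs = d \<and> dg_regular_sequence A m xs"
  have less: "length xs < d" if "dg_regular_sequence A m xs" for xs
  proof (rule ccontr)
    assume "\<not> length xs < d"
    then have "length (take d xs) = d" by simp
    moreover have "dg_regular_sequence A m (take d xs)"
      using that regular_sequence_prefix[of leafA "take d xs" "drop d xs"] by (simp add: dg_regular_sequence_iff)
    ultimately show False using none by blast
  qed
  have "0 < d" using less[of "[]"] by (simp add: dg_regular_sequence_iff)
  moreover have "seq_depth A m \<le> enat (d - 1)"
    unfolding seq_depth_def by (rule Sup_least) (use less in fastforce)
  ultimately show False using order.trans[OF assms, of "enat (d - 1)"] by simp
qed

text \<open>If \<open>p\<close> contains a regular element \<open>y\<close>, the exchange theorem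
  yields a sequence on K(M; y) that is one shorter, and the induction continues there; the
  difference of the lengths is unchanged. Otherwise prime avoidance puts \<open>p\<close> inside an
  associated prime of the lowest cohomology, and the remaining sequence produces the chain that
  starts there.\<close>

lemma regular_sequence_in_prime:
  fixes M :: "('a, 'm tree) dg_mod"
  assumes "coherent M" "regular_tree_sequence A m M xs" "primeideal p (H0 A)"
  shows "\<exists>ys q. set ys \<subseteq> p \<and> length ys \<le> length xs \<and> regular_tree_sequence A m M ys \<and>
    prime_chain (H0 A) q (length xs - length ys) \<and> p \<subseteq> q 0"
  using assms(1,2)
proof (induction "length xs" arbitrary: xs M)
  case 0
  have "prime_chain (H0 A) (\<lambda>_. p) 0" using assms(3) by (simp add: prime_chain_def)
  then show ?case using 0 by (intro exI[of _ "[]"] exI[of _ "\<lambda>_. p"]) simp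
next
  case (Suc k)
  show ?case
  proof (cases "\<exists>y\<in>p. regular_element m M y")
    case True
    then obtain y where y: "y \<in> p" "regular_element m M y" by blast
    have ym: "y \<in> m" using y(2) by (simp add: regular_element_def)
    obtain zs where zs: "length zs = k" "regular_tree_sequence A m (koszul A M y) zs"
      using regular_sequence_exchange[OF Suc.prems Suc.hyps(2)[symmetric] y(2)] by blast
    from Suc.hyps(1)[OF zs(1)[symmetric] coherent_koszul[OF Suc.prems(1) ym] zs(2)]
    obtain ys q where ys: "set ys \<subseteq> p" "length ys \<le> length zs" "regular_tree_sequence A m (koszul A M y) ys"
      "prime_chain (H0 A) q (length zs - length ys)" "p \<subseteq> q 0" by blast
    have "length xs - length (y # ys) = length zs - length ys" using zs(1) Suc.hyps(2) by simp
    then show ?thesis using ys y zs(1) Suc.hyps(2) by (intro exI[of _ "y # ys"] exI[of _ q]) simp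
  next
    case False
    define F where "F = maximal_annihilators (H0 A) (cohomology M (dg_inf M))"
    have "\<exists>P\<in>F. p \<subseteq> P"
    proof (rule ccontr)
      assume no: "\<not> (\<exists>P\<in>F. p \<subseteq> P)"
      have idp: "ideal p (H0 A)" using assms(3) by (simp add: primeideal_def)
      have "\<exists>c\<in>p. \<forall>P\<in>F. \<zero>\<^bsub>H0 A\<^esub> \<oplus>\<^bsub>H0 A\<^esub> c \<notin> P"
      proof (rule R.coset_prime_avoidance[OF _ _ idp R.zero_closed])
        show "finite F" unfolding F_def by (rule R.finite_maximal_annihilators[OF coherent_noetherian[OF Suc.prems(1)]])
        show "primeideal P (H0 A)" if "P \<in> F" for P using that maximal_annihilators_prime unfolding F_def by blast
      qed (use no in blast)
      then obtain c where c: "c \<in> p" "\<And>P. P \<in> F \<Longrightarrow> \<zero>\<^bsub>H0 A\<^esub> \<oplus>\<^bsub>H0 A\<^esub> c \<notin> P" by blast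
      have cm: "c \<in> m" using c(1) R.prime_le_m[OF assms(3)] by blast
      then have "\<zero>\<^bsub>H0 A\<^esub> \<oplus>\<^bsub>H0 A\<^esub> c = c" using R.m_carrier by auto
      then have "regular_element m M c"
        using c(2) by (intro regular_if_avoids[OF Suc.prems(1) cm]) (simp add: F_def)
      then show False using False c(1) by blast
    qed
    then obtain u where u: "p \<subseteq> annihilator (H0 A) (cohomology M (dg_inf M)) u"
      "u \<in> carrier (cohomology M (dg_inf M))" "u \<noteq> \<zero>\<^bsub>cohomology M (dg_inf M)\<^esub>"
      "primeideal (annihilator (H0 A) (cohomology M (dg_inf M)) u) (H0 A)"
      unfolding F_def maximal_annihilators_def by blast
    obtain q where "prime_chain (H0 A) q (length xs)" "q 0 = annihilator (H0 A) (cohomology M (dg_inf M)) u"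
      using regular_sequence_chain[OF Suc.prems u(2-4)] by blast
    then show ?thesis using u(1) by (intro exI[of _ "[]"] exI[of _ q]) simp
  qed
qed

text \<open>
  By the last claim \<open>H\<^sup>0(A)\<close> embeds into the lowest cohomology of \<open>M\<close>, which therefore survives
  every localization.
\<close>

lemma generating_regular_sequence:
  assumes "coherent M" "regular_tree_sequence A m M xs" "m = Idl\<^bsub>H0 A\<^esub> (set xs)"
  shows "regular_local_ring (H0 A) m" "krull_dim (H0 A) = enat (length xs)"
    "\<exists>u\<in>carrier (cohomology M (dg_inf M)). annihilator (H0 A) (cohomology M (dg_inf M)) u = {\<zero>\<^bsub>H0 A\<^esub>}"
proof -
  have xs: "set xs \<subseteq> carrier (H0 A)" using regular_sequence_m[OF assms(2)] R.m_carrier by blast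
  have le: "enat (length xs) \<le> krull_dim (H0 A)" by (rule regular_sequence_length_le[OF assms(1,2)])
  show "regular_local_ring (H0 A) m" "krull_dim (H0 A) = enat (length xs)"
    using R.regular_local_ringI[OF xs assms(3) le] by blast+
  obtain u where u: "u \<in> carrier (cohomology M (dg_inf M))" "u \<noteq> \<zero>\<^bsub>cohomology M (dg_inf M)\<^esub>"
    "primeideal (annihilator (H0 A) (cohomology M (dg_inf M)) u) (H0 A)"
    using exists_associated_prime[OF assms(1)] .
  obtain p where p: "prime_chain (H0 A) p (length xs)" "p 0 = annihilator (H0 A) (cohomology M (dg_inf M)) u"
    "\<And>k. k < length xs \<Longrightarrow> xs ! k \<in> p (Suc k) - p k"
    using regular_sequence_chain[OF assms(1,2) u] by blast
  have "p 0 = Idl\<^bsub>H0 A\<^esub> {}" using R.chain_of_generators[OF p(1,3) assms(3), of 0] by simp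
  moreover have "Idl\<^bsub>H0 A\<^esub> {} = {\<zero>\<^bsub>H0 A\<^esub>}"
    using R.genideal_minimal[OF R.zeroideal, of "{}"] R.genideal_ideal[of "{}"] by (auto simp: R.ideal_iff)
  ultimately show "\<exists>u\<in>carrier (cohomology M (dg_inf M)).
      annihilator (H0 A) (cohomology M (dg_inf M)) u = {\<zero>\<^bsub>H0 A\<^esub>}"
    using u(1) p(2) by auto
qed

end

section \<open>Regular sequences and localization\<close>

context local_base_change
begin

text \<open>Vanishing always passes to \<open>M'\<close>, so the infimum can only go up. A class
  that no element of \<open>T\<close> kills survives and keeps it in place.\<close>

lemma comparison_inf_of_annihilator:
  assumes "comparison_map A A' \<phi> T M M' f" "L.coherent M" "u \<in> carrier (cohomology M (dg_inf M))"
    and ann: "\<And>t. t \<in> T \<Longrightarrow> A.rcls t \<notin> annihilator (H0 A) (cohomology M (dg_inf M)) u"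
  shows "dg_inf M' = dg_inf M"
proof (rule L.dg_inf_eqI)
  interpret comparison_map A A' \<phi> T M M' f by fact
  show "cohomology_zero M' j" if "j < dg_inf M" for j
    by (rule comparison_zero[OF assms(1) L.coherent_inf(2)[OF assms(2) that]])
  obtain z where z: "z \<in> cocycles M (dg_inf M)" "u = M.hcls (dg_inf M) z"
    using assms(3) unfolding M.cohomology_carrier by blast
  show "\<not> cohomology_zero M' (dg_inf M)"
  proof
    assume "cohomology_zero M' (dg_inf M)"
    then have "f z \<in> coboundaries M' (dg_inf M)" using f_cocycle[OF z(1)] unfolding M'.cohomology_zero_iff by blast
    then obtain t where t: "t \<in> T" "act M t z \<in> coboundaries M (dg_inf M)" using f_inj[OF z(1)] by blast
    have "A.rcls t \<odot>\<^bsub>cohomology M (dg_inf M)\<^esub> u = \<zero>\<^bsub>cohomology M (dg_inf M)\<^esub>"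
      unfolding z(2) M.hcls_act[OF T_gr0[OF t(1)] z(1)]
      using M.hcls_eq_zero_iff[OF M.coboundary_carrier[OF t(2)]] t(2) by simp
    then show False using ann[OF t(1)] A.rcls_closed[OF T_gr0[OF t(1)]] by (simp add: annihilator_def)
  qed
qed

lemma comparison_regular_sequence:
  fixes M :: "('a, 'm tree) dg_mod" and M' :: "('c, 'k tree) dg_mod"
  assumes "comparison_map A A' \<phi> T M M' f" "L.coherent M" "L'.coherent M'" "dg_inf M' = dg_inf M"
    and "regular_tree_sequence A m M ys" "\<And>y. y \<in> set ys \<Longrightarrow> H0_map y \<in> m'"
  shows "regular_tree_sequence A' m' M' (map H0_map ys)"
  using assms
proof (induction ys arbitrary: M M' f)
  case (Cons y ys)
  have reg: "regular_element m M y" and regs: "regular_tree_sequence A m (koszul A M y) ys"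
    using Cons.prems(5) by simp_all
  have ym: "y \<in> m" using reg by (simp add: regular_element_def)
  obtain a where a: "a \<in> gr A 0" "y = A.rcls a" using L.m_rcls[OF ym] by blast
  have y': "H0_map y = A'.rcls (\<phi> a)" using a by (simp add: H0_map_rcls)
  have am: "A.rcls a \<in> m" "A'.rcls (\<phi> a) \<in> m'" using ym a(2) y' Cons.prems(6)[of y] by simp_all
  have reg': "regular_element m' M' (A'.rcls (\<phi> a))"
    using comparison_regular[OF Cons.prems(1-4) a(1) am] reg a(2) by simp
  obtain g where g: "comparison_map A A' \<phi> T (koszul A M (A.rcls a)) (koszul A' M' (A'.rcls (\<phi> a))) g"
    using koszul_comparison'[OF Cons.prems(1) a(1) am] by blast
  have "regular_tree_sequence A' m' (koszul A' M' (A'.rcls (\<phi> a))) (map H0_map ys)"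
  proof (rule Cons.IH[OF g])
    show "L.coherent (koszul A M (A.rcls a))" by (rule L.coherent_koszul[OF Cons.prems(2) am(1)])
    show "L'.coherent (koszul A' M' (A'.rcls (\<phi> a)))" by (rule L'.coherent_koszul[OF Cons.prems(3) am(2)])
    \<comment> \<open>Passing to the Koszul complex on a regular element preserves the infimum on
      both sides, so the equality propagates.\<close>
    show "dg_inf (koszul A' M' (A'.rcls (\<phi> a))) = dg_inf (koszul A M (A.rcls a))"
      using L.koszul_inf[OF Cons.prems(2) reg] L'.koszul_inf[OF Cons.prems(3) reg'] Cons.prems(4) a(2) by simp
  qed (use regs a(2) Cons.prems(6) in auto)
  then show ?case using reg' y' by simp
qed simp

text \<open>The generators \<open>zs\<close> are replaced one by one, those already replaced being
  collected in \<open>ys\<close>. The sequence \<open>xs\<close> over \<open>M'\<close> is never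
  pulled back: it certifies that \<open>M'\<close> still has positive depth, which yields a regular
  element for \<open>M\<close>, and the exchange theorem adapts it to the image of that
  element.\<close>

lemma comparison_regular_generators:
  fixes M :: "('a, 'm tree) dg_mod" and M' :: "('c, 'k tree) dg_mod"
  assumes units: "\<And>t. t \<in> T \<Longrightarrow> A.rcls t \<notin> m"
    and loc: "\<And>a. a \<in> gr A 0 \<Longrightarrow> A.rcls a \<in> m \<Longrightarrow> A'.rcls (\<phi> a) \<in> m'"
    and "comparison_map A A' \<phi> T M M' f" "L.coherent M" "L'.coherent M'"
    and "regular_tree_sequence A' m' M' xs" "length xs = length zs"
    and "m = Idl\<^bsub>H0 A\<^esub> (set ys \<union> set zs)" "set ys \<union> set zs \<subseteq> carrier (H0 A)"
  shows "\<exists>ws. regular_tree_sequence A m M ws \<and> m = Idl\<^bsub>H0 A\<^esub> (set ys \<union> set ws)"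
  using assms(3-)
proof (induction zs arbitrary: M M' f xs ys)
  case Nil
  then show ?case by (intro exI[of _ "[]"]) simp
next
  case (Cons z zs)
  have inf: "dg_inf M' = dg_inf M" by (rule comparison_inf[OF Cons.prems(1) units])
  obtain x where "regular_element m' M' x" using Cons.prems(4,5) by (cases xs) auto
  then have "\<not> L'.has_socle M' (dg_inf M')" by (rule L'.regular_no_socle[OF Cons.prems(3)])
  \<comment> \<open>A socle of \<open>M\<close> would give a socle of \<open>M'\<close> in the same
    degree, where the first element of \<open>xs\<close> forbids it.\<close>
  then have nosoc: "\<not> L.has_socle M (dg_inf M)"
    using comparison_socle[OF Cons.prems(1) units, of "dg_inf M"] inf by auto
  define J where "J = Idl\<^bsub>H0 A\<^esub> (set ys \<union> set zs)"
  have sc: "set ys \<union> set zs \<subseteq> carrier (H0 A)" "z \<in> carrier (H0 A)" using Cons.prems(7) by auto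
  have sJ: "set ys \<union> set zs \<subseteq> J" unfolding J_def by (rule L.R.genideal_self[OF sc(1)])
  have sm: "set ys \<union> set (z # zs) \<subseteq> m" using L.R.genideal_self[OF Cons.prems(7)] Cons.prems(6) by simp
  have zm: "z \<in> m" and szm: "set ys \<union> set zs \<subseteq> m" using sm by auto
  have J: "ideal J (H0 A)" unfolding J_def by (rule L.R.genideal_ideal[OF sc(1)])
  have Jm: "J \<subseteq> m" unfolding J_def by (rule L.R.genideal_minimal[OF L.R.m_ideal szm])
  have gen: "m \<subseteq> P" if P: "ideal P (H0 A)" "J \<subseteq> P" "z \<in> P" for P
  proof -
    have "set ys \<union> set (z # zs) \<subseteq> P" using sJ P(2,3) by auto
    then show ?thesis using L.R.genideal_minimal[OF P(1)] Cons.prems(6) by simp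
  qed
  obtain c where c: "c \<in> J" "z \<oplus>\<^bsub>H0 A\<^esub> c \<in> m" "regular_element m M (z \<oplus>\<^bsub>H0 A\<^esub> c)"
    using L.exists_common_regular[of "{M}" J z] Cons.prems(2) nosoc J Jm zm gen by blast
  define w where "w = z \<oplus>\<^bsub>H0 A\<^esub> c"
  have wm: "w \<in> m" and reg: "regular_element m M w" using c(2,3) unfolding w_def by simp_all
  obtain a where a: "a \<in> gr A 0" "w = A.rcls a" using L.m_rcls[OF wm] by blast
  have am: "A.rcls a \<in> m" using wm a(2) by simp
  have am': "A'.rcls (\<phi> a) \<in> m'" by (rule loc[OF a(1) am])
  have reg': "regular_element m' M' (A'.rcls (\<phi> a))"
    using comparison_regular[OF Cons.prems(1-3) inf a(1) am am'] reg a(2) by simp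
  have lx: "length xs = Suc (length zs)" using Cons.prems(5) by simp
  obtain xs' where xs': "length xs' = length zs" "regular_tree_sequence A' m' (koszul A' M' (A'.rcls (\<phi> a))) xs'"
    using L'.regular_sequence_exchange[OF Cons.prems(3,4) lx reg'] by blast
  obtain g where g: "comparison_map A A' \<phi> T (koszul A M (A.rcls a)) (koszul A' M' (A'.rcls (\<phi> a))) g"
    using koszul_comparison'[OF Cons.prems(1) a(1) am am'] by blast
  have wc: "w \<in> carrier (H0 A)" using wm L.R.m_carrier by blast
  have sc': "set (w # ys) \<union> set zs \<subseteq> carrier (H0 A)" using sc wc by auto
  \<comment> \<open>Replacing \<open>z\<close> by \<open>w\<close> keeps the generated ideal,
    because the difference \<open>c\<close> lies in the ideal of the other generators.\<close>
  have gen': "m = Idl\<^bsub>H0 A\<^esub> (set (w # ys) \<union> set zs)"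
  proof
    define I where "I = Idl\<^bsub>H0 A\<^esub> (set (w # ys) \<union> set zs)"
    have I: "ideal I (H0 A)" unfolding I_def by (rule L.R.genideal_ideal[OF sc'])
    have sI: "set (w # ys) \<union> set zs \<subseteq> I" unfolding I_def by (rule L.R.genideal_self[OF sc'])
    have JI: "J \<subseteq> I" unfolding J_def using sI by (intro L.R.genideal_minimal[OF I]) auto
    have "\<ominus>\<^bsub>H0 A\<^esub> c \<in> I" using additive_subgroup.a_inv_closed[OF ideal.axioms(1)[OF I]] c(1) JI by blast
    moreover have "w \<in> I" using sI by simp
    ultimately have "w \<oplus>\<^bsub>H0 A\<^esub> \<ominus>\<^bsub>H0 A\<^esub> c \<in> I" using I unfolding L.R.ideal_iff by blast
    moreover have "c \<in> carrier (H0 A)" using c(1) J by (auto simp: L.R.ideal_iff)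
    then have "w \<oplus>\<^bsub>H0 A\<^esub> \<ominus>\<^bsub>H0 A\<^esub> c = z" unfolding w_def using sc(2) by (simp add: L.R.a_assoc L.R.r_neg)
    ultimately have "z \<in> I" by simp
    from gen[OF I JI this] show "m \<subseteq> Idl\<^bsub>H0 A\<^esub> (set (w # ys) \<union> set zs)" unfolding I_def .
    show "Idl\<^bsub>H0 A\<^esub> (set (w # ys) \<union> set zs) \<subseteq> m"
      using szm wm by (intro L.R.genideal_minimal[OF L.R.m_ideal]) auto
  qed
  obtain ws where ws: "regular_tree_sequence A m (koszul A M (A.rcls a)) ws"
    "m = Idl\<^bsub>H0 A\<^esub> (set (w # ys) \<union> set ws)"
    using Cons.IH[OF g L.coherent_koszul[OF Cons.prems(2) am] L'.coherent_koszul[OF Cons.prems(3) am']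
        xs'(2,1) gen' sc'] by blast
  have "set (w # ys) \<union> set ws = set ys \<union> set (w # ws)" by auto
  then show ?case using ws reg a(2) by (intro exI[of _ "w # ws"]) simp
qed

end

section \<open>The Cohen-Macaulay property of localizations\<close>

context prime_localization
begin

text \<open>The length of \<open>ys\<close> is squeezed: it is at most the depth of the
  localization, which is at most the dimension of its H^0, which is at most the length of
  \<open>ys\<close>.\<close>

lemma localization_cohen_macaulay:
  assumes noeth: "noetherian_dg_ring A" and bounded: "bounded_cohomology A"
    and xs: "dg_regular_sequence A m xs" and gen: "m = Idl\<^bsub>H0 A\<^esub> (set xs)"
  shows "local_cohen_macaulay (localization_at A p) n"
proof -
  have coh: "coherent leafA" by (rule coherent_leafA[OF noeth bounded])
  have reg: "regular_tree_sequence A m leafA xs" using xs by (simp add: dg_regular_sequence_iff)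
  have dim: "krull_dim (H0 A) = enat (length xs)" by (rule generating_regular_sequence(2)[OF coh reg gen])
  obtain u where u: "u \<in> carrier (cohomology leafA (dg_inf leafA))"
    "annihilator (H0 A) (cohomology leafA (dg_inf leafA)) u = {\<zero>\<^bsub>H0 A\<^esub>}"
    using generating_regular_sequence(3)[OF coh reg gen] by blast
  have coh': "L.coherent (leaf_module (self_module L))"
    by (rule L.coherent_leafA[OF L_noetherian_dg_ring[OF noeth] L_bounded[OF bounded]])
  have zp: "\<zero>\<^bsub>H0 A\<^esub> \<in> p" using p_prime by (simp add: R.primeideal_iff R.ideal_iff)
  have inf: "dg_inf (leaf_module (self_module L)) = dg_inf leafA"
  proof (rule B.comparison_inf_of_annihilator[OF leaf_localization_comparison coh u(1)])
    show "rcls t \<notin> annihilator (H0 A) (cohomology leafA (dg_inf leafA)) u" if "t \<in> S" for t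
      unfolding u(2) using S_rcls[OF that] zp by (metis singletonD)
  qed
  obtain ys q where ys: "set ys \<subseteq> p" "length ys \<le> length xs" "regular_tree_sequence A m leafA ys"
    and q: "prime_chain (H0 A) q (length xs - length ys)" "p \<subseteq> q 0"
    using regular_sequence_in_prime[OF coh reg p_prime] by blast
  have "h \<le> length ys" if Q: "prime_chain (H0 L) Q h" for Q h
  proof -
    obtain r where "prime_chain (H0 A) r h" "r h \<subseteq> p" using pull_chain[OF Q] by blast
    then obtain r' where "prime_chain (H0 A) r' (h + (length xs - length ys))"
      using prime_chain_append[of "H0 A" r h q] q by blast
    \<comment> \<open>A chain of length h below \<open>p\<close> and the chain above
      \<open>p\<close> concatenate, and the result must fit into the dimension of H^0(A), which is
      the length of \<open>xs\<close>.\<close>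
    then have "h + (length xs - length ys) \<le> length xs" using prime_chain_le_krull_dim dim by fastforce
    then show ?thesis using ys(2) by simp
  qed
  then have "krull_dim (H0 L) \<le> enat (length ys)" by (rule krull_dim_le)
  moreover have "B.H0_map y \<in> n" if "y \<in> set ys" for y
  proof -
    have "y \<in> p" using that ys(1) by blast
    moreover from this have "y \<in> carrier (H0 A)" using R.prime_le_m[OF p_prime] R.m_carrier by blast
    then obtain a where "a \<in> gr A 0" "y = rcls a" unfolding H0_carrier by blast
    ultimately show ?thesis using push_iff[OF p_prime order_refl _ S_one, of a] by (simp add: B.H0_map_rcls)
  qed
  then have "regular_tree_sequence L n (leaf_module (self_module L)) (map B.H0_map ys)"
    by (rule B.comparison_regular_sequence[OF leaf_localization_comparison coh coh' inf ys(3)])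
  then have "enat (length ys) \<le> seq_depth L n"
    using L.seq_depth_ge[of "map B.H0_map ys"] by (simp add: L.dg_regular_sequence_iff)
  moreover have "seq_depth L n \<le> krull_dim (H0 L)" by (rule L.seq_depth_le[OF coh'])
  ultimately have "seq_depth L n = krull_dim (H0 L)" by (meson order.antisym order.trans)
  then show ?thesis
    unfolding local_cohen_macaulay_def localization_at_eq
    using L_noetherian_local_dg_ring[OF noeth] L_bounded[OF bounded] by blast
qed

text \<open>The hypothesis gives the depth of the localization at \<open>m\<close>. There the
  denominators are already units in H^0(A), so the localization map compares \<open>A\<close> with
  its localization in both directions, and depth together with minimal generators yields the
  sequence in \<open>A\<close>.\<close>

lemma sequence_regular_if_localization_cohen_macaulay:
  assumes noeth: "noetherian_dg_ring A" and bounded: "bounded_cohomology A" and pm: "p = m"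
    and cm: "local_cohen_macaulay (localization_at A p) n'" and reg: "regular_local_ring (H0 A) m"
  shows "sequence_regular A m"
proof -
  have cm': "local_cohen_macaulay L n'" using cm by (simp only: localization_at_eq)
  \<comment> \<open>The definition of Cohen-Macaulay quantifies existentially over the maximal ideal
    of the localization; it is unique.\<close>
  then have "n' = n"
    using local_ring_unique[OF _ L_local] unfolding local_cohen_macaulay_def noetherian_local_dg_ring_def by blast
  then have depth: "seq_depth L n = krull_dim (H0 L)" using cm' by (simp add: local_cohen_macaulay_def)
  obtain G where G: "G \<subseteq> carrier (H0 A)" "finite G" "card G = min_generators (H0 A) m" "m = Idl\<^bsub>H0 A\<^esub> G"
    using R.exists_minimal_generators by blast
  obtain zs where zs: "set zs = G" "length zs = card G"
    using finite_distinct_list[OF G(2)] distinct_card by metis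
  have "enat (length zs) = krull_dim (H0 A)" using reg G(3) zs(2) by (simp add: regular_local_ring_def)
  then obtain q where q: "prime_chain (H0 A) q (length zs)" using R.krull_dim_attained[of "length zs"] by auto
  \<comment> \<open>A chain of primes realizing the dimension of H^0(A) survives the localization at
    \<open>m\<close>. So the depth there is at least the number of minimal generators.\<close>
  have "q (length zs) \<subseteq> p" unfolding pm using q by (intro R.prime_le_m) (simp add: prime_chain_def)
  from prime_chain_le_krull_dim[OF push_chain[OF q this]] have "enat (length zs) \<le> seq_depth L n"
    using depth by simp
  from L.seq_depth_attained[OF this] obtain xs where xs: "length xs = length zs"
    "regular_tree_sequence L n (leaf_module (self_module L)) xs" unfolding L.dg_regular_sequence_iff by blast
  have "\<exists>ws. regular_tree_sequence A m leafA ws \<and> m = Idl\<^bsub>H0 A\<^esub> (set [] \<union> set ws)"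
  proof (rule B.comparison_regular_generators[OF _ _ leaf_localization_comparison])
    show "rcls t \<notin> m" if "t \<in> S" for t using S_rcls[OF that] pm by simp
    show "L.rcls (fr a \<one>) \<in> n" if "a \<in> gr A 0" "rcls a \<in> m" for a
      using push_iff[OF p_prime order_refl that(1) S_one] that(2) pm by simp
    show "coherent leafA" by (rule coherent_leafA[OF noeth bounded])
    show "L.coherent (leaf_module (self_module L))"
      by (rule L.coherent_leafA[OF L_noetherian_dg_ring[OF noeth] L_bounded[OF bounded]])
    show "m = Idl\<^bsub>H0 A\<^esub> (set [] \<union> set zs)" using G(4) zs(1) by simp
    show "set [] \<union> set zs \<subseteq> carrier (H0 A)" using G(1) zs(1) by simp
  qed (rule xs)+
  then show ?thesis unfolding sequence_regular_def dg_regular_sequence_iff by simp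
qed

end

section \<open>The characterization of sequence-regular DG-rings\<close>

theorem theorem2:
  fixes A :: "'a cochain" and m :: "'a set set"
  assumes "noetherian_local_dg_ring A m"
    and "bounded_cohomology A"
  shows "sequence_regular A m \<longleftrightarrow> cohen_macaulay A \<and> regular_local_ring (H0 A) m"
proof -
  interpret local_dg_ring A m by (rule noetherian_local_dg_ring_locale[OF assms(1)])
  have noeth: "noetherian_dg_ring A" using assms(1) by (simp add: noetherian_local_dg_ring_def)
  have loc: "prime_localization A m p" if "primeideal p (H0 A)" for p
    by (intro prime_localization.intro prime_localization_axioms.intro local_dg_ring_axioms that)
  show ?thesis
  proof
    assume "sequence_regular A m"
    then obtain xs where xs: "dg_regular_sequence A m xs" "m = Idl\<^bsub>H0 A\<^esub> (set xs)"
      unfolding sequence_regular_def by blast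
    have "regular_local_ring (H0 A) m"
      using generating_regular_sequence(1)[OF coherent_leafA[OF noeth assms(2)] _ xs(2)] xs(1)
      by (simp add: dg_regular_sequence_iff)
    moreover have "cohen_macaulay A"
      unfolding cohen_macaulay_def
      using noeth assms(2) prime_localization.localization_cohen_macaulay[OF loc noeth assms(2) xs] by blast
    ultimately show "cohen_macaulay A \<and> regular_local_ring (H0 A) m" by blast
  next
    assume a: "cohen_macaulay A \<and> regular_local_ring (H0 A) m"
    then obtain n where n: "local_cohen_macaulay (localization_at A m) n"
      using R.m_prime unfolding cohen_macaulay_def by blast
    show "sequence_regular A m"
      by (rule prime_localization.sequence_regular_if_localization_cohen_macaulay
          [OF loc[OF R.m_prime] noeth assms(2) refl n]) (use a in blast)
  qed
qed

end
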